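(* Let $A_1,\dots,A_d$ be constant complex $N\times N$ matrices, $L=L_1(\partial_t,\partial_x)=\partial_t+\sum_{l=1}^dA_l\partial_l$ with symbol $L_1(\tau,\xi)=\tau I_N+\sum_l\xi_lA_l$. Suppose that $\tau=0$ is an isolated root of constant multiplicity $m$ of $\det L_1(\tau,\xi)=0$, i.e. the multiplicity $m\ge 0$ of $\tau=0$ as a root of $\tau\mapsto\det L_1(\tau,\xi)$ is the same for all $\xi\in\mathbb R^d\setminus\{0\}$. Let $\widetilde L=\widetilde L_1+B$ be the Bérenger split operator with constant absorptions $\sigma_1,\dots,\sigma_d$. (i) If the Cauchy problem for $L_1$ is strongly well posed, then for arbitrary constant absorptions $\sigma_j\in\mathbb C$ the Cauchy problem for $\widetilde L_1+B$ is weakly well posed. (ii) If the Cauchy problem for $L_1$ is strongly well posed and there is a $\xi\in\mathbb R^d\setminus\{0\}$ such that $\ker L_1(0,\xi)\neq\bigcap_{j:\,\xi_j\ne0}\ker A_j$, then $\widetilde L_1(0,\xi)$ is not diagonalizable. Therefore the Cauchy problem for $\widetilde L$ is not strongly well posed. (iii) If the Cauchy problem for $L$ is strongly well posed and for all $\xi\in\mathbb R^d\setminus\{0\}$ one has $\ker L_1(0,\xi)=\bigcap_{j:\,\xi_j\neq0}\ker A_j$, then the Cauchy problem for $\widetilde L$ is strongly well posed. This condition holds if $L_1(0,\partial_x)$ is elliptic, that is, $\det L_1(0,\xi)\ne0$ for all $\xi\in\mathbb R^d\setminus\{0\}$.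
   Context: Bérenger split operator: for $\widetilde U=(U^1,\dots,U^d)$ with $U^l$ valued in $\mathbb C^N$, $(\widetilde L\widetilde U)_l:=\partial_tU^l+A_l\partial_l\big(\sum_{j=1}^dU^j\big)+\sigma_lU^l$, $1\le l\le d$. Its principal part $\widetilde L_1$ is obtained by dropping the terms $\sigma_lU^l$; $B=\mathrm{diag}(\sigma_1I_N,\dots,\sigma_dI_N)$. The symbol $\widetilde L_1(\tau,\xi)$ is the $dN\times dN$ matrix whose $(l,k)$ block is $\xi_lA_l+\tau\delta_{lk}I_N$. Cauchy problem: an operator $\mathcal L=\partial_t+\sum_l\mathcal A_l\partial_l+\mathcal B(x)$ (constant $\mathcal A_l$) has a weakly well posed Cauchy problem if there exist $q>0$, $K>0$, $\alpha\in\mathbb R$ such that for any initial value in $H^q(\mathbb R^d)$ there is a unique solution $U\in C^0([0,\infty[;L^2(\mathbb R^d))$ of $\mathcal LU=0$, and $\|U(t,\cdot)\|_{L^2}\le Ke^{\alpha t}\|U(0,\cdot)\|_{H^q}$ for all $t\ge0$. It is strongly well posed if this holds with $q=0$. *)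

theory Defs
  imports "HOL-Analysis.Analysis" "HOL-Computational_Algebra.Polynomial"
begin

section \<open>Symbols of first order systems\<close>

text \<open>The system \<open>\<partial>\<^sub>t + \<Sum>\<^sub>l A\<^sub>l \<partial>\<^sub>l + B(x)\<close> on \<open>\<real>\<^sup>d\<close> is represented by its constant coefficients
  \<open>A :: 'd \<Rightarrow> complex^'n^'n\<close> and by \<open>B :: real^'d \<Rightarrow> complex^'n^'n\<close>; here \<open>d = CARD('d)\<close> and
  \<open>N = CARD('n)\<close>.\<close>

definition symbol :: "('d::finite \<Rightarrow> complex^'n^'n) \<Rightarrow> complex \<Rightarrow> real^'d \<Rightarrow> complex^'n^'n::finite" where
  "symbol A \<tau> \<xi> = mat \<tau> + (\<Sum>l\<in>UNIV. (\<xi> $ l) *\<^sub>R A l)"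

text \<open>\<open>\<tau> \<mapsto> det L\<^sub>1(\<tau>,\<xi>)\<close> as a polynomial, so that the multiplicity of a root (0 for a non-root) is
  given by \<^const>\<open>order\<close>.\<close>

definition symbol_det :: "('d::finite \<Rightarrow> complex^'n^'n) \<Rightarrow> real^'d \<Rightarrow> complex poly" where
  "symbol_det A \<xi> = det (\<chi> i j. [: symbol A 0 \<xi> $ i $ j, if i = j then 1 else 0 :] :: complex poly^'n^'n::finite)"

lemma poly_symbol_det: "poly (symbol_det A \<xi>) \<tau> = det (symbol A \<tau> \<xi>)"
  unfolding symbol_det_def det_def
  by (auto simp: poly_sum poly_prod symbol_def mat_def algebra_simps intro!: sum.cong prod.cong)

definition mat_kernel :: "complex^'n^'n \<Rightarrow> (complex^'n::finite) set" where
  "mat_kernel M = {v. M *v v = 0}"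

definition diagonalizable :: "complex^'n^'n::finite \<Rightarrow> bool" where
  "diagonalizable M \<longleftrightarrow>
     (\<exists>(P :: complex^'n^'n) (D :: complex^'n^'n). invertible P \<and> (\<forall>i j. i \<noteq> j \<longrightarrow> D $ i $ j = 0) \<and>
        M = P ** D ** matrix_inv P)"

section \<open>The Berenger split operator\<close>

text \<open>The unknown \<open>(U\<^sup>1,\<dots>,U\<^sup>d)\<close> is a vector with index set \<open>'d \<times> 'n\<close>, the component
  \<open>(l, i)\<close> being \<open>(U\<^sup>l)\<^sub>i\<close>. The matrix multiplying \<open>\<partial>\<^sub>l\<close> has \<open>A\<^sub>l\<close> in every block of the
  block row \<open>l\<close> and zeros elsewhere.\<close>

definition split_coeff :: "('d::finite \<Rightarrow> complex^'n^'n) \<Rightarrow> 'd \<Rightarrow> complex^('d \<times> 'n)^('d \<times> 'n::finite)" where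
  "split_coeff A l = (\<chi> p q. if fst p = l then A l $ snd p $ snd q else 0)"

definition absorption :: "('d::finite \<Rightarrow> complex) \<Rightarrow> complex^('d \<times> 'n)^('d \<times> 'n::finite)" where
  "absorption \<sigma> = (\<chi> p q. if p = q then \<sigma> (fst p) else 0)"

lemma split_symbol_block:
  "symbol (split_coeff A) \<tau> \<xi> $ (l, i) $ (k, j) =
     ((\<xi> $ l) *\<^sub>R A l + (if l = k then mat \<tau> else 0)) $ i $ j"
proof -
  have "(\<Sum>r\<in>UNIV. \<xi> $ r *\<^sub>R (split_coeff A r $ (l, i) $ (k, j))) =
        (\<Sum>r\<in>UNIV. if l = r then \<xi> $ r *\<^sub>R (A r $ i $ j) else 0)"
    by (rule sum.cong) (auto simp: split_coeff_def)
  then show ?thesis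
    by (auto simp: symbol_def mat_def)
qed

lemma split_operator_block:
  fixes D :: "'d::finite \<Rightarrow> complex^('d \<times> 'n::finite)"
  shows "((\<Sum>r\<in>UNIV. split_coeff A r *v D r) + absorption \<sigma> *v U) $ (l, i) =
     (A l *v (\<Sum>k\<in>UNIV. \<chi> j. D l $ (k, j))) $ i + \<sigma> l * U $ (l, i)"
proof -
  have *: "(split_coeff A r *v D r) $ (l, i) =
      (if l = r then (A r *v (\<Sum>k\<in>UNIV. \<chi> j. D r $ (k, j))) $ i else 0)" for r
  proof -
    have "(\<Sum>q\<in>UNIV. A r $ i $ snd q * D r $ q) =
          (\<Sum>k\<in>UNIV. \<Sum>j\<in>UNIV. A r $ i $ j * D r $ (k, j))"
      by (simp add: sum.cartesian_product case_prod_unfold)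
    also have "\<dots> = (\<Sum>j\<in>UNIV. A r $ i $ j * (\<Sum>k\<in>UNIV. D r $ (k, j)))"
      by (subst sum.swap) (simp add: sum_distrib_left)
    finally show ?thesis
      by (auto simp: split_coeff_def matrix_vector_mult_def)
  qed
  have "(absorption \<sigma> *v U) $ (l, i) = (\<Sum>q\<in>UNIV. if (l, i) = q then \<sigma> l * U $ q else 0)"
    unfolding absorption_def matrix_vector_mult_def vec_lambda_beta by (rule sum.cong) auto
  then show ?thesis
    by (simp add: *)
qed

section \<open>Square integrable functions and Sobolev spaces\<close>

definition square_integrable :: "('a::euclidean_space \<Rightarrow> 'b::euclidean_space) \<Rightarrow> bool" where
  "square_integrable f \<longleftrightarrow> f \<in> borel_measurable lborel \<and> integrable lborel (\<lambda>x. (norm (f x))\<^sup>2)"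

definition L2_norm :: "('a::euclidean_space \<Rightarrow> 'b::euclidean_space) \<Rightarrow> real" where
  "L2_norm f = sqrt (LINT x|lborel. (norm (f x))\<^sup>2)"

definition truncated_fourier ::
    "real \<Rightarrow> (real^'d \<Rightarrow> complex^'n) \<Rightarrow> real^'d::finite \<Rightarrow> complex^'n::finite" where
  "truncated_fourier R f \<xi> = (2 * pi) powr (- real CARD('d) / 2) *\<^sub>R
     (LINT x|lborel. indicator (cball 0 R) x *\<^sub>R (cis (- (\<xi> \<bullet> x)) *s f x))"

text \<open>The Fourier-Plancherel transform on \<open>L\<^sup>2\<close>, as the \<open>L\<^sup>2\<close> limit of the transforms of
  the truncations \<open>f 1\<^bsub>|x| \<le> R\<^esub>\<close>. The nonnegative integral takes the value \<open>\<infinity>\<close> on functions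
  which are not square integrable, unlike \<^const>\<open>L2_norm\<close>.\<close>

definition is_fourier :: "(real^'d::finite \<Rightarrow> complex^'n::finite) \<Rightarrow> (real^'d \<Rightarrow> complex^'n) \<Rightarrow> bool" where
  "is_fourier f g \<longleftrightarrow> square_integrable f \<and> square_integrable g \<and>
     ((\<lambda>R. \<integral>\<^sup>+\<xi>. ennreal ((norm (truncated_fourier R f \<xi> - g \<xi>))\<^sup>2) \<partial>lborel) \<longlongrightarrow> 0) at_top"

definition fourier :: "(real^'d::finite \<Rightarrow> complex^'n::finite) \<Rightarrow> (real^'d \<Rightarrow> complex^'n)" where
  "fourier f = (SOME g. is_fourier f g)"

definition sobolev_weighted :: "real \<Rightarrow> (real^'d::finite \<Rightarrow> complex^'n::finite) \<Rightarrow> real^'d \<Rightarrow> complex^'n" where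
  "sobolev_weighted q f \<xi> = (1 + (norm \<xi>)\<^sup>2) powr (q / 2) *\<^sub>R fourier f \<xi>"

definition in_sobolev :: "real \<Rightarrow> (real^'d::finite \<Rightarrow> complex^'n::finite) \<Rightarrow> bool" where
  "in_sobolev q f \<longleftrightarrow> square_integrable f \<and> (\<exists>g. is_fourier f g) \<and>
     square_integrable (sobolev_weighted q f)"

definition sobolev_norm :: "real \<Rightarrow> (real^'d::finite \<Rightarrow> complex^'n::finite) \<Rightarrow> real" where
  "sobolev_norm q f = L2_norm (sobolev_weighted q f)"

section \<open>Weak solutions and well-posedness\<close>

fun differentiable_times :: "nat \<Rightarrow> ('a::euclidean_space \<Rightarrow> real) \<Rightarrow> bool" where
  "differentiable_times 0 f \<longleftrightarrow> continuous_on UNIV f"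
| "differentiable_times (Suc k) f \<longleftrightarrow> (\<forall>x. f differentiable (at x)) \<and>
     (\<forall>b\<in>Basis. differentiable_times k (\<lambda>x. frechet_derivative f (at x) b))"

definition smooth :: "('a::euclidean_space \<Rightarrow> real) \<Rightarrow> bool" where
  "smooth f \<longleftrightarrow> (\<forall>k. differentiable_times k f)"

text \<open>Smooth functions with compact support in \<open>]0,\<infinity>[ \<times> \<real>\<^sup>d\<close>. Real-valued ones are enough to
  test an equation between complex distributions.\<close>

definition test_function :: "(real \<times> (real^'d::finite) \<Rightarrow> real) \<Rightarrow> bool" where
  "test_function \<phi> \<longleftrightarrow> smooth \<phi> \<and> compact (closure {z. \<phi> z \<noteq> 0}) \<and>
     closure {z. \<phi> z \<noteq> 0} \<subseteq> {0<..} \<times> UNIV"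

definition continuous_L2 :: "(real \<Rightarrow> real^'d::finite \<Rightarrow> complex^'n::finite) \<Rightarrow> bool" where
  "continuous_L2 U \<longleftrightarrow> (\<forall>t\<ge>0. square_integrable (U t)) \<and>
     (\<forall>t\<ge>0. ((\<lambda>s. L2_norm (\<lambda>x. U s x - U t x)) \<longlongrightarrow> 0) (at t within {0..}))"

text \<open>The equation \<open>\<partial>\<^sub>t U + \<Sum>\<^sub>l A\<^sub>l \<partial>\<^sub>l U + B U = 0\<close> in the sense of distributions on
  \<open>]0,\<infinity>[ \<times> \<real>\<^sup>d\<close>. The pairing is an iterated integral because the representatives \<open>U t\<close> are
  chosen separately for each \<open>t\<close>; the inner integral is continuous in \<open>t\<close>.\<close>

definition distributional_solution ::
    "('d::finite \<Rightarrow> complex^'n^'n) \<Rightarrow> (real^'d \<Rightarrow> complex^'n^'n) \<Rightarrow> (real \<Rightarrow> real^'d \<Rightarrow> complex^'n::finite) \<Rightarrow> bool" where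
  "distributional_solution A B U \<longleftrightarrow> (\<forall>\<phi>. test_function \<phi> \<longrightarrow>
     (LINT t|lborel. LINT x|lborel.
        - (frechet_derivative \<phi> (at (t, x)) (1, 0) *\<^sub>R U t x)
        - (\<Sum>l\<in>UNIV. frechet_derivative \<phi> (at (t, x)) (0, axis l 1) *\<^sub>R (A l *v U t x))
        + \<phi> (t, x) *\<^sub>R (B x *v U t x)) = 0)"

definition cauchy_solution ::
    "('d::finite \<Rightarrow> complex^'n^'n) \<Rightarrow> (real^'d \<Rightarrow> complex^'n^'n) \<Rightarrow>
     (real^'d \<Rightarrow> complex^'n) \<Rightarrow> (real \<Rightarrow> real^'d \<Rightarrow> complex^'n::finite) \<Rightarrow> bool" where
  "cauchy_solution A B u0 U \<longleftrightarrow> continuous_L2 U \<and> (AE x in lborel. U 0 x = u0 x) \<and>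
     distributional_solution A B U"

definition well_posed ::
    "real \<Rightarrow> ('d::finite \<Rightarrow> complex^'n^'n) \<Rightarrow> (real^'d \<Rightarrow> complex^'n^'n::finite) \<Rightarrow> bool" where
  "well_posed q A B \<longleftrightarrow> (\<exists>K>0. \<exists>\<alpha>::real. \<forall>u0. in_sobolev q u0 \<longrightarrow>
     (\<exists>U. cauchy_solution A B u0 U \<and>
        (\<forall>V. cauchy_solution A B u0 V \<longrightarrow> (\<forall>t\<ge>0. AE x in lborel. V t x = U t x)) \<and>
        (\<forall>t\<ge>0. L2_norm (U t) \<le> K * exp (\<alpha> * t) * sobolev_norm q (U 0))))"

definition weakly_well_posed ::
    "('d::finite \<Rightarrow> complex^'n^'n) \<Rightarrow> (real^'d \<Rightarrow> complex^'n^'n::finite) \<Rightarrow> bool" where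
  "weakly_well_posed A B \<longleftrightarrow> (\<exists>q>0. well_posed q A B)"

definition strongly_well_posed ::
    "('d::finite \<Rightarrow> complex^'n^'n) \<Rightarrow> (real^'d \<Rightarrow> complex^'n^'n::finite) \<Rightarrow> bool" where
  "strongly_well_posed A B \<longleftrightarrow> well_posed 0 A B"

end

theory Submission
  imports Defs "HOL-Probability.Probability" "HOL-Computational_Algebra.Fundamental_Theorem_Algebra"
begin

text \<open>Let \<open>A(\<xi>) = \<Sum>\<^sub>l \<xi>\<^sub>l A\<^sub>l\<close>. A constant coefficient problem is well posed from \<open>H\<^sup>q\<close> to \<open>L\<^sup>2\<close> as
  soon as \<open>|exp (- t (i A(\<xi>) + B))| \<le> K exp (\<alpha>t) (1 + |\<xi>|\<^sup>2)\<^bsup>q/2\<^esup>\<close>: existence follows by evolving the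
  Fourier transform, uniqueness by localizing a weak solution with \<open>\<kappa>(\<epsilon>x)\<close>, \<open>\<epsilon> \<rightarrow> 0\<close>, so that its Fourier
  modes satisfy an ordinary differential equation up to an error of order \<open>\<epsilon>\<close>. The bound with \<open>q = 0\<close> is also
  necessary for strong well posedness, by testing with the wave packets \<open>\<kappa>(\<epsilon>x) exp (i \<xi>\<cdot>x) v\<close>. Replacing
  \<open>\<xi>\<close> by \<open>r \<xi>\<close>, \<open>r \<rightarrow> \<infinity>\<close>, removes \<open>\<alpha>\<close> and \<open>B\<close>: the group \<open>exp (- i t A(\<xi>))\<close> is bounded.

  For weak well posedness, let \<open>\<lambda>\<close> be an eigenvalue of the damped split system with eigenvector \<open>U\<close>. Then
  \<open>V = \<Sum>\<^sub>j U\<^sup>j\<close> satisfies \<open>\<lambda> V = - i A(\<zeta>) V\<close> with \<open>\<zeta>\<^sub>k = \<xi>\<^sub>k \<lambda> / (\<lambda> + \<sigma>\<^sub>k)\<close>, a complex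
  perturbation of \<open>\<xi>\<close> of size \<open>O(|\<xi>| / |\<lambda>|)\<close>. The multiplicity of the root zero is constant
  also at complex frequencies near the real ones, hence there is \<open>\<delta> > 0\<close> such that \<open>A(\<zeta>)\<close> has no nonzero eigenvalue
  of modulus at most \<open>\<delta> |\<xi>|\<close>. So either \<open>\<lambda>\<close> is bounded or \<open>|\<xi>| = O(|\<lambda>|)\<close>; in the latter case \<open>\<zeta> - \<xi>\<close>
  is bounded, and \<open>Re \<lambda>\<close> is bounded because \<open>- i A(\<xi>)\<close> generates a bounded group. A bound for the real parts of
  the eigenvalues bounds the exponential up to a power of \<open>1 + |\<xi>|\<close>.

  For the undamped split system, write \<open>\<Sum>\<^sub>j U\<^sup>j = k + A(\<xi>) y\<close> with \<open>A(\<xi>) k = 0\<close> and \<open>|\<xi>| |y| \<le> c |U|\<close>. If all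
  \<open>\<xi>\<^sub>l A\<^sub>l k\<close> vanish, then \<open>U\<close> evolves to \<open>U\<^sup>l + \<xi>\<^sub>l A\<^sub>l (exp (- i t A(\<xi>)) y - y)\<close>, which is bounded; otherwise \<open>k\<close>
  gives rise to a nilpotent block of the split symbol.\<close>

section \<open>The Banach algebra of linear maps\<close>

text \<open>Weak solutions may be tested only with compactly supported functions, so a plane wave is
  not an admissible test. Hence cutoffs enter both the uniqueness proof and the necessity of the
  growth bound; the commutator of the operator with a cutoff of width 1/\<epsilon> is smaller than
  the cutoff itself by a factor \<epsilon>, while time and frequency stay bounded as \<epsilon>
  tends to zero. All constants must be uniform in \<xi>, which rules out Jordan forms, since these
  depend discontinuously on \<xi>. They are replaced by shortest products of eigenvalue factors that
  annihilate the matrix: only the length of the product, the norm of the matrix and bounds for its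
  eigenvalues enter the estimates. Complex vectors are treated as elements of a real Euclidean
  space, so dimensions are real ones, for instance 2 N^2 for N by N matrices. The Fourier transform
  on square integrable functions is only shown to be bounded by sqrt 2, because |a + b|^2 \<le> 2
  |a|^2 + 2 |b|^2 is used in place of the triangle inequality; the definition of well-posedness
  absorbs such factors.\<close>

text \<open>A copy of \<open>'a \<Rightarrow>\<^sub>L 'a\<close>, because only a type of its own can be an instance of the classes of
  normed algebras.\<close>

typedef (overloaded) ('a::euclidean_space) endo = "UNIV :: ('a \<Rightarrow>\<^sub>L 'a) set"
  morphisms endo_blinfun Endo
  by simp

setup_lifting type_definition_endo

lift_definition app :: "'a::euclidean_space endo \<Rightarrow> 'a \<Rightarrow> 'a" is blinfun_apply .

lemma blinfun_ext: "(S = T) = (\<forall>v. blinfun_apply S v = blinfun_apply T v)"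
  by (metis blinfun_eqI)

lemma endo_eqI: "(\<And>v. app S v = app T v) \<Longrightarrow> S = T"
  by transfer (rule blinfun_eqI)

instantiation endo :: (euclidean_space) real_normed_algebra_1
begin

lift_definition zero_endo :: "'a endo" is 0 .
lift_definition one_endo :: "'a endo" is id_blinfun .
lift_definition plus_endo :: "'a endo \<Rightarrow> 'a endo \<Rightarrow> 'a endo" is "(+)" .
lift_definition minus_endo :: "'a endo \<Rightarrow> 'a endo \<Rightarrow> 'a endo" is "(-)" .
lift_definition uminus_endo :: "'a endo \<Rightarrow> 'a endo" is uminus .
lift_definition times_endo :: "'a endo \<Rightarrow> 'a endo \<Rightarrow> 'a endo" is "(o\<^sub>L)" .
lift_definition scaleR_endo :: "real \<Rightarrow> 'a endo \<Rightarrow> 'a endo" is scaleR .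
lift_definition norm_endo :: "'a endo \<Rightarrow> real" is norm .
lift_definition dist_endo :: "'a endo \<Rightarrow> 'a endo \<Rightarrow> real" is dist .
lift_definition sgn_endo :: "'a endo \<Rightarrow> 'a endo" is sgn .

definition uniformity_endo :: "('a endo \<times> 'a endo) filter" where
  "uniformity_endo = (INF e\<in>{0<..}. principal {(S, T). dist S T < e})"

definition open_endo :: "'a endo set \<Rightarrow> bool" where
  "open_endo U = (\<forall>S\<in>U. eventually (\<lambda>(S', T). S' = S \<longrightarrow> T \<in> U) uniformity)"

instance
proof
  fix a b c :: "'a endo" and r s :: real
  show "a + b + c = a + (b + c)" by transfer simp
  show "a + b = b + a" by transfer simp
  show "0 + a = a" by transfer simp
  show "- a + a = 0" by transfer simp
  show "a - b = a + - b" by transfer simp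
  show "a * b * c = a * (b * c)" by transfer (rule blinfun_eqI, simp)
  show "1 * a = a" by transfer (rule blinfun_eqI, simp)
  show "a * 1 = a" by transfer (rule blinfun_eqI, simp)
  show "(a + b) * c = a * c + b * c" by transfer (rule blinfun_eqI, simp add: blinfun.add_left)
  show "a * (b + c) = a * b + a * c"
    by transfer (rule blinfun_eqI, simp add: blinfun.add_left blinfun.add_right)
  show "r *\<^sub>R (a + b) = r *\<^sub>R a + r *\<^sub>R b" by (simp add: endo_blinfun_inject[symmetric] scaleR_endo.rep_eq plus_endo.rep_eq norm_endo.rep_eq times_endo.rep_eq sgn_endo.rep_eq scaleR_add_right)
  show "(r + s) *\<^sub>R a = r *\<^sub>R a + s *\<^sub>R a" by (simp add: endo_blinfun_inject[symmetric] scaleR_endo.rep_eq plus_endo.rep_eq norm_endo.rep_eq times_endo.rep_eq sgn_endo.rep_eq scaleR_add_left)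
  show "r *\<^sub>R s *\<^sub>R a = (r * s) *\<^sub>R a" by (simp add: endo_blinfun_inject[symmetric] scaleR_endo.rep_eq plus_endo.rep_eq norm_endo.rep_eq times_endo.rep_eq sgn_endo.rep_eq )
  show "1 *\<^sub>R a = a" by (simp add: endo_blinfun_inject[symmetric] scaleR_endo.rep_eq plus_endo.rep_eq norm_endo.rep_eq times_endo.rep_eq sgn_endo.rep_eq )
  show "r *\<^sub>R a * b = r *\<^sub>R (a * b)"
    by (simp add: endo_blinfun_inject[symmetric] scaleR_endo.rep_eq plus_endo.rep_eq norm_endo.rep_eq times_endo.rep_eq sgn_endo.rep_eq blinfun_ext blinfun.scaleR_left)
  show "a * r *\<^sub>R b = r *\<^sub>R (a * b)"
    by (simp add: endo_blinfun_inject[symmetric] scaleR_endo.rep_eq plus_endo.rep_eq norm_endo.rep_eq times_endo.rep_eq sgn_endo.rep_eq blinfun_ext blinfun.scaleR_left blinfun.scaleR_right)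
  show "dist a b = norm (a - b)" by transfer (rule dist_norm)
  show "sgn a = inverse (norm a) *\<^sub>R a" by (simp add: endo_blinfun_inject[symmetric] scaleR_endo.rep_eq plus_endo.rep_eq norm_endo.rep_eq times_endo.rep_eq sgn_endo.rep_eq sgn_div_norm)
  show "(norm a = 0) = (a = 0)" by transfer simp
  show "norm (a + b) \<le> norm a + norm b" by transfer (rule norm_triangle_ineq)
  show "norm (r *\<^sub>R a) = \<bar>r\<bar> * norm a" by (simp add: endo_blinfun_inject[symmetric] scaleR_endo.rep_eq plus_endo.rep_eq norm_endo.rep_eq times_endo.rep_eq sgn_endo.rep_eq )
  show "norm (a * b) \<le> norm a * norm b" by transfer (rule norm_blinfun_compose)
  show "norm (1 :: 'a endo) = 1" by transfer (rule norm_blinfun_id)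
  show "(0 :: 'a endo) \<noteq> 1"
    by transfer (metis norm_blinfun_id norm_zero zero_neq_one)
qed (rule uniformity_endo_def open_endo_def)+

end

lemma bounded_bilinear_app: "bounded_bilinear app"
proof
  fix S T :: "'a endo" and v w :: 'a and r :: real
  show "app (S + T) v = app S v + app T v" by transfer (rule blinfun.add_left)
  show "app S (v + w) = app S v + app S w" by transfer (rule blinfun.add_right)
  show "app (r *\<^sub>R S) v = r *\<^sub>R app S v" by transfer (rule blinfun.scaleR_left)
  show "app S (r *\<^sub>R v) = r *\<^sub>R app S v" by transfer (rule blinfun.scaleR_right)
  show "\<exists>K. \<forall>(S::'a endo) v. norm (app S v) \<le> norm S * norm v * K"
    by (rule exI[of _ 1], transfer, simp add: norm_blinfun)
qed

interpretation app: bounded_bilinear app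
  by (rule bounded_bilinear_app)

lemma app_mult [simp]: "app (S * T) v = app S (app T v)"
  by transfer simp

lemma app_one [simp]: "app 1 v = v"
  by transfer simp

lemma norm_app: "norm (app T v) \<le> norm T * norm v"
  by transfer (rule norm_blinfun)

lemma norm_endo_bound:
  assumes "\<And>v. norm (app T v) \<le> K * norm v" "0 \<le> K"
  shows "norm T \<le> K"
  using assms by transfer (rule norm_blinfun_bound)

instance endo :: (euclidean_space) banach
proof
  fix X :: "nat \<Rightarrow> 'a endo"
  assume "Cauchy X"
  then have "Cauchy (\<lambda>n. endo_blinfun (X n))"
    unfolding Cauchy_def by transfer
  then obtain L where L: "(\<lambda>n. endo_blinfun (X n)) \<longlonglongrightarrow> L"
    by (auto simp: Cauchy_convergent_iff convergent_def)
  have "dist (X n) (Endo L) = dist (endo_blinfun (X n)) L" for n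
    by (simp add: dist_endo.rep_eq Endo_inverse)
  then have "X \<longlonglongrightarrow> Endo L"
    using L by (simp add: tendsto_iff)
  then show "convergent X"
    by (auto simp: convergent_def)
qed

section \<open>Exponentials\<close>

text \<open>The vector exp (- s T) u(s) is constant in s. The explicit formulas for exponentials on
  nilpotent vectors, on eigenvectors and for the split system are all obtained in this way, by
  exhibiting a solution with the right initial value.\<close>

lemma exp_ode_unique:
  fixes u :: "real \<Rightarrow> 'a::euclidean_space"
  assumes der: "\<And>t. 0 \<le> t \<Longrightarrow> t \<le> b \<Longrightarrow> (u has_vector_derivative app T (u t)) (at t within {0..b})"
    and t: "0 \<le> t" "t \<le> b"
  shows "u t = app (exp (t *\<^sub>R T)) (u 0)"
proof -
  define z where "z s = app (exp (s *\<^sub>R (- T))) (u s)" for s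
  have "(z has_vector_derivative 0) (at s within {0..b})" if s: "s \<in> {0..b}" for s
  proof -
    have "(z has_vector_derivative (app (exp (s *\<^sub>R (- T))) (app T (u s)) +
            app (exp (s *\<^sub>R (- T)) * (- T)) (u s))) (at s within {0..b})"
      unfolding z_def
      using s by (intro app.has_vector_derivative exp_scaleR_has_vector_derivative_right der) auto
    then show ?thesis
      by (simp add: app.minus_left app.minus_right)
  qed
  then obtain c where c: "\<And>s. s \<in> {0..b} \<Longrightarrow> z s = c"
    using has_vector_derivative_zero_constant[of "{0..b}" z] by (auto)
  have "z t = z 0"
    using c t by simp
  then have "app (exp (t *\<^sub>R (- T))) (u t) = u 0"
    by (simp add: z_def)
  then have "app (exp (t *\<^sub>R T) * exp (t *\<^sub>R (- T))) (u t) = app (exp (t *\<^sub>R T)) (u 0)"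
    by simp
  moreover have "exp (t *\<^sub>R T) * exp (t *\<^sub>R (- T)) = 1"
    using exp_minus_inverse[of "t *\<^sub>R T"] by simp
  ultimately show ?thesis
    by (metis app_one)
qed

lemma app_exp_has_vector_derivative:
  "((\<lambda>t. app (exp (t *\<^sub>R T)) v) has_vector_derivative app T (app (exp (t *\<^sub>R T)) v)) (at t within S)"
proof -
  have "((\<lambda>t. app (exp (t *\<^sub>R T)) v) has_vector_derivative
      (app (exp (t *\<^sub>R T)) 0 + app (T * exp (t *\<^sub>R T)) v)) (at t within S)"
    by (intro app.has_vector_derivative has_vector_derivative_const
        has_vector_derivative_at_within[OF exp_scaleR_has_vector_derivative_left])
  then show ?thesis
    by (simp add: app.zero_right)
qed

lemma exp_app_nilpotent:
  assumes "app T (app T v) = 0" and that: "0 \<le> t"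
  shows "app (exp (t *\<^sub>R T)) v = v + t *\<^sub>R app T v"
proof -
  have "v + t *\<^sub>R app T v = app (exp (t *\<^sub>R T)) (v + 0 *\<^sub>R app T v)"
  proof (rule exp_ode_unique[where b = t])
    fix s
    have "((\<lambda>s. v + s *\<^sub>R app T v) has_vector_derivative (0 + app T v)) (at s within {0..t})"
      by (intro has_vector_derivative_add has_vector_derivative_const)
         (auto intro!: derivative_eq_intros)
    then show "((\<lambda>s. v + s *\<^sub>R app T v) has_vector_derivative app T (v + s *\<^sub>R app T v)) (at s within {0..t})"
      using assms by (simp add: app.add_right app.scaleR_right)
  qed (use that in auto)
  then show ?thesis
    by simp
qed

text \<open>On such a vector the exponential is v + t T v, which stays bounded in t only if T v
  vanishes.\<close>

lemma exp_bounded_semisimple: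
  assumes bd: "\<And>t. 0 \<le> t \<Longrightarrow> norm (exp (t *\<^sub>R T)) \<le> K"
    and "app T (app T v) = 0"
  shows "app T v = 0"
proof (rule ccontr)
  assume nz: "app T v \<noteq> 0"
  \<comment> \<open>Chosen so that t |T v| = K |v| + |v| + 1, one more than the bound derived
    below.\<close>
  define t where "t = (K * norm v + norm v + 1) / norm (app T v)"
  have "0 \<le> K"
    using bd[of 0] by simp
  then have t0: "0 \<le> t"
    unfolding t_def by (intro divide_nonneg_nonneg add_nonneg_nonneg mult_nonneg_nonneg) auto
  have "norm (t *\<^sub>R app T v) = norm (app (exp (t *\<^sub>R T)) v - v)"
    using exp_app_nilpotent[OF assms(2) t0] by simp
  also have "\<dots> \<le> norm (app (exp (t *\<^sub>R T)) v) + norm v"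
    by (rule norm_triangle_ineq4)
  also have "\<dots> \<le> K * norm v + norm v"
    using norm_app[of "exp (t *\<^sub>R T)" v] mult_right_mono[OF bd[OF t0], of "norm v"] by simp
  finally show False
    using nz t0 by (simp add: t_def)
qed

text \<open>The product of exp (- c t) with K + c times the integral of f has a nonpositive
  derivative.\<close>

lemma gronwall:
  fixes f :: "real \<Rightarrow> real"
  assumes cont: "continuous_on {0..T} f" and c: "0 \<le> c"
    and le: "\<And>t. 0 \<le> t \<Longrightarrow> t \<le> T \<Longrightarrow> f t \<le> K + c * integral {0..t} f"
    and t: "0 \<le> t" "t \<le> T"
  shows "f t \<le> K * exp (c * t)"
proof -
  define F where "F s = (K + c * integral {0..s} f) * exp (- (c * s))" for s
  have der: "((\<lambda>s. F s) has_real_derivative (c * f s - c * (K + c * integral {0..s} f)) * exp (- (c * s)))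
      (at s within {0..t})" if s: "s \<in> {0..t}" for s
  proof -
    have "((\<lambda>s. integral {0..s} f) has_real_derivative f s) (at s within {0..t})"
      using integral_has_real_derivative[of 0 t f s] s t continuous_on_subset[OF cont, of "{0..t}"]
      by auto
    then show ?thesis
      unfolding F_def by (auto intro!: derivative_eq_intros simp: algebra_simps)
  qed
  have "F t \<le> F 0"
  proof (cases "t = 0")
    case False
    have "\<exists>y. ((\<lambda>s. F s) has_real_derivative y) (at s) \<and> y \<le> 0" if s: "0 < s" "s < t" for s
    proof -
      have "((\<lambda>s. F s) has_real_derivative (c * f s - c * (K + c * integral {0..s} f)) * exp (- (c * s))) (at s)"
        using der[of s] s at_within_Icc_at[of 0 s t] by auto
      moreover have "c * f s \<le> c * (K + c * integral {0..s} f)"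
        using le[of s] s t c by (intro mult_left_mono) auto
      ultimately show ?thesis
        by (auto simp: mult_nonpos_nonneg)
    qed
    moreover have "continuous_on {0..t} F"
      using der by (rule DERIV_continuous_on)
    ultimately show ?thesis
      using DERIV_nonpos_imp_decreasing_open[of 0 t F] t by auto
  qed simp
  then have "(K + c * integral {0..t} f) \<le> K * exp (c * t)"
    by (simp add: F_def exp_minus field_simps)
  then show ?thesis
    using le[OF t] by simp
qed

text \<open>A bounded perturbation changes only the rate of growth, by K |P|. It is applied to the
  zero order term B and, in the estimate of eigenvalues, to a bounded complex shift of the
  frequency.\<close>

lemma exp_perturbation:
  fixes X P :: "'a::{real_normed_algebra_1,banach}"
  assumes bd: "\<And>t. 0 \<le> t \<Longrightarrow> norm (exp (t *\<^sub>R X)) \<le> K * exp (\<alpha> * t)" and t: "0 \<le> t"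
  shows "norm (exp (t *\<^sub>R (X + P))) \<le> K * exp ((\<alpha> + K * norm P) * t)"
proof -
  have K: "0 \<le> K"
    using bd[of 0] by (simp)
  \<comment> \<open>Duhamel's formula: integrate in r the derivative of exp ((s - r) X) exp (r (X +
    P)), in which the two terms with X cancel.\<close>
  have duhamel: "exp (s *\<^sub>R (X + P)) = exp (s *\<^sub>R X) +
      integral {0..s} (\<lambda>r. exp ((s - r) *\<^sub>R X) * P * exp (r *\<^sub>R (X + P)))" if s: "0 \<le> s" for s
  proof -
    define z where "z r = exp ((s - r) *\<^sub>R X) * exp (r *\<^sub>R (X + P))" for r
    have "(z has_vector_derivative (exp ((s - r) *\<^sub>R X) * ((X + P) * exp (r *\<^sub>R (X + P))) +
        ((-1) *\<^sub>R (exp ((s - r) *\<^sub>R X) * X)) * exp (r *\<^sub>R (X + P)))) (at r within {0..s})" for r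
    proof -
      have "((\<lambda>r. exp ((s - r) *\<^sub>R X)) has_vector_derivative (-1) *\<^sub>R (exp ((s - r) *\<^sub>R X) * X)) (at r within {0..s})"
      proof -
        have "((\<lambda>r. s - r) has_vector_derivative -1) (at r within {0..s})"
          by (auto intro!: derivative_eq_intros)
        from vector_diff_chain_within[OF this has_vector_derivative_at_within[OF exp_scaleR_has_vector_derivative_right]]
        show ?thesis
          by (simp add: o_def)
      qed
      then show ?thesis
        unfolding z_def
        by (intro has_vector_derivative_mult has_vector_derivative_at_within[OF exp_scaleR_has_vector_derivative_left])
    qed
    then have "(z has_vector_derivative exp ((s - r) *\<^sub>R X) * P * exp (r *\<^sub>R (X + P))) (at r within {0..s})" for r
      by (simp add: algebra_simps)
    then have "((\<lambda>r. exp ((s - r) *\<^sub>R X) * P * exp (r *\<^sub>R (X + P))) has_integral (z s - z 0)) {0..s}"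
      using s by (intro fundamental_theorem_of_calculus) auto
    then show ?thesis
      by (simp add: z_def integral_unique)
  qed
  have ce: "continuous_on S (\<lambda>r. exp (r *\<^sub>R Z))" for S and Z :: 'a
    by (intro continuous_at_imp_continuous_on ballI
        has_vector_derivative_continuous[OF exp_scaleR_has_vector_derivative_right])
  have ce': "continuous_on S (\<lambda>r. exp ((s - r) *\<^sub>R Z))" for S s and Z :: 'a
    by (rule continuous_on_compose2[OF ce[of UNIV]]) (auto intro!: continuous_intros)
  \<comment> \<open>The weight exp (- \<alpha> s) cancels the growth of the free term, so that
    Gronwall's inequality applies with the constant K.\<close>
  define f where "f s = norm (exp (s *\<^sub>R (X + P))) * exp (- (\<alpha> * s))" for s
  have "f t \<le> K * exp ((K * norm P) * t)"
  proof (rule gronwall[where T = t])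
    show "continuous_on {0..t} f"
      unfolding f_def by (intro continuous_intros ce)
    show "0 \<le> K * norm P" using K by simp
    fix s assume s: "0 \<le> s" "s \<le> t"
    have cf: "continuous_on {0..s} f"
      unfolding f_def by (intro continuous_intros ce)
    have "norm (exp (s *\<^sub>R (X + P))) \<le> norm (exp (s *\<^sub>R X)) +
       norm (integral {0..s} (\<lambda>r. exp ((s - r) *\<^sub>R X) * P * exp (r *\<^sub>R (X + P))))"
      by (subst duhamel[OF s(1)]) (rule norm_triangle_ineq)
    also have "\<dots> \<le> K * exp (\<alpha> * s) + integral {0..s} (\<lambda>r. (K * norm P * exp (\<alpha> * s)) * f r)"
    proof (intro add_mono bd s integral_norm_bound_integral)
      show "(\<lambda>r. exp ((s - r) *\<^sub>R X) * P * exp (r *\<^sub>R (X + P))) integrable_on {0..s}"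
        by (intro integrable_continuous_real continuous_intros ce ce')
      show "(\<lambda>r. (K * norm P * exp (\<alpha> * s)) * f r) integrable_on {0..s}"
        by (intro integrable_continuous_real continuous_intros cf)
      fix r assume r: "r \<in> {0..s}"
      have "norm (exp ((s - r) *\<^sub>R X) * P * exp (r *\<^sub>R (X + P))) \<le>
          norm (exp ((s - r) *\<^sub>R X)) * norm P * norm (exp (r *\<^sub>R (X + P)))"
        by (meson norm_mult_ineq order_trans mult_right_mono norm_ge_zero)
      also have "\<dots> \<le> (K * exp (\<alpha> * (s - r))) * norm P * norm (exp (r *\<^sub>R (X + P)))"
        using r by (intro mult_right_mono bd) auto
      also have "\<dots> = (K * norm P * exp (\<alpha> * s)) * f r"
        by (simp add: f_def algebra_simps flip: exp_add)
      finally show "norm (exp ((s - r) *\<^sub>R X) * P * exp (r *\<^sub>R (X + P))) \<le> (K * norm P * exp (\<alpha> * s)) * f r" .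
    qed
    also have "\<dots> = (K + K * norm P * integral {0..s} f) * exp (\<alpha> * s)"
      by (simp add: algebra_simps)
    finally show "f s \<le> K + K * norm P * integral {0..s} f"
      by (simp add: f_def exp_minus field_simps)
  qed (use t in auto)
  then show ?thesis
    by (simp add: f_def exp_minus exp_add field_simps distrib_right)
qed

text \<open>The exponential series converges uniformly on balls. Continuity serves for the limit of
  rescaled generators and for the measurability of the evolved Fourier transform.\<close>

lemma continuous_exp:
  "continuous_on UNIV (exp :: 'a::{real_normed_algebra_1,banach} \<Rightarrow> 'a)"
proof -
  have "continuous_on (ball 0 r) (exp :: 'a \<Rightarrow> 'a)" for r
  proof -
    have "uniform_limit (ball 0 r) (\<lambda>n x. \<Sum>i<n. x ^ i /\<^sub>R fact i) (\<lambda>x :: 'a. \<Sum>i. x ^ i /\<^sub>R fact i) sequentially"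
    proof (rule Weierstrass_m_test)
      show "norm (x ^ n /\<^sub>R fact n) \<le> r ^ n /\<^sub>R fact n" if "x \<in> ball 0 r" for n and x :: 'a
      proof -
        have "norm (x ^ n) \<le> norm x ^ n" by (rule norm_power_ineq)
        also have "\<dots> \<le> r ^ n" using that by (intro power_mono) auto
        finally show ?thesis by (simp add: divide_simps)
      qed
      show "summable (\<lambda>n. r ^ n /\<^sub>R fact n)"
        by (rule summable_exp_generic)
    qed
    then show ?thesis
      unfolding exp_def
      by (rule uniform_limit_theorem[rotated]) (auto intro!: always_eventually continuous_intros)
  qed
  then have "continuous_on (\<Union>n::nat. ball 0 (real n)) (exp :: 'a \<Rightarrow> 'a)"
    by (intro continuous_on_open_UN) auto
  moreover have "(\<Union>n::nat. ball (0::'a) (real n)) = UNIV"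
    using reals_Archimedean2 by fastforce
  ultimately show ?thesis
    by simp
qed

section \<open>Complex matrices\<close>

definition op :: "complex^'n^'n \<Rightarrow> (complex^'n::finite) endo" where
  "op M = Endo (Blinfun ((*v) M))"

lemma app_op [simp]: "app (op M) v = M *v v"
  by (simp add: op_def app.rep_eq Endo_inverse bounded_linear_Blinfun_apply)

lemma op_add: "op (M + N) = op M + op N"
  by (rule endo_eqI) (simp add: matrix_vector_mult_add_rdistrib app.add_left)

lemma op_diff: "op (M - N) = op M - op N"
  by (rule endo_eqI) (simp add: matrix_vector_mult_diff_rdistrib app.diff_left)

lemma op_scaleR: "op (r *\<^sub>R M) = r *\<^sub>R op M"
  by (rule endo_eqI) (simp add: app.scaleR_left vec_eq_iff matrix_vector_mult_def scaleR_sum_right)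

lemma op_zero [simp]: "op 0 = 0"
  by (rule endo_eqI) (simp add: app.zero_left)

lemma op_minus: "op (- M) = - op M"
  using op_diff[of 0 M] by simp

lemma op_mult: "op (M ** N) = op M * op N"
  by (rule endo_eqI) (simp add: matrix_vector_mul_assoc)

lemma linear_op: "linear op"
  by (rule linearI) (simp_all add: op_add op_scaleR)

lemma bounded_linear_op: "bounded_linear op"
  using linear_op by (rule linear_conv_bounded_linear[THEN iffD1])

lemma op_sum: "op (sum f S) = (\<Sum>x\<in>S. op (f x))"
  using linear_sum[OF linear_op] .

lemma matrix_vector_mult_minus: "M *v (- v) = - (M *v v)" for M :: "complex^'n^'n::finite"
  using app.minus_right[of "op M" v] by simp

lemma mat_mult_vector: "mat c *v v = c *s (v :: complex^'n::finite)"
  by (simp add: vec_eq_iff matrix_vector_mult_def mat_def if_distrib[of "\<lambda>x. x * _"] cong: if_cong)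

lemma norm_cvec_scale: "norm (c *s v) = norm c * norm (v :: complex^'n::finite)"
  by (simp add: norm_vec_def norm_mult L2_set_right_distrib)

lemma bounded_bilinear_cvec_scale:
  "bounded_bilinear ((*s) :: complex \<Rightarrow> complex^'n::finite \<Rightarrow> complex^'n)"
proof
  show "\<exists>K. \<forall>a (b :: complex^'n). norm (a *s b) \<le> norm a * norm b * K"
    by (rule exI[of _ 1]) (simp add: norm_cvec_scale)
qed (simp_all add: vec_eq_iff algebra_simps)

interpretation cvec: bounded_bilinear "(*s) :: complex \<Rightarrow> complex^'n::finite \<Rightarrow> complex^'n"
  by (rule bounded_bilinear_cvec_scale)

text \<open>The real-linear maps do not form a complex algebra, so complex scalars appear as
  elements of it. They commute with every \<open>op M\<close>, but not with every element: complex
  conjugation is a counterexample.\<close>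

abbreviation scal :: "complex \<Rightarrow> (complex^'n::finite) endo" where
  "scal c \<equiv> op (mat c)"

lemma app_scal [simp]: "app (scal c) v = c *s v"
  by (simp add: mat_mult_vector)

lemma scal_zero [simp]: "scal 0 = 0"
  by (rule endo_eqI) (simp add: app.zero_left del: app_op)

lemma scal_one [simp]: "scal 1 = 1"
  by (rule endo_eqI) (simp del: app_op)

lemma scal_add: "scal (a + b) = scal a + scal b"
  by (rule endo_eqI) (simp add: app.add_left del: app_op)

lemma scal_minus: "scal (- a) = - scal a"
  by (rule endo_eqI) (simp add: app.minus_left cvec.minus_left del: app_op)

lemma scal_mult: "scal (a * b) = scal a * scal b"
  by (rule endo_eqI) (simp add: vector_smult_assoc del: app_op)

lemma scal_commute: "scal c * op M = op M * scal c"
  by (rule endo_eqI) (simp add: mat_mult_vector vector_scalar_commute)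

lemma eigenvalue_norm:
  assumes "M *v v = l *s v" "v \<noteq> 0"
  shows "norm l \<le> norm (op M)"
proof -
  have "norm l * norm v = norm (app (op M) v)"
    using assms by (simp add: norm_cvec_scale)
  also have "\<dots> \<le> norm (op M) * norm v"
    by (rule norm_app)
  finally show ?thesis
    using assms by simp
qed

lemma exp_scal:
  assumes t: "0 \<le> t"
  shows "app (exp (t *\<^sub>R scal l)) v = exp (of_real t * l) *s v"
proof -
  have "((\<lambda>s. exp (of_real s * l) *s v) has_vector_derivative app (scal l) (exp (of_real s * l) *s v)) (at s within {0..t})"
    for s
  proof -
    have "((\<lambda>s. exp (of_real s * l)) has_vector_derivative (l * exp (of_real s * l))) (at s within {0..t})"
      using exp_scaleR_has_vector_derivative_right[of l s]
      by (auto intro!: has_vector_derivative_at_within simp: scaleR_conv_of_real mult.commute)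
    then have "((\<lambda>s. exp (of_real s * l) *s v) has_vector_derivative
        (exp (of_real s * l) *s 0 + (l * exp (of_real s * l)) *s v)) (at s within {0..t})"
      by (intro cvec.has_vector_derivative has_vector_derivative_const)
    then show ?thesis
      by (simp add: vector_smult_assoc del: app_op)
  qed
  from exp_ode_unique[of t "\<lambda>s. exp (of_real s * l) *s v" "scal l" t, OF this] show ?thesis
    using t by simp
qed

lemma exp_eigenvector:
  assumes M: "M *v v = l *s v" and t: "0 \<le> t"
  shows "app (exp (t *\<^sub>R op M)) v = exp (of_real t * l) *s v"
proof -
  have "((\<lambda>s. exp (of_real s * l) *s v) has_vector_derivative app (op M) (exp (of_real s * l) *s v)) (at s within {0..t})"
    for s
  proof -
    have "((\<lambda>s. exp (of_real s * l)) has_vector_derivative (l * exp (of_real s * l))) (at s within {0..t})"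
      using exp_scaleR_has_vector_derivative_right[of l s]
      by (auto intro!: has_vector_derivative_at_within simp: scaleR_conv_of_real mult.commute)
    then have "((\<lambda>s. exp (of_real s * l) *s v) has_vector_derivative
        (exp (of_real s * l) *s 0 + (l * exp (of_real s * l)) *s v)) (at s within {0..t})"
      by (intro cvec.has_vector_derivative has_vector_derivative_const)
    then show ?thesis
      by (simp add: vector_smult_assoc vector_scalar_commute M mult.commute)
  qed
  from exp_ode_unique[of t "\<lambda>s. exp (of_real s * l) *s v" "op M" t, OF this] show ?thesis
    using t by simp
qed

subsection \<open>Annihilating products of eigenvalue factors\<close>

text \<open>A list of roots keeps multiplicities and lets an induction peel off one factor at a
  time.\<close>

definition factor_product :: "complex^'n^'n \<Rightarrow> complex list \<Rightarrow> (complex^'n::finite) endo" where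
  "factor_product M ls = prod_list (map (\<lambda>l. op M - scal l) ls)"

lemma factor_product_simps [simp]:
  "factor_product M [] = 1"
  "factor_product M (l # ls) = (op M - scal l) * factor_product M ls"
  by (simp_all add: factor_product_def)

lemma factor_commute:
  "(op M - scal l) * factor_product M ls = factor_product M ls * (op M - scal l)"
proof (induction ls)
  case (Cons k ls)
  have "(op M - scal l) * (op M - scal k) = (op M - scal k) * (op M - scal l)"
    using scal_commute[of l M] scal_commute[of k M] scal_commute[of l "mat k"]
    by (simp add: algebra_simps)
  then show ?case
    by (simp add: Cons.IH[symmetric] mult.assoc[symmetric]) (simp add: mult.assoc Cons.IH)
qed simp

text \<open>The factors commute, so one from the middle can be moved to the front; this is how a
  factor that belongs to no eigenvalue is discarded.\<close>

lemma factor_product_append: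
  "factor_product M (ls @ l # ks) = (op M - scal l) * factor_product M (ls @ ks)"
proof (induction ls)
  case (Cons a ls)
  have "(op M - scal l) * (op M - scal a) = (op M - scal a) * (op M - scal l)"
    using factor_commute[of M l "[a]"] by simp
  then show ?case
    by (simp add: Cons.IH) (simp add: mult.assoc[symmetric])
qed simp

definition poly_endo :: "complex^'n^'n \<Rightarrow> complex poly \<Rightarrow> (complex^'n::finite) endo" where
  "poly_endo M p = fold_coeffs (\<lambda>a X. scal a + op M * X) p 0"

lemma poly_endo_0 [simp]: "poly_endo M 0 = 0"
  by (simp add: poly_endo_def)

lemma poly_endo_pCons [simp]: "poly_endo M (pCons a p) = scal a + op M * poly_endo M p"
  by (cases "p = 0 \<and> a = 0") (auto simp: poly_endo_def)

lemma poly_endo_add: "poly_endo M (p + q) = poly_endo M p + poly_endo M q"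
  by (induction p q rule: poly_induct2) (simp_all add: scal_add algebra_simps)

lemma poly_endo_smult: "poly_endo M (smult c p) = scal c * poly_endo M p"
proof (induction p)
  case (pCons a p)
  then show ?case
    using scal_commute[of c M] by (simp add: scal_mult distrib_left flip: mult.assoc)
qed simp

lemma poly_endo_sum: "poly_endo M (sum f S) = (\<Sum>x\<in>S. poly_endo M (f x))"
  by (induction S rule: infinite_finite_induct) (simp_all add: poly_endo_add)

lemma poly_endo_monom: "poly_endo M (monom c n) = scal c * op M ^ n"
proof (induction n)
  case (Suc n)
  then show ?case
    using scal_commute[of c M] by (simp add: monom_Suc flip: mult.assoc)
qed (simp add: monom_0)

lemma poly_endo_factors: "poly_endo M (prod_list (map (\<lambda>l. [:- l, 1:]) ls)) = factor_product M ls"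
proof (induction ls)
  case (Cons l ls)
  let ?q = "prod_list (map (\<lambda>l. [:- l, 1:]) ls)"
  have "prod_list (map (\<lambda>l. [:- l, 1:]) (l # ls)) = smult (- l) ?q + pCons 0 ?q"
    by simp
  then show ?case
    by (simp only: poly_endo_add poly_endo_smult poly_endo_pCons Cons.IH) (simp add: scal_minus algebra_simps)
qed (simp add: one_pCons)

text \<open>The powers M^0, ..., M^n are n + 1 elements of a real space of dimension n = 2 N^2,
  hence linearly dependent. The polynomial given by the relation splits over the complex
  numbers.\<close>

lemma annihilating_factors:
  fixes M :: "complex^'n^'n::finite"
  shows "\<exists>ls. length ls \<le> DIM(complex^'n^'n) \<and> factor_product M ls = 0"
proof -
  define n where "n = DIM(complex^'n^'n)"
  define pw where "pw k = ((**) M ^^ k) (mat 1)" for k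
  have op_pw: "op (pw k) = op M ^ k" for k
    by (induction k) (simp_all add: pw_def op_mult)
  have "\<exists>c :: nat \<Rightarrow> real. (\<exists>k\<le>n. c k \<noteq> 0) \<and> (\<Sum>k\<le>n. c k *\<^sub>R pw k) = 0"
  \<comment> \<open>Linear dependence is a property of the set of powers, so a repeated power is
    treated apart: there the relation is the difference of two equal powers.\<close>
  proof (cases "inj_on pw {..n}")
    case True
    then have "card (pw ` {..n}) = Suc n"
      by (simp add: card_image)
    then have "dependent (pw ` {..n})"
      using independent_bound[of "pw ` {..n}"] unfolding n_def by fastforce
    then obtain u where u: "\<exists>v\<in>pw ` {..n}. u v \<noteq> 0" "(\<Sum>v\<in>pw ` {..n}. u v *\<^sub>R v) = 0"
      using dependent_finite[of "pw ` {..n}"] by auto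
    show ?thesis
      by (rule exI[of _ "\<lambda>k. u (pw k)"]) (use u True in \<open>auto simp: sum.reindex\<close>)
  next
    case False
    then obtain i j where ij: "i \<le> n" "j \<le> n" "i \<noteq> j" "pw i = pw j"
      by (auto simp: inj_on_def)
    let ?c = "\<lambda>k. (if k = i then 1 else 0) - (if k = j then 1 else 0) :: real"
    have "(\<Sum>k\<le>n. ?c k *\<^sub>R pw k) = (\<Sum>k\<le>n. if k = i then pw k else 0) - (\<Sum>k\<le>n. if k = j then pw k else 0)"
      unfolding sum_subtractf[symmetric] by (rule sum.cong) auto
    also have "\<dots> = 0"
      using ij by simp
    finally show ?thesis
      using ij by (intro exI[of _ ?c]) auto
  qed
  then obtain c :: "nat \<Rightarrow> real" where c: "\<exists>k\<le>n. c k \<noteq> 0" "(\<Sum>k\<le>n. c k *\<^sub>R pw k) = 0"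
    by blast
  define p where "p = (\<Sum>k\<le>n. monom (complex_of_real (c k)) k)"
  have coeff_p: "coeff p k = (if k \<le> n then of_real (c k) else 0)" for k
    by (simp add: p_def coeff_sum)
  then have "p \<noteq> 0"
    using c(1) by (metis coeff_0 of_real_eq_0_iff)
  have deg: "degree p \<le> n"
    by (rule degree_le) (simp add: coeff_p)
  have scal_real: "scal (of_real r) = (r *\<^sub>R 1 :: (complex^'n) endo)" for r
    by (rule endo_eqI) (simp add: app.scaleR_left vec_eq_iff scaleR_conv_of_real[where 'a = complex] del: app_op)
  have "poly_endo M p = (\<Sum>k\<le>n. c k *\<^sub>R op M ^ k)"
    by (simp add: p_def poly_endo_sum poly_endo_monom scal_real)
  also have "\<dots> = op (\<Sum>k\<le>n. c k *\<^sub>R pw k)"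
    by (simp add: op_sum op_scaleR op_pw)
  finally have p0: "poly_endo M p = 0"
    using c(2) by simp
  obtain root where root: "smult (lead_coeff p) (\<Prod>i<degree p. [:- root i, 1:]) = p"
    by (rule complex_poly_decompose')
  define ls where "ls = map root [0..<degree p]"
  have "(\<Prod>i<degree p. [:- root i, 1:]) = prod_list (map (\<lambda>l. [:- l, 1:]) ls)"
    using prod.distinct_set_conv_list[of "[0..<degree p]" "\<lambda>i. [:- root i, 1:]"]
    by (simp add: ls_def comp_def atLeast0LessThan)
  then have "scal (lead_coeff p) * factor_product M ls = 0"
    using p0 by (metis poly_endo_factors poly_endo_smult root)
  \<comment> \<open>The leading coefficient is nonzero and is cancelled by its inverse, taken as an
    operator.\<close>
  then have "scal (inverse (lead_coeff p) * lead_coeff p) * factor_product M ls = 0"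
    by (simp only: scal_mult mult.assoc) simp
  then have "factor_product M ls = 0"
    using \<open>p \<noteq> 0\<close> by simp
  moreover have "length ls \<le> n"
    using deg by (simp add: ls_def)
  ultimately show ?thesis
    unfolding n_def by blast
qed

text \<open>Take an annihilating list of least length. If an entry were not an eigenvalue, its
  factor would be injective and could be deleted, against minimality.\<close>

lemma annihilating_eigenvalues:
  fixes M :: "complex^'n^'n::finite"
  obtains ls where "length ls \<le> DIM(complex^'n^'n)" "factor_product M ls = 0"
    "\<And>l. l \<in> set ls \<Longrightarrow> \<exists>v. v \<noteq> 0 \<and> M *v v = l *s v"
proof -
  obtain ls where ls: "factor_product M ls = 0" and
    min: "\<And>ks. factor_product M ks = 0 \<Longrightarrow> length ls \<le> length ks"
    using ex_has_least_nat[of "\<lambda>ls. factor_product M ls = 0" _ length] annihilating_factors[of M] by blast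
  have "\<exists>v. v \<noteq> 0 \<and> M *v v = l *s v" if l: "l \<in> set ls" for l
  proof (rule ccontr)
    assume no: "\<not> ?thesis"
    obtain as bs where as: "ls = as @ l # bs"
      using split_list[OF l] by blast
    have "app (factor_product M (as @ bs)) x = 0" for x
    proof -
      have "app ((op M - scal l) * factor_product M (as @ bs)) x = 0"
        using ls as by (simp add: factor_product_append app.zero_left)
      then have "M *v app (factor_product M (as @ bs)) x = l *s app (factor_product M (as @ bs)) x"
        by (simp add: app.diff_left mat_mult_vector)
      then show ?thesis
        using no by blast
    qed
    then have "factor_product M (as @ bs) = 0"
      by (intro endo_eqI) (simp add: app.zero_left)
    then show False
      using min as by fastforce
  qed
  moreover have "length ls \<le> DIM(complex^'n^'n)"
    using annihilating_factors[of M] min order_trans by blast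
  ultimately show ?thesis
    using ls that by blast
qed

subsection \<open>Growth of the exponential\<close>

text \<open>Induction on the number of factors. The shorter product annihilates y = (M - l) x, and
  exp (s (M - l)) x has the derivative exp (s (M - l)) y. Integration costs a factor t, and |y|
  \<le> 2 b |x| gives the factor 2 b.\<close>

lemma exp_growth_factors:
  fixes M :: "complex^'n^'n::finite"
  assumes "app (factor_product M ls) x = 0"
    and "\<And>l. l \<in> set ls \<Longrightarrow> Re l \<le> a \<and> norm l \<le> b" and "norm (op M) \<le> b" and "0 \<le> t"
  shows "norm (app (exp (t *\<^sub>R op M)) x) \<le> exp (a * t) * (\<Sum>k<length ls. (2 * b * t) ^ k) * norm x"
  using assms
proof (induction ls arbitrary: x t)
  case (Cons l ls)
  have b: "0 \<le> b"
    using Cons.prems(3) norm_ge_zero order_trans by blast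
  let ?T = "op M"
  let ?S = "op M - scal l"
  let ?p = "\<lambda>t. \<Sum>k<length ls. (2 * b * t) ^ k"
  define y where "y = app ?S x"
  have y: "app (factor_product M ls) y = 0"
    using Cons.prems(1) factor_commute[of M l ls] unfolding y_def
    by (metis app_mult factor_product_simps(2))
  have ny: "norm y \<le> 2 * b * norm x"
  proof -
    have "norm y \<le> norm (M *v x) + norm (l *s x)"
      unfolding y_def by (simp add: app.diff_left mat_mult_vector norm_triangle_ineq4)
    moreover have "norm (M *v x) \<le> b * norm x"
      using norm_app[of "op M" x] Cons.prems(3) mult_right_mono[of "norm (op M)" b "norm x"] by simp
    moreover have "norm (l *s x) \<le> b * norm x"
      using Cons.prems(2)[of l] by (simp add: norm_cvec_scale mult_right_mono)
    ultimately show ?thesis by simp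
  qed
  \<comment> \<open>Subtracting the scalar l multiplies norms by exp (- Re l s), so that estimates
    for M and for M - l are interchangeable.\<close>
  have shift: "norm (app (exp (s *\<^sub>R ?S)) w) = exp (- Re l * s) * norm (app (exp (s *\<^sub>R ?T)) w)" if "0 \<le> s" for s w
  proof -
    have "s *\<^sub>R ?S = s *\<^sub>R scal (- l) + s *\<^sub>R ?T"
      by (simp add: scal_minus algebra_simps)
    moreover have "s *\<^sub>R scal (- l) * s *\<^sub>R ?T = s *\<^sub>R ?T * s *\<^sub>R scal (- l)"
      using scal_commute[of "- l" M] by simp
    ultimately have "exp (s *\<^sub>R ?S) = exp (s *\<^sub>R scal (- l)) * exp (s *\<^sub>R ?T)"
      using exp_add_commuting by metis
    then show ?thesis
      using that by (simp add: exp_scal norm_cvec_scale mult.commute)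
  qed
  define z where "z s = app (exp (s *\<^sub>R ?S)) x" for s
  define B where "B = exp ((a - Re l) * t) * ?p t * (2 * b * norm x)"
  have zder: "(z has_vector_derivative app (exp (s *\<^sub>R ?S)) y) (at s within {0..t})" for s
  proof -
    have "app (exp (s *\<^sub>R ?S)) y = app ?S (app (exp (s *\<^sub>R ?S)) x)"
      unfolding y_def by (metis app_mult exp_times_scaleR_commute)
    then show ?thesis
      unfolding z_def using app_exp_has_vector_derivative[of ?S x s "{0..t}"] by simp
  qed
  have "norm (app (exp (s *\<^sub>R ?S)) y) \<le> B" if s: "s \<in> {0..t}" for s
  proof -
    have "norm (app (exp (s *\<^sub>R ?S)) y) \<le> exp (- Re l * s) * (exp (a * s) * ?p s * norm y)"
      using s Cons.IH[OF y, of s] Cons.prems by (subst shift) auto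
    also have "\<dots> = exp ((a - Re l) * s) * ?p s * norm y"
      by (simp add: algebra_simps flip: exp_add)
    also have "\<dots> \<le> B"
      unfolding B_def using s ny b Cons.prems(2)[of l]
      by (intro mult_mono sum_mono power_mono mult_nonneg_nonneg sum_nonneg zero_le_power)
         (auto intro!: mult_left_mono)
    finally show ?thesis .
  qed
  moreover have "((\<lambda>s. app (exp (s *\<^sub>R ?S)) y) has_integral (z t - z 0)) {0..t}"
    using Cons.prems(4) zder by (intro fundamental_theorem_of_calculus) auto
  moreover have "0 \<le> B"
    unfolding B_def using b Cons.prems(4) by (intro mult_nonneg_nonneg sum_nonneg zero_le_power) auto
  ultimately have "norm (z t - z 0) \<le> B * t"
    using has_integral_bound_real[of B "{}" "\<lambda>s. app (exp (s *\<^sub>R ?S)) y" "z t - z 0" 0 t] Cons.prems(4) by auto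
  then have "norm (z t) \<le> norm x + B * t"
    using norm_triangle_sub[of "z t" "z 0"] by (simp add: z_def)
  \<comment> \<open>Both terms now contain exp ((a - Re l) t), which is at least one because Re l
    \<le> a.\<close>
  also have "\<dots> \<le> exp ((a - Re l) * t) * norm x + B * t"
    using Cons.prems(2)[of l] Cons.prems(4) by (simp add: mult_le_cancel_right1 one_le_exp_iff)
  finally have "exp (Re l * t) * norm (z t) \<le> exp (Re l * t) * (exp ((a - Re l) * t) * norm x + B * t)"
    by (intro mult_left_mono) auto
  also have "\<dots> = exp (a * t) * (1 + (2 * b * t) * ?p t) * norm x"
    unfolding B_def by (simp add: algebra_simps flip: exp_add)
  also have "1 + (2 * b * t) * ?p t = (\<Sum>k<length (l # ls). (2 * b * t) ^ k)"
    by (simp add: sum.lessThan_Suc_shift sum_distrib_left del: sum.lessThan_Suc)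
  also have "exp (Re l * t) * norm (z t) = norm (app (exp (t *\<^sub>R ?T)) x)"
    using Cons.prems(4) unfolding z_def by (subst shift) (simp_all add: flip: exp_add mult.assoc)
  finally show ?case .
qed (simp add: app.zero_right)

text \<open>The exponential rate sees only the real parts of the eigenvalues; the norm of M enters
  polynomially, with a degree fixed by the dimension. With b of order 1 + |\<xi>| this is a loss of
  finitely many derivatives.\<close>

lemma exp_growth:
  fixes M :: "complex^'n^'n::finite"
  assumes "\<And>l v. v \<noteq> 0 \<Longrightarrow> M *v v = l *s v \<Longrightarrow> Re l \<le> a" and b: "norm (op M) \<le> b" and t: "0 \<le> t"
  shows "norm (exp (t *\<^sub>R op M)) \<le> exp (a * t) * (real DIM(complex^'n^'n) * (1 + 2 * b * t) ^ DIM(complex^'n^'n))"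
proof (rule norm_endo_bound)
  let ?n = "DIM(complex^'n^'n)"
  have b0: "0 \<le> b"
    using b norm_ge_zero order_trans by blast
  then show "0 \<le> exp (a * t) * (real ?n * (1 + 2 * b * t) ^ ?n)"
    using t by simp
  fix x
  obtain ls where ls: "length ls \<le> ?n" "factor_product M ls = 0"
    "\<And>l. l \<in> set ls \<Longrightarrow> \<exists>v. v \<noteq> 0 \<and> M *v v = l *s v"
    using annihilating_eigenvalues[of M] by blast
  have "Re l \<le> a \<and> norm l \<le> b" if "l \<in> set ls" for l
    using ls(3)[OF that] assms(1) eigenvalue_norm b order_trans by metis
  then have "norm (app (exp (t *\<^sub>R op M)) x) \<le> exp (a * t) * (\<Sum>k<length ls. (2 * b * t) ^ k) * norm x"
    using ls b t by (intro exp_growth_factors) (auto simp: app.zero_left)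
  also have "(\<Sum>k<length ls. (2 * b * t) ^ k) \<le> (\<Sum>k<length ls. (1 + 2 * b * t) ^ ?n)"
  proof (rule sum_mono)
    fix k assume k: "k \<in> {..<length ls}"
    have "(2 * b * t) ^ k \<le> (1 + 2 * b * t) ^ k"
      using b0 t by (intro power_mono) auto
    also have "\<dots> \<le> (1 + 2 * b * t) ^ ?n"
      using b0 t k ls(1) by (intro power_increasing) auto
    finally show "(2 * b * t) ^ k \<le> (1 + 2 * b * t) ^ ?n" .
  qed
  also have "(\<Sum>k<length ls. (1 + 2 * b * t) ^ ?n) \<le> real ?n * (1 + 2 * b * t) ^ ?n"
    using ls(1) b0 t by (simp add: mult_right_mono del: DIM_cart flip: of_nat_mult)
  finally show "norm (app (exp (t *\<^sub>R op M)) x) \<le> exp (a * t) * (real ?n * (1 + 2 * b * t) ^ ?n) * norm x"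
    by (simp add: mult_left_mono mult_right_mono)
qed

subsection \<open>Splitting off the kernel\<close>

text \<open>The recursion is that of the induction in \<open>factor_remainder\<close>. The matrix
  enters only through a lower bound \<delta> for its nonzero eigenvalues and an upper bound b for
  its norm, which makes the constant uniform over unit frequencies.\<close>

fun splitting_constant :: "real \<Rightarrow> real \<Rightarrow> nat \<Rightarrow> real" where
  "splitting_constant \<delta> b 0 = 0"
| "splitting_constant \<delta> b (Suc n) = splitting_constant \<delta> b n + (1 + b * splitting_constant \<delta> b n) / \<delta>"

lemma splitting_constant_nonneg: "0 < \<delta> \<Longrightarrow> 0 \<le> b \<Longrightarrow> 0 \<le> splitting_constant \<delta> b n"
  by (induction n) auto

lemma splitting_constant_mono:
  assumes "0 < \<delta>" "0 \<le> b" "m \<le> n"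
  shows "splitting_constant \<delta> b m \<le> splitting_constant \<delta> b n"
proof (rule lift_Suc_mono_le[of "splitting_constant \<delta> b", OF _ assms(3)])
  show "splitting_constant \<delta> b n \<le> splitting_constant \<delta> b (Suc n)" for n
    using assms splitting_constant_nonneg[of \<delta> b n] by simp
qed

text \<open>If w is in the range of the current product, then w = (M - l) (- w / l) + M (w / l). So
  each factor with a nonzero root is absorbed at the price of a term in the range of M, of size at
  most |w| / \<delta> before M is applied.\<close>

lemma factor_remainder:
  fixes M :: "complex^'n^'n::finite"
  assumes "\<And>l. l \<in> set ls \<Longrightarrow> \<delta> \<le> norm l" and "0 < \<delta>" and "norm (op M) \<le> b"
  shows "\<exists>x y. v = app (factor_product M ls) x + M *v y \<and> norm y \<le> splitting_constant \<delta> b (length ls) * norm v"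
  using assms(1)
proof (induction ls)
  case (Cons l ls)
  let ?C = "splitting_constant \<delta> b (length ls)"
  obtain x y where xy: "v = app (factor_product M ls) x + M *v y" "norm y \<le> ?C * norm v"
    using Cons by auto
  have b: "0 \<le> b"
    using assms(3) norm_ge_zero order_trans by blast
  define w where "w = app (factor_product M ls) x"
  have l: "l \<noteq> 0" "\<delta> \<le> norm l"
    using Cons.prems[of l] assms(2) by auto
  have "app (factor_product M (l # ls)) (- (inverse l) *s x) = - (inverse l) *s app (op M - scal l) w"
  proof -
    have lin: "app (factor_product M ls) (c *s x) = c *s app (factor_product M ls) x" for c
    proof (induction ls)
      case (Cons k ls)
      then show ?case
        by (simp add: app.diff_left mat_mult_vector vector_scalar_commute mult.commute)
    qed simp
    show ?thesis
      unfolding w_def by (simp only: lin factor_product_simps app_mult)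
        (simp add: app.diff_left mat_mult_vector vector_scalar_commute mult.commute matrix_vector_mult_minus)
  qed
  also have "\<dots> = w - M *v (inverse l *s w)"
    using l by (simp add: app.diff_left mat_mult_vector vector_scalar_commute cvec.minus_left matrix_vector_mult_minus)
  finally have "v = app (factor_product M (l # ls)) (- (inverse l) *s x) + M *v (y + inverse l *s w)"
    using xy by (simp add: w_def matrix_vector_right_distrib)
  moreover have "norm (y + inverse l *s w) \<le> splitting_constant \<delta> b (length (l # ls)) * norm v"
  proof -
    have "norm w = norm (v - M *v y)"
      using xy by (simp add: w_def)
    also have "\<dots> \<le> norm v + norm (M *v y)"
      by (rule norm_triangle_ineq4)
    also have "norm (M *v y) \<le> b * norm y"
      using norm_app[of "op M" y] assms(3) mult_right_mono[of "norm (op M)" b "norm y"] by simp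
    also have "b * norm y \<le> b * (?C * norm v)"
      using xy(2) b by (intro mult_left_mono) auto
    finally have w: "norm w \<le> (1 + b * ?C) * norm v"
      by (simp add: algebra_simps)
    have "norm (y + inverse l *s w) \<le> norm y + inverse (norm l) * norm w"
      using norm_triangle_ineq[of y "inverse l *s w"] by (simp add: norm_cvec_scale norm_inverse)
    also have "\<dots> \<le> ?C * norm v + inverse \<delta> * ((1 + b * ?C) * norm v)"
      using l assms(2) w xy(2) by (intro add_mono mult_mono le_imp_inverse_le) auto
    finally show ?thesis
      by (simp add: algebra_simps divide_inverse)
  qed
  ultimately show ?case by blast
qed auto

text \<open>In an annihilating product every factor for the eigenvalue zero is M itself, and
  semisimplicity shortens its powers. Hence the product over the nonzero eigenvalues maps into the
  kernel of M, and its remainder is in the range of M.\<close>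

lemma kernel_range_splitting:
  fixes M :: "complex^'n^'n::finite"
  assumes semisimple: "\<And>x. M *v (M *v x) = 0 \<Longrightarrow> M *v x = 0"
    and gap: "\<And>l v. v \<noteq> 0 \<Longrightarrow> l \<noteq> 0 \<Longrightarrow> M *v v = l *s v \<Longrightarrow> \<delta> \<le> norm l"
    and \<delta>: "0 < \<delta>" and b: "norm (op M) \<le> b"
  shows "\<exists>k y. v = k + M *v y \<and> M *v k = 0 \<and> norm y \<le> splitting_constant \<delta> b DIM(complex^'n^'n) * norm v"
proof -
  obtain ls where ls: "length ls \<le> DIM(complex^'n^'n)" "factor_product M ls = 0"
    "\<And>l. l \<in> set ls \<Longrightarrow> \<exists>v. v \<noteq> 0 \<and> M *v v = l *s v"
    using annihilating_eigenvalues[of M] by blast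
  let ?ks = "filter (\<lambda>l. l \<noteq> 0) ls"
  \<comment> \<open>The leading M is part of the induction: a zero in the list yields M applied
    twice, which \<open>semisimple\<close> shortens to once.\<close>
  have filter: "M *v app (factor_product M (filter (\<lambda>l. l \<noteq> 0) ls)) x = 0"
    if "M *v app (factor_product M ls) x = 0" for ls x
    using that
  proof (induction ls arbitrary: x)
    case (Cons l ls)
    have "M *v app (factor_product M ls) (app (op M - scal l) x) = 0"
      using Cons.prems factor_commute[of M l ls] by (metis app_mult factor_product_simps(2))
    from Cons.IH[OF this]
    have *: "M *v app (op M - scal l) (app (factor_product M (filter (\<lambda>l. l \<noteq> 0) ls)) x) = 0"
      using factor_commute[of M l "filter (\<lambda>l. l \<noteq> 0) ls"] by (metis app_mult)
    show ?case
    proof (cases "l = 0")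
      case True
      then have "op M - scal l = op M" by simp
      then show ?thesis
        using * semisimple True by simp
    qed (use * in simp)
  qed simp
  have "norm (op M) \<le> b" and "0 \<le> b"
    using b norm_ge_zero order_trans by blast+
  have ks: "\<delta> \<le> norm l" if "l \<in> set ?ks" for l
    using that ls(3) gap by auto
  obtain x y where xy: "v = app (factor_product M ?ks) x + M *v y"
    "norm y \<le> splitting_constant \<delta> b (length ?ks) * norm v"
    using factor_remainder[where ls = ?ks and M = M and v = v, OF ks \<delta> b] by blast
  have "splitting_constant \<delta> b (length ?ks) \<le> splitting_constant \<delta> b DIM(complex^'n^'n)"
    using ls(1) \<delta> \<open>0 \<le> b\<close> length_filter_le order_trans by (intro splitting_constant_mono) blast+
  then have "norm y \<le> splitting_constant \<delta> b DIM(complex^'n^'n) * norm v"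
    using xy(2) by (meson mult_right_mono norm_ge_zero order_trans)
  moreover have "M *v app (factor_product M ?ks) x = 0"
    by (rule filter) (simp add: ls(2) app.zero_left)
  ultimately show ?thesis
    using xy(1) by blast
qed

section \<open>The spectral gap at the root zero\<close>

text \<open>The polynomial of \<open>symbol_det\<close> for an arbitrary matrix, so that it can be
  formed at complex frequencies as well.\<close>

definition shifted_det :: "complex^'n^'n \<Rightarrow> complex poly" where
  "shifted_det Z = det (\<chi> i j. [: Z $ i $ j, if i = j then 1 else 0 :] :: complex poly^'n^'n::finite)"

lemma symbol_det_eq: "symbol_det A \<xi> = shifted_det (symbol A 0 \<xi>)"
  by (simp add: symbol_det_def shifted_det_def)

lemma poly_shifted_det: "poly (shifted_det Z) \<tau> = det (Z + mat \<tau>)"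
  unfolding shifted_det_def det_def
  by (auto simp: poly_sum poly_prod mat_def algebra_simps intro!: sum.cong prod.cong)

section \<open>Coefficients of the characteristic polynomial\<close>

lemma degree_shifted_det: "degree (shifted_det (Z :: complex^'n^'n::finite)) \<le> CARD('n)"
  unfolding shifted_det_def det_def
proof (rule degree_sum_le, simp)
  fix p :: "'n \<Rightarrow> 'n"
  let ?f = "\<lambda>i. (\<chi> i j. [: Z $ i $ j, if i = j then 1 else 0 :] :: complex poly^'n^'n) $ i $ p i"
  have "degree (prod ?f UNIV) \<le> sum (degree \<circ> ?f) UNIV"
    by (rule degree_prod_sum_le) simp
  also have "\<dots> \<le> (\<Sum>i\<in>(UNIV :: 'n set). 1)"
    by (rule sum_mono) simp
  finally have "degree (prod ?f UNIV) \<le> CARD('n)"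
    by simp
  moreover have "degree (of_int (sign p) * prod ?f UNIV) \<le> degree (of_int (sign p) :: complex poly) + degree (prod ?f UNIV)"
    by (rule degree_mult_le)
  ultimately show "degree (of_int (sign p) * prod ?f UNIV) \<le> CARD('n)"
    by simp
qed

lemma continuous_on_coeff_prod:
  assumes "\<And>i k. continuous_on S (\<lambda>z. coeff (f i z :: complex poly) k)"
  shows "continuous_on S (\<lambda>z. coeff (\<Prod>i\<in>I. f i z) k)"
proof (induction I arbitrary: k rule: infinite_finite_induct)
  case (insert i I)
  then show ?case
    using assms by (simp add: coeff_mult) (intro continuous_intros)
qed auto

lemma continuous_on_coeff_shifted_det: "continuous_on UNIV (\<lambda>Z :: complex^'n^'n::finite. coeff (shifted_det Z) k)"
proof -
  have entry: "continuous_on UNIV (\<lambda>Z :: complex^'n^'n. coeff [: Z $ i $ j, c :] k)" for i j c k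
    by (cases k) (auto intro!: continuous_intros)
  have of_int: "of_int c * q = smult (of_int c) q" for c and q :: "complex poly"
    by (simp add: of_int_poly)
  show ?thesis
    unfolding shifted_det_def det_def coeff_sum of_int coeff_smult vec_lambda_beta
    by (intro continuous_intros continuous_on_coeff_prod entry)
qed

text \<open>Translates the multiplicity of the root zero into conditions on coefficients, which
  depend polynomially on the frequency.\<close>

lemma coeff_below_order:
  fixes p :: "complex poly"
  assumes "p \<noteq> 0"
  shows "k < order 0 p \<Longrightarrow> coeff p k = 0" and "coeff p (order 0 p) \<noteq> 0"
proof -
  obtain q where q: "p = [:- 0, 1:] ^ order 0 p * q" "\<not> [:- 0, 1:] dvd q"
    using order_decomp[OF assms, of 0] by blast
  define n where "n = order 0 p"
  have p: "p = monom 1 n * q"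
    using q(1) unfolding n_def by (simp add: monom_altdef)
  have "coeff q 0 \<noteq> 0"
    using q(2) by (metis poly_0_coeff_0 poly_eq_0_iff_dvd)
  then show "k < order 0 p \<Longrightarrow> coeff p k = 0" and "coeff p (order 0 p) \<noteq> 0"
    unfolding n_def[symmetric] by (subst p, simp add: coeff_monom_mult)+
qed

lemma det_eq_0_kernel:
  fixes M :: "complex^'n^'n::finite"
  shows "det M = 0 \<longleftrightarrow> (\<exists>v. v \<noteq> 0 \<and> M *v v = 0)"
  using matrix_left_invertible_ker[of M] invertible_left_inverse[of M] invertible_det_nz[of M] by auto

text \<open>A number of modulus larger than the norm is not an eigenvalue. This makes
  \<open>coeff_below_order\<close> applicable at every frequency.\<close>

lemma shifted_det_nonzero: "shifted_det (Z :: complex^'n^'n::finite) \<noteq> 0"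
proof
  assume "shifted_det Z = 0"
  then have "det (Z + mat (of_real (norm (op Z) + 1))) = 0"
    by (metis poly_0 poly_shifted_det)
  then obtain v where "v \<noteq> 0" "(Z + mat (of_real (norm (op Z) + 1))) *v v = 0"
    by (auto simp: det_eq_0_kernel)
  then have "v \<noteq> 0" "Z *v v = (- of_real (norm (op Z) + 1)) *s v"
    by (auto simp only: matrix_vector_mult_add_rdistrib mat_mult_vector add_eq_0_iff2 cvec.minus_left)
  from eigenvalue_norm[OF this(2,1)] show False
    by (simp only: norm_minus_cancel norm_of_real)
qed

definition complex_symbol :: "('d::finite \<Rightarrow> complex^'n^'n) \<Rightarrow> complex^'d \<Rightarrow> complex^'n^'n::finite" where
  "complex_symbol A \<zeta> = (\<chi> i j. \<Sum>l\<in>UNIV. \<zeta> $ l * A l $ i $ j)"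

abbreviation cvec_of :: "real^'d \<Rightarrow> complex^'d::finite" where
  "cvec_of \<xi> \<equiv> (\<chi> l. complex_of_real (\<xi> $ l))"

lemma complex_symbol_real: "complex_symbol A (cvec_of \<xi>) = symbol A 0 \<xi>"
  by (simp add: complex_symbol_def symbol_def vec_eq_iff scaleR_conv_of_real[where 'a = complex])

lemma complex_symbol_vector: "complex_symbol A \<zeta> *v v = (\<Sum>l\<in>UNIV. \<zeta> $ l *s (A l *v v))"
proof -
  have "(\<Sum>j\<in>UNIV. (\<Sum>l\<in>UNIV. \<zeta> $ l * A l $ i $ j) * v $ j) =
      (\<Sum>l\<in>UNIV. \<zeta> $ l * (\<Sum>j\<in>UNIV. A l $ i $ j * v $ j))" for i
    by (simp add: sum_distrib_left sum_distrib_right mult.assoc) (rule sum.swap)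
  then show ?thesis
    by (simp add: vec_eq_iff complex_symbol_def matrix_vector_mult_def)
qed

lemma linear_complex_symbol: "linear (complex_symbol A)"
  by (rule linearI)
    (simp_all add: complex_symbol_def vec_eq_iff algebra_simps sum.distrib scaleR_sum_right)

lemma complex_symbol_scale: "complex_symbol A (c *s \<zeta>) *v v = c *s (complex_symbol A \<zeta> *v v)"
  by (simp add: complex_symbol_vector vec_eq_iff sum_distrib_left mult.assoc)

lemma continuous_complex_symbol: "continuous_on UNIV (complex_symbol A)"
  by (rule linear_continuous_on[OF linear_conv_bounded_linear[THEN iffD1, OF linear_complex_symbol]])

text \<open>Evaluation of the inner variable is a ring homomorphism and so commutes with the
  determinant. It is used with \<tau> as the outer variable and a parameter s of the frequency as
  the inner one.\<close>

lemma eval_coeff_det: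
  fixes M :: "complex poly poly^'n^'n::finite"
  shows "map_poly (\<lambda>q. poly q s) (det M) = det (\<chi> i j. map_poly (\<lambda>q. poly q s) (M $ i $ j))"
proof -
  let ?h = "map_poly (\<lambda>q. poly q s) :: complex poly poly \<Rightarrow> complex poly"
  have c: "coeff (?h p) k = poly (coeff p k) s" for p k
    by (simp add: coeff_map_poly)
  have add: "?h (p + q) = ?h p + ?h q" for p q
    by (rule poly_eqI) (simp add: c)
  have mult: "?h (p * q) = ?h p * ?h q" for p q
    by (rule poly_eqI) (simp add: c coeff_mult poly_sum)
  have zero: "?h 0 = 0" and one: "?h 1 = 1"
    by (rule poly_eqI, simp add: c)+
  have minus: "?h (- p) = - ?h p" for p
    by (rule poly_eqI) (simp add: c)
  have sum: "?h (sum f S) = (\<Sum>x\<in>S. ?h (f x))" for f and S :: "('n \<Rightarrow> 'n) set"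
    by (induction S rule: infinite_finite_induct) (simp_all add: add zero)
  have prod: "?h (prod f S) = (\<Prod>x\<in>S. ?h (f x))" for f and S :: "'n set"
    by (induction S rule: infinite_finite_induct) (simp_all add: mult one)
  have sign: "?h (of_int (sign p)) = of_int (sign p)" for p :: "'n \<Rightarrow> 'n"
    by (simp add: sign_def one minus)
  show ?thesis
    unfolding det_def by (simp add: sum mult prod sign)
qed

text \<open>The low order coefficients are polynomials in the frequency, so their vanishing extends from
  real to complex frequencies.\<close>

lemma coeff_vanish_complex:
  fixes A :: "'d::finite \<Rightarrow> complex^'n^'n::finite"
  assumes "\<And>\<xi>. \<xi> \<noteq> 0 \<Longrightarrow> coeff (shifted_det (symbol A 0 \<xi>)) k = 0" and "\<zeta> \<noteq> 0"
  shows "coeff (shifted_det (complex_symbol A \<zeta>)) k = 0"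
proof -
  \<comment> \<open>The complex line s \<mapsto> x + s y passes through \<zeta> at s = i, and its
    points with real s are real frequencies.\<close>
  define x y :: "real^'d" where "x = (\<chi> l. Re (\<zeta> $ l))" and "y = (\<chi> l. Im (\<zeta> $ l))"
  define X Y where "X = symbol A 0 x" and "Y = symbol A 0 y"
  \<comment> \<open>The outer variable is \<tau>, the inner one is s: each coefficient of P is a
    polynomial in s.\<close>
  define P where "P = det (\<chi> i j. [: [: X $ i $ j, Y $ i $ j :], [: if i = j then 1 else 0 :] :] :: complex poly poly^'n^'n)"
  have P: "poly (coeff P k) s = coeff (shifted_det (\<chi> i j. X $ i $ j + s * Y $ i $ j)) k" for s
  proof -
    have "map_poly (\<lambda>q. poly q s) P = shifted_det (\<chi> i j. X $ i $ j + s * Y $ i $ j)"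
      unfolding P_def eval_coeff_det shifted_det_def
      by (rule arg_cong[where f = det]) (simp add: vec_eq_iff map_poly_pCons)
    then show ?thesis
      by (metis coeff_map_poly poly_0)
  qed
  have real: "(\<chi> i j. X $ i $ j + of_real s * Y $ i $ j) = symbol A 0 (x + s *\<^sub>R y)" for s
    by (simp add: vec_eq_iff X_def Y_def symbol_def algebra_simps sum.distrib scaleR_sum_right
        scaleR_conv_of_real[where 'a = complex] sum_distrib_left)
  \<comment> \<open>The line meets the origin for at most one real s, so the hypothesis yields
    infinitely many zeros of the coefficient.\<close>
  have "\<not> (x = 0 \<and> y = 0)"
    using assms(2) by (auto simp: x_def y_def vec_eq_iff complex_eq_iff)
  then have one: "s = s'" if "x + s *\<^sub>R y = 0" "x + s' *\<^sub>R y = 0" for s s'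
    using that by (metis add.right_neutral add_left_cancel scaleR_cancel_right scaleR_zero_right)
  have "finite {s. x + s *\<^sub>R y = 0}"
  proof (cases "{s. x + s *\<^sub>R y = 0} = {}")
    case False
    then obtain s where "x + s *\<^sub>R y = 0" by blast
    then have "{s. x + s *\<^sub>R y = 0} \<subseteq> {s}"
      using one by blast
    then show ?thesis
      using finite_subset by blast
  qed simp
  then have "infinite (UNIV - {s. x + s *\<^sub>R y = 0})"
    using infinite_UNIV_char_0 Diff_infinite_finite by blast
  then have "infinite (complex_of_real ` (UNIV - {s. x + s *\<^sub>R y = 0}))"
    by (simp add: finite_image_iff inj_on_def)
  moreover have "complex_of_real ` (UNIV - {s. x + s *\<^sub>R y = 0}) \<subseteq> {s. poly (coeff P k) s = 0}"
    using P real assms(1) by auto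
  ultimately have "infinite {s. poly (coeff P k) s = 0}"
    using finite_subset by blast
  then have "coeff P k = 0"
    using poly_roots_finite by blast
  then have "coeff (shifted_det (\<chi> i j. X $ i $ j + \<i> * Y $ i $ j)) k = 0"
    using P[of \<i>] by simp
  moreover have "(\<chi> i j. X $ i $ j + \<i> * Y $ i $ j) = complex_symbol A \<zeta>"
  proof -
    have "\<zeta> $ l = of_real (x $ l) + \<i> * of_real (y $ l)" for l
      by (simp add: x_def y_def complex_eq mult.commute)
    then show ?thesis
      by (simp add: vec_eq_iff X_def Y_def symbol_def complex_symbol_def algebra_simps sum.distrib
          scaleR_conv_of_real[where 'a = complex] sum_distrib_left)
  qed
  ultimately show ?thesis by simp
qed

text \<open>The coefficients of order below m vanish at all nonzero complex frequencies, so the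
  determinant is \<tau>^m R(\<zeta>, \<tau>) with R continuous. At \<tau> = 0 on the real unit
  sphere R is the coefficient of order m, which is nonzero; by compactness R is nonzero in a uniform
  neighbourhood.\<close>

lemma spectral_gap:
  fixes A :: "'d::finite \<Rightarrow> complex^'n^'n::finite"
  assumes mult: "\<And>\<xi>::real^'d. \<xi> \<noteq> 0 \<Longrightarrow> order 0 (symbol_det A \<xi>) = m"
  obtains \<delta> where "\<delta> > 0" and
    "\<And>\<omega> \<zeta> \<tau>. norm \<omega> = 1 \<Longrightarrow> norm (\<zeta> - cvec_of \<omega>) \<le> \<delta> \<Longrightarrow> \<tau> \<noteq> 0 \<Longrightarrow> norm \<tau> \<le> \<delta> \<Longrightarrow>
       det (complex_symbol A \<zeta> + mat \<tau>) \<noteq> 0"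
proof -
  let ?c = "\<lambda>\<zeta> k. coeff (shifted_det (complex_symbol A \<zeta>)) k"
  define R where "R z = (\<Sum>k=m..CARD('n). ?c (fst z) k * snd z ^ (k - m))" for z :: "(complex^'d) \<times> complex"
  have real: "coeff (shifted_det (symbol A 0 \<xi>)) k = 0" if "\<xi> \<noteq> 0" "k < m" for \<xi> k
    using coeff_below_order(1)[OF shifted_det_nonzero, of k "symbol A 0 \<xi>"] mult[OF that(1)] that
    by (simp add: symbol_det_eq)
  have real_m: "coeff (shifted_det (symbol A 0 \<xi>)) m \<noteq> 0" if "\<xi> \<noteq> 0" for \<xi>
    using coeff_below_order(2)[OF shifted_det_nonzero, of "symbol A 0 \<xi>"] mult[OF that(1)]
    by (simp add: symbol_det_eq)
  have "continuous_on UNIV (\<lambda>\<zeta>. ?c \<zeta> k)" for k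
    by (rule continuous_on_compose2[OF continuous_on_coeff_shifted_det continuous_complex_symbol]) auto
  then have cc: "continuous_on UNIV (\<lambda>z :: (complex^'d) \<times> complex. ?c (fst z) k)" for k
    by (rule continuous_on_compose2) (auto intro!: continuous_intros)
  have contR: "continuous_on UNIV R"
    unfolding R_def by (intro continuous_intros cc)
  define K where "K = (\<lambda>\<omega>. (cvec_of \<omega>, 0::complex)) ` sphere (0 :: real^'d) 1"
  define U where "U = {z. R z \<noteq> 0}"
  have "compact K"
    unfolding K_def by (intro compact_continuous_image continuous_intros) auto
  moreover have "open U"
  proof -
    have "open (R -` (- {0}))"
      by (rule open_vimage[OF _ contR]) auto
    then show ?thesis
      by (simp add: U_def vimage_def)
  qed
  moreover have "K \<subseteq> U"
  proof -
    have "R (cvec_of \<omega>, 0) \<noteq> 0" if "norm \<omega> = 1" for \<omega>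
    proof -
      have nz: "\<omega> \<noteq> 0" using that by auto
      have "m \<le> CARD('n)"
        using real_m[OF nz] degree_shifted_det[of "symbol A 0 \<omega>"] le_degree order_trans by blast
      then have "R (cvec_of \<omega>, 0) = (\<Sum>k=m..CARD('n). if k = m then ?c (cvec_of \<omega>) k else 0)"
        unfolding R_def by (intro sum.cong) (auto simp: power_0_left)
      also have "\<dots> = ?c (cvec_of \<omega>) m"
        using \<open>m \<le> CARD('n)\<close> by simp
      finally show ?thesis
        using real_m[OF nz] by (simp add: complex_symbol_real)
    qed
    then show ?thesis
      by (auto simp: K_def U_def)
  qed
  ultimately obtain e where e: "e > 0" "(\<Union>x\<in>K. ball x e) \<subseteq> U"
    by (rule compact_subset_open_imp_ball_epsilon_subset)
  \<comment> \<open>The bound 1/2 keeps \<zeta> away from zero, where the low coefficients need not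
    vanish; e / 3 makes the two deviations add up to less than e.\<close>
  define \<delta> where "\<delta> = min (e / 3) (1 / 2)"
  have "det (complex_symbol A \<zeta> + mat \<tau>) \<noteq> 0"
    if *: "norm \<omega> = 1" "norm (\<zeta> - cvec_of \<omega>) \<le> \<delta>" "\<tau> \<noteq> 0" "norm \<tau> \<le> \<delta>" for \<omega> \<zeta> \<tau>
  proof -
    have "norm (cvec_of \<omega>) = norm \<omega>"
      by (simp add: norm_vec_def)
    then have "\<zeta> \<noteq> 0"
      using * unfolding \<delta>_def by (auto simp: norm_minus_commute)
    have "dist (cvec_of \<omega>, 0) (\<zeta>, \<tau>) \<le> norm (\<zeta> - cvec_of \<omega>) + norm \<tau>"
      using sqrt_sum_squares_le_sum_abs[of "norm (\<zeta> - cvec_of \<omega>)" "norm \<tau>"]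
      unfolding dist_Pair_Pair by (simp add: dist_norm norm_minus_commute)
    also have "\<dots> < e"
      using * e(1) unfolding \<delta>_def by auto
    finally have "(\<zeta>, \<tau>) \<in> U"
    proof -
      assume "dist (cvec_of \<omega>, 0) (\<zeta>, \<tau>) < e"
      then have "(\<zeta>, \<tau>) \<in> ball (cvec_of \<omega>, 0) e"
        by simp
      moreover have "(cvec_of \<omega>, 0) \<in> K"
        using * by (simp add: K_def)
      ultimately show ?thesis
        using e(2) by blast
    qed
    then have "R (\<zeta>, \<tau>) \<noteq> 0"
      by (simp add: U_def)
    have "det (complex_symbol A \<zeta> + mat \<tau>) = (\<Sum>k\<le>CARD('n). ?c \<zeta> k * \<tau> ^ k)"
      unfolding poly_shifted_det[symmetric] poly_altdef
      using degree_shifted_det[of "complex_symbol A \<zeta>"]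
      by (intro sum.mono_neutral_left) (auto simp: coeff_eq_0)
    also have "\<dots> = (\<Sum>k=m..CARD('n). ?c \<zeta> k * \<tau> ^ k)"
      using coeff_vanish_complex[OF real \<open>\<zeta> \<noteq> 0\<close>]
      by (intro sum.mono_neutral_right) auto
    also have "\<dots> = \<tau> ^ m * R (\<zeta>, \<tau>)"
      unfolding R_def sum_distrib_left by (intro sum.cong) (auto simp flip: power_add)
    finally show ?thesis
      using \<open>R (\<zeta>, \<tau>) \<noteq> 0\<close> \<open>\<tau> \<noteq> 0\<close> by simp
  qed
  moreover have "\<delta> > 0"
    using e by (simp add: \<delta>_def)
  ultimately show ?thesis
    using that by blast
qed

section \<open>Generators in Fourier variables\<close>

definition generator :: "('d::finite \<Rightarrow> complex^'n^'n) \<Rightarrow> complex^'n^'n \<Rightarrow> real^'d \<Rightarrow> (complex^'n::finite) endo" where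
  "generator A B \<xi> = op (- (mat \<i> ** symbol A 0 \<xi> + B))"

lemma app_generator: "app (generator A B \<xi>) v = - (\<i> *s (symbol A 0 \<xi> *v v) + B *v v)"
  unfolding generator_def op_minus app.minus_left app_op
  by (simp add: matrix_vector_mult_add_rdistrib mat_mult_vector flip: matrix_vector_mul_assoc)

lemma generator_add: "generator A B \<xi> = generator A 0 \<xi> + op (- B)"
  by (simp add: generator_def flip: op_add)

lemma symbol_vector: "symbol A 0 \<xi> *v v = (\<Sum>l\<in>UNIV. (\<xi> $ l) *\<^sub>R (A l *v v))"
  unfolding complex_symbol_real[symmetric] complex_symbol_vector
  by (intro sum.cong) (simp_all add: vec_eq_iff scaleR_conv_of_real[where 'a = complex])

lemma linear_symbol: "linear (symbol A 0)"
  by (rule linearI) (simp_all add: symbol_def algebra_simps sum.distrib scaleR_sum_right)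

lemma linear_generator: "linear (generator A 0)"
proof (rule linearI)
  show "generator A 0 (x + y) = generator A 0 x + generator A 0 y" for x y
    by (rule endo_eqI)
      (simp add: app_generator app.add_left linear_add[OF linear_symbol] matrix_vector_mult_add_rdistrib)
  show "generator A 0 (r *\<^sub>R x) = r *\<^sub>R generator A 0 x" for r x
  proof (rule endo_eqI)
    fix v
    have "symbol A 0 (r *\<^sub>R x) *v v = r *\<^sub>R (symbol A 0 x *v v)"
      by (simp add: symbol_vector scaleR_sum_right)
    then show "app (generator A 0 (r *\<^sub>R x)) v = app (r *\<^sub>R generator A 0 x) v"
      by (simp add: app_generator app.scaleR_left cvec.scaleR_right)
  qed
qed

lemma bounded_linear_generator: "bounded_linear (generator A 0)"
  using linear_generator linear_conv_bounded_linear by blast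

lemma generator_scale: "generator A 0 (r *\<^sub>R \<xi>) = r *\<^sub>R generator A 0 \<xi>"
  using linear_generator by (rule linear_scale)

lemma continuous_generator: "continuous_on UNIV (generator A B)"
  unfolding generator_add[of A B]
  by (intro continuous_intros bounded_linear.continuous_on[OF bounded_linear_generator])

definition bounded_group :: "('d::finite \<Rightarrow> complex^'n^'n::finite) \<Rightarrow> real \<Rightarrow> bool" where
  "bounded_group A K \<longleftrightarrow> (\<forall>\<xi> t. 0 \<le> t \<longrightarrow> norm (exp (t *\<^sub>R generator A 0 \<xi>)) \<le> K)"

text \<open>Bounded exponentials exclude Jordan blocks of size two or more at the eigenvalue zero of
  the symbol.\<close>

lemma bounded_group_semisimple:
  assumes K: "bounded_group A K" and M: "symbol A 0 \<xi> *v (symbol A 0 \<xi> *v v) = 0"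
  shows "symbol A 0 \<xi> *v v = 0"
proof -
  have "app (generator A 0 \<xi>) (app (generator A 0 \<xi>) v) = 0"
    using M by (simp add: app_generator matrix_vector_mult_minus vector_scalar_commute)
  then have "app (generator A 0 \<xi>) v = 0"
    using exp_bounded_semisimple K unfolding bounded_group_def by blast
  then show ?thesis
    by (simp add: app_generator)
qed

subsection \<open>The split symbol\<close>

text \<open>The split symbol is \<open>block_lift A \<xi>\<close> composed with
  \<open>block_sum\<close>, and the composition in the opposite order is the original symbol. All
  links between the two systems rest on this factorization.\<close>

definition block_sum :: "complex^('d::finite \<times> 'n::finite) \<Rightarrow> complex^'n" where
  "block_sum U = (\<chi> j. \<Sum>k\<in>UNIV. U $ (k, j))"

definition block_lift :: "('d::finite \<Rightarrow> complex^'n^'n) \<Rightarrow> real^'d \<Rightarrow> complex^'n::finite \<Rightarrow> complex^('d \<times> 'n)" where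
  "block_lift A \<xi> v = (\<chi> p. (\<xi> $ fst p) *\<^sub>R (A (fst p) *v v) $ snd p)"

lemma linear_block_sum: "linear block_sum"
  by (rule linearI) (simp_all add: block_sum_def vec_eq_iff sum.distrib scaleR_sum_right)

lemma bounded_linear_block_sum: "bounded_linear block_sum"
  using linear_block_sum linear_conv_bounded_linear by blast

lemma bounded_bilinear_block_lift: "bounded_bilinear (block_lift A)"
proof -
  have "bilinear (block_lift A)"
    unfolding bilinear_def
    by (auto intro!: linearI simp: block_lift_def vec_eq_iff matrix_vector_right_distrib algebra_simps
        linear_scale[OF matrix_vector_mul_linear])
  then show ?thesis
    by (simp add: bilinear_conv_bounded_bilinear)
qed

lemma block_lift_scale: "block_lift A \<xi> (c *s v) = c *s block_lift A \<xi> v"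
  by (simp add: block_lift_def vec_eq_iff vector_scalar_commute)

lemma split_symbol_vector: "symbol (split_coeff A) 0 \<xi> *v U = block_lift A \<xi> (block_sum U)"
proof -
  have "(symbol (split_coeff A) 0 \<xi> *v U) $ (l, i) = block_lift A \<xi> (block_sum U) $ (l, i)" for l i
  proof -
    have "(symbol (split_coeff A) 0 \<xi> *v U) $ (l, i) = (\<Sum>k\<in>UNIV. \<Sum>j\<in>UNIV. \<xi> $ l *\<^sub>R (A l $ i $ j) * U $ (k, j))"
      by (simp add: matrix_vector_mult_def sum.cartesian_product UNIV_Times_UNIV[symmetric] del: UNIV_Times_UNIV)
        (rule sum.cong, auto simp: split_symbol_block mat_def)
    also have "\<dots> = (\<Sum>j\<in>UNIV. \<xi> $ l *\<^sub>R (A l $ i $ j) * (\<Sum>k\<in>UNIV. U $ (k, j)))"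
      by (subst sum.swap) (simp add: sum_distrib_left)
    finally show ?thesis
      by (simp add: block_lift_def block_sum_def matrix_vector_mult_def scaleR_sum_right)
  qed
  then show ?thesis
    by (simp add: vec_eq_iff split_paired_all)
qed

lemma block_sum_lift: "block_sum (block_lift A \<xi> v) = symbol A 0 \<xi> *v v"
  by (simp add: block_sum_def block_lift_def symbol_vector vec_eq_iff)

lemma absorption_vector: "absorption \<sigma> *v U = (\<chi> p. \<sigma> (fst p) * U $ p)"
proof -
  have "(\<Sum>q\<in>UNIV. (if p = q then \<sigma> (fst p) else 0) * U $ q) = \<sigma> (fst p) * U $ p" for p
  proof -
    have "(\<Sum>q\<in>UNIV. (if p = q then \<sigma> (fst p) else 0) * U $ q) = (\<Sum>q\<in>UNIV. if p = q then \<sigma> (fst p) * U $ q else 0)"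
      by (rule sum.cong) auto
    then show ?thesis by simp
  qed
  then show ?thesis
    by (simp add: absorption_def matrix_vector_mult_def vec_eq_iff)
qed

lemma block_sum_surj: "\<exists>U :: complex^('d::finite \<times> 'n::finite). block_sum U = v"
proof -
  \<comment> \<open>The whole vector is put into one arbitrary block.\<close>
  have "block_sum (\<chi> p. if fst p = (undefined :: 'd) then v $ snd p else 0) = v"
    by (simp add: block_sum_def vec_eq_iff)
  then show ?thesis
    by blast
qed

subsection \<open>Eigenvalues of the damped split symbol\<close>

lemma exp_dominated:
  assumes "\<And>t. 0 \<le> t \<Longrightarrow> exp (a * t) \<le> K * exp (b * t)"
  shows "a \<le> (b::real)"
proof (rule ccontr)
  assume ab: "\<not> a \<le> b"
  \<comment> \<open>Makes (a - b) t equal to |K|, while exp |K| is at least |K| + 1.\<close>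
  define t where "t = \<bar>K\<bar> / (a - b)"
  have t: "0 \<le> t"
    unfolding t_def using ab by auto
  have "exp ((a - b) * t) \<le> K"
    using assms[OF t] by (simp add: left_diff_distrib exp_diff field_simps)
  moreover have "\<bar>K\<bar> + 1 \<le> exp ((a - b) * t)"
    using exp_ge_add_one_self[of "\<bar>K\<bar>"] ab by (simp add: t_def add.commute)
  ultimately show False by linarith
qed

lemma split_eigenvalue_bound:
  fixes A :: "'d::finite \<Rightarrow> complex^'n^'n::finite"
  assumes K: "bounded_group A K"
    and mult: "\<And>\<xi>::real^'d. \<xi> \<noteq> 0 \<Longrightarrow> order 0 (symbol_det A \<xi>) = m"
  obtains a where "\<And>\<xi> U l. U \<noteq> 0 \<Longrightarrow>
    app (generator (split_coeff A) (absorption \<sigma>) \<xi>) U = l *s U \<Longrightarrow> Re l \<le> a"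
proof -
  obtain \<delta> where \<delta>: "\<delta> > 0" and gap:
    "\<And>\<omega> \<zeta> \<tau>. norm \<omega> = 1 \<Longrightarrow> norm (\<zeta> - cvec_of \<omega>) \<le> \<delta> \<Longrightarrow> \<tau> \<noteq> 0 \<Longrightarrow> norm \<tau> \<le> \<delta> \<Longrightarrow>
       det (complex_symbol A \<zeta> + mat \<tau>) \<noteq> 0"
    using spectral_gap[of A m] mult by blast
  have K0: "0 \<le> K"
    using K unfolding bounded_group_def by (metis norm_ge_zero order_refl order_trans)
  \<comment> \<open>A common bound for the absorptions; the summand 1 keeps it positive when all of
    them vanish.\<close>
  define s where "s = 1 + (\<Sum>l\<in>UNIV. norm (\<sigma> l))"
  have s: "norm (\<sigma> l) \<le> s" for l
    unfolding s_def using member_le_sum[of l UNIV "\<lambda>l. norm (\<sigma> l)"] by simp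
  have s1: "1 \<le> s"
    unfolding s_def by (simp add: sum_nonneg)
  define D where "D = real CARD('d)"
  have D: "0 < D" by (simp add: D_def)
  have "bounded_linear (\<lambda>\<zeta>. op (complex_symbol A \<zeta>))"
    by (rule bounded_linear_compose[OF bounded_linear_op linear_conv_bounded_linear[THEN iffD1, OF linear_complex_symbol]])
  then obtain C where C: "0 \<le> C" "\<And>\<zeta>. norm (op (complex_symbol A \<zeta>)) \<le> norm \<zeta> * C"
    using bounded_linear.nonneg_bounded by blast
  \<comment> \<open>For |l| above 2 s, each |l + \<sigma>_k| is at least |l| / 2. Above the second
    number, the relative shift |\<zeta> - \<xi>| / |\<xi>| is at most \<delta>.\<close>
  define R where "R = max (2 * s) (D * (2 * s) / \<delta>)"
  \<comment> \<open>R covers the eigenvalues of modulus at most R; the second number is K times the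
    bound for the perturbation P below.\<close>
  define a where "a = max R (K * (D * (2 * s) / \<delta> * C))"
  have "Re l \<le> a" if U: "U \<noteq> 0" and eig: "app (generator (split_coeff A) (absorption \<sigma>) \<xi>) U = l *s U" for \<xi> U l
  proof (cases "norm l \<le> R")
    case True
    then show ?thesis
      using complex_Re_le_cmod[of l] unfolding a_def by linarith
  next
    case False
    then have lR: "R < norm l" by simp
    then have l2s: "2 * s < norm l"
      unfolding R_def by simp
    then have l0: "l \<noteq> 0"
      using s1 by auto
    have large: "norm l / 2 \<le> norm (l + \<sigma> k)" for k
      using norm_triangle_ineq4[of "l + \<sigma> k" "\<sigma> k"] s[of k] l2s by simp
    then have nz: "l + \<sigma> k \<noteq> 0" for k
      using l0 by (metis divide_pos_pos norm_eq_zero not_le zero_less_norm_iff zero_less_numeral)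
    define V where "V = block_sum U"
    \<comment> \<open>The block equation (l + \<sigma>_k) U^k = - i \<xi>_k A_k V, multiplied by l /
      (l + \<sigma>_k), becomes l U^k = - i \<zeta>_k A_k V. Summation over k gives an eigenvalue
      equation for V alone.\<close>
    define \<zeta> where "\<zeta> = (\<chi> k. of_real (\<xi> $ k) * (l / (l + \<sigma> k)))"
    have comp: "l * U $ (k, i) = - (\<i> * (\<zeta> $ k * (A k *v V) $ i))" for k i
    proof -
      have "(l *s U) $ (k, i) = - (\<i> * (\<xi> $ k *\<^sub>R (A k *v V) $ i) + \<sigma> k * U $ (k, i))"
        unfolding eig[symmetric] app_generator split_symbol_vector absorption_vector
        by (simp add: block_lift_def V_def)
      then have "(l + \<sigma> k) * U $ (k, i) = - (\<i> * (of_real (\<xi> $ k) * (A k *v V) $ i))"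
        by (simp add: scaleR_conv_of_real distrib_right eq_neg_iff_add_eq_0 add.assoc add.left_commute)
      then have "l / (l + \<sigma> k) * ((l + \<sigma> k) * U $ (k, i)) = - (\<i> * (\<zeta> $ k * (A k *v V) $ i))"
        by (simp add: \<zeta>_def)
      then show ?thesis
        using nz[of k] by simp
    qed
    have VV: "l *s V = - (\<i> *s (complex_symbol A \<zeta> *v V))"
      unfolding complex_symbol_vector
      by (simp add: vec_eq_iff V_def block_sum_def sum_distrib_left comp[unfolded V_def block_sum_def] sum_negf)
    have V0: "V \<noteq> 0"
    proof
      assume "V = 0"
      then have "A k *v V = 0" for k
        by simp
      then have "l * U $ (k, i) = 0" for k i
        using comp by simp
      then have "(l *s U) $ p = 0" for p
        by (cases p) simp
      then have "l *s U = 0"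
        by (simp only: vec_eq_iff zero_index) simp
      then show False
        using U l0 by simp
    qed
    have \<zeta>: "norm (\<zeta> - cvec_of \<xi>) \<le> D * (2 * s) * norm \<xi> / norm l"
    proof -
      have "norm (\<zeta> $ k - of_real (\<xi> $ k)) \<le> 2 * s * norm \<xi> / norm l" for k
      proof -
        have "\<zeta> $ k - of_real (\<xi> $ k) = - (of_real (\<xi> $ k) * (\<sigma> k / (l + \<sigma> k)))"
          using nz[of k] by (simp add: \<zeta>_def field_simps)
        also have "norm \<dots> = \<bar>\<xi> $ k\<bar> * (norm (\<sigma> k) / norm (l + \<sigma> k))"
          by (simp add: norm_mult norm_divide)
        also have "\<dots> \<le> norm \<xi> * (s / (norm l / 2))"
          using s[of k] s1 large[of k] l0 component_le_norm_cart[of \<xi> k]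
          by (intro mult_mono frac_le) auto
        finally show ?thesis
          by (simp add: mult.commute mult.left_commute)
      qed
      then have "(\<Sum>k\<in>UNIV. norm (\<zeta> $ k - of_real (\<xi> $ k))) \<le> (\<Sum>k\<in>(UNIV :: 'd set). 2 * s * norm \<xi> / norm l)"
        by (intro sum_mono)
      moreover have "norm (\<zeta> - cvec_of \<xi>) \<le> (\<Sum>k\<in>UNIV. norm ((\<zeta> - cvec_of \<xi>) $ k))"
        unfolding norm_vec_def by (rule L2_set_le_sum) simp
      ultimately show ?thesis
        by (simp add: D_def)
    qed
    show ?thesis
    \<comment> \<open>The first case contradicts the spectral gap. In the second |\<xi>| < |l| /
      \<delta>, so the shift |\<zeta> - \<xi>| is bounded.\<close>
    proof (cases "norm l \<le> \<delta> * norm \<xi>")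
      case True
      then have xi: "\<xi> \<noteq> 0"
        using l0 by auto
      define r where "r = 1 / norm \<xi>"
      have r: "r > 0" using xi by (simp add: r_def)
      have "norm (of_real r *s \<zeta> - cvec_of (r *\<^sub>R \<xi>)) = r * norm (\<zeta> - cvec_of \<xi>)"
      proof -
        have "of_real r *s \<zeta> - cvec_of (r *\<^sub>R \<xi>) = of_real r *s (\<zeta> - cvec_of \<xi>)"
          by (simp add: vec_eq_iff algebra_simps)
        then show ?thesis
          using r by (simp only: norm_cvec_scale) simp
      qed
      also have "\<dots> \<le> D * (2 * s) / norm l"
        using \<zeta> xi mult_left_mono[OF \<zeta>, of r] r by (simp add: r_def)
      also have "\<dots> \<le> \<delta>"
        using lR \<delta> l0 unfolding R_def by (simp add: field_simps)
      finally have 1: "norm (of_real r *s \<zeta> - cvec_of (r *\<^sub>R \<xi>)) \<le> \<delta>" .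
      \<comment> \<open>After normalization to unit frequency, V is in the kernel for \<tau> = - i l
        / |\<xi>|, which is nonzero and of modulus at most \<delta>.\<close>
      have "det (complex_symbol A (of_real r *s \<zeta>) + mat (- (\<i> * l * of_real r))) \<noteq> 0"
        using True xi l0 r by (intro gap[OF _ 1]) (auto simp: norm_mult norm_divide r_def field_simps)
      moreover have "(complex_symbol A (of_real r *s \<zeta>) + mat (- (\<i> * l * of_real r))) *v V = 0"
      proof -
        have "complex_symbol A \<zeta> *v V = \<i> *s (- (\<i> *s (complex_symbol A \<zeta> *v V)))"
          by (simp add: cvec.minus_left)
        also have "\<dots> = (\<i> * l) *s V"
          by (simp only: VV[symmetric] vector_smult_assoc)
        finally show ?thesis
          by (simp add: matrix_vector_mult_add_rdistrib mat_mult_vector complex_symbol_scale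
              cvec.minus_left mult.commute)
      qed
      ultimately show ?thesis
        using V0 by (auto simp: det_eq_0_kernel)
    next
      case False
      \<comment> \<open>The effect of the complex shift \<zeta> - \<xi> on the generator.\<close>
      define P where "P = op (- (mat \<i> ** complex_symbol A (\<zeta> - cvec_of \<xi>)))"
      have appP: "app P v = - (\<i> *s (complex_symbol A (\<zeta> - cvec_of \<xi>) *v v))" for v
        unfolding P_def op_minus app.minus_left app_op
        by (simp add: mat_mult_vector flip: matrix_vector_mul_assoc)
      have "norm (app P v) \<le> (D * (2 * s) / \<delta> * C) * norm v" for v
      proof -
        have *: "norm (\<zeta> - cvec_of \<xi>) \<le> D * (2 * s) / \<delta>"
        proof -
          have "D * (2 * s) * norm \<xi> / norm l \<le> D * (2 * s) * norm \<xi> / (\<delta> * norm \<xi>)" if "norm \<xi> \<noteq> 0"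
            using False that \<delta> D s1 by (intro divide_left_mono mult_nonneg_nonneg mult_pos_pos) auto
          then show ?thesis
            using \<zeta> \<delta> D s1 by (cases "norm \<xi> = 0") auto
        qed
        have "norm (app P v) \<le> norm (op (complex_symbol A (\<zeta> - cvec_of \<xi>))) * norm v"
          using norm_app[of "op (complex_symbol A (\<zeta> - cvec_of \<xi>))" v] by (simp add: appP norm_cvec_scale)
        also have "\<dots> \<le> (norm (\<zeta> - cvec_of \<xi>) * C) * norm v"
          using C(2) by (intro mult_right_mono) auto
        also have "\<dots> \<le> (D * (2 * s) / \<delta> * C) * norm v"
          using C(1) * by (intro mult_right_mono) auto
        finally show ?thesis .
      qed
      then have nP: "norm P \<le> D * (2 * s) / \<delta> * C"
        using C(1) D s1 \<delta> by (intro norm_endo_bound) auto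
      have X: "generator A 0 \<xi> + P = op (- (mat \<i> ** complex_symbol A \<zeta>))"
      proof (rule endo_eqI)
        fix v
        have "complex_symbol A \<zeta> = symbol A 0 \<xi> + complex_symbol A (\<zeta> - cvec_of \<xi>)"
          by (simp add: linear_diff[OF linear_complex_symbol] complex_symbol_real)
        then show "app (generator A 0 \<xi> + P) v = app (op (- (mat \<i> ** complex_symbol A \<zeta>))) v"
          unfolding op_minus app.minus_left app_op
          by (simp add: app.add_left appP app_generator mat_mult_vector matrix_vector_mult_add_rdistrib
              flip: matrix_vector_mul_assoc)
      qed
      have eigV: "- (mat \<i> ** complex_symbol A \<zeta>) *v V = l *s V"
        unfolding VV app_op[symmetric] op_minus app.minus_left
        by (simp add: mat_mult_vector flip: matrix_vector_mul_assoc)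
      \<comment> \<open>V is an eigenvector of the perturbed generator, so exp (Re l t) is at most
        the norm of a boundedly perturbed bounded group.\<close>
      have "exp (Re l * t) \<le> K * exp ((K * norm P) * t)" if t: "0 \<le> t" for t
      proof -
        have "norm (exp (t *\<^sub>R (generator A 0 \<xi> + P))) \<le> K * exp ((0 + K * norm P) * t)"
          using K unfolding bounded_group_def by (intro exp_perturbation t) auto
        moreover have "exp (Re l * t) * norm V = norm (app (exp (t *\<^sub>R (generator A 0 \<xi> + P))) V)"
          unfolding X by (subst exp_eigenvector[OF eigV t]) (simp add: norm_cvec_scale mult.commute)
        moreover have "\<dots> \<le> norm (exp (t *\<^sub>R (generator A 0 \<xi> + P))) * norm V"
          by (rule norm_app)
        ultimately have "exp (Re l * t) * norm V \<le> K * exp ((K * norm P) * t) * norm V"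
          by (smt (verit) mult_right_mono norm_ge_zero)
        then show ?thesis
          using V0 by simp
      qed
      then have "Re l \<le> K * norm P"
        by (rule exp_dominated)
      also have "\<dots> \<le> a"
        unfolding a_def using mult_left_mono[OF nP K0] by simp
      finally show ?thesis .
    qed
  qed
  then show ?thesis
    using that by blast
qed

text \<open>The exponent q is the real dimension 2 (d N)^2 of the space of split matrices, which
  bounds the length of an annihilating list.\<close>

lemma split_weak_bound:
  fixes A :: "'d::finite \<Rightarrow> complex^'n^'n::finite"
  assumes "bounded_group A K" and "\<And>\<xi>::real^'d. \<xi> \<noteq> 0 \<Longrightarrow> order 0 (symbol_det A \<xi>) = m"
  obtains q C \<alpha> where "q > 0" "C > 0" and
    "\<And>t \<xi>. 0 \<le> t \<Longrightarrow> norm (exp (t *\<^sub>R generator (split_coeff A) (absorption \<sigma>) \<xi>)) \<le>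
       C * exp (\<alpha> * t) * (1 + (norm \<xi>)\<^sup>2) powr (q / 2)"
proof -
  let ?G = "generator (split_coeff A) (absorption \<sigma>)"
  let ?n = "DIM(complex^('d \<times> 'n)^('d \<times> 'n))"
  obtain a where a: "\<And>\<xi> U l. U \<noteq> 0 \<Longrightarrow> app (?G \<xi>) U = l *s U \<Longrightarrow> Re l \<le> a"
    using split_eigenvalue_bound assms by metis
  obtain c where c: "0 \<le> c" "\<And>\<xi>. norm (generator (split_coeff A) 0 \<xi>) \<le> norm \<xi> * c"
    using bounded_linear.nonneg_bounded[OF bounded_linear_generator] by blast
  define b where "b = c + norm (op (- absorption \<sigma>) :: (complex^('d \<times> 'n)) endo)"
  have b: "0 \<le> b"
    unfolding b_def using c(1) by simp
  have nG: "norm (?G \<xi>) \<le> b * (1 + norm \<xi>)" for \<xi>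
  proof -
    have "norm (?G \<xi>) \<le> norm \<xi> * c + norm (op (- absorption \<sigma>) :: (complex^('d \<times> 'n)) endo)"
      unfolding generator_add[of _ "absorption \<sigma>"] using norm_triangle_ineq c(2) by (smt (verit))
    also have "\<dots> \<le> b * (1 + norm \<xi>)"
      unfolding b_def using c(1) by (simp add: algebra_simps)
    finally show ?thesis .
  qed
  \<comment> \<open>The second summand pays for the powers of t in
    \<open>exp_growth\<close>.\<close>
  define \<alpha> where "\<alpha> = a + real ?n * (2 * b)"
  have n0: "0 < ?n"
    by (rule DIM_positive)
  define C where "C = real ?n * 2 ^ ?n"
  have "norm (exp (t *\<^sub>R ?G \<xi>)) \<le> C * exp (\<alpha> * t) * (1 + (norm \<xi>)\<^sup>2) powr (real ?n / 2)" if t: "0 \<le> t" for t \<xi>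
  proof -
    have "norm (exp (t *\<^sub>R ?G \<xi>)) \<le> exp (a * t) * (real ?n * (1 + 2 * (b * (1 + norm \<xi>)) * t) ^ ?n)"
      unfolding generator_def
    proof (rule exp_growth)
      show "norm (op (- (mat \<i> ** symbol (split_coeff A) 0 \<xi> + absorption \<sigma>))) \<le> b * (1 + norm \<xi>)"
        using nG[of \<xi>] by (simp add: generator_def)
      show "Re l \<le> a" if "v \<noteq> 0" "- (mat \<i> ** symbol (split_coeff A) 0 \<xi> + absorption \<sigma>) *v v = l *s v" for l v
        using a[of v \<xi> l] that unfolding generator_def app_op by blast
    qed (rule t)
    \<comment> \<open>Powers of t are moved into the exponential, whereas powers of 1 + |\<xi>|
      remain as the loss of derivatives.\<close>
    also have "(1 + 2 * (b * (1 + norm \<xi>)) * t) ^ ?n \<le> (exp (2 * b * t) * (1 + norm \<xi>)) ^ ?n"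
    proof (rule power_mono)
      have "1 + 2 * (b * (1 + norm \<xi>)) * t \<le> (1 + 2 * b * t) * (1 + norm \<xi>)"
        by (simp add: algebra_simps)
      also have "\<dots> \<le> exp (2 * b * t) * (1 + norm \<xi>)"
        using exp_ge_add_one_self by (intro mult_right_mono) auto
      finally show "1 + 2 * (b * (1 + norm \<xi>)) * t \<le> exp (2 * b * t) * (1 + norm \<xi>)" .
    qed (use b t in simp)
    also have "\<dots> = exp (real ?n * (2 * b) * t) * (1 + norm \<xi>) ^ ?n"
      by (simp only: power_mult_distrib exp_of_nat_mult[symmetric] mult.assoc)
    also have "(1 + norm \<xi>) ^ ?n \<le> 2 ^ ?n * (1 + (norm \<xi>)\<^sup>2) powr (real ?n / 2)"
    proof -
      have pos: "0 < 1 + (norm \<xi>)\<^sup>2"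
        by (smt (verit) zero_le_power2)
      \<comment> \<open>This inequality is the source of the factor 2^n in C.\<close>
      have "1 + norm \<xi> \<le> 2 * sqrt (1 + (norm \<xi>)\<^sup>2)"
      proof -
        have "1 \<le> sqrt (1 + (norm \<xi>)\<^sup>2)" by simp
        moreover have "norm \<xi> \<le> sqrt (1 + (norm \<xi>)\<^sup>2)" by (rule real_le_rsqrt) simp
        ultimately show ?thesis by linarith
      qed
      then have "(1 + norm \<xi>) ^ ?n \<le> (2 * sqrt (1 + (norm \<xi>)\<^sup>2)) ^ ?n"
        by (intro power_mono) auto
      also have "\<dots> = 2 ^ ?n * (1 + (norm \<xi>)\<^sup>2) powr (real ?n / 2)"
        using pos by (simp only: power_mult_distrib powr_half_sqrt[symmetric] less_imp_le)
          (simp add: powr_powr flip: powr_realpow)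
      finally show ?thesis .
    qed
    finally have "norm (exp (t *\<^sub>R ?G \<xi>)) \<le> exp (a * t) * (real ?n * (exp (real ?n * (2 * b) * t) *
        (2 ^ ?n * (1 + (norm \<xi>)\<^sup>2) powr (real ?n / 2))))"
      by (simp add: mult_left_mono)
    also have "\<dots> = C * exp (\<alpha> * t) * (1 + (norm \<xi>)\<^sup>2) powr (real ?n / 2)"
      unfolding C_def \<alpha>_def distrib_right exp_add by (simp only: ac_simps)
    finally show ?thesis .
  qed
  moreover have "C > 0"
    unfolding C_def using n0 by simp
  ultimately show ?thesis
    using that[of "real ?n" C \<alpha>] n0 by simp
qed

subsection \<open>Bounded split groups\<close>

lemma split_bounded_group:
  fixes A :: "'d::finite \<Rightarrow> complex^'n^'n::finite"
  assumes K: "bounded_group A K" and mult: "\<And>\<xi>::real^'d. \<xi> \<noteq> 0 \<Longrightarrow> order 0 (symbol_det A \<xi>) = m"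
    and kernel: "\<And>\<xi>::real^'d. \<xi> \<noteq> 0 \<Longrightarrow>
      mat_kernel (symbol A 0 \<xi>) = (\<Inter>j\<in>{j. \<xi> $ j \<noteq> 0}. mat_kernel (A j))"
  obtains K' where "bounded_group (split_coeff A) K'"
proof -
  obtain \<delta> where \<delta>: "\<delta> > 0" and gap:
    "\<And>\<omega> \<zeta> \<tau>. norm \<omega> = 1 \<Longrightarrow> norm (\<zeta> - cvec_of \<omega>) \<le> \<delta> \<Longrightarrow> \<tau> \<noteq> 0 \<Longrightarrow> norm \<tau> \<le> \<delta> \<Longrightarrow>
       det (complex_symbol A \<zeta> + mat \<tau>) \<noteq> 0"
    using spectral_gap[of A m] mult by blast
  have K0: "0 \<le> K"
    using K unfolding bounded_group_def by (metis norm_ge_zero order_refl order_trans)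
  have "bounded_linear (\<lambda>\<xi>. op (symbol A 0 \<xi>))"
    by (rule bounded_linear_compose[OF bounded_linear_op linear_conv_bounded_linear[THEN iffD1, OF linear_symbol]])
  then obtain b where b: "0 \<le> b" "\<And>\<xi>. norm (op (symbol A 0 \<xi>)) \<le> norm \<xi> * b"
    using bounded_linear.nonneg_bounded by blast
  obtain C where C: "0 \<le> C" "\<And>\<xi> v. norm (block_lift A \<xi> v) \<le> norm \<xi> * norm v * C"
    using bounded_bilinear.nonneg_bounded[OF bounded_bilinear_block_lift] by blast
  obtain S where S: "0 \<le> S" "\<And>U. norm (block_sum U :: complex^'n) \<le> norm (U :: complex^('d \<times> 'n)) * S"
    using bounded_linear.nonneg_bounded[OF bounded_linear_block_sum] by blast
  define c where "c = splitting_constant \<delta> b DIM(complex^'n^'n)"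
  have c: "0 \<le> c"
    unfolding c_def using splitting_constant_nonneg \<delta> b(1) by blast
  \<comment> \<open>Bounds U together with the lift of exp (t X) y - y, where |y| \<le> c S |U| and
    |exp (t X) y - y| \<le> (K + 1) |y|.\<close>
  define K' where "K' = 1 + (K + 1) * (c * S) * C"
  have K': "1 \<le> K'"
    unfolding K'_def using K0 c S(1) C(1) by simp
  \<comment> \<open>On the unit sphere the gap \<delta> and the bound b are uniform. The other
    frequencies follow since only the product of t and \<xi> enters.\<close>
  have unit: "norm (exp (t *\<^sub>R generator (split_coeff A) 0 \<omega>)) \<le> K'" if \<omega>: "norm \<omega> = 1" and t: "0 \<le> t" for \<omega> t
  proof (rule norm_endo_bound)
    fix U :: "complex^('d \<times> 'n)"
    let ?M = "symbol A 0 \<omega>" and ?X = "generator A 0 \<omega>"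
    let ?E = "\<lambda>s. exp (s *\<^sub>R ?X)"
    have "\<delta> \<le> norm l" if v: "v \<noteq> 0" "l \<noteq> 0" "?M *v v = l *s v" for l v
    proof (rule ccontr)
      assume "\<not> \<delta> \<le> norm l"
      then have "det (complex_symbol A (cvec_of \<omega>) + mat (- l)) \<noteq> 0"
        using \<omega> v \<delta> by (intro gap[of \<omega>]) auto
      moreover have "(complex_symbol A (cvec_of \<omega>) + mat (- l)) *v v = 0"
        using v by (simp add: complex_symbol_real matrix_vector_mult_add_rdistrib mat_mult_vector cvec.minus_left)
      ultimately show False
        using v by (auto simp: det_eq_0_kernel)
    qed
    moreover have "norm (op ?M) \<le> b"
      using b(2)[of \<omega>] \<omega> by simp
    ultimately obtain k y where ky: "block_sum U = k + ?M *v y" "?M *v k = 0" "norm y \<le> c * norm (block_sum U)"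
      using kernel_range_splitting[where M = ?M and \<delta> = \<delta> and b = b and v = "block_sum U"]
        bounded_group_semisimple[OF K] \<delta> unfolding c_def by blast
    have "k \<in> mat_kernel ?M"
      using ky(2) by (simp add: mat_kernel_def)
    then have "A j *v k = 0" if "\<omega> $ j \<noteq> 0" for j
    proof -
      have "\<omega> \<noteq> 0" using \<omega> by auto
      then have "k \<in> mat_kernel (A j)"
        using kernel \<open>k \<in> mat_kernel ?M\<close> that by blast
      then show ?thesis
        by (simp add: mat_kernel_def)
    qed
    \<comment> \<open>Here the kernel condition enters: either the frequency component or A_j k is
      zero, so k has no lift.\<close>
    then have "\<omega> $ j *\<^sub>R (A j *v k) $ i = 0" for j i
      by (cases "\<omega> $ j = 0") auto
    then have Tk: "block_lift A \<omega> k = 0"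
      by (simp add: block_lift_def vec_eq_iff)
    interpret T: bounded_linear "block_lift A \<omega>"
      by (rule bounded_bilinear.bounded_linear_right[OF bounded_bilinear_block_lift])
    \<comment> \<open>The candidate for the solution starting at U. Its correction is lifted from
      the original system, and its block sum is k + A(\<omega>) exp (s X) y, whose lift is the
      derivative of Z up to the factor - i.\<close>
    define Z where "Z s = U + block_lift A \<omega> (app (?E s) y - y)" for s
    have "(Z has_vector_derivative app (generator (split_coeff A) 0 \<omega>) (Z s)) (at s within {0..t})" for s
    proof -
      have "(Z has_vector_derivative (0 + block_lift A \<omega> (app ?X (app (?E s) y) - 0))) (at s within {0..t})"
        unfolding Z_def
        by (intro has_vector_derivative_add has_vector_derivative_const T.has_vector_derivative
            has_vector_derivative_diff app_exp_has_vector_derivative)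
      moreover have "block_sum (Z s) = k + ?M *v app (?E s) y"
        unfolding Z_def linear_add[OF linear_block_sum] block_sum_lift ky(1)
        by (simp add: matrix_vector_mult_diff_distrib)
      then have "app (generator (split_coeff A) 0 \<omega>) (Z s) = block_lift A \<omega> (app ?X (app (?E s) y))"
        by (simp add: app_generator split_symbol_vector T.add linear_simps(4)[OF T.bounded_linear_axioms] Tk block_lift_scale)
      ultimately show ?thesis
        by simp
    qed
    then have "Z t = app (exp (t *\<^sub>R generator (split_coeff A) 0 \<omega>)) (Z 0)"
      using t by (intro exp_ode_unique[where b = t]) auto
    then have "norm (app (exp (t *\<^sub>R generator (split_coeff A) 0 \<omega>)) U) = norm (Z t)"
      by (simp add: Z_def T.zero)
    also have "\<dots> \<le> norm U + norm (block_lift A \<omega> (app (?E t) y - y))"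
      unfolding Z_def by (rule norm_triangle_ineq)
    finally have 1: "norm (app (exp (t *\<^sub>R generator (split_coeff A) 0 \<omega>)) U) \<le>
        norm U + norm (block_lift A \<omega> (app (?E t) y - y))" .
    have 2: "norm (block_lift A \<omega> (app (?E t) y - y)) \<le> norm (app (?E t) y - y) * C"
      using C(2)[of \<omega>] \<omega> by simp
    have "norm (app (?E t) y) \<le> K * norm y"
      using norm_app[of "?E t" y] K t mult_right_mono[of "norm (?E t)" K "norm y"]
      unfolding bounded_group_def by fastforce
    then have 3: "norm (app (?E t) y - y) \<le> (K + 1) * norm y"
      using norm_triangle_ineq4[of "app (?E t) y" y] by (simp add: algebra_simps)
    have "norm y \<le> c * (norm U * S)"
      using ky(3) S(2)[of U] c by (meson mult_left_mono order_trans)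
    then have "(K + 1) * norm y \<le> (K + 1) * (c * (norm U * S))"
      using K0 by (intro mult_left_mono) auto
    with 3 have "norm (app (?E t) y - y) * C \<le> (K + 1) * (c * (norm U * S)) * C"
      using C(1) by (intro mult_right_mono) auto
    with 1 2 have "norm (app (exp (t *\<^sub>R generator (split_coeff A) 0 \<omega>)) U) \<le>
        norm U + (K + 1) * (c * (norm U * S)) * C"
      by linarith
    then show "norm (app (exp (t *\<^sub>R generator (split_coeff A) 0 \<omega>)) U) \<le> K' * norm U"
      unfolding K'_def by (simp add: algebra_simps)
  qed (use K' in simp)
  have "norm (exp (t *\<^sub>R generator (split_coeff A) 0 \<xi>)) \<le> K'" if t: "0 \<le> t" for t \<xi>
  proof (cases "\<xi> = 0")
    case True
    then have "generator (split_coeff A) 0 \<xi> = 0"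
      using linear_0[OF linear_generator] by blast
    then show ?thesis
      using K' by simp
  next
    case False
    then have "t *\<^sub>R generator (split_coeff A) 0 \<xi> = (t * norm \<xi>) *\<^sub>R generator (split_coeff A) 0 (inverse (norm \<xi>) *\<^sub>R \<xi>)"
      by (simp add: generator_scale)
    then show ?thesis
      using unit[of "inverse (norm \<xi>) *\<^sub>R \<xi>" "t * norm \<xi>"] False t by simp
  qed
  then show ?thesis
    using that unfolding bounded_group_def by blast
qed

subsection \<open>Nilpotent blocks\<close>

text \<open>Take v with A(\<xi>) v = 0 but some \<xi>_j A_j v \<noteq> 0, and U with block sum v.
  The split symbol sends U to the lift of v, which is nonzero, and this to the lift of A(\<xi>) v =
  0.\<close>

lemma split_nilpotent:
  fixes A :: "'d::finite \<Rightarrow> complex^'n^'n::finite"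
  assumes "mat_kernel (symbol A 0 \<xi>) \<noteq> (\<Inter>j\<in>{j. \<xi> $ j \<noteq> 0}. mat_kernel (A j))"
  obtains U where "symbol (split_coeff A) 0 \<xi> *v (symbol (split_coeff A) 0 \<xi> *v U) = 0"
    "symbol (split_coeff A) 0 \<xi> *v U \<noteq> 0"
proof -
  have "(\<Inter>j\<in>{j. \<xi> $ j \<noteq> 0}. mat_kernel (A j)) \<subseteq> mat_kernel (symbol A 0 \<xi>)"
    unfolding mat_kernel_def symbol_vector by (auto intro!: sum.neutral)
  then obtain v where v: "symbol A 0 \<xi> *v v = 0" "v \<notin> (\<Inter>j\<in>{j. \<xi> $ j \<noteq> 0}. mat_kernel (A j))"
    using assms unfolding mat_kernel_def by blast
  then obtain j i where j: "\<xi> $ j \<noteq> 0" "(A j *v v) $ i \<noteq> 0"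
    by (auto simp: mat_kernel_def vec_eq_iff)
  obtain U :: "complex^('d \<times> 'n)" where U: "block_sum U = v"
    using block_sum_surj by blast
  interpret T: bounded_linear "block_lift A \<xi>"
    by (rule bounded_bilinear.bounded_linear_right[OF bounded_bilinear_block_lift])
  have "block_lift A \<xi> v $ (j, i) \<noteq> 0"
    using j by (simp add: block_lift_def)
  then have "block_lift A \<xi> v \<noteq> 0"
    by auto
  then show ?thesis
    using that[of U] v(1) by (simp add: split_symbol_vector U block_sum_lift T.zero)
qed

text \<open>In the diagonalizing basis d (d z) = 0 for each entry, hence d z = 0.\<close>

lemma diagonalizable_semisimple:
  assumes "diagonalizable M" "M *v (M *v U) = 0"
  shows "M *v U = 0"
proof -
  obtain P D :: "complex^'a^'a" where P: "invertible P" and D: "\<forall>i j. i \<noteq> j \<longrightarrow> D $ i $ j = 0"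
    and M: "M = P ** D ** matrix_inv P"
    using assms(1) unfolding diagonalizable_def by blast
  have inv: "P ** matrix_inv P = mat 1" "matrix_inv P ** P = mat 1"
    using someI_ex[OF P[unfolded invertible_def]] unfolding matrix_inv_def by auto
  define y where "y = matrix_inv P *v U"
  have Dv: "(D *v z) $ i = D $ i $ i * z $ i" for z i
  proof -
    have "(D *v z) $ i = (\<Sum>j\<in>UNIV. if i = j then D $ i $ j * z $ j else 0)"
      unfolding matrix_vector_mult_def vec_lambda_beta using D by (intro sum.cong) auto
    then show ?thesis by simp
  qed
  have MU: "M *v U = P *v (D *v y)"
    by (simp add: M y_def matrix_vector_mul_assoc matrix_mul_assoc)
  have "P *v (D *v (D *v y)) = M *v (M *v U)"
  proof -
    have "M *v (P *v z) = P *v (D *v ((matrix_inv P ** P) *v z))" for z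
      unfolding M by (simp add: matrix_vector_mul_assoc matrix_mul_assoc)
    then show ?thesis
      by (simp add: MU inv)
  qed
  then have "P *v (D *v (D *v y)) = 0"
    using assms(2) by simp
  then have "(matrix_inv P ** P) *v (D *v (D *v y)) = 0"
    by (simp add: matrix_vector_mul_assoc[symmetric])
  then have "D *v (D *v y) = 0"
    by (simp add: inv)
  then have "D *v y = 0"
    by (auto simp: vec_eq_iff Dv)
  then show ?thesis
    by (simp add: MU)
qed

section \<open>Smooth functions\<close>

lemma frechet_derivative_eq:
  "(f has_derivative f') (at x) \<Longrightarrow> frechet_derivative f (at x) = f'"
  by (rule frechet_derivative_at[symmetric])

text \<open>Lets the derivative be exhibited by a formula instead of being evaluated through
  \<open>frechet_derivative\<close>.\<close>

lemma differentiable_times_SucI: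
  assumes "\<And>x. (f has_derivative f' x) (at x)" and "\<And>b. b \<in> Basis \<Longrightarrow> differentiable_times k (\<lambda>x. f' x b)"
  shows "differentiable_times (Suc k) f"
  using assms by (auto simp: frechet_derivative_eq[OF assms(1)] differentiable_def)

lemma differentiable_times_SucD:
  assumes "differentiable_times (Suc k) f"
  obtains f' where "\<And>x. (f has_derivative f' x) (at x)" "\<And>b. b \<in> Basis \<Longrightarrow> differentiable_times k (\<lambda>x. f' x b)"
  using assms that[of "\<lambda>x. frechet_derivative f (at x)"] frechet_derivative_works by auto

lemma differentiable_times_Suc_imp: "differentiable_times (Suc k) f \<Longrightarrow> differentiable_times k f"
proof (induction k arbitrary: f)
  case 0
  then show ?case
    by (auto intro!: continuous_at_imp_continuous_on differentiable_imp_continuous_within)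
qed auto

lemma differentiable_times_const: "differentiable_times k (\<lambda>_ :: 'a::euclidean_space. c)"
proof (induction k arbitrary: c)
  case (Suc k)
  show ?case
    by (rule differentiable_times_SucI[where f' = "\<lambda>_ _. 0"]) (auto intro: Suc)
qed auto

lemma differentiable_times_add:
  assumes "differentiable_times k f" "differentiable_times k g"
  shows "differentiable_times k (\<lambda>x. f x + g x)"
  using assms
proof (induction k arbitrary: f g)
  case (Suc k)
  obtain f' where f': "\<And>x. (f has_derivative f' x) (at x)" "\<And>b. b \<in> Basis \<Longrightarrow> differentiable_times k (\<lambda>x. f' x b)"
    using differentiable_times_SucD[OF Suc.prems(1)] by blast
  obtain g' where g': "\<And>x. (g has_derivative g' x) (at x)" "\<And>b. b \<in> Basis \<Longrightarrow> differentiable_times k (\<lambda>x. g' x b)"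
    using differentiable_times_SucD[OF Suc.prems(2)] by blast
  show ?case
    by (rule differentiable_times_SucI[where f' = "\<lambda>x b. f' x b + g' x b"])
      (auto intro!: f' g' Suc.IH has_derivative_add)
qed (auto intro!: continuous_intros)

lemma differentiable_times_mult:
  assumes "differentiable_times k f" "differentiable_times k g"
  shows "differentiable_times k (\<lambda>x. f x * g x)"
  using assms
proof (induction k arbitrary: f g)
  case (Suc k)
  obtain f' where f': "\<And>x. (f has_derivative f' x) (at x)" "\<And>b. b \<in> Basis \<Longrightarrow> differentiable_times k (\<lambda>x. f' x b)"
    using differentiable_times_SucD[OF Suc.prems(1)] by blast
  obtain g' where g': "\<And>x. (g has_derivative g' x) (at x)" "\<And>b. b \<in> Basis \<Longrightarrow> differentiable_times k (\<lambda>x. g' x b)"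
    using differentiable_times_SucD[OF Suc.prems(2)] by blast
  show ?case
    by (rule differentiable_times_SucI[where f' = "\<lambda>x b. f x * g' x b + f' x b * g x"])
      (auto intro!: f' g' Suc.IH has_derivative_mult differentiable_times_add
        differentiable_times_Suc_imp[OF Suc.prems(1)] differentiable_times_Suc_imp[OF Suc.prems(2)])
qed (auto intro!: continuous_intros)

lemma differentiable_times_sum:
  "(\<And>i. i \<in> I \<Longrightarrow> differentiable_times k (f i)) \<Longrightarrow> differentiable_times k (\<lambda>x. \<Sum>i\<in>I. f i x)"
  by (induction I rule: infinite_finite_induct) (auto intro!: differentiable_times_const differentiable_times_add)

lemma differentiable_times_affine:
  fixes L :: "'a::euclidean_space \<Rightarrow> 'b::euclidean_space"
  assumes "differentiable_times k f" and L: "bounded_linear L"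
  shows "differentiable_times k (\<lambda>x. f (L x + c))"
  using assms(1)
proof (induction k arbitrary: f)
  case 0
  have "continuous_on UNIV (\<lambda>x. L x + c)"
    by (intro continuous_intros linear_continuous_on L)
  then show ?case
    using 0 by (auto intro: continuous_on_compose2)
next
  case (Suc k)
  obtain f' where f': "\<And>x. (f has_derivative f' x) (at x)" "\<And>b. b \<in> Basis \<Longrightarrow> differentiable_times k (\<lambda>x. f' x b)"
    using differentiable_times_SucD[OF Suc.prems(1)] by blast
  show ?case
  proof (rule differentiable_times_SucI)
    show "((\<lambda>x. f (L x + c)) has_derivative (\<lambda>h. f' (L x + c) (L h))) (at x)" for x
      by (rule has_derivative_compose[OF _ f'(1)])
        (auto intro!: derivative_eq_intros bounded_linear_imp_has_derivative L)
    fix b :: 'a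
    \<comment> \<open>The induction hypothesis covers derivatives along basis vectors, so the
      direction L b is expanded in them.\<close>
    have "f' (L x + c) (L b) = (\<Sum>i\<in>Basis. (L b \<bullet> i) * f' (L x + c) i)" for x
    proof -
      have "f' (L x + c) (\<Sum>i\<in>Basis. (L b \<bullet> i) *\<^sub>R i) = (\<Sum>i\<in>Basis. (L b \<bullet> i) *\<^sub>R f' (L x + c) i)"
        using has_derivative_linear[OF f'(1)] by (simp only: linear_sum linear_scale)
      then show ?thesis
        by (simp add: euclidean_representation)
    qed
    then show "differentiable_times k (\<lambda>x. f' (L x + c) (L b))"
      by (auto intro!: differentiable_times_sum differentiable_times_mult differentiable_times_const Suc.IH f'(2))
  qed
qed

lemma smooth_const: "smooth (\<lambda>_. c)"
  by (simp add: smooth_def differentiable_times_const)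

lemma smooth_mult: "smooth f \<Longrightarrow> smooth g \<Longrightarrow> smooth (\<lambda>x. f x * g x)"
  by (simp add: smooth_def differentiable_times_mult)

lemma smooth_add: "smooth f \<Longrightarrow> smooth g \<Longrightarrow> smooth (\<lambda>x. f x + g x)"
  by (simp add: smooth_def differentiable_times_add)

lemma smooth_diff: "smooth f \<Longrightarrow> smooth g \<Longrightarrow> smooth (\<lambda>x. f x - g x)"
  using smooth_add[of f "\<lambda>x. (-1) * g x"] smooth_mult[OF smooth_const, of g "-1"] by simp

lemma smooth_affine: "smooth f \<Longrightarrow> bounded_linear L \<Longrightarrow> smooth (\<lambda>x. f (L x + c))"
  by (simp add: smooth_def differentiable_times_affine)

lemma smooth_linear: "smooth f \<Longrightarrow> bounded_linear L \<Longrightarrow> smooth (\<lambda>x. f (L x))"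
  using smooth_affine[of f L 0] by simp

lemma smooth_prod: "(\<And>i. i \<in> I \<Longrightarrow> smooth (f i)) \<Longrightarrow> smooth (\<lambda>x. \<Prod>i\<in>I. f i x)"
  by (induction I rule: infinite_finite_induct) (auto intro!: smooth_const smooth_mult)

lemma smooth_has_derivative: "smooth f \<Longrightarrow> (f has_derivative frechet_derivative f (at x)) (at x)"
  unfolding smooth_def using differentiable_times.simps(2)[of 0 f] frechet_derivative_works by blast

lemma smooth_continuous: "smooth f \<Longrightarrow> continuous_on S f"
  unfolding smooth_def by (metis continuous_on_subset differentiable_times.simps(1) subset_UNIV)

lemma smooth_continuous_deriv:
  assumes "smooth f"
  shows "continuous_on S (\<lambda>x. frechet_derivative f (at x) h)"
proof -
  have lin: "linear (frechet_derivative f (at x))" for x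
    using smooth_has_derivative[OF assms] has_derivative_linear by blast
  have "frechet_derivative f (at x) h = (\<Sum>i\<in>Basis. (h \<bullet> i) * frechet_derivative f (at x) i)" for x
  proof -
    have "frechet_derivative f (at x) (\<Sum>i\<in>Basis. (h \<bullet> i) *\<^sub>R i) = (\<Sum>i\<in>Basis. (h \<bullet> i) *\<^sub>R frechet_derivative f (at x) i)"
      by (simp only: linear_sum[OF lin] linear_scale[OF lin])
    then show ?thesis
      by (simp add: euclidean_representation)
  qed
  moreover have "continuous_on S (\<lambda>x. frechet_derivative f (at x) i)" if "i \<in> Basis" for i
    using assms that unfolding smooth_def
    by (metis continuous_on_subset differentiable_times.simps subset_UNIV)
  ultimately show ?thesis
    by (simp add: continuous_on_sum continuous_on_mult_left)
qed

lemma smooth_real: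
  assumes "\<And>k x. (D k has_real_derivative D (Suc k) x) (at x)"
  shows "smooth (D 0)"
proof -
  have "differentiable_times k (D j)" for k j
  proof (induction k arbitrary: j)
    case 0
    show ?case
      using assms by (auto intro!: continuous_at_imp_continuous_on DERIV_isCont)
  next
    case (Suc k)
    show ?case
    proof (rule differentiable_times_SucI)
      show "(D j has_derivative (\<lambda>h. D (Suc j) x * h)) (at x)" for x
        using assms[of j x] by (simp add: has_field_derivative_def)
    qed (use Suc in \<open>auto simp: Basis_real_def\<close>)
  qed
  then show ?thesis
    by (simp add: smooth_def)
qed

text \<open>A family closed under differentiation consists of smooth functions, with no formula for
  the k-th derivative. The sequence of derivatives is returned too, because it is continued by one
  primitive in \<open>smooth_step\<close>.\<close>

lemma smooth_real_coinduct:
  assumes "f \<in> F" and "\<And>g. g \<in> F \<Longrightarrow> \<exists>h\<in>F. \<forall>x. (g has_real_derivative h x) (at x)"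
  shows "smooth f" and "\<exists>D. D 0 = f \<and> (\<forall>k x. (D k has_real_derivative D (Suc k) x) (at x))"
proof -
  obtain d where d: "\<And>g. g \<in> F \<Longrightarrow> d g \<in> F \<and> (\<forall>x. (g has_real_derivative d g x) (at x))"
    using assms(2) by metis
  define D where "D k = (d ^^ k) f" for k
  have "D k \<in> F" for k
    using assms(1) d by (induction k) (auto simp: D_def)
  then have D: "(D k has_real_derivative D (Suc k) x) (at x)" for k x
    using d by (simp add: D_def)
  moreover have "D 0 = f"
    by (simp add: D_def)
  ultimately show "smooth f" and "\<exists>D. D 0 = f \<and> (\<forall>k x. (D k has_real_derivative D (Suc k) x) (at x))"
    using smooth_real[of D] by auto
qed

lemma smooth_cos_sin: "smooth (cos :: real \<Rightarrow> real)" "smooth (sin :: real \<Rightarrow> real)"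
proof -
  \<comment> \<open>The linear combinations of cosine and sine are closed under
    differentiation.\<close>
  define g :: "real \<times> real \<Rightarrow> real \<Rightarrow> real" where "g c x = fst c * cos x + snd c * sin x" for c x
  have "(g c has_real_derivative g (snd c, - fst c) x) (at x)" for c x
    unfolding g_def by (auto intro!: derivative_eq_intros)
  then have "\<exists>h\<in>range g. \<forall>x. (f has_real_derivative h x) (at x)" if "f \<in> range g" for f
    using that by blast
  from smooth_real_coinduct(1)[OF _ this] have "smooth (g c)" for c
    by blast
  from this[of "(1, 0)"] this[of "(0, 1)"]
  show "smooth (cos :: real \<Rightarrow> real)" "smooth (sin :: real \<Rightarrow> real)"
    by (simp_all add: g_def[abs_def])
qed

subsection \<open>Cutoff functions\<close>

text \<open>With y = 1 / x these are the functions p(y) exp (- y), continued by zero to x \<le> 0.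
  The class is closed under differentiation, which replaces p by y^2 (p - p').\<close>

definition flat :: "real poly \<Rightarrow> real \<Rightarrow> real" where
  "flat p x = (if 0 < x then poly p (inverse x) * exp (- inverse x) else 0)"

lemma poly_exp_tendsto_0: "((\<lambda>y. poly p y * exp (- y)) \<longlongrightarrow> (0::real)) at_top"
proof -
  have "((\<lambda>y. \<Sum>i\<le>degree p. coeff p i * (y ^ i / exp y)) \<longlongrightarrow> (\<Sum>i\<le>degree p. coeff p i * 0)) at_top"
    by (intro tendsto_intros tendsto_power_div_exp_0)
  then show ?thesis
    by (simp add: poly_altdef sum_distrib_right exp_minus divide_inverse mult.assoc)
qed

lemma flat_deriv: "(flat p has_real_derivative flat (monom 1 2 * (p - pderiv p)) x) (at x)"
proof (cases "x = 0")
  case False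
  show ?thesis
  proof (cases "0 < x")
    case True
    have "((\<lambda>x. poly p (inverse x) * exp (- inverse x)) has_real_derivative flat (monom 1 2 * (p - pderiv p)) x) (at x)"
      using True by (auto intro!: derivative_eq_intros DERIV_chain2[OF poly_DERIV]
          simp: flat_def poly_monom algebra_simps power2_eq_square)
    then show ?thesis
      by (rule has_field_derivative_transform_within_open[where S = "{0<..}"]) (use True in \<open>auto simp: flat_def\<close>)
  next
    case nonpos: False
    have "((\<lambda>_. 0) has_real_derivative flat (monom 1 2 * (p - pderiv p)) x) (at x)"
      using nonpos by (simp add: flat_def)
    then show ?thesis
      by (rule has_field_derivative_transform_within_open[where S = "{..<0}"]) (use False nonpos in \<open>auto simp: flat_def\<close>)
  qed
next
  case True
  \<comment> \<open>The difference quotient at zero has the extra factor \<open>inverse y\<close>,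
    which is absorbed into the polynomial as \<open>pCons 0 p\<close>.\<close>
  have "((\<lambda>y. poly (pCons 0 p) (inverse y) * exp (- inverse y)) \<longlongrightarrow> 0) (at_right 0)"
    by (rule filterlim_compose[OF poly_exp_tendsto_0 filterlim_inverse_at_top_right])
  then have "((\<lambda>y. flat p y / y) \<longlongrightarrow> 0) (at_right 0)"
    by (rule Lim_transform_eventually, intro eventually_mono[OF eventually_at_right_less[of 0]])
      (simp add: flat_def divide_inverse)
  moreover have "((\<lambda>y. flat p y / y) \<longlongrightarrow> 0) (at_left 0)"
    by (intro tendsto_eventually eventually_at_leftI[of "-1"]) (auto simp: flat_def)
  ultimately have "((\<lambda>y. flat p y / y) \<longlongrightarrow> 0) (at 0)"
    by (rule filterlim_split_at[rotated])
  then show ?thesis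
    using True by (simp add: has_field_derivative_iff flat_def)
qed

text \<open>The bump \<open>e(1 + x) e(1 - x)\<close>, \<open>e(x) = exp (-1/x)\<close>, supported in \<open>[-1, 1]\<close>.\<close>

definition bump :: "real \<Rightarrow> real" where
  "bump x = flat 1 (1 + x) * flat 1 (1 - x)"

text \<open>Finite sums of products of \<open>flat\<close> functions at 1 + x and at 1 - x are
  closed under differentiation. A list of pairs of polynomials encodes such a sum.\<close>

lemma bump_derivs: "\<exists>D. D 0 = bump \<and> (\<forall>k x. (D k has_real_derivative D (Suc k) x) (at x))"
proof -
  define g :: "(real poly \<times> real poly) list \<Rightarrow> real \<Rightarrow> real" where
    "g ps x = (\<Sum>(p, q)\<leftarrow>ps. flat p (1 + x) * flat q (1 - x))" for ps x
  define \<delta> :: "real poly \<Rightarrow> real poly" where "\<delta> p = monom 1 2 * (p - pderiv p)" for p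
  have "\<exists>qs. \<forall>x. (g ps has_real_derivative g qs x) (at x)" for ps
  proof (induction ps)
    case Nil
    show ?case
      by (rule exI[of _ "[]"]) (simp add: g_def[abs_def])
  next
    case (Cons pq ps)
    obtain p q where pq: "pq = (p, q)" by force
    obtain qs where qs: "\<And>x. (g ps has_real_derivative g qs x) (at x)"
      using Cons by blast
    have gC: "g ((p, q) # ps) = (\<lambda>x. flat p (1 + x) * flat q (1 - x) + g ps x)" for p q ps
      by (simp add: g_def fun_eq_iff)
    have "(g ((p, q) # ps) has_real_derivative g ((\<delta> p, q) # (p, - \<delta> q) # qs) x) (at x)" for x
    proof -
      have "((\<lambda>x. flat p (1 + x)) has_real_derivative flat (\<delta> p) (1 + x) * 1) (at x)"
        unfolding \<delta>_def by (rule DERIV_chain2[OF flat_deriv]) (auto intro!: derivative_eq_intros)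
      moreover have "((\<lambda>x. flat q (1 - x)) has_real_derivative flat (\<delta> q) (1 - x) * (-1)) (at x)"
        unfolding \<delta>_def by (rule DERIV_chain2[OF flat_deriv]) (auto intro!: derivative_eq_intros)
      moreover have "flat (- \<delta> q) y = - flat (\<delta> q) y" for y
        by (simp add: flat_def)
      ultimately show ?thesis
        unfolding gC by (auto intro!: derivative_eq_intros qs)
    qed
    then show ?case
      unfolding pq by blast
  qed
  then have "\<exists>h\<in>range g. \<forall>x. (f has_real_derivative h x) (at x)" if "f \<in> range g" for f
    using that by blast
  moreover have "bump = g [(1, 1)]"
    by (simp add: g_def bump_def fun_eq_iff)
  ultimately show ?thesis
    using smooth_real_coinduct(2)[of bump "range g"] by blast
qed

lemma smooth_bump: "smooth bump"
  using bump_derivs smooth_real by metis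

lemma bump_nonneg: "0 \<le> bump x"
  by (simp add: bump_def flat_def)

lemma bump_0: "0 < bump 0"
  by (simp add: bump_def flat_def)

lemma bump_support: "1 \<le> \<bar>x\<bar> \<Longrightarrow> bump x = 0"
  by (auto simp: bump_def flat_def)

text \<open>Normalized to one at the origin, so that \<open>cutoff\<close> at \<epsilon> x tends to
  one for every x as \<epsilon> tends to zero.\<close>

definition cutoff :: "real^'d::finite \<Rightarrow> real" where
  "cutoff x = (\<Prod>i\<in>UNIV. bump (x $ i) / bump 0)"

lemma smooth_cutoff: "smooth cutoff"
proof -
  have "smooth (\<lambda>x :: real^'d. bump (x $ i))" for i
    by (rule smooth_linear[OF smooth_bump bounded_linear_vec_nth])
  from smooth_mult[OF this smooth_const[of "1 / bump 0"]] show ?thesis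
    unfolding cutoff_def[abs_def] by (intro smooth_prod) simp
qed

lemma cutoff_0: "cutoff 0 = 1"
  using bump_0 by (simp add: cutoff_def)

lemma cutoff_support: "cutoff x \<noteq> 0 \<Longrightarrow> x \<in> cbox (- 1) 1"
proof -
  assume "cutoff x \<noteq> 0"
  then have "\<bar>x $ i\<bar> < 1" for i
    using bump_support[of "x $ i"] unfolding cutoff_def by (cases "1 \<le> \<bar>x $ i\<bar>") auto
  then show "x \<in> cbox (- 1) 1"
    unfolding mem_box_cart by (auto simp: abs_less_iff intro: less_imp_le)
qed

text \<open>H is the normalized primitive of the bump. Differences of rescaled translates of H
  approximate the indicator of an interval, and h generates an approximate identity.\<close>

lemma smooth_step:
  obtains H h :: "real \<Rightarrow> real" where "smooth H" "\<And>x. (H has_real_derivative h x) (at x)" "continuous_on UNIV h"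
    "\<And>x. x \<le> -1 \<Longrightarrow> H x = 0" "\<And>x. 1 \<le> x \<Longrightarrow> H x = 1" "\<And>x. 0 \<le> h x" "\<And>x. 1 \<le> \<bar>x\<bar> \<Longrightarrow> h x = 0"
    "\<And>x. 0 \<le> H x \<and> H x \<le> 1" "(h has_integral 1) {-1..1}"
proof -
  obtain D where D: "D 0 = bump" "\<And>k x. (D k has_real_derivative D (Suc k) x) (at x)"
    using bump_derivs by blast
  have "\<exists>F. \<forall>x::real. - \<infinity> < ereal x \<longrightarrow> ereal x < \<infinity> \<longrightarrow> (F has_vector_derivative bump x) (at x)"
    by (rule einterval_antiderivative)
      (use smooth_continuous[OF smooth_bump, of UNIV] in \<open>auto simp: continuous_on_eq_continuous_at\<close>)
  then obtain F where F: "\<And>x. (F has_real_derivative bump x) (at x)"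
    by (auto simp: has_real_derivative_iff_has_vector_derivative)
  have mono: "F x \<le> F y" if "x \<le> y" for x y
  proof (rule DERIV_nonneg_imp_nondecreasing[OF that])
    show "\<exists>d. (F has_real_derivative d) (at z) \<and> 0 \<le> d" for z
      using F[of z] bump_nonneg[of z] by (intro exI conjI)
  qed
  \<comment> \<open>Otherwise the monotone function F would be constant in between, and the bump
    would vanish at zero.\<close>
  have "F (-1) \<noteq> F 1"
  proof
    assume eq: "F (-1) = F 1"
    have "F x = F (-1)" if "x \<in> {-1<..<1}" for x
      using mono[of "-1" x] mono[of x 1] that eq by auto
    then have "((\<lambda>_. F (-1)) has_real_derivative bump 0) (at 0)"
      by (intro has_field_derivative_transform_within_open[OF F[of 0], where S = "{-1<..<1}"]) auto
    then have "bump 0 = 0"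
      using DERIV_unique DERIV_const by blast
    then show False
      using bump_0 by simp
  qed
  then have c: "F (-1) < F 1"
    using mono[of "-1" 1] by simp
  define c where "c = F 1 - F (-1)"
  have c0: "c > 0" using c by (simp add: c_def)
  define H where "H x = (F x - F (-1)) / c" for x
  \<comment> \<open>The derivatives of H: H itself, followed by the derivatives of the bump divided
    by c.\<close>
  define E where "E k = (case k of 0 \<Rightarrow> H | Suc k \<Rightarrow> (\<lambda>x. D k x / c))" for k
  have H: "(H has_real_derivative bump x / c) (at x)" for x
    unfolding H_def using c0 by (auto intro!: derivative_eq_intros F)
  have "(E k has_real_derivative E (Suc k) x) (at x)" for k x
    using H D by (cases k) (auto simp: E_def intro!: DERIV_cdivide)
  from smooth_real[of E, OF this] have smooth: "smooth H"
    by (simp add: E_def)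
  have low: "H x = 0" if "x \<le> -1" for x
  proof -
    have "F x = F (-1)"
    proof -
      have "\<exists>d. \<forall>y\<in>{..-1}. F y = d"
      proof (rule has_field_derivative_zero_constant)
        show "(F has_real_derivative 0) (at y within {..-1})" if "y \<in> {..-1}" for y
          using F[of y] bump_support[of y] that by (auto intro: has_field_derivative_at_within)
      qed auto
      then show ?thesis
        using that by auto
    qed
    then show ?thesis by (simp add: H_def)
  qed
  have high: "H x = 1" if "1 \<le> x" for x
  proof -
    have "F x = F 1"
    proof -
      have "\<exists>d. \<forall>y\<in>{1..}. F y = d"
      proof (rule has_field_derivative_zero_constant)
        show "(F has_real_derivative 0) (at y within {1..})" if "y \<in> {1..}" for y
          using F[of y] bump_support[of y] that by (auto intro: has_field_derivative_at_within)
      qed auto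
      then show ?thesis
        using that by auto
    qed
    then show ?thesis
      using c0 by (simp add: H_def c_def)
  qed
  have range: "0 \<le> H x \<and> H x \<le> 1" for x
  proof (cases "x \<le> -1 \<or> 1 \<le> x")
    case True
    then show ?thesis
      using low high by (auto simp: order_le_less)
  next
    case False
    then have "F (-1) \<le> F x" "F x \<le> F 1"
      using mono by auto
    then show ?thesis
      using c0 by (simp add: H_def c_def)
  qed
  have "((\<lambda>x. bump x / c) has_integral (H 1 - H (-1))) {-1..1}"
    using H by (intro fundamental_theorem_of_calculus)
      (auto simp: has_real_derivative_iff_has_vector_derivative intro: has_vector_derivative_at_within)
  then have int: "((\<lambda>x. bump x / c) has_integral 1) {-1..1}"
    using low[of "-1"] high[of 1] by simp
  have cont: "continuous_on UNIV (\<lambda>x. bump x / c)"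
    using c0 by (intro continuous_intros smooth_continuous[OF smooth_bump]) auto
  show ?thesis
  proof (rule that[OF smooth H cont low high _ _ range int])
    show "0 \<le> bump x / c" for x
      using bump_nonneg c0 by (intro divide_nonneg_nonneg) auto
    show "bump x / c = 0" if "1 \<le> \<bar>x\<bar>" for x
      using bump_support[OF that] by simp
  qed
qed

section \<open>Square integrable functions\<close>

lemma borel_measurable_cvec_scale [measurable (raw)]:
  fixes g :: "'a \<Rightarrow> complex^'n::finite"
  assumes "f \<in> borel_measurable M" "g \<in> borel_measurable M"
  shows "(\<lambda>x. f x *s g x) \<in> borel_measurable M"
  by (rule borel_measurable_continuous_Pair[OF assms]) (intro cvec.continuous_on continuous_intros)

lemma borel_measurable_cis [measurable (raw)]:
  "f \<in> borel_measurable M \<Longrightarrow> (\<lambda>x. cis (f x)) \<in> borel_measurable M"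
  by (rule borel_measurable_continuous_on[of cis]) (auto intro: continuous_on_cis)

lemma tendsto_0_ennrealI:
  fixes f :: "'a \<Rightarrow> ennreal"
  assumes "\<And>e. e > 0 \<Longrightarrow> \<forall>\<^sub>F x in F. f x \<le> ennreal e"
  shows "(f \<longlongrightarrow> 0) F"
proof (rule order_tendstoI)
  fix a :: ennreal assume "0 < a"
  then obtain e where e: "e > 0" "ennreal e < a"
  proof (cases a)
    case (real r)
    then show ?thesis
      using \<open>0 < a\<close> that[of "r / 2"] by (simp add: ennreal_less_iff)
  qed (use that[of 1] in auto)
  show "\<forall>\<^sub>F x in F. f x < a"
    using assms[OF e(1)] e(2) by (auto elim!: eventually_mono intro: le_less_trans)
qed auto

lemma tendsto_0_twice_sum:
  fixes f g :: "'a \<Rightarrow> ennreal"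
  assumes "(f \<longlongrightarrow> 0) F" "(g \<longlongrightarrow> 0) F"
  shows "((\<lambda>x. 2 * f x + 2 * g x) \<longlongrightarrow> 0) F"
  using tendsto_add[OF ennreal_tendsto_cmult[OF _ assms(1), of 2] ennreal_tendsto_cmult[OF _ assms(2), of 2]]
  by simp

text \<open>The value \<infinity> allows estimates before square integrability is known, and working
  with squares lets Fatou's lemma and Fubini's theorem apply directly.\<close>

definition sq_norm :: "('a::euclidean_space \<Rightarrow> 'b::euclidean_space) \<Rightarrow> ennreal" where
  "sq_norm f = (\<integral>\<^sup>+x. ennreal ((norm (f x))\<^sup>2) \<partial>lborel)"

lemma square_integrable_iff: "square_integrable f \<longleftrightarrow> f \<in> borel_measurable borel \<and> sq_norm f < \<infinity>"
  unfolding square_integrable_def sq_norm_def integrable_iff_bounded by auto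

lemma square_integrable_measurable [measurable_dest]: "square_integrable f \<Longrightarrow> f \<in> borel_measurable borel"
  by (simp add: square_integrable_iff)

lemma L2_norm_nonneg: "0 \<le> L2_norm f"
  by (simp add: L2_norm_def)

lemma sq_norm_L2_norm: "square_integrable f \<Longrightarrow> sq_norm f = ennreal ((L2_norm f)\<^sup>2)"
  unfolding square_integrable_def sq_norm_def L2_norm_def by (subst nn_integral_eq_integral) auto

lemma L2_norm_le:
  assumes "f \<in> borel_measurable borel" "sq_norm f \<le> ennreal (C\<^sup>2)" "0 \<le> C"
  shows "L2_norm f \<le> C"
proof -
  have "square_integrable f"
    using assms by (auto simp: square_integrable_iff intro: le_less_trans)
  then have "(L2_norm f)\<^sup>2 \<le> C\<^sup>2"
    using assms(2) sq_norm_L2_norm by fastforce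
  then show ?thesis
    using assms(3) by (rule power2_le_imp_le)
qed

lemma sq_norm_mono:
  "(\<And>x. norm (f x) \<le> norm (g x)) \<Longrightarrow> sq_norm f \<le> sq_norm g"
  unfolding sq_norm_def by (intro nn_integral_mono ennreal_leI power_mono) auto

lemma sq_norm_le_mult:
  assumes [measurable]: "g \<in> borel_measurable borel" and "\<And>x. norm (f x) \<le> C * norm (g x)"
  shows "sq_norm f \<le> ennreal (C\<^sup>2) * sq_norm g"
proof -
  have "sq_norm f \<le> (\<integral>\<^sup>+x. ennreal (C\<^sup>2) * ennreal ((norm (g x))\<^sup>2) \<partial>lborel)"
    unfolding sq_norm_def
    using assms(2) by (intro nn_integral_mono) (simp add: ennreal_mult[symmetric] power_mult_distrib[symmetric] power_mono)
  then show ?thesis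
    by (simp add: sq_norm_def nn_integral_cmult)
qed

lemma sq_norm_cong_AE: "AE x in lborel. f x = g x \<Longrightarrow> sq_norm f = sq_norm g"
  unfolding sq_norm_def by (intro nn_integral_cong_AE) auto

text \<open>The factor 2 replaces the mixed term of the square and is the origin of the constants
  sqrt 2 in the bounds for the Fourier transform.\<close>

lemma sq_norm_add:
  assumes [measurable]: "f \<in> borel_measurable borel" "g \<in> borel_measurable borel"
  shows "sq_norm (\<lambda>x. f x + g x) \<le> 2 * sq_norm f + 2 * sq_norm g"
proof -
  have "(norm (a + b))\<^sup>2 \<le> 2 * (norm a)\<^sup>2 + 2 * (norm b)\<^sup>2" for a b :: 'b
  proof -
    have "(norm (a + b))\<^sup>2 \<le> (norm a + norm b)\<^sup>2"
      by (intro power_mono norm_triangle_ineq) auto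
    also have "\<dots> \<le> 2 * (norm a)\<^sup>2 + 2 * (norm b)\<^sup>2"
      using zero_le_power2[of "norm a - norm b"] by (simp add: power2_eq_square algebra_simps)
    finally show ?thesis .
  qed
  then have "ennreal ((norm (f x + g x))\<^sup>2) \<le> 2 * ennreal ((norm (f x))\<^sup>2) + 2 * ennreal ((norm (g x))\<^sup>2)" for x
    using ennreal_leI[of "(norm (f x + g x))\<^sup>2" "2 * (norm (f x))\<^sup>2 + 2 * (norm (g x))\<^sup>2"]
    by (simp add: ennreal_mult)
  then have "sq_norm (\<lambda>x. f x + g x) \<le> (\<integral>\<^sup>+x. 2 * ennreal ((norm (f x))\<^sup>2) + 2 * ennreal ((norm (g x))\<^sup>2) \<partial>lborel)"
    unfolding sq_norm_def by (intro nn_integral_mono)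
  then show ?thesis
    by (simp add: sq_norm_def nn_integral_add nn_integral_cmult)
qed

lemma sq_norm_uminus: "sq_norm (\<lambda>x. - f x) = sq_norm f"
  by (simp add: sq_norm_def)

lemma sq_norm_minus_commute: "sq_norm (\<lambda>x. f x - g x) = sq_norm (\<lambda>x. g x - f x)"
  by (simp add: sq_norm_def norm_minus_commute)

lemma sq_norm_diff:
  assumes "f \<in> borel_measurable borel" "g \<in> borel_measurable borel"
  shows "sq_norm (\<lambda>x. f x - g x) \<le> 2 * sq_norm f + 2 * sq_norm g"
  using sq_norm_add[OF assms(1), of "\<lambda>x. - g x"] assms(2) by (simp add: sq_norm_uminus)

lemma sq_norm_triangle:
  assumes [measurable]: "f \<in> borel_measurable borel" "g \<in> borel_measurable borel" "h \<in> borel_measurable borel"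
  shows "sq_norm (\<lambda>x. f x - h x) \<le> 2 * sq_norm (\<lambda>x. f x - g x) + 2 * sq_norm (\<lambda>x. g x - h x)"
  using sq_norm_add[of "\<lambda>x. f x - g x" "\<lambda>x. g x - h x"] by simp

lemma sq_norm_eq_0: "f \<in> borel_measurable borel \<Longrightarrow> sq_norm f = 0 \<longleftrightarrow> (AE x in lborel. f x = 0)"
  unfolding sq_norm_def by (subst nn_integral_0_iff_AE) auto

lemma square_integrable_add:
  assumes "square_integrable f" "square_integrable g"
  shows "square_integrable (\<lambda>x. f x + g x)"
proof -
  have "2 * sq_norm f + 2 * sq_norm g < \<infinity>"
    using assms by (simp add: square_integrable_iff ennreal_mult_less_top)
  then show ?thesis
    using sq_norm_add[of f g] assms by (auto simp: square_integrable_iff intro: le_less_trans)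
qed

lemma square_integrable_bound:
  assumes "square_integrable g" "f \<in> borel_measurable borel" "\<And>x. norm (f x) \<le> C * norm (g x)"
  shows "square_integrable f"
proof -
  have "ennreal (C\<^sup>2) * sq_norm g < \<infinity>"
    using assms(1) by (simp add: square_integrable_iff ennreal_mult_less_top)
  then show ?thesis
    using sq_norm_le_mult[of g f C] assms by (auto simp: square_integrable_iff intro: le_less_trans)
qed

lemma square_integrable_diff:
  assumes "square_integrable f" "square_integrable g"
  shows "square_integrable (\<lambda>x. f x - g x)"
proof -
  have "square_integrable (\<lambda>x. - g x)"
    by (rule square_integrable_bound[OF assms(2), where C = 1]) (use assms(2) in auto)
  from square_integrable_add[OF assms(1) this] show ?thesis
    by simp
qed

lemma integrable_norm_mult:
  assumes "square_integrable f" "square_integrable g"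
  shows "integrable lborel (\<lambda>x. norm (f x) * norm (g x))"
proof (rule Bochner_Integration.integrable_bound)
  note [measurable] = assms[THEN square_integrable_measurable]
  show "integrable lborel (\<lambda>x. (norm (f x))\<^sup>2 + (norm (g x))\<^sup>2)"
    using assms by (auto simp: square_integrable_def)
  show "(\<lambda>x. norm (f x) * norm (g x)) \<in> borel_measurable lborel"
    by measurable
  have "norm (f x) * norm (g x) \<le> (norm (f x))\<^sup>2 + (norm (g x))\<^sup>2" for x
  proof -
    have "2 * (norm (f x) * norm (g x)) \<le> (norm (f x))\<^sup>2 + (norm (g x))\<^sup>2"
      using sum_squares_bound[of "norm (f x)" "norm (g x)"] by (simp add: mult.assoc)
    moreover have "0 \<le> norm (f x) * norm (g x)"
      by simp
    ultimately show ?thesis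
      by linarith
  qed
  then show "AE x in lborel. norm (norm (f x) * norm (g x)) \<le> norm ((norm (f x))\<^sup>2 + (norm (g x))\<^sup>2)"
    by auto
qed

lemma cauchy_schwarz_L2:
  assumes f: "square_integrable f" and g: "square_integrable g"
  shows "(LINT x|lborel. norm (f x) * norm (g x)) \<le> L2_norm f * L2_norm g"
proof -
  define I where "I = (LINT x|lborel. norm (f x) * norm (g x))"
  define F where "F = (LINT x|lborel. (norm (f x))\<^sup>2)"
  define G where "G = (LINT x|lborel. (norm (g x))\<^sup>2)"
  have int: "integrable lborel (\<lambda>x. (norm (f x))\<^sup>2)" "integrable lborel (\<lambda>x. (norm (g x))\<^sup>2)"
    "integrable lborel (\<lambda>x. norm (f x) * norm (g x))"
    using f g integrable_norm_mult[OF f g] by (auto simp: square_integrable_def)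
  \<comment> \<open>A nonnegative quadratic polynomial in s; its discriminant is the
    inequality.\<close>
  have q: "0 \<le> F - 2 * s * I + s\<^sup>2 * G" for s
  proof -
    have "0 \<le> (LINT x|lborel. (norm (f x) - s * norm (g x))\<^sup>2)"
      by (rule integral_nonneg_AE) simp
    also have "\<dots> = (LINT x|lborel. (norm (f x))\<^sup>2 - 2 * s * (norm (f x) * norm (g x)) + s\<^sup>2 * (norm (g x))\<^sup>2)"
      by (rule Bochner_Integration.integral_cong) (auto simp: power2_eq_square algebra_simps)
    also have "\<dots> = F - 2 * s * I + s\<^sup>2 * G"
      unfolding F_def G_def I_def using int by simp
    finally show ?thesis .
  qed
  have I0: "0 \<le> I"
    unfolding I_def by (rule integral_nonneg_AE) simp
  have G0: "0 \<le> G" "0 \<le> F"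
    unfolding G_def F_def by (rule integral_nonneg_AE, simp)+
  have "I\<^sup>2 \<le> F * G"
  \<comment> \<open>If G = 0 the polynomial is affine in s, which forces I = 0. Otherwise it is
    evaluated at its minimum s = I / G.\<close>
  proof (cases "G = 0")
    case True
    have "I = 0"
    proof (rule ccontr)
      assume "I \<noteq> 0"
      then show False
        using q[of "(F + 1) / I"] True G0(2) by simp
    qed
    then show ?thesis
      using G0 by simp
  next
    case False
    then show ?thesis
      using q[of "I / G"] G0 by (simp add: power2_eq_square field_simps)
  qed
  then have "I \<le> sqrt (F * G)"
    using I0 by (simp add: real_le_rsqrt)
  then show ?thesis
    by (simp add: I_def F_def G_def L2_norm_def real_sqrt_mult)
qed

lemma fatou_sq_norm:
  assumes [measurable]: "\<And>n. f n \<in> borel_measurable borel" "g \<in> borel_measurable borel"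
    and lim: "AE x in lborel. (\<lambda>n. f n x) \<longlonglongrightarrow> g x" and le: "\<forall>\<^sub>F n in sequentially. sq_norm (f n) \<le> C"
  shows "sq_norm g \<le> C"
proof -
  have "sq_norm g = (\<integral>\<^sup>+x. liminf (\<lambda>n. ennreal ((norm (f n x))\<^sup>2)) \<partial>lborel)"
    unfolding sq_norm_def
  proof (rule nn_integral_cong_AE, use lim in eventually_elim)
    fix x assume "(\<lambda>n. f n x) \<longlonglongrightarrow> g x"
    then have "(\<lambda>n. ennreal ((norm (f n x))\<^sup>2)) \<longlonglongrightarrow> ennreal ((norm (g x))\<^sup>2)"
      by (intro tendsto_intros)
    from lim_imp_Liminf[OF trivial_limit_sequentially this]
    show "ennreal ((norm (g x))\<^sup>2) = liminf (\<lambda>n. ennreal ((norm (f n x))\<^sup>2))"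
      by (rule sym)
  qed
  also have "\<dots> \<le> liminf (\<lambda>n. sq_norm (f n))"
    unfolding sq_norm_def by (rule nn_integral_liminf) measurable
  also have "\<dots> \<le> C"
    by (rule Liminf_le) (use le in auto)
  finally show ?thesis .
qed

lemma sq_norm_tendsto_0:
  fixes f :: "nat \<Rightarrow> 'a::euclidean_space \<Rightarrow> 'b::euclidean_space" and w :: "'a \<Rightarrow> 'c::euclidean_space"
  assumes [measurable]: "\<And>n. f n \<in> borel_measurable borel" and w: "square_integrable w"
    and lim: "\<And>x. (\<lambda>n. f n x) \<longlonglongrightarrow> 0" and le: "\<And>n x. norm (f n x) \<le> norm (w x)"
  shows "(\<lambda>n. sq_norm (f n)) \<longlonglongrightarrow> 0"
proof -
  note [measurable] = w[THEN square_integrable_measurable]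
  have "(\<lambda>n. \<integral>\<^sup>+x. ennreal ((norm (f n x))\<^sup>2) \<partial>lborel) \<longlonglongrightarrow> (\<integral>\<^sup>+(x::'a). 0 \<partial>lborel)"
  proof (rule nn_integral_dominated_convergence)
    show "AE x in lborel. ennreal ((norm (f n x))\<^sup>2) \<le> ennreal ((norm (w x))\<^sup>2)" for n
      using le by (auto intro!: ennreal_leI power_mono)
    show "(\<integral>\<^sup>+x. ennreal ((norm (w x))\<^sup>2) \<partial>lborel) < \<infinity>"
      using w by (simp add: square_integrable_iff sq_norm_def)
    have "(\<lambda>n. ennreal ((norm (f n x))\<^sup>2)) \<longlonglongrightarrow> ennreal ((norm (0::'b))\<^sup>2)" for x
      by (intro tendsto_intros lim)
    then show "AE x in lborel. (\<lambda>n. ennreal ((norm (f n x))\<^sup>2)) \<longlonglongrightarrow> 0"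
      by simp
  qed measurable
  then show ?thesis
    by (simp add: sq_norm_def)
qed

text \<open>Riesz-Fischer: a fast subsequence converges almost everywhere, and Fatou's lemma turns
  the Cauchy condition into convergence to the pointwise limit.\<close>

lemma L2_complete:
  fixes f :: "nat \<Rightarrow> 'a::euclidean_space \<Rightarrow> 'b::euclidean_space"
  assumes [measurable]: "\<And>n. f n \<in> borel_measurable borel"
    and cauchy: "\<And>e. e > 0 \<Longrightarrow> \<exists>N. \<forall>m\<ge>N. \<forall>n\<ge>N. sq_norm (\<lambda>x. f m x - f n x) \<le> ennreal e"
  obtains g where "g \<in> borel_measurable borel" "(\<lambda>n. sq_norm (\<lambda>x. f n x - g x)) \<longlonglongrightarrow> 0"
proof -
  \<comment> \<open>Squared distances of size 4^(-k) remain summable after multiplication by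
    2^k.\<close>
  have "\<exists>N. \<forall>m\<ge>N. \<forall>n\<ge>N. sq_norm (\<lambda>x. f m x - f n x) \<le> ennreal ((1/4) ^ k)" for k
    by (rule cauchy) simp
  then obtain N where N: "\<And>k m n. N k \<le> m \<Longrightarrow> N k \<le> n \<Longrightarrow> sq_norm (\<lambda>x. f m x - f n x) \<le> ennreal ((1/4) ^ k)"
    by metis
  \<comment> \<open>A nondecreasing choice of indices above both N k and k.\<close>
  define r where "r k = (\<Sum>j\<le>k. N j) + k" for k
  have rN: "N k \<le> r k" for k
    unfolding r_def using member_le_sum[of k "{..k}" N] by simp
  have rinc: "r k \<le> r (Suc k)" and rk: "k \<le> r k" for k
    by (simp_all add: r_def)
  define a where "a k x = norm (f (r (Suc k)) x - f (r k) x)" for k x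
  have [measurable]: "a k \<in> borel_measurable borel" for k
    unfolding a_def by measurable
  \<comment> \<open>Where the weighted sum has a finite value S, each (a_k)^2 is at most S 2^(-k),
    so the increments of the subsequence decay geometrically.\<close>
  have "(\<integral>\<^sup>+x. (\<Sum>k. ennreal (2 ^ k * (a k x)\<^sup>2)) \<partial>lborel) = (\<Sum>k. \<integral>\<^sup>+x. ennreal (2 ^ k * (a k x)\<^sup>2) \<partial>lborel)"
    by (rule nn_integral_suminf) measurable
  also have "\<dots> \<le> (\<Sum>k. ennreal ((1/2) ^ k))"
  proof (rule suminf_le)
    fix k
    have "(\<integral>\<^sup>+x. ennreal (2 ^ k * (a k x)\<^sup>2) \<partial>lborel) = ennreal (2 ^ k) * sq_norm (\<lambda>x. f (r (Suc k)) x - f (r k) x)"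
      unfolding sq_norm_def a_def by (subst nn_integral_cmult[symmetric]) (auto simp: ennreal_mult)
    also have "\<dots> \<le> ennreal (2 ^ k) * ennreal ((1/4) ^ k)"
      using rN[of k] rinc[of k] by (intro mult_left_mono N) auto
    also have "\<dots> = ennreal ((1/2) ^ k)"
      by (simp add: ennreal_mult[symmetric] power_mult_distrib[symmetric])
    finally show "(\<integral>\<^sup>+x. ennreal (2 ^ k * (a k x)\<^sup>2) \<partial>lborel) \<le> ennreal ((1/2) ^ k)" .
  qed auto
  also have "\<dots> < \<infinity>"
    by (subst suminf_ennreal2) (auto simp: summable_geometric)
  finally have "AE x in lborel. (\<Sum>k. ennreal (2 ^ k * (a k x)\<^sup>2)) \<noteq> \<infinity>"
    by (intro nn_integral_PInf_AE) auto
  then have conv: "AE x in lborel. (\<lambda>k. f (r k) x) \<longlonglongrightarrow> lim (\<lambda>k. f (r k) x)"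
  proof eventually_elim
    fix x assume fin: "(\<Sum>k. ennreal (2 ^ k * (a k x)\<^sup>2)) \<noteq> \<infinity>"
    define T where "T = (\<Sum>k. ennreal (2 ^ k * (a k x)\<^sup>2))"
    have "T \<noteq> top" using fin by (simp add: T_def)
    then obtain S where "0 \<le> S" "T = ennreal S"
      by (cases T) auto
    then have S: "0 \<le> S" "(\<Sum>k. ennreal (2 ^ k * (a k x)\<^sup>2)) = ennreal S"
      by (simp_all add: T_def)
    have "a k x \<le> sqrt S * sqrt (1/2) ^ k" for k
    proof -
      have "(\<Sum>j\<in>{k}. ennreal (2 ^ j * (a j x)\<^sup>2)) \<le> (\<Sum>k. ennreal (2 ^ k * (a k x)\<^sup>2))"
        by (rule sum_le_suminf) auto
      then have "2 ^ k * (a k x)\<^sup>2 \<le> S"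
        using S by simp
      then have "2 ^ k * (a k x)\<^sup>2 * (1/2) ^ k \<le> S * (1/2) ^ k"
        by (rule mult_right_mono) simp
      moreover have "2 ^ k * (a k x)\<^sup>2 * (1/2) ^ k = (a k x)\<^sup>2"
        by (simp add: power_one_over)
      ultimately have "a k x \<le> sqrt (S * (1/2) ^ k)"
        by (intro real_le_rsqrt) simp
      also have "\<dots> = sqrt S * sqrt (1/2) ^ k"
        by (simp only: real_sqrt_mult real_sqrt_power)
      finally show ?thesis .
    qed
    then have le: "norm (a k x) \<le> sqrt S * sqrt (1/2) ^ k" for k
      by (simp add: a_def)
    have "summable (\<lambda>k. sqrt S * sqrt (1/2) ^ k)"
      by (intro summable_mult summable_geometric) simp
    then have "summable (\<lambda>k. a k x)"
      by (rule summable_comparison_test') (rule le)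
    then have "summable (\<lambda>k. f (r (Suc k)) x - f (r k) x)"
      unfolding a_def by (rule summable_norm_cancel)
    then have "convergent (\<lambda>k. \<Sum>j<k. f (r (Suc j)) x - f (r j) x)"
      by (simp only: summable_iff_convergent)
    moreover have "(\<Sum>j<k. f (r (Suc j)) x - f (r j) x) = f (r k) x - f (r 0) x" for k
      by (rule sum_lessThan_telescope)
    ultimately have "convergent (\<lambda>k. f (r k) x - f (r 0) x)"
      by (simp only:)
    then obtain L where "(\<lambda>k. f (r k) x - f (r 0) x) \<longlonglongrightarrow> L"
      unfolding convergent_def by blast
    then have "(\<lambda>k. f (r k) x - f (r 0) x + f (r 0) x) \<longlonglongrightarrow> L + f (r 0) x"
      by (intro tendsto_intros)
    then have "(\<lambda>k. f (r k) x) \<longlonglongrightarrow> L + f (r 0) x"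
      by (simp only: diff_add_cancel)
    then show "(\<lambda>k. f (r k) x) \<longlonglongrightarrow> lim (\<lambda>k. f (r k) x)"
      using limI by metis
  qed
  define g where "g x = lim (\<lambda>k. f (r k) x)" for x
  have [measurable]: "g \<in> borel_measurable borel"
    unfolding g_def by measurable
  have "(\<lambda>n. sq_norm (\<lambda>x. f n x - g x)) \<longlonglongrightarrow> 0"
  proof (rule tendsto_0_ennrealI)
    fix e :: real assume "e > 0"
    then obtain M where M: "\<And>m n. M \<le> m \<Longrightarrow> M \<le> n \<Longrightarrow> sq_norm (\<lambda>x. f m x - f n x) \<le> ennreal e"
      using cauchy by blast
    have "sq_norm (\<lambda>x. f n x - g x) \<le> ennreal e" if "M \<le> n" for n
    proof (rule fatou_sq_norm)
      show "AE x in lborel. (\<lambda>k. f n x - f (r k) x) \<longlonglongrightarrow> f n x - g x"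
        using conv unfolding g_def by eventually_elim (intro tendsto_intros)
      show "\<forall>\<^sub>F k in sequentially. sq_norm (\<lambda>x. f n x - f (r k) x) \<le> ennreal e"
        using that rk by (intro eventually_sequentiallyI[of M] M) (auto intro: order_trans)
    qed measurable
    then show "\<forall>\<^sub>F n in sequentially. sq_norm (\<lambda>x. f n x - g x) \<le> ennreal e"
      by (rule eventually_sequentiallyI)
  qed
  then show ?thesis
    using that[of g] by simp
qed

section \<open>Gaussians\<close>

lemma lborel_integral_prod_Basis:
  fixes g :: "'a::euclidean_space \<Rightarrow> real \<Rightarrow> 'b::{real_normed_field,banach,second_countable_topology}"
  assumes int: "\<And>b. b \<in> Basis \<Longrightarrow> integrable lborel (g b)"
  shows "integrable lborel (\<lambda>x::'a. \<Prod>b\<in>Basis. g b (x \<bullet> b))"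
    and "(LINT x|lborel. (\<Prod>b\<in>Basis. g b ((x::'a) \<bullet> b))) = (\<Prod>b\<in>Basis. LINT s|lborel. g b s)"
proof -
  interpret product_sigma_finite "\<lambda>_ :: 'a. lborel :: real measure"
    by standard
  have g: "g b \<in> borel_measurable borel" if "b \<in> Basis" for b
    using borel_measurable_integrable[OF int[OF that]] by simp
  have meas: "(\<lambda>x. \<Prod>b\<in>Basis. g b ((x::'a) \<bullet> b)) \<in> borel_measurable borel"
    by (intro borel_measurable_prod measurable_compose[OF _ g]) auto
  have eq: "(\<Prod>b\<in>Basis. g b ((\<Sum>b\<in>Basis. f b *\<^sub>R b) \<bullet> b)) = (\<Prod>b\<in>Basis. g b (f b))" for f :: "'a \<Rightarrow> real"
    by (rule prod.cong) (auto simp: inner_sum_left_Basis)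
  have m: "(\<lambda>f. \<Sum>b\<in>Basis. f b *\<^sub>R (b::'a)) \<in> borel_measurable (Pi\<^sub>M Basis (\<lambda>_. lborel))"
    using measurable_component_singleton[of _ "Basis :: 'a set" "\<lambda>_. lborel :: real measure"]
    by (intro borel_measurable_sum borel_measurable_scaleR borel_measurable_const) simp
  show "integrable lborel (\<lambda>x::'a. \<Prod>b\<in>Basis. g b (x \<bullet> b))"
    by (subst lborel_eq, subst integrable_distr_eq[OF m meas]) (simp add: eq product_integrable_prod int)
  show "(LINT x|lborel. (\<Prod>b\<in>Basis. g b ((x::'a) \<bullet> b))) = (\<Prod>b\<in>Basis. LINT s|lborel. g b s)"
    by (subst (1) lborel_eq, subst integral_distr[OF m meas]) (simp add: eq product_integral_prod int)
qed

text \<open>This is the characteristic function of the standard normal distribution after the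
  substitution x = sqrt \<delta> s.\<close>

lemma gauss_fourier_real:
  assumes \<delta>: "\<delta> > 0"
  shows "integrable lborel (\<lambda>s. cis (s * z) * complex_of_real (exp (- \<delta> * s\<^sup>2 / 2)))"
    and "(LINT s|lborel. cis (s * z) * complex_of_real (exp (- \<delta> * s\<^sup>2 / 2))) =
      complex_of_real (sqrt (2 * pi / \<delta>) * exp (- z\<^sup>2 / (2 * \<delta>)))"
proof -
  define n where "n x = std_normal_density x *\<^sub>R cis (z / sqrt \<delta> * x)" for x
  define N where "N s = n (0 + sqrt \<delta> * s)" for s
  define J where "J = (LINT s|lborel. N s)"
  have n: "integrable lborel n"
    unfolding n_def by (rule Bochner_Integration.integrable_bound[OF integrable_std_normal_moment[of 0]]) auto
  have eq: "(\<lambda>s. cis (s * z) * complex_of_real (exp (- \<delta> * s\<^sup>2 / 2))) = (\<lambda>s. sqrt (2 * pi) *\<^sub>R N s)"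
  proof
    fix s
    have "(0 + sqrt \<delta> * s)\<^sup>2 = \<delta> * s\<^sup>2" "z / sqrt \<delta> * (0 + sqrt \<delta> * s) = s * z"
      using \<delta> by (auto simp: power_mult_distrib)
    then show "cis (s * z) * complex_of_real (exp (- \<delta> * s\<^sup>2 / 2)) = sqrt (2 * pi) *\<^sub>R N s"
      unfolding N_def n_def std_normal_density_def by (simp only:) (simp add: scaleR_conv_of_real)
  qed
  have "integrable lborel N"
    unfolding N_def using \<delta> by (intro lborel_integrable_real_affine n) auto
  then show "integrable lborel (\<lambda>s. cis (s * z) * complex_of_real (exp (- \<delta> * s\<^sup>2 / 2)))"
    unfolding eq by (rule integrable_scaleR_right)
  have "complex_of_real (exp (- (z / sqrt \<delta>)\<^sup>2 / 2)) = char std_normal_distribution (z / sqrt \<delta>)"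
    by (simp add: char_std_normal_distribution)
  also have "\<dots> = (LINT x|lborel. n x)"
    unfolding char_def n_def by (subst integral_density) (auto simp: cis_conv_exp normal_density_nonneg)
  also have "\<dots> = sqrt \<delta> *\<^sub>R J"
    unfolding J_def N_def using \<delta> by (subst lborel_integral_real_affine[of "sqrt \<delta>" _ 0]) auto
  also have "- (z / sqrt \<delta>)\<^sup>2 / 2 = - z\<^sup>2 / (2 * \<delta>)"
    using \<delta> by (simp add: power_divide mult.commute)
  finally have J: "complex_of_real (exp (- z\<^sup>2 / (2 * \<delta>))) = of_real (sqrt \<delta>) * J"
    by (simp only: scaleR_conv_of_real)
  have "(LINT s|lborel. cis (s * z) * complex_of_real (exp (- \<delta> * s\<^sup>2 / 2))) = sqrt (2 * pi) *\<^sub>R J"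
    unfolding eq J_def by (rule integral_scaleR_right)
  also have "\<dots> = of_real (sqrt (2 * pi) / sqrt \<delta>) * (of_real (sqrt \<delta>) * J)"
    using \<delta> by (simp add: scaleR_conv_of_real)
  also have "\<dots> = complex_of_real (sqrt (2 * pi / \<delta>) * exp (- z\<^sup>2 / (2 * \<delta>)))"
    by (simp only: J[symmetric] of_real_mult real_sqrt_divide)
  finally show "(LINT s|lborel. cis (s * z) * complex_of_real (exp (- \<delta> * s\<^sup>2 / 2))) =
      complex_of_real (sqrt (2 * pi / \<delta>) * exp (- z\<^sup>2 / (2 * \<delta>)))" .
qed

definition gauss :: "real \<Rightarrow> 'a::euclidean_space \<Rightarrow> real" where
  "gauss \<delta> \<xi> = exp (- \<delta> * (norm \<xi>)\<^sup>2 / 2)"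

text \<open>The normal density with covariance \<delta> times the identity. It is (2 pi)^(-d) times
  the Fourier integral of \<open>gauss \<delta>\<close>.\<close>

definition heat :: "real \<Rightarrow> 'a::euclidean_space \<Rightarrow> real" where
  "heat \<delta> z = (2 * pi * \<delta>) powr (- real DIM('a) / 2) * exp (- (norm z)\<^sup>2 / (2 * \<delta>))"

lemma gauss_measurable [measurable]: "gauss \<delta> \<in> borel_measurable borel"
  unfolding gauss_def by measurable

lemma heat_measurable [measurable]: "heat \<delta> \<in> borel_measurable borel"
  unfolding heat_def by measurable

lemma gauss_bounds: "0 < gauss \<delta> \<xi>" "0 \<le> \<delta> \<Longrightarrow> gauss \<delta> \<xi> \<le> 1"
  by (auto simp: gauss_def)

lemma heat_nonneg: "0 \<le> heat \<delta> z"
  by (simp add: heat_def)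

lemma heat_minus: "heat \<delta> (- z) = heat \<delta> z" "heat \<delta> (x - y) = heat \<delta> (y - x)"
  by (simp_all add: heat_def norm_minus_commute)

lemma cis_sum: "finite I \<Longrightarrow> cis (sum f I) = (\<Prod>i\<in>I. cis (f i))"
  by (induction I rule: finite_induct) (simp_all add: cis_mult[symmetric])

lemma sqrt_power_powr: "0 < x \<Longrightarrow> sqrt x ^ n = x powr (real n / 2)"
  using powr_realpow[of "sqrt x" n] powr_powr[of x "1/2" "real n"] by (simp add: powr_half_sqrt)

lemma gauss_fourier:
  fixes z :: "'a::euclidean_space"
  assumes \<delta>: "\<delta> > 0"
  shows "integrable lborel (\<lambda>\<xi>::'a. cis (\<xi> \<bullet> z) * complex_of_real (gauss \<delta> \<xi>))"
    and "(LINT \<xi>|lborel. cis (\<xi> \<bullet> z) * complex_of_real (gauss \<delta> \<xi>)) =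
      complex_of_real ((2 * pi) ^ DIM('a) * heat \<delta> z)"
proof -
  let ?g = "\<lambda>b s. cis (s * (z \<bullet> b)) * complex_of_real (exp (- \<delta> * s\<^sup>2 / 2))"
  have norm2: "(norm x)\<^sup>2 = (\<Sum>b\<in>Basis. (x \<bullet> b)\<^sup>2)" for x :: 'a
    unfolding power2_norm_eq_inner by (subst euclidean_inner) (simp add: power2_eq_square)
  have eq: "cis (\<xi> \<bullet> z) * complex_of_real (gauss \<delta> \<xi>) = (\<Prod>b\<in>Basis. ?g b (\<xi> \<bullet> b))" for \<xi>
  proof -
    have "gauss \<delta> \<xi> = (\<Prod>b\<in>Basis. exp (- \<delta> * (\<xi> \<bullet> b)\<^sup>2 / 2))"
      by (simp add: gauss_def norm2 exp_sum[symmetric] sum_distrib_left sum_negf sum_divide_distrib)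
    moreover have "cis (\<xi> \<bullet> z) = (\<Prod>b\<in>Basis. cis ((\<xi> \<bullet> b) * (z \<bullet> b)))"
      by (subst euclidean_inner) (simp add: cis_sum)
    ultimately show ?thesis
      by (simp add: prod.distrib)
  qed
  show "integrable lborel (\<lambda>\<xi>::'a. cis (\<xi> \<bullet> z) * complex_of_real (gauss \<delta> \<xi>))"
    unfolding eq by (intro lborel_integral_prod_Basis gauss_fourier_real \<delta>)
  have "(LINT \<xi>|lborel. cis (\<xi> \<bullet> z) * complex_of_real (gauss \<delta> \<xi>)) =
      (\<Prod>b\<in>Basis. complex_of_real (sqrt (2 * pi / \<delta>) * exp (- (z \<bullet> b)\<^sup>2 / (2 * \<delta>))))"
    unfolding eq gauss_fourier_real(2)[OF \<delta>, symmetric]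
    by (rule lborel_integral_prod_Basis(2)) (rule gauss_fourier_real(1)[OF \<delta>])
  also have "\<dots> = complex_of_real (sqrt (2 * pi / \<delta>) ^ DIM('a) * exp (- (norm z)\<^sup>2 / (2 * \<delta>)))"
    by (simp add: prod.distrib norm2 exp_sum[symmetric] sum_negf sum_divide_distrib flip: of_real_prod)
  also have "sqrt (2 * pi / \<delta>) ^ DIM('a) = (2 * pi) ^ DIM('a) * (2 * pi * \<delta>) powr (- real DIM('a) / 2)"
  proof -
    have "sqrt (2 * pi / \<delta>) = 2 * pi / sqrt (2 * pi * \<delta>)"
      using \<delta> by (simp add: real_sqrt_divide real_sqrt_mult real_div_sqrt field_simps)
    moreover have "sqrt (2 * pi * \<delta>) ^ DIM('a) = (2 * pi * \<delta>) powr (real DIM('a) / 2)"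
      using \<delta> by (intro sqrt_power_powr) simp
    moreover have "(2 * pi * \<delta>) powr (- real DIM('a) / 2) = inverse ((2 * pi * \<delta>) powr (real DIM('a) / 2))"
      by (subst powr_minus[symmetric]) (simp only: minus_divide_left)
    ultimately show ?thesis
      by (simp only: power_divide[of "2 * pi"]) (simp only: divide_inverse)
  qed
  finally show "(LINT \<xi>|lborel. cis (\<xi> \<bullet> z) * complex_of_real (gauss \<delta> \<xi>)) =
      complex_of_real ((2 * pi) ^ DIM('a) * heat \<delta> z)"
    by (simp add: heat_def)
qed

lemma gauss_integrable: "\<delta> > 0 \<Longrightarrow> integrable lborel (gauss \<delta> :: 'a::euclidean_space \<Rightarrow> real)"
  using integrable_Re[OF gauss_fourier(1)[of \<delta> "0::'a"]] by simp

text \<open>\<open>heat \<delta>\<close> is a multiple of \<open>gauss (1 / \<delta>)\<close>, whose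
  integral is its Fourier integral at zero.\<close>

lemma heat_integral:
  assumes \<delta>: "\<delta> > 0"
  shows "integrable lborel (heat \<delta> :: 'a::euclidean_space \<Rightarrow> real)" "(LINT z|lborel. heat \<delta> (z::'a)) = 1"
proof -
  have heat: "heat \<delta> z = (2 * pi * \<delta>) powr (- real DIM('a) / 2) * gauss (1 / \<delta>) z" for z :: 'a
    by (simp add: heat_def gauss_def)
  show "integrable lborel (heat \<delta> :: 'a \<Rightarrow> real)"
    unfolding heat using \<delta> gauss_integrable[of "1 / \<delta>"] by simp
  have "complex_of_real (LINT z|lborel. gauss (1 / \<delta>) (z::'a)) = complex_of_real ((2 * pi) ^ DIM('a) * heat (1 / \<delta>) (0::'a))"
    using gauss_fourier(2)[of "1 / \<delta>" "0::'a"] \<delta> by (simp flip: of_real_mult)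
  then have "(LINT z|lborel. gauss (1 / \<delta>) (z::'a)) = (2 * pi) ^ DIM('a) * heat (1 / \<delta>) (0::'a)"
    by (simp only: of_real_eq_iff)
  moreover have "(2 * pi * \<delta>) powr (- real DIM('a) / 2) * ((2 * pi) ^ DIM('a) * heat (1 / \<delta>) (0::'a)) = 1"
  proof -
    have "(2 * pi * \<delta>) * (2 * pi * (1 / \<delta>)) = (2 * pi) powr 2"
      using \<delta> by (simp add: power2_eq_square)
    then have "((2 * pi * \<delta>) * (2 * pi * (1 / \<delta>))) powr (- real DIM('a) / 2) = (2 * pi) powr (- real DIM('a))"
      by (simp only: powr_powr) simp
    then have "(2 * pi * \<delta>) powr (- real DIM('a) / 2) * (2 * pi * (1 / \<delta>)) powr (- real DIM('a) / 2) = inverse ((2 * pi) ^ DIM('a))"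
      using \<delta> by (subst powr_mult[symmetric]) (auto simp: powr_minus powr_realpow)
    then show ?thesis
      by (simp add: heat_def field_simps)
  qed
  ultimately show "(LINT z|lborel. heat \<delta> (z::'a)) = 1"
    unfolding heat by simp
qed

section \<open>Invariance of Lebesgue measure\<close>

lemma nn_integral_lborel_affine:
  fixes f :: "'a::euclidean_space \<Rightarrow> ennreal"
  assumes [measurable]: "f \<in> borel_measurable borel" and c: "c \<noteq> 0"
  shows "(\<integral>\<^sup>+x. f x \<partial>lborel) = ennreal (\<bar>c\<bar> ^ DIM('a)) * (\<integral>\<^sup>+x. f (t + c *\<^sub>R x) \<partial>lborel)"
  by (subst lborel_affine[OF c, of t]) (simp add: nn_integral_density nn_integral_distr nn_integral_cmult ennreal_power)

lemma integrable_lborel_affine: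
  fixes f :: "'a::euclidean_space \<Rightarrow> 'b::{banach, second_countable_topology}"
  assumes f: "integrable lborel f" and c: "c \<noteq> 0"
  shows "integrable lborel (\<lambda>x. f (t + c *\<^sub>R x))"
proof -
  have [measurable]: "f \<in> borel_measurable borel"
    using f by auto
  have "ennreal (\<bar>c\<bar> ^ DIM('a)) * (\<integral>\<^sup>+x. ennreal (norm (f (t + c *\<^sub>R x))) \<partial>lborel) < \<infinity>"
    using f c by (subst nn_integral_lborel_affine[symmetric]) (auto simp: integrable_iff_bounded)
  then show ?thesis
    using c by (auto simp: integrable_iff_bounded ennreal_mult_less_top)
qed

lemma integral_lborel_affine:
  fixes f :: "'a::euclidean_space \<Rightarrow> 'b::{banach, second_countable_topology}"
  assumes c: "c \<noteq> 0"
  shows "(LINT x|lborel. f x) = (\<bar>c\<bar> ^ DIM('a)) *\<^sub>R (LINT x|lborel. f (t + c *\<^sub>R x))"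
proof (cases "integrable lborel f")
  case f: True
  then have [measurable]: "f \<in> borel_measurable borel"
    by auto
  show ?thesis
    by (subst lborel_affine[OF c, of t]) (simp add: integral_density integral_distr ennreal_power)
next
  \<comment> \<open>Integrability holds on both sides or on neither; in the latter case both
    integrals have the default value zero.\<close>
  case False
  moreover have "\<not> integrable lborel (\<lambda>x. f (t + c *\<^sub>R x))"
  proof
    assume "integrable lborel (\<lambda>x. f (t + c *\<^sub>R x))"
    from integrable_lborel_affine[OF this, of "1 / c" "- (1 / c) *\<^sub>R t"] c
    have "integrable lborel f"
      by (simp add: algebra_simps)
    with False show False by simp
  qed
  ultimately show ?thesis
    by (simp add: not_integrable_integral_eq)
qed

lemma nn_integral_lborel_shift:
  fixes f :: "'a::euclidean_space \<Rightarrow> ennreal"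
  assumes "f \<in> borel_measurable borel"
  shows "(\<integral>\<^sup>+x. f (x - t) \<partial>lborel) = (\<integral>\<^sup>+x. f x \<partial>lborel)"
  using nn_integral_lborel_affine[OF assms, of 1 "- t"] by simp

lemma sq_norm_reflect:
  assumes [measurable]: "f \<in> borel_measurable borel"
  shows "sq_norm (\<lambda>x. f (- x)) = sq_norm f"
  unfolding sq_norm_def by (subst (2) nn_integral_lborel_affine[of _ "-1" 0]) auto

text \<open>The applications of Fubini's theorem to Bochner integrals of kernels below are justified
  by such a product majorant.\<close>

lemma integrable_pair_bound:
  fixes F :: "'a::euclidean_space \<times> 'b::euclidean_space \<Rightarrow> 'c::{banach, second_countable_topology}"
  assumes F [measurable]: "F \<in> borel_measurable (lborel \<Otimes>\<^sub>M lborel)"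
    and f: "integrable lborel f" and g: "integrable lborel g"
    and le: "\<And>x y. norm (F (x, y)) \<le> f x * g y"
  shows "integrable (lborel \<Otimes>\<^sub>M lborel) F"
proof (rule integrableI_bounded)
  have [measurable]: "f \<in> borel_measurable borel" "g \<in> borel_measurable borel"
    using f g by auto
  have "(\<integral>\<^sup>+p. ennreal (norm (F p)) \<partial>(lborel \<Otimes>\<^sub>M lborel)) \<le>
      (\<integral>\<^sup>+p. ennreal (norm (f (fst p))) * ennreal (norm (g (snd p))) \<partial>(lborel \<Otimes>\<^sub>M lborel))"
  proof (rule nn_integral_mono)
    fix p :: "'a \<times> 'b"
    have "norm (F p) \<le> norm (f (fst p)) * norm (g (snd p))"
      using le[of "fst p" "snd p"] abs_ge_self[of "f (fst p) * g (snd p)"] by (simp add: abs_mult)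
    then show "ennreal (norm (F p)) \<le> ennreal (norm (f (fst p))) * ennreal (norm (g (snd p)))"
      by (simp add: ennreal_mult[symmetric] ennreal_leI)
  qed
  also have "\<dots> = (\<integral>\<^sup>+x. ennreal (norm (f x)) \<partial>lborel) * (\<integral>\<^sup>+y. ennreal (norm (g y)) \<partial>lborel)"
    by (subst lborel.nn_integral_fst[symmetric]) (simp_all add: nn_integral_cmult nn_integral_multc)
  also have "\<dots> < \<infinity>"
    using f g by (auto simp: integrable_iff_bounded ennreal_mult_less_top)
  finally show "(\<integral>\<^sup>+p. ennreal (norm (F p)) \<partial>(lborel \<Otimes>\<^sub>M lborel)) < \<infinity>" .
qed (rule F)

section \<open>The Fourier transform of integrable functions\<close>

abbreviation fourier_const :: "'d::finite itself \<Rightarrow> real" where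
  "fourier_const (_ :: 'd itself) \<equiv> (2 * pi) powr (- real CARD('d) / 2)"

definition FT :: "(real^'d::finite \<Rightarrow> complex^'n::finite) \<Rightarrow> real^'d \<Rightarrow> complex^'n" where
  "FT f \<xi> = fourier_const TYPE('d) *\<^sub>R (LINT x|lborel. cis (- (\<xi> \<bullet> x)) *s f x)"

lemma norm_cis_scale [simp]: "norm (cis a *s v) = norm (v :: complex^'n::finite)"
  by (simp add: norm_cvec_scale)

lemma integrable_cis_scale:
  assumes f: "integrable lborel f" and [measurable]: "a \<in> borel_measurable borel"
  shows "integrable lborel (\<lambda>x. cis (a x) *s (f x :: complex^'n::finite))"
proof -
  have [measurable]: "f \<in> borel_measurable borel" using f by auto
  show ?thesis
    by (rule Bochner_Integration.integrable_bound[OF f]) auto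
qed

lemma FT_diff:
  assumes "integrable lborel f" "integrable lborel g"
  shows "FT (\<lambda>x. f x - g x) \<xi> = FT f \<xi> - FT g \<xi>"
  using integrable_cis_scale[OF assms(1), of "\<lambda>x. - (\<xi> \<bullet> x)"] integrable_cis_scale[OF assms(2), of "\<lambda>x. - (\<xi> \<bullet> x)"]
  by (simp add: FT_def cvec.diff_right scaleR_diff_right)

lemma FT_diff_fun:
  "integrable lborel f \<Longrightarrow> integrable lborel g \<Longrightarrow> FT (\<lambda>x. f x - g x) = (\<lambda>\<xi>. FT f \<xi> - FT g \<xi>)"
  by (rule ext) (rule FT_diff)

lemma norm_FT_le: "norm (FT (f :: real^'d::finite \<Rightarrow> complex^'n::finite) \<xi>) \<le> fourier_const TYPE('d) * (LINT x|lborel. norm (f x))"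
proof -
  have "norm (LINT x|lborel. cis (- (\<xi> \<bullet> x)) *s f x) \<le> (LINT x|lborel. norm (cis (- (\<xi> \<bullet> x)) *s f x))"
    by (rule integral_norm_bound)
  then show ?thesis
    by (simp add: FT_def mult_left_mono)
qed

lemma continuous_FT:
  assumes f: "integrable lborel f"
  shows "continuous_on UNIV (FT f)"
proof -
  have [measurable]: "f \<in> borel_measurable borel" using f by auto
  have "isCont (FT f) \<xi>" for \<xi>
    unfolding continuous_at_sequentially
  proof (intro allI impI)
    fix s assume s: "s \<longlonglongrightarrow> \<xi>"
    have "(\<lambda>n. LINT x|lborel. cis (- (s n \<bullet> x)) *s f x) \<longlonglongrightarrow> (LINT x|lborel. cis (- (\<xi> \<bullet> x)) *s f x)"
    proof (rule integral_dominated_convergence)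
      show "integrable lborel (\<lambda>x. norm (f x))" using f by simp
      have "(\<lambda>n. cis (- (s n \<bullet> x)) *s f x) \<longlonglongrightarrow> cis (- (\<xi> \<bullet> x)) *s f x" for x
        by (intro cvec.tendsto tendsto_intros tendsto_cis s)
      then show "AE x in lborel. (\<lambda>n. cis (- (s n \<bullet> x)) *s f x) \<longlonglongrightarrow> cis (- (\<xi> \<bullet> x)) *s f x"
        by simp
    qed auto
    then show "((FT f) \<circ> s) \<longlonglongrightarrow> FT f \<xi>"
      unfolding FT_def o_def by (intro tendsto_intros)
  qed
  then show ?thesis
    by (simp add: continuous_at_imp_continuous_on)
qed

lemma FT_measurable: "integrable lborel f \<Longrightarrow> FT f \<in> borel_measurable borel"
  using continuous_FT by (rule borel_measurable_continuous_onI)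

lemma integrable_gauss_FT:
  fixes f :: "real^'d::finite \<Rightarrow> complex^'n::finite"
  assumes f: "integrable lborel f" and \<delta>: "\<delta> > 0"
  shows "integrable lborel (\<lambda>\<xi>. gauss \<delta> \<xi> *\<^sub>R FT f \<xi>)"
proof (rule Bochner_Integration.integrable_bound)
  note [measurable] = FT_measurable[OF f]
  show "integrable lborel (\<lambda>\<xi>::real^'d. gauss \<delta> \<xi> * (fourier_const TYPE('d) * (LINT x|lborel. norm (f x))))"
    using gauss_integrable[OF \<delta>, where 'a = "real^'d"] by simp
  show "(\<lambda>\<xi>. gauss \<delta> \<xi> *\<^sub>R FT f \<xi>) \<in> borel_measurable lborel"
    by measurable
  show "AE \<xi> in lborel. norm (gauss \<delta> \<xi> *\<^sub>R FT f \<xi>) \<le> norm (gauss \<delta> \<xi> * (fourier_const TYPE('d) * (LINT x|lborel. norm (f x))))"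
  proof (rule AE_I2)
    fix \<xi> :: "real^'d"
    have "norm (FT f \<xi>) \<le> \<bar>fourier_const TYPE('d) * (LINT x|lborel. norm (f x))\<bar>"
      using norm_FT_le[of f \<xi>] by linarith
    then show "norm (gauss \<delta> \<xi> *\<^sub>R FT f \<xi>) \<le> norm (gauss \<delta> \<xi> * (fourier_const TYPE('d) * (LINT x|lborel. norm (f x))))"
      using gauss_bounds(1)[of \<delta> \<xi>] by (simp only: norm_scaleR real_norm_def abs_mult) (simp add: mult_left_mono)
  qed
qed

text \<open>Fubini's theorem. For the real inner product the adjoint of multiplication by
  \<open>cis (- a)\<close> is multiplication by \<open>cis a\<close>, whence the reflection on the
  right.\<close>

lemma FT_adjoint:
  fixes f k :: "real^'d::finite \<Rightarrow> complex^'n::finite"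
  assumes f: "integrable lborel f" and k: "integrable lborel k"
  shows "(LINT \<xi>|lborel. FT f \<xi> \<bullet> k \<xi>) = (LINT x|lborel. f x \<bullet> FT k (- x))"
proof -
  have [measurable]: "f \<in> borel_measurable borel" "k \<in> borel_measurable borel" using f k by auto
  have inner: "(cis (- a) *s u) \<bullet> v = u \<bullet> (cis a *s v)" for a and u v :: "complex^'n"
    by (simp add: inner_vec_def inner_complex_def algebra_simps)
  have "(LINT \<xi>|lborel. FT f \<xi> \<bullet> k \<xi>) = (LINT \<xi>|lborel. LINT x|lborel. fourier_const TYPE('d) * ((cis (- (\<xi> \<bullet> x)) *s f x) \<bullet> k \<xi>))"
    unfolding FT_def using integrable_cis_scale[OF f]
    by (intro Bochner_Integration.integral_cong) auto
  also have "\<dots> = (LINT x|lborel. LINT \<xi>|lborel. fourier_const TYPE('d) * ((cis (- (\<xi> \<bullet> x)) *s f x) \<bullet> k \<xi>))"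
  proof (rule lborel_pair.Fubini_integral[symmetric])
    show "integrable (lborel \<Otimes>\<^sub>M lborel) (\<lambda>(\<xi>, x). fourier_const TYPE('d) * ((cis (- (\<xi> \<bullet> x)) *s f x) \<bullet> k \<xi>))"
    proof (rule integrable_pair_bound)
      show "integrable lborel (\<lambda>\<xi>. fourier_const TYPE('d) * norm (k \<xi>))" "integrable lborel (\<lambda>x. norm (f x))"
        using f k by auto
      show "norm (case (\<xi>, x) of (\<xi>, x) \<Rightarrow> fourier_const TYPE('d) * ((cis (- (\<xi> \<bullet> x)) *s f x) \<bullet> k \<xi>)) \<le>
          fourier_const TYPE('d) * norm (k \<xi>) * norm (f x)" for \<xi> x
        using Cauchy_Schwarz_ineq2[of "cis (- (\<xi> \<bullet> x)) *s f x" "k \<xi>"]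
        by (simp add: abs_mult mult.commute mult_left_mono mult.assoc)
    qed measurable
  qed
  also have "\<dots> = (LINT x|lborel. f x \<bullet> FT k (- x))"
    unfolding FT_def inner using integrable_cis_scale[OF k, of "\<lambda>\<xi>. \<xi> \<bullet> _"]
    by (intro Bochner_Integration.integral_cong) (auto simp: inner_commute)
  finally show ?thesis .
qed

lemma fourier_const_sq: "fourier_const TYPE('d::finite) * fourier_const TYPE('d) = inverse ((2 * pi) ^ CARD('d))"
  by (subst powr_add[symmetric]) (simp add: powr_minus powr_realpow)

text \<open>Inversion regularized by a Gaussian: the weight makes the double integral absolutely
  convergent, and its own transform is the heat kernel.\<close>

lemma FT_gauss_FT:
  fixes f :: "real^'d::finite \<Rightarrow> complex^'n::finite"
  assumes f: "integrable lborel f" and \<delta>: "\<delta> > 0"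
  shows "FT (\<lambda>\<xi>. gauss \<delta> \<xi> *\<^sub>R FT f \<xi>) (- x) = (LINT y|lborel. heat \<delta> (x - y) *\<^sub>R f y)"
proof -
  have [measurable]: "f \<in> borel_measurable borel" using f by auto
  let ?c = "fourier_const TYPE('d)"
  have inner: "cis (- ((- x) \<bullet> \<xi>)) *s (gauss \<delta> \<xi> *\<^sub>R FT f \<xi>) =
      (LINT y|lborel. ?c *\<^sub>R ((cis (\<xi> \<bullet> (x - y)) * of_real (gauss \<delta> \<xi>)) *s f y))" for \<xi>
  proof -
    have "(LINT y|lborel. ?c *\<^sub>R ((cis (\<xi> \<bullet> (x - y)) * of_real (gauss \<delta> \<xi>)) *s f y)) =
        (LINT y|lborel. ?c *\<^sub>R ((cis (\<xi> \<bullet> x) * of_real (gauss \<delta> \<xi>)) *s (cis (- (\<xi> \<bullet> y)) *s f y)))"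
    proof -
      have "cis (\<xi> \<bullet> (x - y)) = cis (\<xi> \<bullet> x) * cis (- (\<xi> \<bullet> y))" for y
        by (simp add: inner_diff_right cis_mult)
      then show ?thesis
        by (simp only: vector_smult_assoc mult_ac)
    qed
    also have "\<dots> = ?c *\<^sub>R ((cis (\<xi> \<bullet> x) * of_real (gauss \<delta> \<xi>)) *s (LINT y|lborel. cis (- (\<xi> \<bullet> y)) *s f y))"
      using integrable_cis_scale[OF f, of "\<lambda>y. - (\<xi> \<bullet> y)"]
      by (simp add: integral_bounded_linear[OF cvec.bounded_linear_right, symmetric])
    also have "\<dots> = cis (- ((- x) \<bullet> \<xi>)) *s (gauss \<delta> \<xi> *\<^sub>R FT f \<xi>)"
      by (simp add: FT_def vec_eq_iff inner_commute scaleR_conv_of_real[where 'a = complex] mult_ac)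
    finally show ?thesis ..
  qed
  have "FT (\<lambda>\<xi>. gauss \<delta> \<xi> *\<^sub>R FT f \<xi>) (- x) =
      ?c *\<^sub>R (LINT \<xi>|lborel. LINT y|lborel. ?c *\<^sub>R ((cis (\<xi> \<bullet> (x - y)) * of_real (gauss \<delta> \<xi>)) *s f y))"
    unfolding FT_def[of "\<lambda>\<xi>. gauss \<delta> \<xi> *\<^sub>R FT f \<xi>"] inner ..
  also have "(LINT \<xi>|lborel. LINT y|lborel. ?c *\<^sub>R ((cis (\<xi> \<bullet> (x - y)) * of_real (gauss \<delta> \<xi>)) *s f y)) =
      (LINT y|lborel. LINT \<xi>|lborel. ?c *\<^sub>R ((cis (\<xi> \<bullet> (x - y)) * of_real (gauss \<delta> \<xi>)) *s f y))"
  proof (rule lborel_pair.Fubini_integral[symmetric])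
    show "integrable (lborel \<Otimes>\<^sub>M lborel) (\<lambda>(\<xi>, y). ?c *\<^sub>R ((cis (\<xi> \<bullet> (x - y)) * of_real (gauss \<delta> \<xi>)) *s f y))"
    proof (rule integrable_pair_bound)
      show "integrable lborel (\<lambda>\<xi>::real^'d. ?c * gauss \<delta> \<xi>)" "integrable lborel (\<lambda>x. norm (f x))"
        using f gauss_integrable[OF \<delta>] by auto
      show "norm (case (\<xi>, y) of (\<xi>, y) \<Rightarrow> ?c *\<^sub>R ((cis (\<xi> \<bullet> (x - y)) * of_real (gauss \<delta> \<xi>)) *s f y)) \<le>
          ?c * gauss \<delta> \<xi> * norm (f y)" for \<xi> y
        using gauss_bounds(1)[of \<delta> \<xi>] by (simp add: norm_cvec_scale norm_mult)
    qed measurable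
  qed
  also have "\<dots> = (LINT y|lborel. ?c *\<^sub>R (complex_of_real ((2 * pi) ^ CARD('d) * heat \<delta> (x - y)) *s f y))"
  proof (rule Bochner_Integration.integral_cong)
    fix y
    have "(LINT \<xi>|lborel. (cis (\<xi> \<bullet> (x - y)) * of_real (gauss \<delta> \<xi>)) *s f y) =
        (LINT \<xi>|lborel. cis (\<xi> \<bullet> (x - y)) * of_real (gauss \<delta> \<xi>)) *s f y"
      by (rule integral_bounded_linear[OF cvec.bounded_linear_left gauss_fourier(1)[OF \<delta>]])
    then show "(LINT \<xi>|lborel. ?c *\<^sub>R ((cis (\<xi> \<bullet> (x - y)) * of_real (gauss \<delta> \<xi>)) *s f y)) =
        ?c *\<^sub>R (complex_of_real ((2 * pi) ^ CARD('d) * heat \<delta> (x - y)) *s f y)"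
      using gauss_fourier(2)[OF \<delta>, of "x - y"] by simp
  qed simp
  also have "?c *\<^sub>R \<dots> = (LINT y|lborel. heat \<delta> (x - y) *\<^sub>R f y)"
  proof -
    have c: "?c * (?c * ((2 * pi) ^ CARD('d) * h)) = h" for h
    proof -
      have "?c * (?c * ((2 * pi) ^ CARD('d) * h)) = (inverse ((2 * pi) ^ CARD('d)) * (2 * pi) ^ CARD('d)) * h"
        by (simp only: fourier_const_sq[where 'd = 'd, symmetric] mult.assoc)
      also have "inverse ((2 * pi) ^ CARD('d)) * (2 * pi) ^ CARD('d) = 1"
        by (rule left_inverse) simp
      finally show ?thesis by simp
    qed
    have of_real: "complex_of_real r *s v = r *\<^sub>R v" for r and v :: "complex^'n"
      by (simp add: vec_eq_iff scaleR_conv_of_real[where 'a = complex])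
    have "?c *\<^sub>R ?c *\<^sub>R (complex_of_real ((2 * pi) ^ CARD('d) * h) *s v) = h *\<^sub>R v" for h and v :: "complex^'n"
      by (simp only: of_real scaleR_scaleR c)
    then show ?thesis
      by (simp only: integral_scaleR_right[symmetric])
  qed
  finally show ?thesis .
qed

section \<open>The Fourier transform on square integrable functions\<close>

text \<open>For a nonintegrable function the left side is the default value zero.\<close>

lemma norm_integral_le_nn_integral:
  fixes f :: "'a \<Rightarrow> 'b::{banach, second_countable_topology}"
  shows "ennreal (norm (LINT x|M. f x)) \<le> (\<integral>\<^sup>+x. ennreal (norm (f x)) \<partial>M)"
proof (cases "integrable M f")
  case True
  then show ?thesis
    by (rule integral_norm_bound_ennreal)
qed (simp add: not_integrable_integral_eq)

lemma nn_integral_heat: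
  assumes \<delta>: "\<delta> > 0"
  shows "(\<integral>\<^sup>+y. ennreal (heat \<delta> (x - y)) \<partial>lborel) = 1" "(\<integral>\<^sup>+y. ennreal (heat \<delta> (y - x)) \<partial>lborel) = 1"
proof -
  have "(\<integral>\<^sup>+y. ennreal (heat \<delta> (y - x)) \<partial>lborel) = (\<integral>\<^sup>+y. ennreal (heat \<delta> (y :: 'a)) \<partial>lborel)"
    by (rule nn_integral_lborel_shift) measurable
  also have "\<dots> = 1"
    using heat_integral[OF \<delta>, where 'a = 'a] by (subst nn_integral_eq_integral) (auto simp: heat_nonneg)
  finally show "(\<integral>\<^sup>+y. ennreal (heat \<delta> (y - x)) \<partial>lborel) = 1" .
  then show "(\<integral>\<^sup>+y. ennreal (heat \<delta> (x - y)) \<partial>lborel) = 1"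
    by (simp add: heat_minus(2)[of \<delta> x])
qed

text \<open>By the adjoint formula the left side is the pairing of f with its heat convolution. It
  is estimated by 2 |f(x)| |f(y)| \<le> |f(x)|^2 + |f(y)|^2, the kernel having integral one in each
  variable.\<close>

lemma sq_norm_gauss_FT:
  fixes f :: "real^'d::finite \<Rightarrow> complex^'n::finite"
  assumes f: "integrable lborel f" and \<delta>: "\<delta> > 0"
  shows "(\<integral>\<^sup>+\<xi>. ennreal (gauss \<delta> \<xi> * (norm (FT f \<xi>))\<^sup>2) \<partial>lborel) \<le> sq_norm f"
proof -
  have [measurable]: "f \<in> borel_measurable borel" using f by auto
  note [measurable] = FT_measurable[OF f]
  let ?k = "\<lambda>\<xi>. gauss \<delta> \<xi> *\<^sub>R FT f \<xi>"
  define M where "M = fourier_const TYPE('d) * (LINT x|lborel. norm (f x))"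
  have M: "norm (FT f \<xi>) \<le> M" for \<xi>
    unfolding M_def by (rule norm_FT_le)
  have k: "integrable lborel ?k"
    by (rule integrable_gauss_FT[OF f \<delta>])
  have eq: "FT f \<xi> \<bullet> ?k \<xi> = gauss \<delta> \<xi> * (norm (FT f \<xi>))\<^sup>2" for \<xi>
    by (simp add: power2_norm_eq_inner)
  have "integrable lborel (\<lambda>\<xi>. FT f \<xi> \<bullet> ?k \<xi>)"
  proof (rule Bochner_Integration.integrable_bound)
    show "integrable lborel (\<lambda>\<xi>. M * norm (?k \<xi>))"
      using k by (intro integrable_mult_right integrable_norm)
    show "AE \<xi> in lborel. norm (FT f \<xi> \<bullet> ?k \<xi>) \<le> norm (M * norm (?k \<xi>))"
    proof (rule AE_I2)
      fix \<xi>
      have "norm (FT f \<xi> \<bullet> ?k \<xi>) \<le> norm (FT f \<xi>) * norm (?k \<xi>)"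
        using Cauchy_Schwarz_ineq2[of "FT f \<xi>" "?k \<xi>"] by simp
      also have "\<dots> \<le> M * norm (?k \<xi>)"
        by (intro mult_right_mono M) simp
      also have "\<dots> \<le> norm (M * norm (?k \<xi>))"
        by simp
      finally show "norm (FT f \<xi> \<bullet> ?k \<xi>) \<le> norm (M * norm (?k \<xi>))" .
    qed
  qed measurable
  then have "(\<integral>\<^sup>+\<xi>. ennreal (gauss \<delta> \<xi> * (norm (FT f \<xi>))\<^sup>2) \<partial>lborel) = ennreal (LINT \<xi>|lborel. FT f \<xi> \<bullet> ?k \<xi>)"
    unfolding eq[symmetric]
    by (intro nn_integral_eq_integral AE_I2) (simp_all add: eq gauss_bounds(1) less_imp_le)
  also have "\<dots> = ennreal (LINT x|lborel. f x \<bullet> (LINT y|lborel. heat \<delta> (x - y) *\<^sub>R f y))"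
    by (simp only: FT_adjoint[OF f k] FT_gauss_FT[OF f \<delta>])
  also have "\<dots> \<le> (\<integral>\<^sup>+x. ennreal (norm (f x \<bullet> (LINT y|lborel. heat \<delta> (x - y) *\<^sub>R f y))) \<partial>lborel)"
    by (rule order_trans[OF ennreal_leI norm_integral_le_nn_integral]) simp
  also have "\<dots> \<le> (\<integral>\<^sup>+x. \<integral>\<^sup>+y. ennreal (heat \<delta> (x - y)) * ennreal ((norm (f x))\<^sup>2 / 2) +
      ennreal (heat \<delta> (x - y)) * ennreal ((norm (f y))\<^sup>2 / 2) \<partial>lborel \<partial>lborel)"
  proof (rule nn_integral_mono)
    fix x
    have "ennreal (norm (f x \<bullet> (LINT y|lborel. heat \<delta> (x - y) *\<^sub>R f y))) \<le>
        ennreal (norm (f x)) * ennreal (norm (LINT y|lborel. heat \<delta> (x - y) *\<^sub>R f y))"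
      using Cauchy_Schwarz_ineq2[of "f x"] by (simp add: ennreal_mult[symmetric] ennreal_leI)
    also have "\<dots> \<le> ennreal (norm (f x)) * (\<integral>\<^sup>+y. ennreal (norm (heat \<delta> (x - y) *\<^sub>R f y)) \<partial>lborel)"
    proof (rule mult_left_mono)
      show "ennreal (norm (LINT y|lborel. heat \<delta> (x - y) *\<^sub>R f y)) \<le> (\<integral>\<^sup>+y. ennreal (norm (heat \<delta> (x - y) *\<^sub>R f y)) \<partial>lborel)"
        by (rule norm_integral_le_nn_integral)
    qed simp
    also have "\<dots> = (\<integral>\<^sup>+y. ennreal (norm (f x)) * ennreal (norm (heat \<delta> (x - y) *\<^sub>R f y)) \<partial>lborel)"
      by (rule nn_integral_cmult[symmetric]) measurable
    also have "\<dots> \<le> (\<integral>\<^sup>+y. ennreal (heat \<delta> (x - y)) * ennreal ((norm (f x))\<^sup>2 / 2) +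
        ennreal (heat \<delta> (x - y)) * ennreal ((norm (f y))\<^sup>2 / 2) \<partial>lborel)"
    proof (rule nn_integral_mono)
      fix y
      have "norm (f x) * norm (f y) \<le> (norm (f x))\<^sup>2 / 2 + (norm (f y))\<^sup>2 / 2"
        using sum_squares_bound[of "norm (f x)" "norm (f y)"] by simp
      then have "heat \<delta> (x - y) * (norm (f x) * norm (f y)) \<le> heat \<delta> (x - y) * ((norm (f x))\<^sup>2 / 2 + (norm (f y))\<^sup>2 / 2)"
        by (rule mult_left_mono) (rule heat_nonneg)
      then have "norm (f x) * norm (heat \<delta> (x - y) *\<^sub>R f y) \<le>
          heat \<delta> (x - y) * ((norm (f x))\<^sup>2 / 2) + heat \<delta> (x - y) * ((norm (f y))\<^sup>2 / 2)"
        by (simp only: norm_scaleR abs_of_nonneg[OF heat_nonneg] distrib_left mult.left_commute)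
      then have "ennreal (norm (f x) * norm (heat \<delta> (x - y) *\<^sub>R f y)) \<le>
          ennreal (heat \<delta> (x - y) * ((norm (f x))\<^sup>2 / 2) + heat \<delta> (x - y) * ((norm (f y))\<^sup>2 / 2))"
        by (rule ennreal_leI)
      then show "ennreal (norm (f x)) * ennreal (norm (heat \<delta> (x - y) *\<^sub>R f y)) \<le>
          ennreal (heat \<delta> (x - y)) * ennreal ((norm (f x))\<^sup>2 / 2) + ennreal (heat \<delta> (x - y)) * ennreal ((norm (f y))\<^sup>2 / 2)"
        by (simp only: ennreal_mult[OF norm_ge_zero norm_ge_zero, symmetric]
            ennreal_mult[OF heat_nonneg divide_nonneg_pos[OF zero_le_power2 zero_less_numeral], symmetric]
            ennreal_plus[OF mult_nonneg_nonneg[OF heat_nonneg divide_nonneg_pos[OF zero_le_power2 zero_less_numeral]]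
              mult_nonneg_nonneg[OF heat_nonneg divide_nonneg_pos[OF zero_le_power2 zero_less_numeral]], symmetric])
    qed
    finally show "ennreal (norm (f x \<bullet> (LINT y|lborel. heat \<delta> (x - y) *\<^sub>R f y))) \<le>
        (\<integral>\<^sup>+y. ennreal (heat \<delta> (x - y)) * ennreal ((norm (f x))\<^sup>2 / 2) +
        ennreal (heat \<delta> (x - y)) * ennreal ((norm (f y))\<^sup>2 / 2) \<partial>lborel)" .
  qed
  also have "\<dots> = (\<integral>\<^sup>+x. (\<integral>\<^sup>+y. ennreal (heat \<delta> (x - y)) * ennreal ((norm (f x))\<^sup>2 / 2) \<partial>lborel) +
      (\<integral>\<^sup>+y. ennreal (heat \<delta> (x - y)) * ennreal ((norm (f y))\<^sup>2 / 2) \<partial>lborel) \<partial>lborel)"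
    by (intro nn_integral_cong nn_integral_add) measurable
  also have "\<dots> = (\<integral>\<^sup>+x. (\<integral>\<^sup>+y. ennreal (heat \<delta> (x - y)) * ennreal ((norm (f x))\<^sup>2 / 2) \<partial>lborel) \<partial>lborel) +
      (\<integral>\<^sup>+x. (\<integral>\<^sup>+y. ennreal (heat \<delta> (x - y)) * ennreal ((norm (f y))\<^sup>2 / 2) \<partial>lborel) \<partial>lborel)"
    by (rule nn_integral_add) measurable
  also have "(\<integral>\<^sup>+x. (\<integral>\<^sup>+y. ennreal (heat \<delta> (x - y)) * ennreal ((norm (f y))\<^sup>2 / 2) \<partial>lborel) \<partial>lborel) =
      (\<integral>\<^sup>+y. (\<integral>\<^sup>+x. ennreal (heat \<delta> (x - y)) * ennreal ((norm (f y))\<^sup>2 / 2) \<partial>lborel) \<partial>lborel)"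
    by (rule lborel_pair.Fubini'[symmetric]) measurable
  also have "(\<integral>\<^sup>+x. (\<integral>\<^sup>+y. ennreal (heat \<delta> (x - y)) * ennreal ((norm (f x))\<^sup>2 / 2) \<partial>lborel) \<partial>lborel) = (\<integral>\<^sup>+x. ennreal ((norm (f x))\<^sup>2 / 2) \<partial>lborel)"
    by (simp add: nn_integral_multc nn_integral_heat[OF \<delta>])
  also have "(\<integral>\<^sup>+y. (\<integral>\<^sup>+x. ennreal (heat \<delta> (x - y)) * ennreal ((norm (f y))\<^sup>2 / 2) \<partial>lborel) \<partial>lborel) = (\<integral>\<^sup>+x. ennreal ((norm (f x))\<^sup>2 / 2) \<partial>lborel)"
    by (simp add: nn_integral_multc nn_integral_heat[OF \<delta>])
  also have "(\<integral>\<^sup>+x. ennreal ((norm (f x))\<^sup>2 / 2) \<partial>lborel) + (\<integral>\<^sup>+x. ennreal ((norm (f x))\<^sup>2 / 2) \<partial>lborel) = sq_norm f"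
    unfolding sq_norm_def
    by (subst nn_integral_add[symmetric]) (auto intro!: nn_integral_cong simp: ennreal_plus[symmetric] simp del: ennreal_plus)
  finally show ?thesis .
qed

text \<open>The Gaussian weight is removed by Fatou's lemma. This is one half of Plancherel's
  theorem; the opposite control is obtained by applying the bound for transforms to the inverse
  transform.\<close>

lemma sq_norm_FT:
  fixes f :: "real^'d::finite \<Rightarrow> complex^'n::finite"
  assumes f: "integrable lborel f"
  shows "sq_norm (FT f) \<le> sq_norm f"
proof (rule fatou_sq_norm)
  note [measurable] = FT_measurable[OF f]
  \<comment> \<open>The square root, because the weight in \<open>sq_norm_gauss_FT\<close>
    multiplies the square.\<close>
  let ?u = "\<lambda>n \<xi>. sqrt (gauss (1 / real (Suc n)) \<xi>) *\<^sub>R FT f \<xi>"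
  show "?u n \<in> borel_measurable borel" for n
    by measurable
  have "(\<lambda>n. ?u n \<xi>) \<longlonglongrightarrow> sqrt 1 *\<^sub>R FT f \<xi>" for \<xi>
  proof -
    have "(\<lambda>n. exp (- (1 / real (Suc n)) * (norm \<xi>)\<^sup>2 / 2)) \<longlonglongrightarrow> exp (- 0 * (norm \<xi>)\<^sup>2 / 2)"
      by (intro tendsto_intros LIMSEQ_Suc[OF lim_1_over_n]) auto
    then have "(\<lambda>n. gauss (1 / real (Suc n)) \<xi>) \<longlonglongrightarrow> 1"
      by (simp add: gauss_def)
    then show ?thesis
      by (intro tendsto_intros)
  qed
  then show "AE \<xi> in lborel. (\<lambda>n. ?u n \<xi>) \<longlonglongrightarrow> FT f \<xi>"
    by simp
  have "sq_norm (?u n) \<le> sq_norm f" for n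
    using sq_norm_gauss_FT[OF f, of "1 / real (Suc n)"]
    by (simp add: sq_norm_def power_mult_distrib gauss_bounds(1) less_imp_le)
  then show "\<forall>\<^sub>F n in sequentially. sq_norm (?u n) \<le> sq_norm f"
    by simp
qed (rule FT_measurable[OF f])

subsection \<open>Truncation\<close>

definition trunc :: "real \<Rightarrow> ('a::euclidean_space \<Rightarrow> 'b::euclidean_space) \<Rightarrow> 'a \<Rightarrow> 'b" where
  "trunc R f x = indicator (cball 0 R) x *\<^sub>R f x"

lemma trunc_measurable [measurable]: "f \<in> borel_measurable borel \<Longrightarrow> trunc R f \<in> borel_measurable borel"
  unfolding trunc_def[abs_def] by (intro borel_measurable_scaleR borel_measurable_indicator) auto

lemma trunc_inside: "norm x \<le> R \<Longrightarrow> trunc R f x = f x"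
  by (simp add: trunc_def)

lemma norm_trunc_le: "norm (trunc R f x) \<le> norm (f x)"
  by (simp add: trunc_def indicator_def)

lemma square_integrable_trunc: "square_integrable f \<Longrightarrow> square_integrable (trunc R f)"
  by (rule square_integrable_bound[where C = 1]) (auto simp: norm_trunc_le)

lemma integrable_trunc:
  assumes "square_integrable f"
  shows "integrable lborel (trunc R f)"
proof (rule Bochner_Integration.integrable_bound)
  note [measurable] = square_integrable_measurable[OF assms]
  have "emeasure lborel (cball (0 :: 'a) R) < \<infinity>"
    by (rule emeasure_bounded_finite) simp
  then have "integrable lborel (indicator (cball (0 :: 'a) R) :: 'a \<Rightarrow> real)"
    by (intro integrable_real_indicator) auto
  then show "integrable lborel (\<lambda>x. indicator (cball 0 R) x + (norm (f x))\<^sup>2 :: real)"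
    using assms by (auto simp: square_integrable_def)
  have "norm (f x) \<le> 1 + (norm (f x))\<^sup>2" for x
    using sum_squares_bound[of 1 "norm (f x)"] norm_ge_zero[of "f x"] by (simp, linarith)
  then show "AE x in lborel. norm (trunc R f x) \<le> norm (indicator (cball 0 R) x + (norm (f x))\<^sup>2 :: real)"
    by (auto simp: trunc_def indicator_def)
qed (use assms in measurable)

lemma sq_norm_tail:
  fixes f :: "'a::euclidean_space \<Rightarrow> 'b::euclidean_space"
  assumes f: "square_integrable f"
  shows "((\<lambda>R. sq_norm (\<lambda>x. f x - trunc R f x)) \<longlongrightarrow> 0) at_top"
proof (rule tendsto_at_topI_sequentially)
  note [measurable] = square_integrable_measurable[OF f]
  fix X :: "nat \<Rightarrow> real" assume X: "filterlim X at_top sequentially"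
  show "(\<lambda>n. sq_norm (\<lambda>x. f x - trunc (X n) f x)) \<longlonglongrightarrow> 0"
  proof (rule sq_norm_tendsto_0[OF _ f])
    fix x :: 'a
    have "\<forall>\<^sub>F n in sequentially. norm x \<le> X n"
      using X by (simp add: filterlim_at_top)
    then show "(\<lambda>n. f x - trunc (X n) f x) \<longlonglongrightarrow> 0"
      by (intro tendsto_eventually) (auto elim!: eventually_mono simp: trunc_inside)
  qed (auto simp: trunc_def indicator_def)
qed

lemma FT_trunc: "FT (trunc R f) = truncated_fourier R f"
  by (simp add: fun_eq_iff FT_def truncated_fourier_def trunc_def cvec.scaleR_right)

lemma is_fourier_iff:
  "is_fourier f g \<longleftrightarrow> square_integrable f \<and> square_integrable g \<and>
     ((\<lambda>R. sq_norm (\<lambda>\<xi>. FT (trunc R f) \<xi> - g \<xi>)) \<longlongrightarrow> 0) at_top"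
  by (simp add: is_fourier_def FT_trunc sq_norm_def)

text \<open>For R \<le> S the difference of the truncations is a part of the tail of f outside the
  ball of radius R.\<close>

lemma sq_norm_FT_trunc_diff:
  assumes f: "square_integrable f" and RS: "R \<le> S"
  shows "sq_norm (\<lambda>\<xi>. FT (trunc S f) \<xi> - FT (trunc R f) \<xi>) \<le> sq_norm (\<lambda>x. f x - trunc R f x)"
proof -
  have "sq_norm (\<lambda>\<xi>. FT (trunc S f) \<xi> - FT (trunc R f) \<xi>) = sq_norm (FT (\<lambda>x. trunc S f x - trunc R f x))"
    by (simp only: FT_diff_fun[OF integrable_trunc[OF f] integrable_trunc[OF f]])
  also have "\<dots> \<le> sq_norm (\<lambda>x. trunc S f x - trunc R f x)"
    by (intro sq_norm_FT Bochner_Integration.integrable_diff integrable_trunc f)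
  also have "\<dots> \<le> sq_norm (\<lambda>x. f x - trunc R f x)"
    using RS by (intro sq_norm_mono) (auto simp: trunc_def indicator_def)
  finally show ?thesis .
qed

lemma FT_trunc_measurable: "square_integrable f \<Longrightarrow> FT (trunc R f) \<in> borel_measurable borel"
  by (intro FT_measurable integrable_trunc)

lemma fourier_exists:
  fixes f :: "real^'d::finite \<Rightarrow> complex^'n::finite"
  assumes f: "square_integrable f"
  obtains g where "is_fourier f g"
proof -
  note [measurable] = square_integrable_measurable[OF f] FT_trunc_measurable[OF f]
  let ?T = "\<lambda>R. FT (trunc R f)"
  let ?\<tau> = "\<lambda>R. sq_norm (\<lambda>x. f x - trunc R f x)"
  note tail = sq_norm_tail[OF f]
  obtain g where g [measurable]: "g \<in> borel_measurable borel"
    and lim: "(\<lambda>n. sq_norm (\<lambda>\<xi>. ?T (real n) \<xi> - g \<xi>)) \<longlonglongrightarrow> 0"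
  proof (rule L2_complete[of "\<lambda>n. ?T (real n)"])
    fix e :: real assume e: "e > 0"
    have "(\<lambda>n. ?\<tau> (real n)) \<longlonglongrightarrow> 0"
      using filterlim_compose[OF tail filterlim_real_sequentially] .
    then have "\<forall>\<^sub>F n in sequentially. ?\<tau> (real n) < ennreal e"
      using e by (intro order_tendstoD(2)) auto
    then obtain N where N: "\<And>n. N \<le> n \<Longrightarrow> ?\<tau> (real n) < ennreal e"
      by (auto simp: eventually_sequentially)
    have "sq_norm (\<lambda>\<xi>. ?T (real m) \<xi> - ?T (real n) \<xi>) \<le> ennreal e" if "N \<le> m" "N \<le> n" for m n
    proof (cases "n \<le> m")
      case True
      then show ?thesis
        using sq_norm_FT_trunc_diff[OF f, of "real n" "real m"] N[OF that(2)] by auto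
    next
      case False
      then show ?thesis
        using sq_norm_FT_trunc_diff[OF f, of "real m" "real n"] N[OF that(1)]
        by (subst sq_norm_minus_commute) auto
    qed
    then show "\<exists>N. \<forall>m\<ge>N. \<forall>n\<ge>N. sq_norm (\<lambda>\<xi>. ?T (real m) \<xi> - ?T (real n) \<xi>) \<le> ennreal e"
      by blast
  qed auto
  \<comment> \<open>The limit was taken along the integers. Comparison of a real R with integers n
    \<ge> R, n tending to infinity, extends it to all R.\<close>
  have le: "sq_norm (\<lambda>\<xi>. ?T R \<xi> - g \<xi>) \<le> 2 * ?\<tau> R" for R
  proof (rule LIMSEQ_le_const)
    show "(\<lambda>n. 2 * ?\<tau> R + 2 * sq_norm (\<lambda>\<xi>. ?T (real n) \<xi> - g \<xi>)) \<longlonglongrightarrow> 2 * ?\<tau> R"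
      using tendsto_add[OF tendsto_const[of "2 * ?\<tau> R"] ennreal_tendsto_cmult[OF _ lim, of 2]] by simp
    have "sq_norm (\<lambda>\<xi>. ?T R \<xi> - g \<xi>) \<le> 2 * ?\<tau> R + 2 * sq_norm (\<lambda>\<xi>. ?T (real n) \<xi> - g \<xi>)" if "R \<le> real n" for n
    proof -
      have "sq_norm (\<lambda>\<xi>. ?T R \<xi> - g \<xi>) \<le> 2 * sq_norm (\<lambda>\<xi>. ?T R \<xi> - ?T (real n) \<xi>) + 2 * sq_norm (\<lambda>\<xi>. ?T (real n) \<xi> - g \<xi>)"
        by (rule sq_norm_triangle) measurable
      also have "sq_norm (\<lambda>\<xi>. ?T R \<xi> - ?T (real n) \<xi>) \<le> ?\<tau> R"
        using sq_norm_FT_trunc_diff[OF f that] by (subst sq_norm_minus_commute)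
      finally show ?thesis
        by (simp add: add_mono mult_left_mono)
    qed
    then show "\<exists>N. \<forall>n\<ge>N. sq_norm (\<lambda>\<xi>. ?T R \<xi> - g \<xi>) \<le> 2 * ?\<tau> R + 2 * sq_norm (\<lambda>\<xi>. ?T (real n) \<xi> - g \<xi>)"
      by (meson of_nat_le_iff order_trans real_nat_ceiling_ge)
  qed
  have "((\<lambda>R. 2 * ?\<tau> R) \<longlongrightarrow> 0) at_top"
    using ennreal_tendsto_cmult[OF _ tail, of 2] by simp
  then have conv: "((\<lambda>R. sq_norm (\<lambda>\<xi>. ?T R \<xi> - g \<xi>)) \<longlongrightarrow> 0) at_top"
    by (rule tendsto_sandwich[OF _ _ tendsto_const, rotated 2]) (auto simp: le)
  have "sq_norm g < \<infinity>"
  proof -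
    have "sq_norm g = sq_norm (\<lambda>\<xi>. ?T 0 \<xi> - (?T 0 \<xi> - g \<xi>))"
      by simp
    also have "\<dots> \<le> 2 * sq_norm (?T 0) + 2 * sq_norm (\<lambda>\<xi>. ?T 0 \<xi> - g \<xi>)"
      by (rule sq_norm_diff) measurable
    also have "\<dots> \<le> 2 * sq_norm f + 2 * (2 * ?\<tau> 0)"
      using le[of 0] order_trans[OF sq_norm_FT[OF integrable_trunc[OF f]] sq_norm_mono[OF norm_trunc_le]]
      by (intro add_mono mult_left_mono) auto
    also have "\<dots> < \<infinity>"
    proof -
      have "square_integrable (\<lambda>x. f x - trunc 0 f x)"
        by (intro square_integrable_diff f square_integrable_trunc)
      then show ?thesis
        using f by (simp add: square_integrable_iff ennreal_mult_less_top)
    qed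
    finally show ?thesis .
  qed
  then have "is_fourier f g"
    using f conv g by (simp add: is_fourier_iff square_integrable_iff)
  then show ?thesis
    by (rule that)
qed

lemma is_fourierD:
  assumes "is_fourier f g"
  shows "square_integrable f" "square_integrable g"
    "((\<lambda>R. sq_norm (\<lambda>\<xi>. FT (trunc R f) \<xi> - g \<xi>)) \<longlongrightarrow> 0) at_top"
  using assms by (auto simp: is_fourier_iff)

text \<open>Passing from truncations to the limit by \<open>sq_norm_diff\<close> costs the factor 2,
  which appears as sqrt 2 in the norms.\<close>

lemma is_fourier_bound:
  assumes "is_fourier f g"
  shows "sq_norm g \<le> 2 * sq_norm f"
proof -
  note f = is_fourierD(1)[OF assms]
  note [measurable] = is_fourierD(1,2)[OF assms, THEN square_integrable_measurable] FT_trunc_measurable[OF f]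
  let ?T = "\<lambda>R. FT (trunc R f)"
  have "sq_norm g \<le> 2 * sq_norm f + 2 * sq_norm (\<lambda>\<xi>. ?T R \<xi> - g \<xi>)" for R
  proof -
    have "sq_norm g = sq_norm (\<lambda>\<xi>. ?T R \<xi> - (?T R \<xi> - g \<xi>))"
      by simp
    also have "\<dots> \<le> 2 * sq_norm (?T R) + 2 * sq_norm (\<lambda>\<xi>. ?T R \<xi> - g \<xi>)"
      by (rule sq_norm_diff) measurable
    also have "\<dots> \<le> 2 * sq_norm f + 2 * sq_norm (\<lambda>\<xi>. ?T R \<xi> - g \<xi>)"
      using order_trans[OF sq_norm_FT[OF integrable_trunc[OF f]] sq_norm_mono[OF norm_trunc_le]]
      by (intro add_mono mult_left_mono) auto
    finally show ?thesis .
  qed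
  moreover have "((\<lambda>R. 2 * sq_norm f + 2 * sq_norm (\<lambda>\<xi>. ?T R \<xi> - g \<xi>)) \<longlongrightarrow> 2 * sq_norm f + 2 * 0) at_top"
    by (intro tendsto_add tendsto_const ennreal_tendsto_cmult is_fourierD(3)[OF assms]) simp
  ultimately show ?thesis
    by (intro tendsto_lowerbound[of "\<lambda>R. 2 * sq_norm f + 2 * sq_norm (\<lambda>\<xi>. ?T R \<xi> - g \<xi>)" _ at_top]) auto
qed

lemma is_fourier_diff:
  assumes "is_fourier f g" "is_fourier f' g'"
  shows "is_fourier (\<lambda>x. f x - f' x) (\<lambda>\<xi>. g \<xi> - g' \<xi>)"
proof -
  note f = is_fourierD(1)[OF assms(1)] is_fourierD(1)[OF assms(2)]
  note [measurable] = is_fourierD(2)[OF assms(1), THEN square_integrable_measurable]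
    is_fourierD(2)[OF assms(2), THEN square_integrable_measurable] FT_trunc_measurable[OF f(1)] FT_trunc_measurable[OF f(2)]
  have tr: "trunc R (\<lambda>x. f x - f' x) = (\<lambda>x. trunc R f x - trunc R f' x)" for R
    by (simp add: trunc_def fun_eq_iff scaleR_diff_right)
  have "sq_norm (\<lambda>\<xi>. FT (trunc R (\<lambda>x. f x - f' x)) \<xi> - (g \<xi> - g' \<xi>)) \<le>
      2 * sq_norm (\<lambda>\<xi>. FT (trunc R f) \<xi> - g \<xi>) + 2 * sq_norm (\<lambda>\<xi>. FT (trunc R f') \<xi> - g' \<xi>)" for R
    using sq_norm_diff[of "\<lambda>\<xi>. FT (trunc R f) \<xi> - g \<xi>" "\<lambda>\<xi>. FT (trunc R f') \<xi> - g' \<xi>"]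
    unfolding tr by (simp add: FT_diff_fun[OF integrable_trunc[OF f(1)] integrable_trunc[OF f(2)]] algebra_simps)
  then have "((\<lambda>R. sq_norm (\<lambda>\<xi>. FT (trunc R (\<lambda>x. f x - f' x)) \<xi> - (g \<xi> - g' \<xi>))) \<longlongrightarrow> 0) at_top"
    by (intro tendsto_sandwich[OF _ _ tendsto_const
          tendsto_0_twice_sum[OF is_fourierD(3)[OF assms(1)] is_fourierD(3)[OF assms(2)]]]) auto
  then show ?thesis
    using is_fourierD(1,2)[OF assms(1)] is_fourierD(1,2)[OF assms(2)]
    by (simp add: is_fourier_iff square_integrable_diff)
qed

lemma is_fourier_cong:
  assumes "AE x in lborel. f x = f' x" "f' \<in> borel_measurable borel" "is_fourier f g"
  shows "is_fourier f' g"
proof -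
  note f = is_fourierD(1)[OF assms(3)]
  have f': "square_integrable f'"
    using f assms(2) sq_norm_cong_AE[OF assms(1)] by (simp add: square_integrable_iff)
  note [measurable] = square_integrable_measurable[OF f] assms(2)
  have "FT (trunc R f) = FT (trunc R f')" for R
    unfolding FT_def
  proof (intro ext arg_cong2[where f = "(*\<^sub>R)"] refl integral_cong_AE)
    fix \<xi> :: "real^'a"
    show "(\<lambda>x. cis (- (\<xi> \<bullet> x)) *s trunc R f x) \<in> borel_measurable lborel"
      "(\<lambda>x. cis (- (\<xi> \<bullet> x)) *s trunc R f' x) \<in> borel_measurable lborel"
      by measurable
    show "AE x in lborel. cis (- (\<xi> \<bullet> x)) *s trunc R f x = cis (- (\<xi> \<bullet> x)) *s trunc R f' x"
      using assms(1) by eventually_elim (simp add: trunc_def)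
  qed
  then show ?thesis
    using assms(3) f' by (simp add: is_fourier_iff)
qed

lemma is_fourier_cong_right:
  assumes "AE \<xi> in lborel. g \<xi> = g' \<xi>" "g' \<in> borel_measurable borel" "is_fourier f g"
  shows "is_fourier f g'"
proof -
  have "sq_norm (\<lambda>\<xi>. FT (trunc R f) \<xi> - g \<xi>) = sq_norm (\<lambda>\<xi>. FT (trunc R f) \<xi> - g' \<xi>)" for R
    using assms(1) by (intro sq_norm_cong_AE) (auto elim!: eventually_mono)
  then show ?thesis
    using assms sq_norm_cong_AE[OF assms(1)] by (simp add: is_fourier_iff square_integrable_iff)
qed

lemma is_fourier_FT:
  assumes f: "square_integrable f" "integrable lborel f"
  shows "is_fourier f (FT f)"
proof -
  have "sq_norm (\<lambda>\<xi>. FT (trunc R f) \<xi> - FT f \<xi>) \<le> sq_norm (\<lambda>x. f x - trunc R f x)" for R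
    using sq_norm_FT[OF Bochner_Integration.integrable_diff[OF f(2) integrable_trunc[OF f(1)]], of R]
    by (subst sq_norm_minus_commute) (simp only: FT_diff_fun[OF f(2) integrable_trunc[OF f(1)]])
  then have "((\<lambda>R. sq_norm (\<lambda>\<xi>. FT (trunc R f) \<xi> - FT f \<xi>)) \<longlongrightarrow> 0) at_top"
    by (intro tendsto_sandwich[OF _ _ tendsto_const sq_norm_tail[OF f(1)]]) auto
  moreover have "square_integrable (FT f)"
    using sq_norm_FT[OF f(2)] f FT_measurable[OF f(2)] by (auto simp: square_integrable_iff intro: le_less_trans)
  ultimately show ?thesis
    using f by (simp add: is_fourier_iff)
qed

lemma is_fourier_fourier:
  assumes "square_integrable f"
  shows "is_fourier f (fourier f)"
  unfolding fourier_def using fourier_exists[OF assms] by (metis someI)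

text \<open>The equality is literal: functions that agree almost everywhere have the same set of
  transforms, and the choice operator selects the same element of it.\<close>

lemma fourier_cong:
  assumes "AE x in lborel. f x = f' x" "f \<in> borel_measurable borel" "f' \<in> borel_measurable borel"
  shows "fourier f = fourier f'"
proof -
  have "is_fourier f g \<longleftrightarrow> is_fourier f' g" for g
    using is_fourier_cong[of f f' g] is_fourier_cong[of f' f g] assms by (auto simp: eq_commute)
  then show ?thesis
    by (simp add: fourier_def)
qed

section \<open>Fourier inversion\<close>

lemma square_integrable_reflect:
  assumes "square_integrable f"
  shows "square_integrable (\<lambda>x. f (- x))"
proof -
  note [measurable] = square_integrable_measurable[OF assms]
  have "(\<lambda>x. f (- x)) \<in> borel_measurable borel"
    by measurable
  then show ?thesis
    using assms by (simp add: square_integrable_iff sq_norm_reflect)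
qed

text \<open>Boxes generate the Borel sets and are stable under intersection, so vanishing of the
  integrals passes from boxes to all Borel sets.\<close>

lemma AE_zero_of_box_integrals:
  fixes u :: "'a::euclidean_space \<Rightarrow> real"
  assumes loc: "\<And>a b. integrable lborel (\<lambda>x. indicator (box a b) x * u x)"
    and zero: "\<And>a b. (LINT x|lborel. indicator (box a b) x * u x) = 0"
  shows "AE x in lborel. u x = 0"
proof -
  \<comment> \<open>First on a fixed box, where u is integrable; countably many boxes exhaust the
    space at the end.\<close>
  have on_box: "AE x in lborel. indicator (box a b) x * u x = (0::real)" for a b
  proof (rule density_unique_real)
    define v where "v x = indicator (box a b) x * u x" for x
    have v: "integrable lborel v"
      unfolding v_def by (rule loc)
    show "integrable lborel (\<lambda>x. indicator (box a b) x * u x)" "integrable lborel (\<lambda>_::'a. 0::real)"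
      by (auto intro: loc)
    fix A :: "'a set" assume "A \<in> sets lborel"
    then have "A \<in> sigma_sets UNIV (range (\<lambda>(a, b). box a b))"
      by (simp add: borel_eq_box)
    then have "(LINT x:A|lborel. v x) = 0"
    \<comment> \<open>Complements use that the integral of v over the whole space is zero, countable
      disjoint unions use that v is integrable.\<close>
    proof (induction rule: sigma_sets_induct_disjoint[rotated 2, consumes 1])
      show "Int_stable (range (\<lambda>(a, b). box a b :: 'a set))"
        unfolding Int_stable_def by (auto simp: box_Int_box)
      show "range (\<lambda>(a, b). box a b :: 'a set) \<subseteq> Pow UNIV"
        by simp
    next
      fix B assume "B \<in> range (\<lambda>(a, b). box a b :: 'a set)"
      then obtain c d where B: "B = box c d" by auto
      obtain e f where ef: "box c d \<inter> box a b = box e f"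
        by (auto simp: box_Int_box)
      have "(LINT x:B|lborel. v x) = (LINT x|lborel. indicator (box e f) x * u x)"
        unfolding set_lebesgue_integral_def v_def B ef[symmetric]
        by (intro Bochner_Integration.integral_cong) (auto simp: indicator_def)
      then show "(LINT x:B|lborel. v x) = 0"
        by (simp add: zero)
    next
      show "(LINT x:{}|lborel. v x) = 0"
        by (simp add: set_lebesgue_integral_def)
    next
      fix B assume "B \<in> sigma_sets UNIV (range (\<lambda>(a, b). box a b :: 'a set))" and B0: "(LINT x:B|lborel. v x) = 0"
      then have B: "B \<in> sets borel"
        by (simp add: borel_eq_box)
      have "(LINT x:UNIV - B|lborel. v x) = (LINT x|lborel. v x - indicator B x *\<^sub>R v x)"
        unfolding set_lebesgue_integral_def
        by (intro Bochner_Integration.integral_cong) (auto simp: indicator_def)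
      also have "\<dots> = (LINT x|lborel. v x) - (LINT x:B|lborel. v x)"
        unfolding set_lebesgue_integral_def
        using B by (intro Bochner_Integration.integral_diff v integrable_mult_indicator) auto
      also have "\<dots> = 0"
        using B0 zero[of a b] by (simp add: v_def)
      finally show "(LINT x:UNIV - B|lborel. v x) = 0" .
    next
      fix B :: "nat \<Rightarrow> 'a set"
      assume disj: "disjoint_family B" and "range B \<subseteq> sigma_sets UNIV (range (\<lambda>(a, b). box a b :: 'a set))"
        and B0: "\<And>i. (LINT x:B i|lborel. v x) = 0"
      then have B: "B i \<in> sets lborel" for i
        by (auto simp: borel_eq_box)
      have "(LINT x:(\<Union>i. B i)|lborel. v x) = (\<Sum>i. (LINT x:B i|lborel. v x))"
      proof (rule lebesgue_integral_countable_add[OF B])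
        show "i \<noteq> j \<Longrightarrow> B i \<inter> B j = {}" for i j
          using disj by (auto simp: disjoint_family_on_def)
        show "set_integrable lborel (\<Union>i. B i) v"
          unfolding set_integrable_def using B by (intro integrable_mult_indicator v) auto
      qed
      then show "(LINT x:(\<Union>i. B i)|lborel. v x) = 0"
        using B0 by simp
    qed
    then show "(LINT x:A|lborel. indicator (box a b) x * u x) = (LINT x:A|lborel. 0)"
      by (simp add: v_def)
  qed
  have "AE x in lborel. \<forall>n::nat. indicator (box (- (real n *\<^sub>R One)) (real n *\<^sub>R One)) x * u x = (0::real)"
    unfolding AE_all_countable using on_box by blast
  then show ?thesis
  proof eventually_elim
    fix x assume all: "\<forall>n::nat. indicator (box (- (real n *\<^sub>R One)) (real n *\<^sub>R One)) x * u x = (0::real)"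
    obtain n :: nat where n: "norm x < real n"
      using reals_Archimedean2 by blast
    have "x \<in> box (- (real n *\<^sub>R One)) (real n *\<^sub>R One)"
    proof -
      have "\<bar>x \<bullet> i\<bar> < real n" if "i \<in> Basis" for i
        using Basis_le_norm[OF that, of x] n by simp
      then show ?thesis
        by (auto simp: mem_box abs_less_iff) fastforce
    qed
    then show "u x = 0"
      using all[rule_format, of n] by simp
  qed
qed

section \<open>Heat regularization tested against boxes\<close>

lemma heat_scale:
  assumes "\<delta> > 0"
  shows "sqrt \<delta> ^ DIM('a) * heat \<delta> (sqrt \<delta> *\<^sub>R z) = heat 1 (z :: 'a::euclidean_space)"
proof -
  have "(norm (sqrt \<delta> *\<^sub>R z))\<^sup>2 / (2 * \<delta>) = (norm z)\<^sup>2 / 2"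
    using assms by (simp add: power_mult_distrib)
  then have e: "- (norm (sqrt \<delta> *\<^sub>R z))\<^sup>2 / (2 * \<delta>) = - (norm z)\<^sup>2 / (2 * 1)"
    by (simp only: minus_divide_left[symmetric] mult_1_right)
  have 1: "sqrt \<delta> ^ DIM('a) = \<delta> powr (real DIM('a) / 2)"
    using assms by (rule sqrt_power_powr)
  have 2: "(2 * pi * \<delta>) powr (- real DIM('a) / 2) = (2 * pi) powr (- real DIM('a) / 2) * \<delta> powr (- real DIM('a) / 2)"
    using assms by (simp add: powr_mult)
  have 3: "\<delta> powr (real DIM('a) / 2) * \<delta> powr (- real DIM('a) / 2) = 1"
    using assms by (simp flip: powr_add)
  have "sqrt \<delta> ^ DIM('a) * (2 * pi * \<delta>) powr (- real DIM('a) / 2) =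
      (2 * pi) powr (- real DIM('a) / 2) * (\<delta> powr (real DIM('a) / 2) * \<delta> powr (- real DIM('a) / 2))"
    unfolding 1 2 by (rule mult.left_commute)
  then have "sqrt \<delta> ^ DIM('a) * (2 * pi * \<delta>) powr (- real DIM('a) / 2) = (2 * pi * 1) powr (- real DIM('a) / 2)"
    by (simp only: 3 mult_1_right)
  then show ?thesis
    unfolding heat_def e by (simp only: mult.assoc[symmetric])
qed

text \<open>The heat convolution of the indicator of a box. It is bounded by one and tends to the
  indicator off the boundary.\<close>

definition box_heat :: "'a::euclidean_space \<Rightarrow> 'a \<Rightarrow> real \<Rightarrow> 'a \<Rightarrow> real" where
  "box_heat a b \<delta> y = (LINT x|lborel. indicator (box a b) x * heat \<delta> (x - y))"

lemma box_heat_scaled: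
  assumes "\<delta> > 0"
  shows "box_heat a b \<delta> y = (LINT z|lborel. indicator (box a b) (y + sqrt \<delta> *\<^sub>R z) * heat 1 (z :: 'a::euclidean_space))"
proof -
  have "box_heat a b \<delta> y = \<bar>sqrt \<delta>\<bar> ^ DIM('a) *\<^sub>R
      (LINT z|lborel. indicator (box a b) (y + sqrt \<delta> *\<^sub>R z) * heat \<delta> (y + sqrt \<delta> *\<^sub>R z - y))"
    unfolding box_heat_def using assms by (intro integral_lborel_affine) simp
  also have "\<dots> = (LINT z|lborel. \<bar>sqrt \<delta>\<bar> ^ DIM('a) *\<^sub>R (indicator (box a b) (y + sqrt \<delta> *\<^sub>R z) * heat \<delta> (y + sqrt \<delta> *\<^sub>R z - y)))"
    by (rule integral_scaleR_right[symmetric])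
  also have "\<dots> = (LINT z|lborel. indicator (box a b) (y + sqrt \<delta> *\<^sub>R z) * heat 1 z)"
  proof (rule Bochner_Integration.integral_cong)
    fix z
    show "\<bar>sqrt \<delta>\<bar> ^ DIM('a) *\<^sub>R (indicator (box a b) (y + sqrt \<delta> *\<^sub>R z) * heat \<delta> (y + sqrt \<delta> *\<^sub>R z - y)) =
        indicator (box a b) (y + sqrt \<delta> *\<^sub>R z) * heat 1 z"
      using assms heat_scale[OF assms, of z] by (simp add: mult.left_commute)
  qed simp
  finally show ?thesis .
qed

lemma box_heat_bounds:
  assumes "\<delta> > 0"
  shows "\<bar>box_heat a b \<delta> (y::'a::euclidean_space)\<bar> \<le> 1"
proof -
  have "norm (box_heat a b \<delta> y) \<le> (LINT z|lborel. norm (indicator (box a b) (y + sqrt \<delta> *\<^sub>R z) * heat 1 z))"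
    unfolding box_heat_scaled[OF assms] by (rule integral_norm_bound)
  also have "\<dots> \<le> (LINT z|lborel. heat 1 (z::'a))"
  proof (rule Bochner_Integration.integral_mono)
    show "integrable lborel (heat 1 :: 'a \<Rightarrow> real)"
      by (simp add: heat_integral)
    then show "integrable lborel (\<lambda>z. norm (indicator (box a b) (y + sqrt \<delta> *\<^sub>R z) * heat 1 z))"
      by (rule Bochner_Integration.integrable_bound) (auto simp: heat_nonneg indicator_def)
  qed (auto simp: heat_nonneg indicator_def)
  finally show ?thesis
    by (simp add: heat_integral)
qed

lemma box_heat_tendsto:
  fixes y :: "'a::euclidean_space"
  assumes y: "y \<notin> cbox a b - box a b"
  shows "(\<lambda>n. box_heat a b (1 / real (Suc n)) y) \<longlonglongrightarrow> indicator (box a b) y"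
proof -
  have "(\<lambda>n. LINT z|lborel. indicator (box a b) (y + sqrt (1 / real (Suc n)) *\<^sub>R z) * heat 1 z) \<longlonglongrightarrow>
      (LINT z|lborel. indicator (box a b) y * heat 1 (z::'a))"
  proof (rule integral_dominated_convergence)
    show "integrable lborel (heat 1 :: 'a \<Rightarrow> real)"
      by (simp add: heat_integral)
    show "AE z in lborel. norm (indicator (box a b) (y + sqrt (1 / real (Suc n)) *\<^sub>R z) * heat 1 z) \<le> heat 1 z" for n
      by (auto simp: heat_nonneg indicator_def)
    \<comment> \<open>Off the boundary the indicator is locally constant, so its values along the
      sequence are eventually those at y.\<close>
    have "\<forall>\<^sub>F n in sequentially. indicator (box a b) (y + sqrt (1 / real (Suc n)) *\<^sub>R z) = (indicator (box a b) y :: real)" for z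
    proof -
      have "(\<lambda>n. y + sqrt (1 / real (Suc n)) *\<^sub>R z) \<longlonglongrightarrow> y + sqrt 0 *\<^sub>R z"
        by (intro tendsto_intros LIMSEQ_Suc[OF lim_1_over_n])
      then have lim: "(\<lambda>n. y + sqrt (1 / real (Suc n)) *\<^sub>R z) \<longlonglongrightarrow> y"
        by simp
      show ?thesis
      proof (cases "y \<in> box a b")
        case True
        have "\<forall>\<^sub>F n in sequentially. y + sqrt (1 / real (Suc n)) *\<^sub>R z \<in> box a b"
          by (rule topological_tendstoD[OF lim open_box True])
        then show ?thesis
          by eventually_elim (simp add: True)
      next
        case False
        then have "y \<in> - cbox a b"
          using y by simp
        then have "\<forall>\<^sub>F n in sequentially. y + sqrt (1 / real (Suc n)) *\<^sub>R z \<in> - cbox a b"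
          by (intro topological_tendstoD[OF lim]) (auto intro: closed_cbox)
        then show ?thesis
          by eventually_elim (use False box_subset_cbox[of a b] in \<open>auto simp: indicator_def\<close>)
      qed
    qed
    then have "(\<lambda>n. indicator (box a b) (y + sqrt (1 / real (Suc n)) *\<^sub>R z) * heat 1 z) \<longlonglongrightarrow> indicator (box a b) y * heat 1 z" for z
      by (intro tendsto_mult tendsto_const tendsto_eventually)
    then show "AE z in lborel. (\<lambda>n. indicator (box a b) (y + sqrt (1 / real (Suc n)) *\<^sub>R z) * heat 1 z) \<longlonglongrightarrow> indicator (box a b) y * heat 1 z"
      by simp
  qed measurable
  then show ?thesis
    by (simp add: box_heat_scaled heat_integral)
qed

text \<open>Fubini's theorem moves the convolution from f to the indicator of the box, where it
  converges boundedly; then |f| is an integrable majorant.\<close>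

lemma heat_box_integral_tendsto:
  fixes f :: "'a::euclidean_space \<Rightarrow> 'b::euclidean_space"
  assumes f: "integrable lborel f"
  shows "(\<lambda>n. LINT x|lborel. indicator (box a b) x *\<^sub>R (LINT y|lborel. heat (1 / real (Suc n)) (x - y) *\<^sub>R f y)) \<longlonglongrightarrow>
     (LINT x|lborel. indicator (box a b) x *\<^sub>R f x)"
proof -
  have [measurable]: "f \<in> borel_measurable borel" using f by auto
  have ind: "integrable lborel (indicator (box a b) :: 'a \<Rightarrow> real)"
    by (intro integrable_real_indicator) (auto simp: emeasure_lborel_box_eq)
  have "(LINT x|lborel. indicator (box a b) x *\<^sub>R (LINT y|lborel. heat \<delta> (x - y) *\<^sub>R f y)) =
      (LINT y|lborel. box_heat a b \<delta> y *\<^sub>R f y)" if \<delta>: "\<delta> > 0" for \<delta>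
  proof -
    let ?C = "(2 * pi * \<delta>) powr (- real DIM('a) / 2)"
    have C: "heat \<delta> z \<le> ?C" for z :: 'a
      unfolding heat_def using \<delta> by (intro mult_left_le) (auto simp: divide_nonneg_pos)
    have int: "integrable (lborel \<Otimes>\<^sub>M lborel) (\<lambda>(x, y). (indicator (box a b) x * heat \<delta> (x - y)) *\<^sub>R f y)"
    proof (rule integrable_pair_bound)
      show "integrable lborel (\<lambda>x. indicator (box a b) x * ?C)" "integrable lborel (\<lambda>y. norm (f y))"
        using ind f by auto
      show "norm (case (x, y) of (x, y) \<Rightarrow> (indicator (box a b) x * heat \<delta> (x - y)) *\<^sub>R f y) \<le>
          indicator (box a b) x * ?C * norm (f y)" for x y
        using C[of "x - y"] heat_nonneg[of \<delta> "x - y"] by (auto simp: indicator_def mult_right_mono)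
    qed measurable
    have "(LINT x|lborel. indicator (box a b) x *\<^sub>R (LINT y|lborel. heat \<delta> (x - y) *\<^sub>R f y)) =
        (LINT x|lborel. LINT y|lborel. (indicator (box a b) x * heat \<delta> (x - y)) *\<^sub>R f y)"
      by (simp add: scaleR_scaleR[symmetric] del: scaleR_scaleR)
    also have "\<dots> = (LINT y|lborel. LINT x|lborel. (indicator (box a b) x * heat \<delta> (x - y)) *\<^sub>R f y)"
      by (rule lborel_pair.Fubini_integral[OF int, symmetric])
    also have "\<dots> = (LINT y|lborel. box_heat a b \<delta> y *\<^sub>R f y)"
    proof (rule Bochner_Integration.integral_cong)
      fix y
      have "integrable lborel (\<lambda>x. indicator (box a b) x * heat \<delta> (x - y))"
      proof (rule Bochner_Integration.integrable_bound[OF integrable_mult_left[OF ind, of ?C]])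
        show "AE x in lborel. norm (indicator (box a b) x * heat \<delta> (x - y)) \<le> norm (indicator (box a b) x * ?C)"
        proof (rule AE_I2)
          fix x
          show "norm (indicator (box a b) x * heat \<delta> (x - y)) \<le> norm (indicator (box a b) x * ?C)"
            using C[of "x - y"] heat_nonneg[of \<delta> "x - y"] unfolding real_norm_def abs_mult
            by (intro mult_left_mono) auto
        qed
      qed measurable
      then show "(LINT x|lborel. (indicator (box a b) x * heat \<delta> (x - y)) *\<^sub>R f y) = box_heat a b \<delta> y *\<^sub>R f y"
        unfolding box_heat_def by (rule integral_scaleR_left)
    qed simp
    finally show ?thesis .
  qed
  moreover have "(\<lambda>n. LINT y|lborel. box_heat a b (1 / real (Suc n)) y *\<^sub>R f y) \<longlonglongrightarrow> (LINT x|lborel. indicator (box a b) x *\<^sub>R f x)"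
  proof (rule integral_dominated_convergence)
    have [measurable]: "box_heat a b \<delta> \<in> borel_measurable borel" for \<delta>
      unfolding box_heat_def by measurable
    show "(\<lambda>y. box_heat a b (1 / real (Suc n)) y *\<^sub>R f y) \<in> borel_measurable lborel" for n
      by measurable
    show "integrable lborel (\<lambda>y. norm (f y))" using f by simp
    show "AE y in lborel. norm (box_heat a b (1 / real (Suc n)) y *\<^sub>R f y) \<le> norm (f y)" for n
      using box_heat_bounds[of "1 / real (Suc n)" a b] by (auto intro!: mult_left_le_one_le)
    have "emeasure lborel (cbox a b - box a b) = 0"
      by (subst emeasure_Diff) (auto simp: emeasure_lborel_box_eq emeasure_lborel_cbox_eq box_subset_cbox)
    then have "AE y in lborel. y \<notin> cbox a b - box a b"
      by (intro AE_not_in) (auto simp: null_sets_def)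
    then show "AE y in lborel. (\<lambda>n. box_heat a b (1 / real (Suc n)) y *\<^sub>R f y) \<longlonglongrightarrow> indicator (box a b) y *\<^sub>R f y"
      by eventually_elim (intro tendsto_intros box_heat_tendsto)
  qed measurable
  ultimately show ?thesis
    by simp
qed

lemma norm_integral_scaleR_le:
  assumes "square_integrable \<psi>" "square_integrable u"
  shows "norm (LINT x|lborel. \<psi> x *\<^sub>R u x) \<le> L2_norm (\<psi> :: 'a::euclidean_space \<Rightarrow> real) * L2_norm u"
proof -
  have "norm (LINT x|lborel. \<psi> x *\<^sub>R u x) \<le> (LINT x|lborel. norm (\<psi> x) * norm (u x))"
    using integral_norm_bound[of lborel "\<lambda>x. \<psi> x *\<^sub>R u x"] by simp
  also have "\<dots> \<le> L2_norm \<psi> * L2_norm u"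
    by (rule cauchy_schwarz_L2[OF assms])
  finally show ?thesis .
qed

lemma integrable_scaleR_L2:
  assumes "square_integrable \<psi>" "square_integrable u"
  shows "integrable lborel (\<lambda>x. (\<psi> :: 'a::euclidean_space \<Rightarrow> real) x *\<^sub>R u x)"
proof -
  note [measurable] = assms[THEN square_integrable_measurable]
  show ?thesis
    by (rule Bochner_Integration.integrable_bound[OF integrable_norm_mult[OF assms]]) auto
qed

lemma L2_norm_tendsto_0:
  assumes "\<And>i. square_integrable (u i)" "((\<lambda>i. sq_norm (u i)) \<longlongrightarrow> 0) F"
  shows "((\<lambda>i. L2_norm (u i)) \<longlongrightarrow> 0) F"
proof -
  have "((\<lambda>i. ennreal ((L2_norm (u i))\<^sup>2)) \<longlongrightarrow> ennreal 0) F"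
    using assms(2) by (simp add: sq_norm_L2_norm[OF assms(1)])
  then have "((\<lambda>i. (L2_norm (u i))\<^sup>2) \<longlongrightarrow> 0) F"
    by (subst (asm) tendsto_ennreal_iff) auto
  then have "((\<lambda>i. sqrt ((L2_norm (u i))\<^sup>2)) \<longlongrightarrow> sqrt 0) F"
    by (rule tendsto_real_sqrt)
  then show ?thesis
    by (simp add: L2_norm_nonneg)
qed

lemma L2_pairing_tendsto:
  assumes \<psi>: "square_integrable \<psi>" and u: "\<And>i. square_integrable (u i)" "square_integrable v"
    and lim: "((\<lambda>i. sq_norm (\<lambda>x. u i x - v x)) \<longlongrightarrow> 0) F"
  shows "((\<lambda>i. LINT x|lborel. (\<psi> :: 'a::euclidean_space \<Rightarrow> real) x *\<^sub>R u i x) \<longlongrightarrow> (LINT x|lborel. \<psi> x *\<^sub>R v x)) F"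
proof (rule LIM_zero_cancel, rule tendsto_norm_zero_cancel)
  have d: "square_integrable (\<lambda>x. u i x - v x)" for i
    by (rule square_integrable_diff[OF u])
  have "((\<lambda>i. L2_norm \<psi> * L2_norm (\<lambda>x. u i x - v x)) \<longlongrightarrow> L2_norm \<psi> * 0) F"
    by (intro tendsto_mult tendsto_const L2_norm_tendsto_0 d lim)
  then have up: "((\<lambda>i. L2_norm \<psi> * L2_norm (\<lambda>x. u i x - v x)) \<longlongrightarrow> 0) F"
    by simp
  have le: "norm ((LINT x|lborel. \<psi> x *\<^sub>R u i x) - (LINT x|lborel. \<psi> x *\<^sub>R v x)) \<le> L2_norm \<psi> * L2_norm (\<lambda>x. u i x - v x)" for i
    using norm_integral_scaleR_le[OF \<psi> d, of i] integrable_scaleR_L2[OF \<psi> u(1)] integrable_scaleR_L2[OF \<psi> u(2)]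
    by (simp add: scaleR_diff_right)
  show "((\<lambda>i. norm ((LINT x|lborel. \<psi> x *\<^sub>R u i x) - (LINT x|lborel. \<psi> x *\<^sub>R v x))) \<longlongrightarrow> 0) F"
    by (rule tendsto_sandwich[OF _ _ tendsto_const up]) (simp_all add: le)
qed

lemma square_integrable_indicator_box: "square_integrable (indicator (box a b) :: 'a::euclidean_space \<Rightarrow> real)"
proof -
  have "integrable lborel (indicator (box a b) :: 'a \<Rightarrow> real)"
    by (intro integrable_real_indicator) (auto simp: emeasure_lborel_box_eq)
  moreover have "(norm (indicator (box a b) x :: real))\<^sup>2 = indicator (box a b) x" for x :: 'a
    by (simp add: indicator_def)
  ultimately show ?thesis
    by (simp add: square_integrable_def)
qed

lemma AE_eq_of_box_integrals:
  fixes u v :: "'a::euclidean_space \<Rightarrow> 'b::euclidean_space"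
  assumes u: "square_integrable u" and v: "square_integrable v"
    and eq: "\<And>a b. (LINT x|lborel. indicator (box a b) x *\<^sub>R u x) = (LINT x|lborel. indicator (box a b) x *\<^sub>R v x)"
  shows "AE x in lborel. u x = v x"
proof -
  have int: "integrable lborel (\<lambda>x. indicator (box a b) x *\<^sub>R u x)" "integrable lborel (\<lambda>x. indicator (box a b) x *\<^sub>R v x)" for a b
    by (rule integrable_scaleR_L2[OF square_integrable_indicator_box u], rule integrable_scaleR_L2[OF square_integrable_indicator_box v])
  have "AE x in lborel. (u x - v x) \<bullet> i = 0" for i
  proof (rule AE_zero_of_box_integrals)
    fix a b :: 'a
    have e: "indicator (box a b) x * ((u x - v x) \<bullet> i) = (indicator (box a b) x *\<^sub>R u x) \<bullet> i - (indicator (box a b) x *\<^sub>R v x) \<bullet> i" for x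
      by (simp add: inner_diff_left algebra_simps)
    show "integrable lborel (\<lambda>x. indicator (box a b) x * ((u x - v x) \<bullet> i))"
      unfolding e by (intro Bochner_Integration.integrable_diff integrable_inner_left int)
    show "(LINT x|lborel. indicator (box a b) x * ((u x - v x) \<bullet> i)) = 0"
      unfolding e
      by (subst Bochner_Integration.integral_diff) (auto intro!: integrable_inner_left int simp: integral_inner_left[OF int(1)] integral_inner_left[OF int(2)] eq simp del: inner_scaleR_left)
  qed
  then have "AE x in lborel. \<forall>i\<in>Basis. (u x - v x) \<bullet> i = 0"
    by (intro AE_finite_allI) auto
  then show ?thesis
    by eventually_elim (simp add: euclidean_eq_iff[of "u _" "v _"] inner_diff_left)
qed

text \<open>The heat convolutions of f have two limits. They are the inverse transforms of Gaussian
  multiples of \<open>FT f\<close>, hence tend to h(- x) in mean square; and their integrals over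
  boxes tend to those of f. The box integrals identify the two limits.\<close>

lemma inversion_integrable:
  fixes f :: "real^'d::finite \<Rightarrow> complex^'n::finite"
  assumes f: "square_integrable f" "integrable lborel f" and h: "is_fourier (FT f) h"
  shows "AE x in lborel. h (- x) = f x"
proof -
  let ?\<delta> = "\<lambda>n. 1 / real (Suc n)"
  let ?k = "\<lambda>n \<xi>. gauss (?\<delta> n) \<xi> *\<^sub>R FT f \<xi>"
  let ?P = "\<lambda>n x. LINT y|lborel. heat (?\<delta> n) (x - y) *\<^sub>R f y"
  note g = is_fourierD(1)[OF h]
  note [measurable] = square_integrable_measurable[OF f(1)] FT_measurable[OF f(2)] is_fourierD(2)[OF h, THEN square_integrable_measurable]
  have k: "integrable lborel (?k n)" for n
    by (rule integrable_gauss_FT[OF f(2)]) simp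
  have k2: "square_integrable (?k n)" for n
  proof (rule square_integrable_bound[OF g, where C = 1])
    show "norm (?k n \<xi>) \<le> 1 * norm (FT f \<xi>)" for \<xi>
      using gauss_bounds(1)[of "?\<delta> n" \<xi>] gauss_bounds(2)[of "?\<delta> n" \<xi>]
      unfolding norm_scaleR by (intro mult_right_mono) auto
  qed measurable
  have FTk: "FT (?k n) (- x) = ?P n x" for n x
    by (rule FT_gauss_FT[OF f(2)]) simp
  have "(\<lambda>n. sq_norm (\<lambda>\<xi>. ?k n \<xi> - FT f \<xi>)) \<longlonglongrightarrow> 0"
  proof (rule sq_norm_tendsto_0[OF _ g])
    show "(\<lambda>n. ?k n \<xi> - FT f \<xi>) \<longlonglongrightarrow> 0" for \<xi>
    proof -
      have "(\<lambda>n. exp (- ?\<delta> n * (norm \<xi>)\<^sup>2 / 2) *\<^sub>R FT f \<xi> - FT f \<xi>) \<longlonglongrightarrow> exp (- 0 * (norm \<xi>)\<^sup>2 / 2) *\<^sub>R FT f \<xi> - FT f \<xi>"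
        by (intro tendsto_intros LIMSEQ_Suc[OF lim_1_over_n]) auto
      then show ?thesis
        by (simp add: gauss_def)
    qed
    show "norm (?k n \<xi> - FT f \<xi>) \<le> norm (FT f \<xi>)" for n \<xi>
    proof -
      have "?k n \<xi> - FT f \<xi> = (gauss (?\<delta> n) \<xi> - 1) *\<^sub>R FT f \<xi>"
        by (simp add: scaleR_diff_left)
      moreover have "\<bar>gauss (?\<delta> n) \<xi> - 1\<bar> \<le> 1"
        using gauss_bounds[of "?\<delta> n" \<xi>] by auto
      ultimately show ?thesis
        by (simp add: mult_left_le_one_le)
    qed
  qed measurable
  then have "(\<lambda>n. 2 * sq_norm (\<lambda>\<xi>. ?k n \<xi> - FT f \<xi>)) \<longlonglongrightarrow> 2 * 0"
    by (intro ennreal_tendsto_cmult) auto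
  then have up: "(\<lambda>n. 2 * sq_norm (\<lambda>\<xi>. ?k n \<xi> - FT f \<xi>)) \<longlonglongrightarrow> 0"
    by simp
  have le: "sq_norm (\<lambda>x. ?P n x - h (- x)) \<le> 2 * sq_norm (\<lambda>\<xi>. ?k n \<xi> - FT f \<xi>)" for n
  proof -
    note [measurable] = FT_measurable[OF k]
    have "sq_norm (\<lambda>x. ?P n x - h (- x)) = sq_norm (\<lambda>x. FT (?k n) x - h x)"
      unfolding FTk[symmetric] by (rule sq_norm_reflect[of "\<lambda>x. FT (?k n) x - h x"]) measurable
    also have "\<dots> \<le> 2 * sq_norm (\<lambda>\<xi>. ?k n \<xi> - FT f \<xi>)"
      by (rule is_fourier_bound[OF is_fourier_diff[OF is_fourier_FT[OF k2 k] h]])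
    finally show ?thesis .
  qed
  have lim: "(\<lambda>n. sq_norm (\<lambda>x. ?P n x - h (- x))) \<longlonglongrightarrow> 0"
    by (rule tendsto_sandwich[OF always_eventually[OF allI] always_eventually[OF allI] tendsto_const up])
      (rule zero_le le)+
  have h2: "square_integrable (\<lambda>x. h (- x))"
    by (rule square_integrable_reflect[OF is_fourierD(2)[OF h]])
  have P2: "square_integrable (?P n)" for n
  proof -
    have "square_integrable (FT (?k n))"
      by (rule is_fourierD(2)[OF is_fourier_FT[OF k2 k]])
    then have "square_integrable (\<lambda>x. FT (?k n) (- x))"
      by (rule square_integrable_reflect)
    then show ?thesis
      unfolding FTk .
  qed
  show ?thesis
  proof (rule AE_eq_of_box_integrals[OF h2 f(1)])
    fix a b :: "real^'d"
    show "(LINT x|lborel. indicator (box a b) x *\<^sub>R h (- x)) = (LINT x|lborel. indicator (box a b) x *\<^sub>R f x)"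
      by (rule LIMSEQ_unique[OF L2_pairing_tendsto[OF square_integrable_indicator_box P2 h2 lim]
            heat_box_integral_tendsto[OF f(2)]])
  qed
qed

text \<open>Truncations are integrable, so they can be inverted; the general case follows by
  approximation, as transforms in both directions are bounded.\<close>

lemma fourier_inversion:
  fixes f :: "real^'d::finite \<Rightarrow> complex^'n::finite"
  assumes fg: "is_fourier f g"
  shows "is_fourier g (\<lambda>x. f (- x))"
proof -
  note f = is_fourierD(1)[OF fg] and g = is_fourierD(2)[OF fg]
  obtain h where h: "is_fourier g h"
    using fourier_exists[OF g] by blast
  note [measurable] = square_integrable_measurable[OF f] square_integrable_measurable[OF g]
    is_fourierD(2)[OF h, THEN square_integrable_measurable] FT_trunc_measurable[OF f]
  let ?r = "\<lambda>R x. trunc R f (- x)"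
  have tr: "is_fourier (FT (trunc R f)) (?r R)" for R
  proof -
    have tf: "is_fourier (trunc R f) (FT (trunc R f))"
      by (intro is_fourier_FT square_integrable_trunc integrable_trunc f)
    obtain k where k: "is_fourier (FT (trunc R f)) k"
      using fourier_exists[OF is_fourierD(2)[OF tf]] by blast
    have "AE x in lborel. k (- x) = trunc R f x"
      by (rule inversion_integrable[OF square_integrable_trunc[OF f] integrable_trunc[OF f] k])
    then have "sq_norm (\<lambda>x. k (- x) - trunc R f x) = 0"
      using is_fourierD(2)[OF k, THEN square_integrable_measurable]
      by (subst sq_norm_eq_0) (auto elim: eventually_mono)
    then have "sq_norm (\<lambda>x. k x - ?r R x) = 0"
      using sq_norm_reflect[of "\<lambda>x. k (- x) - trunc R f x"] is_fourierD(2)[OF k, THEN square_integrable_measurable] by simp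
    then have "AE x in lborel. k x = ?r R x"
      using is_fourierD(2)[OF k, THEN square_integrable_measurable]
      by (subst (asm) sq_norm_eq_0) (auto elim: eventually_mono)
    then show ?thesis
      using is_fourier_cong_right[OF _ _ k] by simp
  qed
  \<comment> \<open>The left side does not depend on R, while both terms on the right vanish as R
    tends to infinity.\<close>
  have "sq_norm (\<lambda>x. h x - f (- x)) \<le>
      2 * (2 * sq_norm (\<lambda>\<xi>. FT (trunc R f) \<xi> - g \<xi>)) + 2 * sq_norm (\<lambda>x. f x - trunc R f x)" for R
  proof -
    have "sq_norm (\<lambda>x. h x - f (- x)) \<le> 2 * sq_norm (\<lambda>x. h x - ?r R x) + 2 * sq_norm (\<lambda>x. ?r R x - f (- x))"
      by (rule sq_norm_triangle) measurable
    also have "sq_norm (\<lambda>x. h x - ?r R x) \<le> 2 * sq_norm (\<lambda>\<xi>. FT (trunc R f) \<xi> - g \<xi>)"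
      using is_fourier_bound[OF is_fourier_diff[OF tr h]] by (subst sq_norm_minus_commute)
    also have "sq_norm (\<lambda>x. ?r R x - f (- x)) = sq_norm (\<lambda>x. f x - trunc R f x)"
      using sq_norm_reflect[of "\<lambda>x. trunc R f x - f x"] by (simp add: sq_norm_minus_commute)
    finally show ?thesis
      by (simp add: add_mono mult_left_mono)
  qed
  moreover have "((\<lambda>R. 2 * (2 * sq_norm (\<lambda>\<xi>. FT (trunc R f) \<xi> - g \<xi>)) + 2 * sq_norm (\<lambda>x. f x - trunc R f x)) \<longlongrightarrow> 0) at_top"
    using ennreal_tendsto_cmult[OF _ is_fourierD(3)[OF fg], of 2]
    by (intro tendsto_0_twice_sum sq_norm_tail f) simp
  ultimately have "sq_norm (\<lambda>x. h x - f (- x)) \<le> 0"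
    by (intro tendsto_lowerbound) auto
  then have "AE x in lborel. h x = f (- x)"
    by (subst (asm) le_zero_eq, subst (asm) sq_norm_eq_0) (auto elim: eventually_mono)
  then show ?thesis
    using is_fourier_cong_right[OF _ _ h] by simp
qed

section \<open>Compactly supported functions\<close>

lemma compactly_supported_bounded:
  fixes f :: "'a::euclidean_space \<Rightarrow> 'b::euclidean_space"
  assumes f: "continuous_on UNIV f" and supp: "bounded {x. f x \<noteq> 0}"
  shows "\<exists>M\<ge>0. \<forall>x. norm (f x) \<le> M"
proof -
  obtain R where R: "\<And>x. f x \<noteq> 0 \<Longrightarrow> norm x \<le> R"
    using supp unfolding bounded_iff by blast
  have "compact (f ` cball 0 R)"
    by (intro compact_continuous_image continuous_on_subset[OF f]) auto
  then obtain M where M: "\<And>x. x \<in> cball 0 R \<Longrightarrow> norm (f x) \<le> M"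
    by (meson bounded_iff compact_imp_bounded imageI)
  have "norm (f x) \<le> max M 0" for x
    using M[of x] R[of x] by (cases "f x = 0") auto
  then show ?thesis
    by (intro exI[of _ "max M 0"]) auto
qed

lemma compactly_supported_integrable:
  fixes f :: "'a::euclidean_space \<Rightarrow> 'b::euclidean_space"
  assumes f: "continuous_on UNIV f" and supp: "bounded {x. f x \<noteq> 0}"
  shows "integrable lborel f"
proof -
  obtain R where R: "\<And>x. f x \<noteq> 0 \<Longrightarrow> norm x \<le> R"
    using supp unfolding bounded_iff by blast
  obtain M where M: "0 \<le> M" "\<And>x. norm (f x) \<le> M"
    using compactly_supported_bounded[OF assms] by blast
  have "emeasure lborel (cball (0 :: 'a) R) < \<infinity>"
    by (rule emeasure_bounded_finite) simp
  then have ind: "integrable lborel (\<lambda>x. indicator (cball (0 :: 'a) R) x * M)"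
    by (intro integrable_mult_left integrable_real_indicator) auto
  show ?thesis
  proof (rule Bochner_Integration.integrable_bound[OF ind])
    show "f \<in> borel_measurable lborel"
      using borel_measurable_continuous_onI[OF f] by simp
    show "AE x in lborel. norm (f x) \<le> norm (indicator (cball 0 R) x * M)"
      using M R by (intro AE_I2) (metis indicator_simps(1) abs_of_nonneg mem_cball_0 mult_1 norm_ge_zero norm_zero real_norm_def)
  qed
qed

lemma compactly_supported_square_integrable:
  fixes f :: "'a::euclidean_space \<Rightarrow> 'b::euclidean_space"
  assumes f: "continuous_on UNIV f" and supp: "bounded {x. f x \<noteq> 0}"
  shows "square_integrable f"
proof -
  have "integrable lborel (\<lambda>x. (norm (f x))\<^sup>2)"
    by (rule compactly_supported_integrable) (use assms in \<open>auto intro!: continuous_intros\<close>)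
  then show ?thesis
    using borel_measurable_continuous_onI[OF f] by (simp add: square_integrable_def)
qed

lemma derivative_support:
  assumes d: "\<And>x. (f has_derivative f' x) (at x)" and x: "x \<notin> closure {x. f x \<noteq> 0}"
  shows "f' x h = 0"
proof -
  have "((\<lambda>_. 0) has_derivative f' x) (at x)"
    by (rule has_derivative_transform_within_open[OF d, of "- closure {x. f x \<noteq> 0}"])
      (use x closure_subset[of "{x. f x \<noteq> 0}"] in auto)
  then have "f' x = (\<lambda>_. 0)"
    using has_derivative_unique has_derivative_const by blast
  then show ?thesis by simp
qed

text \<open>The test functions in x alone. Boundedness of the set where \<psi> is nonzero means that
  its closure is compact.\<close>

definition bump_function :: "(real^'d::finite \<Rightarrow> real) \<Rightarrow> bool" where
  "bump_function \<psi> \<longleftrightarrow> smooth \<psi> \<and> bounded {x. \<psi> x \<noteq> 0}"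

definition pd :: "(real^'d::finite \<Rightarrow> real) \<Rightarrow> 'd \<Rightarrow> real^'d \<Rightarrow> real" where
  "pd \<psi> l x = frechet_derivative \<psi> (at x) (axis l 1)"

lemma bump_function_L2: "bump_function \<psi> \<Longrightarrow> square_integrable \<psi>"
  by (auto simp: bump_function_def intro: compactly_supported_square_integrable smooth_continuous)

lemma bump_function_pd:
  assumes "bump_function \<psi>"
  shows "continuous_on UNIV (pd \<psi> l)" "bounded {x. pd \<psi> l x \<noteq> 0}" "square_integrable (pd \<psi> l)"
proof -
  have s: "smooth \<psi>" "bounded {x. \<psi> x \<noteq> 0}"
    using assms by (auto simp: bump_function_def)
  show c: "continuous_on UNIV (pd \<psi> l)"
    unfolding pd_def by (rule smooth_continuous_deriv[OF s(1)])
  have "{x. pd \<psi> l x \<noteq> 0} \<subseteq> closure {x. \<psi> x \<noteq> 0}"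
    using derivative_support[OF smooth_has_derivative[OF s(1)]] unfolding pd_def by blast
  then show b: "bounded {x. pd \<psi> l x \<noteq> 0}"
    using s(2) bounded_closure bounded_subset by blast
  show "square_integrable (pd \<psi> l)"
    by (rule compactly_supported_square_integrable[OF c b])
qed

lemma pd_has_derivative: "(f has_derivative f') (at x) \<Longrightarrow> pd f l x = f' (axis l 1)"
  by (simp add: pd_def frechet_derivative_eq)

lemma L2_norm_scaled:
  fixes f :: "'a::euclidean_space \<Rightarrow> 'b::euclidean_space"
  assumes "\<epsilon> > 0"
  shows "L2_norm (\<lambda>x. f (\<epsilon> *\<^sub>R x)) = sqrt (inverse (\<epsilon> ^ DIM('a))) * L2_norm f"
proof -
  have "(LINT x|lborel. (norm (f x))\<^sup>2) = \<epsilon> ^ DIM('a) * (LINT x|lborel. (norm (f (\<epsilon> *\<^sub>R x)))\<^sup>2)"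
    using integral_lborel_affine[of \<epsilon> "\<lambda>x. (norm (f x))\<^sup>2" 0] assms by simp
  then have "(LINT x|lborel. (norm (f (\<epsilon> *\<^sub>R x)))\<^sup>2) = inverse (\<epsilon> ^ DIM('a)) * (LINT x|lborel. (norm (f x))\<^sup>2)"
    using assms by simp
  then show ?thesis
    by (simp add: L2_norm_def real_sqrt_mult)
qed

lemma L2_norm_triangle:
  assumes f: "square_integrable f" and g: "square_integrable g"
  shows "L2_norm (\<lambda>x. f x + g x) \<le> L2_norm f + L2_norm g"
proof -
  have int: "integrable lborel (\<lambda>x. (norm (f x))\<^sup>2)" "integrable lborel (\<lambda>x. (norm (g x))\<^sup>2)"
    "integrable lborel (\<lambda>x. norm (f x) * norm (g x))" "integrable lborel (\<lambda>x. (norm (f x + g x))\<^sup>2)"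
    using f g square_integrable_add[OF f g] integrable_norm_mult[OF f g] by (auto simp: square_integrable_def)
  have "(LINT x|lborel. (norm (f x + g x))\<^sup>2) \<le>
      (LINT x|lborel. (norm (f x))\<^sup>2 + 2 * (norm (f x) * norm (g x)) + (norm (g x))\<^sup>2)"
  proof (rule Bochner_Integration.integral_mono)
    fix x
    have "(norm (f x + g x))\<^sup>2 \<le> (norm (f x) + norm (g x))\<^sup>2"
      by (intro power_mono norm_triangle_ineq) simp
    then show "(norm (f x + g x))\<^sup>2 \<le> (norm (f x))\<^sup>2 + 2 * (norm (f x) * norm (g x)) + (norm (g x))\<^sup>2"
      by (simp add: power2_sum)
  qed (use int in auto)
  also have "\<dots> = (L2_norm f)\<^sup>2 + 2 * (LINT x|lborel. norm (f x) * norm (g x)) + (L2_norm g)\<^sup>2"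
    using int by (simp add: L2_norm_def)
  also have "\<dots> \<le> (L2_norm f + L2_norm g)\<^sup>2"
    using cauchy_schwarz_L2[OF f g] by (simp add: power2_sum)
  finally have "(LINT x|lborel. (norm (f x + g x))\<^sup>2) \<le> (L2_norm f + L2_norm g)\<^sup>2" .
  then show ?thesis
    unfolding L2_norm_def[of "\<lambda>x. f x + g x"]
    by (intro real_le_lsqrt) (simp_all add: L2_norm_nonneg)
qed

lemma L2_norm_minus_commute: "L2_norm (\<lambda>x. f x - g x) = L2_norm (\<lambda>x. g x - f x)"
  by (simp add: L2_norm_def norm_minus_commute)

lemma L2_norm_diff_triangle:
  assumes f: "square_integrable f" and g: "square_integrable g"
  shows "\<bar>L2_norm f - L2_norm g\<bar> \<le> L2_norm (\<lambda>x. f x - g x)"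
proof -
  have "L2_norm f \<le> L2_norm (\<lambda>x. f x - g x) + L2_norm g"
    using L2_norm_triangle[OF square_integrable_diff[OF f g] g] by simp
  moreover have "L2_norm g \<le> L2_norm (\<lambda>x. g x - f x) + L2_norm f"
    using L2_norm_triangle[OF square_integrable_diff[OF g f] f] by simp
  ultimately show ?thesis
    by (simp add: L2_norm_minus_commute[of g])
qed

section \<open>Continuous functions with values in the square integrable functions\<close>

lemma continuous_L2D:
  assumes "continuous_L2 W" "0 \<le> t"
  shows "square_integrable (W t)" "((\<lambda>s. L2_norm (\<lambda>x. W s x - W t x)) \<longlongrightarrow> 0) (at t within {0..})"
  using assms by (auto simp: continuous_L2_def)

lemma continuous_on_L2_norm:
  assumes W: "continuous_L2 W"
  shows "continuous_on {0..} (\<lambda>t. L2_norm (W t))"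
  unfolding continuous_on_def
proof
  fix t :: real assume t: "t \<in> {0..}"
  show "((\<lambda>t. L2_norm (W t)) \<longlongrightarrow> L2_norm (W t)) (at t within {0..})"
  proof (rule LIM_zero_cancel, rule Lim_null_comparison)
    show "((\<lambda>s. L2_norm (\<lambda>x. W s x - W t x)) \<longlongrightarrow> 0) (at t within {0..})"
      using continuous_L2D(2)[OF W] t by simp
    have "norm (L2_norm (W s) - L2_norm (W t)) \<le> L2_norm (\<lambda>x. W s x - W t x)" if "0 \<le> s" for s
      using L2_norm_diff_triangle[OF continuous_L2D(1)[OF W that] continuous_L2D(1)[OF W, of t]] t by simp
    then show "\<forall>\<^sub>F s in at t within {0..}. norm (L2_norm (W s) - L2_norm (W t)) \<le> L2_norm (\<lambda>x. W s x - W t x)"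
      by (auto simp: eventually_at_filter)
  qed
qed

lemma L2_norm_bounded:
  assumes W: "continuous_L2 W"
  obtains M where "0 \<le> M" "\<And>t. 0 \<le> t \<Longrightarrow> t \<le> T \<Longrightarrow> L2_norm (W t) \<le> M"
proof -
  have "compact ((\<lambda>t. L2_norm (W t)) ` {0..T})"
    by (intro compact_continuous_image continuous_on_subset[OF continuous_on_L2_norm[OF W]]) auto
  then obtain M where M: "\<And>t. t \<in> {0..T} \<Longrightarrow> norm (L2_norm (W t)) \<le> M"
    by (meson bounded_iff compact_imp_bounded imageI)
  have "L2_norm (W t) \<le> max M 0" if "0 \<le> t" "t \<le> T" for t
    using M[of t] that by auto
  then show ?thesis
    using that[of "max M 0"] by auto
qed

lemma continuous_on_pairing:
  assumes W: "continuous_L2 W" and \<psi>: "square_integrable \<psi>"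
  shows "continuous_on {0..} (\<lambda>t. LINT x|lborel. (\<psi> :: _ \<Rightarrow> real) x *\<^sub>R W t x)"
  unfolding continuous_on_def
proof
  fix t :: real assume t: "t \<in> {0..}"
  show "((\<lambda>t. LINT x|lborel. \<psi> x *\<^sub>R W t x) \<longlongrightarrow> (LINT x|lborel. \<psi> x *\<^sub>R W t x)) (at t within {0..})"
  proof (rule LIM_zero_cancel, rule Lim_null_comparison)
    have "((\<lambda>s. L2_norm \<psi> * L2_norm (\<lambda>x. W s x - W t x)) \<longlongrightarrow> L2_norm \<psi> * 0) (at t within {0..})"
      using t by (intro tendsto_mult tendsto_const continuous_L2D(2)[OF W]) simp
    then show "((\<lambda>s. L2_norm \<psi> * L2_norm (\<lambda>x. W s x - W t x)) \<longlongrightarrow> 0) (at t within {0..})"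
      by simp
    have "norm ((LINT x|lborel. \<psi> x *\<^sub>R W s x) - (LINT x|lborel. \<psi> x *\<^sub>R W t x)) \<le> L2_norm \<psi> * L2_norm (\<lambda>x. W s x - W t x)"
      if s: "0 \<le> s" for s
    proof -
      have t0: "0 \<le> t" using t by simp
      note sq = continuous_L2D(1)[OF W s] continuous_L2D(1)[OF W t0]
      show ?thesis
        using norm_integral_scaleR_le[OF \<psi> square_integrable_diff[OF sq]]
          integrable_scaleR_L2[OF \<psi> sq(1)] integrable_scaleR_L2[OF \<psi> sq(2)]
        by (simp add: scaleR_diff_right)
    qed
    then show "\<forall>\<^sub>F s in at t within {0..}. norm ((LINT x|lborel. \<psi> x *\<^sub>R W s x) - (LINT x|lborel. \<psi> x *\<^sub>R W t x)) \<le>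
        L2_norm \<psi> * L2_norm (\<lambda>x. W s x - W t x)"
      by (auto simp: eventually_at_filter)
  qed
qed

section \<open>Weak derivatives in time\<close>

lemma mollified_value_tendsto:
  fixes w :: "real \<Rightarrow> 'b::euclidean_space"
  assumes h: "continuous_on UNIV h" "\<And>x. 0 \<le> h x" "\<And>x. 1 \<le> \<bar>x\<bar> \<Longrightarrow> h x = 0" "(h has_integral 1) {-1..1}"
    and w: "continuous_on UNIV w" and \<eta>: "\<And>n. \<eta> n > 0" "\<eta> \<longlonglongrightarrow> 0" "\<And>n. \<eta> n \<le> (1::real)"
  shows "(\<lambda>n. LINT t|lborel. (h ((t - a) / \<eta> n) / \<eta> n) *\<^sub>R w t) \<longlonglongrightarrow> w a"
proof -
  have [measurable]: "h \<in> borel_measurable borel" "w \<in> borel_measurable borel"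
    using h(1) w by (auto intro: borel_measurable_continuous_onI)
  have supp: "bounded {x. h x \<noteq> 0}"
    using h(3) by (intro boundedI[of _ 1]) force
  have hint: "integrable lborel h"
    by (rule compactly_supported_integrable[OF h(1) supp])
  have "(h has_integral (LINT x|lborel. h x)) UNIV"
    by (rule has_integral_integral_lborel[OF hint])
  moreover have "(h has_integral 1) UNIV"
    by (rule has_integral_on_superset[OF h(4)]) (auto intro!: h(3))
  ultimately have h1: "(LINT x|lborel. h x) = 1"
    by (rule has_integral_unique)
  have "compact (w ` {a - 1..a + 1})"
    by (intro compact_continuous_image continuous_on_subset[OF w]) auto
  then obtain M where M: "\<And>t. t \<in> {a - 1..a + 1} \<Longrightarrow> norm (w t) \<le> M"
    by (meson bounded_iff compact_imp_bounded imageI)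
  have scale: "(LINT t|lborel. (h ((t - a) / \<eta> n) / \<eta> n) *\<^sub>R w t) = (LINT s|lborel. h s *\<^sub>R w (a + \<eta> n * s))" for n
  proof -
    have "(LINT t|lborel. (h ((t - a) / \<eta> n) / \<eta> n) *\<^sub>R w t) =
        \<bar>\<eta> n\<bar> *\<^sub>R (LINT s|lborel. (h ((a + \<eta> n * s - a) / \<eta> n) / \<eta> n) *\<^sub>R w (a + \<eta> n * s))"
      using \<eta>(1)[of n] by (intro lborel_integral_real_affine) simp
    also have "\<dots> = (LINT s|lborel. \<bar>\<eta> n\<bar> *\<^sub>R ((h ((a + \<eta> n * s - a) / \<eta> n) / \<eta> n) *\<^sub>R w (a + \<eta> n * s)))"
      by (rule integral_scaleR_right[symmetric])
    also have "\<dots> = (LINT s|lborel. h s *\<^sub>R w (a + \<eta> n * s))"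
      using \<eta>(1)[of n] by (intro Bochner_Integration.integral_cong) auto
    finally show ?thesis .
  qed
  have "(\<lambda>n. LINT s|lborel. h s *\<^sub>R w (a + \<eta> n * s)) \<longlonglongrightarrow> (LINT s|lborel. h s *\<^sub>R w a)"
  proof (rule integral_dominated_convergence)
    show "integrable lborel (\<lambda>s. h s * M)"
      using hint by simp
    have "(\<lambda>n. h s *\<^sub>R w (a + \<eta> n * s)) \<longlonglongrightarrow> h s *\<^sub>R w (a + 0 * s)" for s
      by (intro tendsto_intros continuous_on_tendsto_compose[OF w] \<eta>) auto
    then show "AE s in lborel. (\<lambda>n. h s *\<^sub>R w (a + \<eta> n * s)) \<longlonglongrightarrow> h s *\<^sub>R w a"
      by simp
    fix n
    have "norm (h s *\<^sub>R w (a + \<eta> n * s)) \<le> h s * M" for s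
    proof (cases "1 \<le> \<bar>s\<bar>")
      case False
      then have "\<bar>\<eta> n * s\<bar> \<le> 1 * 1"
        unfolding abs_mult using \<eta>(1)[of n] \<eta>(3)[of n] by (intro mult_mono) auto
      then have "norm (w (a + \<eta> n * s)) \<le> M"
        by (intro M) (auto simp: abs_le_iff)
      then show ?thesis
        using h(2)[of s] by (simp add: mult_left_mono)
    qed (simp add: h(3))
    then show "AE s in lborel. norm (h s *\<^sub>R w (a + \<eta> n * s)) \<le> h s * M"
      by simp
  qed measurable
  then show ?thesis
    by (simp add: scale h1 hint)
qed

text \<open>The test functions are smooth approximations of the indicator of [a, b]; their
  derivatives are approximate identities at a minus those at b.\<close>

lemma du_bois_reymond:
  fixes w G :: "real \<Rightarrow> 'b::euclidean_space"
  assumes w: "continuous_on UNIV w" and G: "continuous_on UNIV G"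
    and weak: "\<And>\<theta> \<theta>' p q. smooth \<theta> \<Longrightarrow> (\<And>t. (\<theta> has_real_derivative \<theta>' t) (at t)) \<Longrightarrow> 0 < p \<Longrightarrow>
        (\<And>t. \<theta> t \<noteq> 0 \<Longrightarrow> p \<le> t \<and> t \<le> q) \<Longrightarrow> (\<And>t. \<theta>' t \<noteq> 0 \<Longrightarrow> p \<le> t \<and> t \<le> q) \<Longrightarrow>
        (LINT t|lborel. \<theta>' t *\<^sub>R w t) = (LINT t|lborel. \<theta> t *\<^sub>R G t)"
    and ab: "0 < a" "a \<le> b"
  shows "w a - w b = integral {a..b} G"
proof -
  obtain H h :: "real \<Rightarrow> real" where H: "smooth H" "\<And>x. (H has_real_derivative h x) (at x)" "continuous_on UNIV h"
    "\<And>x. x \<le> -1 \<Longrightarrow> H x = 0" "\<And>x. 1 \<le> x \<Longrightarrow> H x = 1" "\<And>x. 0 \<le> h x" "\<And>x. 1 \<le> \<bar>x\<bar> \<Longrightarrow> h x = 0"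
    "\<And>x. 0 \<le> H x \<and> H x \<le> 1" "(h has_integral 1) {-1..1}"
    by (rule smooth_step) blast
  have [measurable]: "H \<in> borel_measurable borel" "G \<in> borel_measurable borel" "h \<in> borel_measurable borel" "w \<in> borel_measurable borel"
    using H(3) G w smooth_continuous[OF H(1)] by (auto intro: borel_measurable_continuous_onI)
  \<comment> \<open>Keeps every \<eta> n below a, so that the test functions are supported in
    positive times.\<close>
  define e where "e = min a 1"
  have e: "0 < e" "e \<le> 1" "e \<le> a" using ab by (auto simp: e_def)
  \<comment> \<open>The shift by two makes \<eta> n strictly smaller than e already for n =
    0.\<close>
  define \<eta> where "\<eta> n = e / real (Suc (Suc n))" for n
  have \<eta>: "\<eta> n > 0" "\<eta> n \<le> 1" "\<eta> n < a" for n
  proof -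
    show "\<eta> n > 0" using e by (simp add: \<eta>_def)
    have "\<eta> n < e" using e by (simp add: \<eta>_def divide_less_eq)
    then show "\<eta> n \<le> 1" "\<eta> n < a" using e by auto
  qed
  have "(\<lambda>n. e * (1 / real (Suc (Suc n)))) \<longlonglongrightarrow> e * 0"
    by (intro tendsto_mult tendsto_const LIMSEQ_Suc[OF LIMSEQ_Suc[OF lim_1_over_n]])
  then have \<eta>0: "\<eta> \<longlonglongrightarrow> 0"
    by (simp add: \<eta>_def[abs_def])
  define \<theta> where "\<theta> n t = H ((t - a) / \<eta> n) - H ((t - b) / \<eta> n)" for n t
  define \<theta>' where "\<theta>' n t = h ((t - a) / \<eta> n) / \<eta> n - h ((t - b) / \<eta> n) / \<eta> n" for n t
  have small: "H ((t - c) / \<eta> n) = 0" if "t \<le> c - \<eta> n" for t c n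
    using that \<eta>(1)[of n] by (intro H(4)) (simp add: divide_le_eq)
  have large: "H ((t - c) / \<eta> n) = 1" if "c + \<eta> n \<le> t" for t c n
    using that \<eta>(1)[of n] by (intro H(5)) (simp add: le_divide_eq)
  have eq: "(LINT t|lborel. \<theta>' n t *\<^sub>R w t) = (LINT t|lborel. \<theta> n t *\<^sub>R G t)" for n
  proof (rule weak)
    have aff: "smooth (\<lambda>t. H ((t - c) / \<eta> n))" for c
    proof -
      have "smooth (\<lambda>t. H (t / \<eta> n + (- c / \<eta> n)))"
        by (rule smooth_affine[OF H(1)]) (rule bounded_linear_divide)
      then show ?thesis
        by (simp add: diff_divide_distrib)
    qed
    show "smooth (\<theta> n)"
      unfolding \<theta>_def[abs_def] by (intro smooth_diff aff)
    have "((\<lambda>t. H ((t - c) / \<eta> n)) has_real_derivative h ((t - c) / \<eta> n) * (1 / \<eta> n)) (at t)" for c t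
      by (rule DERIV_chain2[OF H(2)]) (use DERIV_cdivide[OF DERIV_diff[OF DERIV_ident DERIV_const]] in simp)
    from DERIV_diff[OF this[of a] this[of b]] show "(\<theta> n has_real_derivative \<theta>' n t) (at t)" for t
      by (simp add: \<theta>_def[abs_def] \<theta>'_def)
    show "0 < a - \<eta> n" using \<eta>(3)[of n] by simp
    show "a - \<eta> n \<le> t \<and> t \<le> b + \<eta> n" if "\<theta> n t \<noteq> 0" for t
      using that small[of t a n] small[of t b n] large[of a n t] large[of b n t] ab unfolding \<theta>_def by force
    have hz: "h ((t - c) / \<eta> n) = 0" if "t < c - \<eta> n \<or> c + \<eta> n < t" for t c
    proof (rule H(7))
      show "1 \<le> \<bar>(t - c) / \<eta> n\<bar>"
        using that \<eta>(1)[of n] by (auto simp: abs_if divide_le_eq le_divide_eq field_simps)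
    qed
    show "a - \<eta> n \<le> t \<and> t \<le> b + \<eta> n" if "\<theta>' n t \<noteq> 0" for t
      using that hz[of t a] hz[of t b] ab unfolding \<theta>'_def by force
  qed
  have int: "integrable lborel (\<lambda>t. (h ((t - c) / \<eta> n) / \<eta> n) *\<^sub>R w t)" for c n
  proof (rule compactly_supported_integrable)
    have "continuous_on UNIV (\<lambda>t. h ((t - c) / \<eta> n))"
      using less_imp_neq[OF \<eta>(1)[of n]]
      by (intro continuous_on_compose2[OF H(3)] continuous_intros) auto
    then show "continuous_on UNIV (\<lambda>t. (h ((t - c) / \<eta> n) / \<eta> n) *\<^sub>R w t)"
      using \<eta>(1)[of n] by (intro continuous_intros w) auto
    have "t \<in> {c - \<eta> n..c + \<eta> n}" if "h ((t - c) / \<eta> n) \<noteq> 0" for t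
    proof -
      have "\<not> 1 \<le> \<bar>(t - c) / \<eta> n\<bar>"
        using that H(7) by blast
      then show ?thesis
        using \<eta>(1)[of n] by (auto simp: abs_if field_simps split: if_splits)
    qed
    then show "bounded {t. (h ((t - c) / \<eta> n) / \<eta> n) *\<^sub>R w t \<noteq> 0}"
      by (intro bounded_subset[OF bounded_closed_interval[of "c - \<eta> n" "c + \<eta> n"]]) auto
  qed
  have lhs: "(\<lambda>n. LINT t|lborel. \<theta>' n t *\<^sub>R w t) \<longlonglongrightarrow> w a - w b"
    unfolding \<theta>'_def scaleR_diff_left Bochner_Integration.integral_diff[OF int int]
    by (intro tendsto_diff mollified_value_tendsto H w \<eta> \<eta>0)
  have rhs: "(\<lambda>n. LINT t|lborel. \<theta> n t *\<^sub>R G t) \<longlonglongrightarrow> (LINT t|lborel. indicator {a..b} t *\<^sub>R G t)"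
  proof (rule integral_dominated_convergence)
    have "set_integrable lborel {0..b + 1} G"
      by (rule borel_integrable_atLeastAtMost') (rule continuous_on_subset[OF G], simp)
    then show "integrable lborel (\<lambda>t. norm (indicator {0..b + 1} t *\<^sub>R G t))"
      unfolding set_integrable_def by (rule integrable_norm)
    show "(\<lambda>t. \<theta> n t *\<^sub>R G t) \<in> borel_measurable lborel" for n
      unfolding \<theta>_def by measurable
    show "AE t in lborel. norm (\<theta> n t *\<^sub>R G t) \<le> norm (indicator {0..b + 1} t *\<^sub>R G t)" for n
    proof (rule AE_I2)
      fix t
      have "\<bar>\<theta> n t\<bar> \<le> 1"
        using H(8)[of "(t - a) / \<eta> n"] H(8)[of "(t - b) / \<eta> n"] by (simp add: \<theta>_def abs_le_iff)
      moreover have "\<theta> n t = 0" if "t \<notin> {0..b + 1}"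
        using that small[of t a n] small[of t b n] large[of a n t] large[of b n t] \<eta>[of n] ab unfolding \<theta>_def by force
      ultimately show "norm (\<theta> n t *\<^sub>R G t) \<le> norm (indicator {0..b + 1} t *\<^sub>R G t)"
        by (cases "t \<in> {0..b + 1}") (auto intro: mult_left_le_one_le)
    qed
    have H_lim: "\<forall>\<^sub>F n in sequentially. H ((t - c) / \<eta> n) = indicator {c..} t" if "t \<noteq> c" for t c
    proof -
      have "\<forall>\<^sub>F n in sequentially. \<eta> n < \<bar>t - c\<bar>"
        using \<eta>0 that by (intro order_tendstoD(2)) auto
      then show ?thesis
        by eventually_elim (use that small[of t c] large[of c _ t] in \<open>auto simp: indicator_def abs_if split: if_splits\<close>)
    qed
    have "(\<lambda>n. \<theta> n t *\<^sub>R G t) \<longlonglongrightarrow> indicator {a..b} t *\<^sub>R G t" if "t \<noteq> a" "t \<noteq> b" for t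
    proof (rule tendsto_eventually)
      show "\<forall>\<^sub>F n in sequentially. \<theta> n t *\<^sub>R G t = indicator {a..b} t *\<^sub>R G t"
        using H_lim[OF that(1)] H_lim[OF that(2)]
        by eventually_elim (use that ab in \<open>auto simp: \<theta>_def indicator_def\<close>)
    qed
    moreover have "AE t in lborel. t \<noteq> a" "AE t in lborel. t \<noteq> b"
      by (rule AE_lborel_singleton)+
    ultimately show "AE t in lborel. (\<lambda>n. \<theta> n t *\<^sub>R G t) \<longlonglongrightarrow> indicator {a..b} t *\<^sub>R G t"
      by (auto elim: eventually_elim2)
  qed measurable
  have "w a - w b = (LINT t|lborel. indicator {a..b} t *\<^sub>R G t)"
    using LIMSEQ_unique[OF lhs] rhs unfolding eq by blast
  also have "\<dots> = integral {a..b} G"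
  proof -
    have "set_integrable lborel {a..b} G"
      by (rule borel_integrable_atLeastAtMost') (rule continuous_on_subset[OF G], simp)
    from set_borel_integral_eq_integral(2)[OF this] show ?thesis
      by (simp add: set_lebesgue_integral_def)
  qed
  finally show ?thesis .
qed

text \<open>By \<open>du_bois_reymond\<close> the sum of w and the integral of G is constant on ]0,
  T[, and by continuity on [0, T]. So the derivative is obtained up to the initial time.\<close>

lemma weak_derivative_in_time:
  fixes w G :: "real \<Rightarrow> 'b::euclidean_space"
  assumes w: "continuous_on {0..} w" and G: "continuous_on {0..} G"
    and weak: "\<And>\<theta> \<theta>' p q. smooth \<theta> \<Longrightarrow> (\<And>t. (\<theta> has_real_derivative \<theta>' t) (at t)) \<Longrightarrow> 0 < p \<Longrightarrow>
        (\<And>t. \<theta> t \<noteq> 0 \<Longrightarrow> p \<le> t \<and> t \<le> q) \<Longrightarrow> (\<And>t. \<theta>' t \<noteq> 0 \<Longrightarrow> p \<le> t \<and> t \<le> q) \<Longrightarrow>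
        (LINT t|lborel. \<theta>' t *\<^sub>R w t) = (LINT t|lborel. \<theta> t *\<^sub>R G t)"
    and t: "0 \<le> t" "t \<le> T" and T: "0 < T"
  shows "(w has_vector_derivative - G t) (at t within {0..T})"
proof -
  \<comment> \<open>Constant continuations to negative times, which the test functions do not
    see.\<close>
  let ?w = "\<lambda>t. w (max 0 t)" and ?G = "\<lambda>t. G (max 0 t)"
  have cw: "continuous_on UNIV ?w" and cG: "continuous_on UNIV ?G"
    by (rule continuous_on_compose2[OF w], auto intro!: continuous_intros)
      (rule continuous_on_compose2[OF G], auto intro!: continuous_intros)
  have step: "?w a - ?w b = integral {a..b} ?G" if "0 < a" "a \<le> b" for a b
  proof (rule du_bois_reymond[OF cw cG _ that])
    fix \<theta> \<theta>' :: "real \<Rightarrow> real" and p q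
    assume \<theta>: "smooth \<theta>" "\<And>t. (\<theta> has_real_derivative \<theta>' t) (at t)" "0 < p"
      "\<And>t. \<theta> t \<noteq> 0 \<Longrightarrow> p \<le> t \<and> t \<le> q" "\<And>t. \<theta>' t \<noteq> 0 \<Longrightarrow> p \<le> t \<and> t \<le> q"
    have *: "(\<lambda>t. \<theta>' t *\<^sub>R ?w t) = (\<lambda>t. \<theta>' t *\<^sub>R w t)" "(\<lambda>t. \<theta> t *\<^sub>R ?G t) = (\<lambda>t. \<theta> t *\<^sub>R G t)"
      using \<theta>(3,4,5) by (intro ext, case_tac "0 \<le> t", auto, force)+
    show "(LINT t|lborel. \<theta>' t *\<^sub>R ?w t) = (LINT t|lborel. \<theta> t *\<^sub>R ?G t)"
      unfolding * by (rule weak[OF \<theta>])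
  qed
  define z where "z t = ?w t + integral {0..t} ?G" for t
  have Gint: "?G integrable_on {c..d}" for c d
    by (rule integrable_continuous_real) (rule continuous_on_subset[OF cG], simp)
  have zconst: "z a = z T" if "a \<in> {0<..<T}" for a
  proof -
    have "integral {0..a} ?G + integral {a..T} ?G = integral {0..T} ?G"
      using that Gint by (intro Henstock_Kurzweil_Integration.integral_combine) auto
    then show ?thesis
      using step[of a T] that by (simp add: z_def algebra_simps)
  qed
  have cz: "continuous_on {0..T} z"
    unfolding z_def using Gint
    by (intro continuous_on_add continuous_on_subset[OF cw] indefinite_integral_continuous_1) auto
  have zT: "z s = z T" if "s \<in> {0..T}" for s
    by (rule continuous_constant_on_closure[of "{0<..<T}" z "z T" s])
      (use cz zconst that T in auto)
  have "((\<lambda>s. z T - integral {0..s} ?G) has_vector_derivative 0 - ?G t) (at t within {0..T})"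
    using t by (intro has_vector_derivative_diff has_vector_derivative_const
        integral_has_vector_derivative continuous_on_subset[OF cG]) auto
  then have "((\<lambda>s. z T - integral {0..s} ?G) has_vector_derivative - G t) (at t within {0..T})"
    using t by simp
  then show ?thesis
  proof (rule has_vector_derivative_transform[rotated 2])
    show "t \<in> {0..T}" using t by simp
    fix s assume s: "s \<in> {0..T}"
    then show "w s = z T - integral {0..s} ?G"
      using zT[OF s] by (simp add: z_def eq_diff_eq)
  qed
qed

section \<open>Weak solutions\<close>

text \<open>Tested against functions of \<open>x\<close> alone, a weak solution satisfies an ordinary differential
  equation in \<open>t\<close>. In this form solutions can be subtracted.\<close>

definition weak_evolution ::
    "('d::finite \<Rightarrow> complex^'n^'n) \<Rightarrow> complex^'n^'n \<Rightarrow> (real \<Rightarrow> real^'d \<Rightarrow> complex^'n::finite) \<Rightarrow> bool" where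
  "weak_evolution A B W \<longleftrightarrow> continuous_L2 W \<and> (\<forall>\<psi> t T. bump_function \<psi> \<longrightarrow> 0 \<le> t \<longrightarrow> t \<le> T \<longrightarrow> 0 < T \<longrightarrow>
     ((\<lambda>t. LINT x|lborel. \<psi> x *\<^sub>R W t x) has_vector_derivative
       (\<Sum>l\<in>UNIV. A l *v (LINT x|lborel. pd \<psi> l x *\<^sub>R W t x)) - B *v (LINT x|lborel. \<psi> x *\<^sub>R W t x)) (at t within {0..T}))"

lemma test_function_product:
  fixes \<psi> :: "real^'d::finite \<Rightarrow> real"
  assumes \<theta>: "smooth \<theta>" "0 < p" "\<And>t. \<theta> t \<noteq> 0 \<Longrightarrow> p \<le> t \<and> t \<le> q" and \<psi>: "bump_function \<psi>"
  shows "test_function (\<lambda>z. \<theta> (fst z) * \<psi> (snd z))"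
proof -
  have s: "smooth \<psi>" "bounded {x. \<psi> x \<noteq> 0}"
    using \<psi> by (auto simp: bump_function_def)
  have sm: "smooth (\<lambda>z :: real \<times> (real^'d). \<theta> (fst z) * \<psi> (snd z))"
    by (intro smooth_mult smooth_linear[OF \<theta>(1)] smooth_linear[OF s(1)] bounded_linear_fst bounded_linear_snd)
  have sub: "{z. \<theta> (fst z) * \<psi> (snd z) \<noteq> 0} \<subseteq> {p..q} \<times> closure {x. \<psi> x \<noteq> 0}"
    using \<theta>(3) closure_subset[of "{x. \<psi> x \<noteq> 0}"] by auto
  have comp: "compact ({p..q} \<times> closure {x. \<psi> x \<noteq> 0})"
    using s(2) by (intro compact_Times) auto
  from sub have "closure {z. \<theta> (fst z) * \<psi> (snd z) \<noteq> 0} \<subseteq> {p..q} \<times> closure {x. \<psi> x \<noteq> 0}"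
    by (rule closure_minimal) (rule compact_imp_closed[OF comp])
  moreover from this have "compact (closure {z. \<theta> (fst z) * \<psi> (snd z) \<noteq> 0})"
    using comp by (meson bounded_subset closed_closure compact_eq_bounded_closed)
  ultimately show ?thesis
    using sm \<theta>(2) by (auto simp: test_function_def)
qed

lemma matrix_vector_scaleR: "A *v (r *\<^sub>R v) = r *\<^sub>R (A *v (v :: complex^'n::finite))"
  by (rule linear_scale[OF matrix_vector_mul_linear])

lemma integral_matrix_vector:
  "integrable M f \<Longrightarrow> (LINT x|M. A *v f x) = A *v ((LINT x|M. f x) :: complex^'n::finite)"
  by (rule integral_bounded_linear) simp_all

lemma integral_combination:
  fixes f :: "'a \<Rightarrow> complex^'n::finite" and g :: "'d::finite \<Rightarrow> 'a \<Rightarrow> complex^'n"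
  assumes f: "integrable M f" and g: "\<And>l. integrable M (g l)"
  shows "(LINT x|M. - (a *\<^sub>R f x) - (\<Sum>l\<in>UNIV. b *\<^sub>R (A l *v g l x)) + b *\<^sub>R (B *v f x)) =
    - (a *\<^sub>R (LINT x|M. f x)) - (\<Sum>l\<in>UNIV. b *\<^sub>R (A l *v (LINT x|M. g l x))) + b *\<^sub>R (B *v (LINT x|M. f x))"
proof -
  have 1: "integrable M (\<lambda>x. A l *v g l x)" for l
    by (rule integrable_bounded_linear[OF matrix_vector_mul_bounded_linear g])
  have 2: "integrable M (\<lambda>x. B *v f x)"
    by (rule integrable_bounded_linear[OF matrix_vector_mul_bounded_linear f])
  show ?thesis
    using f 1 2 by (simp add: integral_matrix_vector f g)
qed

text \<open>For test functions of the form \<theta>(t) \<psi>(x), the equation is the weak form of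
  an ordinary differential equation for the pairing of W with \<psi>.\<close>

lemma distributional_solution_weak_evolution:
  fixes W :: "real \<Rightarrow> real^'d::finite \<Rightarrow> complex^'n::finite"
  assumes W: "continuous_L2 W" and sol: "distributional_solution A (\<lambda>_. B) W"
  shows "weak_evolution A B W"
  unfolding weak_evolution_def
proof (intro conjI W allI impI)
  fix \<psi> :: "real^'d \<Rightarrow> real" and t T :: real
  assume \<psi>: "bump_function \<psi>" and t: "0 \<le> t" "t \<le> T" "0 < T"
  note \<psi>2 = bump_function_L2[OF \<psi>] and pd2 = bump_function_pd(3)[OF \<psi>]
  define w where "w t = (LINT x|lborel. \<psi> x *\<^sub>R W t x)" for t
  define v where "v l t = (LINT x|lborel. pd \<psi> l x *\<^sub>R W t x)" for l t
  define G where "G t = B *v w t - (\<Sum>l\<in>UNIV. A l *v v l t)" for t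
  have cw: "continuous_on {0..} w" and cv: "continuous_on {0..} (v l)" for l
    unfolding w_def v_def by (rule continuous_on_pairing[OF W \<psi>2], rule continuous_on_pairing[OF W pd2])
  have cG: "continuous_on {0..} G"
    unfolding G_def
    by (intro continuous_intros linear_continuous_on_compose[OF cw] linear_continuous_on_compose[OF cv]) auto
  have s: "smooth \<psi>"
    using \<psi> by (simp add: bump_function_def)
  have "(w has_vector_derivative - G t) (at t within {0..T})"
  proof (rule weak_derivative_in_time[OF cw cG _ t])
    fix \<theta> \<theta>' :: "real \<Rightarrow> real" and p q
    assume \<theta>: "smooth \<theta>" "\<And>t. (\<theta> has_real_derivative \<theta>' t) (at t)" "0 < p"
      "\<And>t. \<theta> t \<noteq> 0 \<Longrightarrow> p \<le> t \<and> t \<le> q" "\<And>t. \<theta>' t \<noteq> 0 \<Longrightarrow> p \<le> t \<and> t \<le> q"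
    let ?\<phi> = "\<lambda>z :: real \<times> (real^'d). \<theta> (fst z) * \<psi> (snd z)"
    have test: "test_function ?\<phi>"
      by (rule test_function_product[OF \<theta>(1,3,4) \<psi>])
    have der: "frechet_derivative ?\<phi> (at (t, x)) = (\<lambda>h. \<theta> t * frechet_derivative \<psi> (at x) (snd h) + \<theta>' t * fst h * \<psi> x)" for t x
    proof (rule frechet_derivative_eq)
      have "(\<theta> has_derivative (\<lambda>h. \<theta>' t * h)) (at t)"
        using \<theta>(2)[of t] by (simp add: has_field_derivative_def)
      then have "((\<lambda>z. \<theta> (fst z)) has_derivative (\<lambda>h. \<theta>' t * fst h)) (at (t, x))"
        by (intro has_derivative_compose[of fst fst "(t, x)" UNIV \<theta>, simplified]) (auto intro!: derivative_eq_intros)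
      moreover have "((\<lambda>z. \<psi> (snd z)) has_derivative (\<lambda>h. frechet_derivative \<psi> (at x) (snd h))) (at (t, x))"
        using smooth_has_derivative[OF s, of x]
        by (intro has_derivative_compose[of snd snd "(t, x)" UNIV \<psi>, simplified]) (auto intro!: derivative_eq_intros)
      ultimately show "(?\<phi> has_derivative (\<lambda>h. \<theta> t * frechet_derivative \<psi> (at x) (snd h) + \<theta>' t * fst h * \<psi> x)) (at (t, x))"
        by (auto intro!: derivative_eq_intros)
    qed
    have zero: "frechet_derivative \<psi> (at x) 0 = 0" for x
      using smooth_has_derivative[OF s, of x] has_derivative_linear linear_0 by blast
    have "(LINT x|lborel. - (frechet_derivative ?\<phi> (at (t, x)) (1, 0) *\<^sub>R W t x)
        - (\<Sum>l\<in>UNIV. frechet_derivative ?\<phi> (at (t, x)) (0, axis l 1) *\<^sub>R (A l *v W t x))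
        + ?\<phi> (t, x) *\<^sub>R (B *v W t x)) = \<theta> t *\<^sub>R G t - \<theta>' t *\<^sub>R w t" for t
    proof (cases "0 \<le> t")
      case False
      then have "\<theta> t = 0" "\<theta>' t = 0"
        using \<theta>(3) \<theta>(4)[of t] \<theta>(5)[of t] by auto
      then show ?thesis
        by (simp add: der)
    next
      case True
      note Wt = continuous_L2D(1)[OF W True]
      have i1: "integrable lborel (\<lambda>x. \<psi> x *\<^sub>R W t x)" and i2: "integrable lborel (\<lambda>x. pd \<psi> l x *\<^sub>R W t x)" for l
        by (rule integrable_scaleR_L2[OF \<psi>2 Wt], rule integrable_scaleR_L2[OF pd2 Wt])
      have "(LINT x|lborel. - (frechet_derivative ?\<phi> (at (t, x)) (1, 0) *\<^sub>R W t x)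
          - (\<Sum>l\<in>UNIV. frechet_derivative ?\<phi> (at (t, x)) (0, axis l 1) *\<^sub>R (A l *v W t x))
          + ?\<phi> (t, x) *\<^sub>R (B *v W t x)) =
          (LINT x|lborel. - (\<theta>' t *\<^sub>R (\<psi> x *\<^sub>R W t x)) - (\<Sum>l\<in>UNIV. \<theta> t *\<^sub>R (A l *v (pd \<psi> l x *\<^sub>R W t x)))
          + \<theta> t *\<^sub>R (B *v (\<psi> x *\<^sub>R W t x)))"
        by (intro Bochner_Integration.integral_cong)
          (simp_all add: der zero pd_def matrix_vector_scaleR)
      also have "\<dots> = - (\<theta>' t *\<^sub>R w t) - (\<Sum>l\<in>UNIV. \<theta> t *\<^sub>R (A l *v v l t)) + \<theta> t *\<^sub>R (B *v w t)"
        unfolding w_def v_def by (rule integral_combination[OF i1 i2])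
      also have "\<dots> = \<theta> t *\<^sub>R G t - \<theta>' t *\<^sub>R w t"
        by (simp add: G_def scaleR_diff_right scaleR_sum_right)
      finally show ?thesis .
    qed
    from sol[unfolded distributional_solution_def, rule_format, OF test, unfolded this]
    have "(LINT t|lborel. \<theta> t *\<^sub>R G t - \<theta>' t *\<^sub>R w t) = 0" .
    moreover have supp: "integrable lborel (\<lambda>t. \<theta> t *\<^sub>R G t)" "integrable lborel (\<lambda>t. \<theta>' t *\<^sub>R w t)"
    proof -
      \<comment> \<open>A factor supported in [p, q] with p > 0 hides the values of f at negative
        times.\<close>
      have gen: "integrable lborel (\<lambda>t. \<kappa> t *\<^sub>R f t)"
        if \<kappa>: "continuous_on UNIV \<kappa>" "\<And>t. \<kappa> t \<noteq> 0 \<Longrightarrow> p \<le> t \<and> t \<le> q" and f: "continuous_on {0..} f"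
        for \<kappa> and f :: "real \<Rightarrow> complex^'n"
      proof -
        have "(\<lambda>t. \<kappa> t *\<^sub>R f t) = (\<lambda>t. \<kappa> t *\<^sub>R f (max 0 t))"
        proof
          show "\<kappa> t *\<^sub>R f t = \<kappa> t *\<^sub>R f (max 0 t)" for t
            using \<kappa>(2)[of t] \<theta>(3) by (cases "\<kappa> t = 0") auto
        qed
        moreover have "integrable lborel (\<lambda>t. \<kappa> t *\<^sub>R f (max 0 t))"
        proof (rule compactly_supported_integrable)
          show "continuous_on UNIV (\<lambda>t. \<kappa> t *\<^sub>R f (max 0 t))"
            by (intro continuous_intros \<kappa> continuous_on_compose2[OF f]) auto
          show "bounded {t. \<kappa> t *\<^sub>R f (max 0 t) \<noteq> 0}"
            by (rule bounded_subset[OF bounded_closed_interval[of p q]]) (use \<kappa>(2) in auto)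
        qed
        ultimately show ?thesis by simp
      qed
      have "\<theta>' t = frechet_derivative \<theta> (at t) 1" for t
        using \<theta>(2)[of t] by (simp add: has_field_derivative_def frechet_derivative_eq)
      then have "continuous_on UNIV \<theta>'"
        using smooth_continuous_deriv[OF \<theta>(1), of UNIV 1] by simp
      then show "integrable lborel (\<lambda>t. \<theta> t *\<^sub>R G t)" "integrable lborel (\<lambda>t. \<theta>' t *\<^sub>R w t)"
        using gen[OF smooth_continuous[OF \<theta>(1)] \<theta>(4) cG] gen[OF _ \<theta>(5) cw] by auto
    qed
    ultimately show "(LINT t|lborel. \<theta>' t *\<^sub>R w t) = (LINT t|lborel. \<theta> t *\<^sub>R G t)"
      by simp
  qed
  then show "((\<lambda>t. LINT x|lborel. \<psi> x *\<^sub>R W t x) has_vector_derivative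
       (\<Sum>l\<in>UNIV. A l *v (LINT x|lborel. pd \<psi> l x *\<^sub>R W t x)) - B *v (LINT x|lborel. \<psi> x *\<^sub>R W t x)) (at t within {0..T})"
    by (simp add: w_def[abs_def] v_def G_def)
qed

lemma continuous_L2_diff:
  assumes V: "continuous_L2 V" and U: "continuous_L2 U"
  shows "continuous_L2 (\<lambda>t x. V t x - U t x)"
  unfolding continuous_L2_def
proof (intro conjI allI impI)
  fix t :: real assume t: "0 \<le> t"
  show "square_integrable (\<lambda>x. V t x - U t x)"
    by (intro square_integrable_diff continuous_L2D(1) V U t)
  show "((\<lambda>s. L2_norm (\<lambda>x. V s x - U s x - (V t x - U t x))) \<longlongrightarrow> 0) (at t within {0..})"
  proof (rule Lim_null_comparison)
    show "((\<lambda>s. L2_norm (\<lambda>x. V s x - V t x) + L2_norm (\<lambda>x. U t x - U s x)) \<longlongrightarrow> 0) (at t within {0..})"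
      using tendsto_add[OF continuous_L2D(2)[OF V t] continuous_L2D(2)[OF U t]]
      by (simp add: L2_norm_minus_commute[of "U t"])
    have "norm (L2_norm (\<lambda>x. V s x - U s x - (V t x - U t x))) \<le> L2_norm (\<lambda>x. V s x - V t x) + L2_norm (\<lambda>x. U t x - U s x)"
      if s: "0 \<le> s" for s
    proof -
      have "L2_norm (\<lambda>x. (V s x - V t x) + (U t x - U s x)) \<le> L2_norm (\<lambda>x. V s x - V t x) + L2_norm (\<lambda>x. U t x - U s x)"
        by (intro L2_norm_triangle square_integrable_diff continuous_L2D(1) V U t s)
      moreover have "(\<lambda>x. (V s x - V t x) + (U t x - U s x)) = (\<lambda>x. V s x - U s x - (V t x - U t x))"
        by (simp add: fun_eq_iff)
      ultimately show ?thesis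
        by (simp add: L2_norm_nonneg)
    qed
    then show "\<forall>\<^sub>F s in at t within {0..}. norm (L2_norm (\<lambda>x. V s x - U s x - (V t x - U t x))) \<le>
        L2_norm (\<lambda>x. V s x - V t x) + L2_norm (\<lambda>x. U t x - U s x)"
      by (auto simp: eventually_at_filter)
  qed
qed

lemma weak_evolution_diff:
  assumes V: "weak_evolution A B V" and U: "weak_evolution A B U"
  shows "weak_evolution A B (\<lambda>t x. V t x - U t x)"
proof -
  have c: "continuous_L2 V" "continuous_L2 U"
    using V U by (auto simp: weak_evolution_def)
  have pair: "(LINT x|lborel. \<psi> x *\<^sub>R (V t x - U t x)) = (LINT x|lborel. \<psi> x *\<^sub>R V t x) - (LINT x|lborel. \<psi> x *\<^sub>R U t x)"
    if "square_integrable \<psi>" "0 \<le> t" for \<psi> :: "real^'a \<Rightarrow> real" and t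
    using integrable_scaleR_L2[OF that(1) continuous_L2D(1)[OF c(1) that(2)]]
      integrable_scaleR_L2[OF that(1) continuous_L2D(1)[OF c(2) that(2)]]
    by (simp add: scaleR_diff_right)
  show ?thesis
    unfolding weak_evolution_def
  proof (intro conjI continuous_L2_diff c allI impI)
    fix \<psi> :: "real^'a \<Rightarrow> real" and t T :: real
    assume \<psi>: "bump_function \<psi>" and t: "0 \<le> t" "t \<le> T" "0 < T"
    note \<psi>2 = bump_function_L2[OF \<psi>] and pd2 = bump_function_pd(3)[OF \<psi>]
    have "((\<lambda>t. (LINT x|lborel. \<psi> x *\<^sub>R V t x) - (LINT x|lborel. \<psi> x *\<^sub>R U t x)) has_vector_derivative
       ((\<Sum>l\<in>UNIV. A l *v (LINT x|lborel. pd \<psi> l x *\<^sub>R V t x)) - B *v (LINT x|lborel. \<psi> x *\<^sub>R V t x)) -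
       ((\<Sum>l\<in>UNIV. A l *v (LINT x|lborel. pd \<psi> l x *\<^sub>R U t x)) - B *v (LINT x|lborel. \<psi> x *\<^sub>R U t x))) (at t within {0..T})"
      using V U \<psi> t unfolding weak_evolution_def by (intro has_vector_derivative_diff) auto
    then have "((\<lambda>t. (LINT x|lborel. \<psi> x *\<^sub>R V t x) - (LINT x|lborel. \<psi> x *\<^sub>R U t x)) has_vector_derivative
       (\<Sum>l\<in>UNIV. A l *v (LINT x|lborel. pd \<psi> l x *\<^sub>R (V t x - U t x))) - B *v (LINT x|lborel. \<psi> x *\<^sub>R (V t x - U t x))) (at t within {0..T})"
      unfolding pair[OF pd2 t(1)] pair[OF \<psi>2 t(1)]
      by (rule has_vector_derivative_eq_rhs) (simp add: matrix_vector_mult_diff_distrib sum_subtractf)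
    then show "((\<lambda>t. LINT x|lborel. \<psi> x *\<^sub>R (V t x - U t x)) has_vector_derivative
       (\<Sum>l\<in>UNIV. A l *v (LINT x|lborel. pd \<psi> l x *\<^sub>R (V t x - U t x))) - B *v (LINT x|lborel. \<psi> x *\<^sub>R (V t x - U t x))) (at t within {0..T})"
      by (rule has_vector_derivative_transform[rotated 2]) (use t pair[OF \<psi>2] in auto)
  qed
qed

section \<open>Localized Fourier modes of a weak solution\<close>

text \<open>Splits the complex wave into its real parts, to match the real-valued test
  functions.\<close>

lemma integral_cis_scaleR:
  fixes u :: "real^'d::finite \<Rightarrow> complex^'n::finite"
  assumes "integrable lborel (\<lambda>x. cos (\<xi> \<bullet> x) *\<^sub>R u x)" "integrable lborel (\<lambda>x. sin (\<xi> \<bullet> x) *\<^sub>R u x)"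
  shows "(LINT x|lborel. cis (- (\<xi> \<bullet> x)) *s u x) = (LINT x|lborel. cos (\<xi> \<bullet> x) *\<^sub>R u x) - \<i> *s (LINT x|lborel. sin (\<xi> \<bullet> x) *\<^sub>R u x)"
proof -
  have "cis (- (\<xi> \<bullet> x)) *s u x = cos (\<xi> \<bullet> x) *\<^sub>R u x - \<i> *s (sin (\<xi> \<bullet> x) *\<^sub>R u x)" for x
    by (simp add: vec_eq_iff complex_eq_iff)
  then show ?thesis
    using assms integrable_bounded_linear[OF cvec.bounded_linear_right assms(2), of \<i>]
    by (simp add: integral_bounded_linear[OF cvec.bounded_linear_right])
qed

lemma smooth_wave: "smooth (\<lambda>x :: real^'d::finite. cos (\<xi> \<bullet> x))" "smooth (\<lambda>x. sin (\<xi> \<bullet> x))"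
  by (rule smooth_linear[OF smooth_cos_sin(1) bounded_linear_inner_right],
      rule smooth_linear[OF smooth_cos_sin(2) bounded_linear_inner_right])

lemma bump_function_wave:
  assumes \<kappa>: "bump_function \<kappa>"
  shows "bump_function (\<lambda>x. \<kappa> x * cos (\<xi> \<bullet> x))" "bump_function (\<lambda>x. \<kappa> x * sin (\<xi> \<bullet> x))"
    and "pd (\<lambda>x. \<kappa> x * cos (\<xi> \<bullet> x)) l x = pd \<kappa> l x * cos (\<xi> \<bullet> x) - \<kappa> x * (\<xi> $ l) * sin (\<xi> \<bullet> x)"
    and "pd (\<lambda>x. \<kappa> x * sin (\<xi> \<bullet> x)) l x = pd \<kappa> l x * sin (\<xi> \<bullet> x) + \<kappa> x * (\<xi> $ l) * cos (\<xi> \<bullet> x)"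
proof -
  have s: "smooth \<kappa>" and b: "bounded {x. \<kappa> x \<noteq> 0}"
    using \<kappa> by (auto simp: bump_function_def)
  show "bump_function (\<lambda>x. \<kappa> x * cos (\<xi> \<bullet> x))" "bump_function (\<lambda>x. \<kappa> x * sin (\<xi> \<bullet> x))"
    unfolding bump_function_def using s b
    by (auto intro!: smooth_mult smooth_wave elim!: bounded_subset)
  have d: "(\<kappa> has_derivative frechet_derivative \<kappa> (at x)) (at x)"
    by (rule smooth_has_derivative[OF s])
  have "((\<lambda>x. \<kappa> x * cos (\<xi> \<bullet> x)) has_derivative (\<lambda>h. \<kappa> x * (- sin (\<xi> \<bullet> x) * (\<xi> \<bullet> h)) + frechet_derivative \<kappa> (at x) h * cos (\<xi> \<bullet> x))) (at x)"
    by (auto intro!: derivative_eq_intros d)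
  from pd_has_derivative[OF this, of l]
  show "pd (\<lambda>x. \<kappa> x * cos (\<xi> \<bullet> x)) l x = pd \<kappa> l x * cos (\<xi> \<bullet> x) - \<kappa> x * (\<xi> $ l) * sin (\<xi> \<bullet> x)"
    by (simp add: pd_def inner_axis)
  have "((\<lambda>x. \<kappa> x * sin (\<xi> \<bullet> x)) has_derivative (\<lambda>h. \<kappa> x * (cos (\<xi> \<bullet> x) * (\<xi> \<bullet> h)) + frechet_derivative \<kappa> (at x) h * sin (\<xi> \<bullet> x))) (at x)"
    by (auto intro!: derivative_eq_intros d)
  from pd_has_derivative[OF this, of l]
  show "pd (\<lambda>x. \<kappa> x * sin (\<xi> \<bullet> x)) l x = pd \<kappa> l x * sin (\<xi> \<bullet> x) + \<kappa> x * (\<xi> $ l) * cos (\<xi> \<bullet> x)"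
    by (simp add: pd_def inner_axis)
qed

definition mode :: "(real^'d::finite \<Rightarrow> real) \<Rightarrow> (real^'d \<Rightarrow> complex^'n::finite) \<Rightarrow> real^'d \<Rightarrow> complex^'n" where
  "mode \<kappa> u \<xi> = (LINT x|lborel. cis (- (\<xi> \<bullet> x)) *s (\<kappa> x *\<^sub>R u x))"

text \<open>The commutator of the operator with multiplication by \<kappa>, in Fourier
  variables.\<close>

definition mode_error :: "('d::finite \<Rightarrow> complex^'n^'n) \<Rightarrow> (real^'d \<Rightarrow> real) \<Rightarrow> (real^'d \<Rightarrow> complex^'n::finite) \<Rightarrow> real^'d \<Rightarrow> complex^'n" where
  "mode_error A \<kappa> u \<xi> = (\<Sum>l\<in>UNIV. A l *v mode (pd \<kappa> l) u \<xi>)"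

lemma square_integrable_wave:
  assumes "square_integrable (f :: real^'d::finite \<Rightarrow> real)"
  shows "square_integrable (\<lambda>x. f x * cos (\<xi> \<bullet> x))" "square_integrable (\<lambda>x. f x * sin (\<xi> \<bullet> x))"
proof -
  note [measurable] = square_integrable_measurable[OF assms]
  show "square_integrable (\<lambda>x. f x * cos (\<xi> \<bullet> x))"
    by (rule square_integrable_bound[OF assms, where C = 1]) (auto simp: abs_mult mult_left_le)
  show "square_integrable (\<lambda>x. f x * sin (\<xi> \<bullet> x))"
    by (rule square_integrable_bound[OF assms, where C = 1]) (auto simp: abs_mult mult_left_le)
qed

lemma mode_eq:
  assumes f: "square_integrable f" and u: "square_integrable u"
  shows "mode f u \<xi> = (LINT x|lborel. (f x * cos (\<xi> \<bullet> x)) *\<^sub>R u x) - \<i> *s (LINT x|lborel. (f x * sin (\<xi> \<bullet> x)) *\<^sub>R u x)"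
proof -
  have e: "(\<lambda>x. cos (\<xi> \<bullet> x) *\<^sub>R (f x *\<^sub>R u x)) = (\<lambda>x. (f x * cos (\<xi> \<bullet> x)) *\<^sub>R u x)"
    "(\<lambda>x. sin (\<xi> \<bullet> x) *\<^sub>R (f x *\<^sub>R u x)) = (\<lambda>x. (f x * sin (\<xi> \<bullet> x)) *\<^sub>R u x)"
    by (simp_all add: mult.commute)
  show ?thesis
    unfolding mode_def
    by (rule integral_cis_scaleR[of \<xi> "\<lambda>x. f x *\<^sub>R u x", unfolded e])
      (rule integrable_scaleR_L2[OF square_integrable_wave(1)[OF f] u] integrable_scaleR_L2[OF square_integrable_wave(2)[OF f] u])+
qed

lemma norm_mode_le:
  assumes f: "square_integrable f" and u: "square_integrable u"
  shows "norm (mode f u \<xi>) \<le> L2_norm f * L2_norm u"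
proof -
  have "norm (mode f u \<xi>) \<le> (LINT x|lborel. norm (cis (- (\<xi> \<bullet> x)) *s (f x *\<^sub>R u x)))"
    unfolding mode_def by (rule integral_norm_bound)
  also have "\<dots> = (LINT x|lborel. norm (f x) * norm (u x))"
    by simp
  also have "\<dots> \<le> L2_norm f * L2_norm u"
    by (rule cauchy_schwarz_L2[OF f u])
  finally show ?thesis .
qed

text \<open>Test with \<kappa> cos and \<kappa> sin of \<xi> \<bullet> x. Derivatives that fall on
  the wave produce the symbol, those that fall on \<kappa> the error.\<close>

lemma mode_has_vector_derivative:
  assumes W: "weak_evolution A B W" and \<kappa>: "bump_function \<kappa>" and t: "0 \<le> t" "t \<le> T" "0 < T"
  shows "((\<lambda>t. mode \<kappa> (W t) \<xi>) has_vector_derivative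
      app (generator A B \<xi>) (mode \<kappa> (W t) \<xi>) + mode_error A \<kappa> (W t) \<xi>) (at t within {0..T})"
proof -
  have c: "continuous_L2 W"
    using W by (simp add: weak_evolution_def)
  note \<kappa>2 = bump_function_L2[OF \<kappa>] and pd2 = bump_function_pd(3)[OF \<kappa>]
  note Wt = continuous_L2D(1)[OF c]
  define C where "C t = (LINT x|lborel. (\<kappa> x * cos (\<xi> \<bullet> x)) *\<^sub>R W t x)" for t
  define S where "S t = (LINT x|lborel. (\<kappa> x * sin (\<xi> \<bullet> x)) *\<^sub>R W t x)" for t
  define c' where "c' l = (LINT x|lborel. (pd \<kappa> l x * cos (\<xi> \<bullet> x)) *\<^sub>R W t x)" for l
  define s' where "s' l = (LINT x|lborel. (pd \<kappa> l x * sin (\<xi> \<bullet> x)) *\<^sub>R W t x)" for l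
  have mode: "mode \<kappa> (W s) \<xi> = C s - \<i> *s S s" if "0 \<le> s" for s
    unfolding C_def S_def by (rule mode_eq[OF \<kappa>2 Wt[OF that]])
  have error: "mode_error A \<kappa> (W t) \<xi> = (\<Sum>l\<in>UNIV. A l *v (c' l - \<i> *s s' l))"
    unfolding mode_error_def c'_def s'_def by (simp add: mode_eq[OF pd2 Wt[OF t(1)]])
  note int = integrable_scaleR_L2[OF square_integrable_wave(1)[OF \<kappa>2, where \<xi> = \<xi>] Wt[OF t(1)]]
    integrable_scaleR_L2[OF square_integrable_wave(2)[OF \<kappa>2, where \<xi> = \<xi>] Wt[OF t(1)]]
    integrable_scaleR_L2[OF square_integrable_wave(1)[OF pd2, where \<xi> = \<xi>] Wt[OF t(1)]]
    integrable_scaleR_L2[OF square_integrable_wave(2)[OF pd2, where \<xi> = \<xi>] Wt[OF t(1)]]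
  have pdc: "(LINT x|lborel. pd (\<lambda>x. \<kappa> x * cos (\<xi> \<bullet> x)) l x *\<^sub>R W t x) = c' l - (\<xi> $ l) *\<^sub>R S t" for l
  proof -
    have "pd (\<lambda>x. \<kappa> x * cos (\<xi> \<bullet> x)) l x *\<^sub>R W t x = (pd \<kappa> l x * cos (\<xi> \<bullet> x)) *\<^sub>R W t x - (\<xi> $ l) *\<^sub>R ((\<kappa> x * sin (\<xi> \<bullet> x)) *\<^sub>R W t x)" for x
      by (simp add: bump_function_wave(3)[OF \<kappa>] scaleR_diff_left mult_ac)
    then show ?thesis
      using int by (simp add: c'_def S_def del: scaleR_scaleR)
  qed
  have pds: "(LINT x|lborel. pd (\<lambda>x. \<kappa> x * sin (\<xi> \<bullet> x)) l x *\<^sub>R W t x) = s' l + (\<xi> $ l) *\<^sub>R C t" for l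
  proof -
    have "pd (\<lambda>x. \<kappa> x * sin (\<xi> \<bullet> x)) l x *\<^sub>R W t x = (pd \<kappa> l x * sin (\<xi> \<bullet> x)) *\<^sub>R W t x + (\<xi> $ l) *\<^sub>R ((\<kappa> x * cos (\<xi> \<bullet> x)) *\<^sub>R W t x)" for x
      by (simp add: bump_function_wave(4)[OF \<kappa>] scaleR_add_left mult_ac)
    then show ?thesis
      using int by (simp add: s'_def C_def del: scaleR_scaleR)
  qed
  have dC: "(C has_vector_derivative (\<Sum>l\<in>UNIV. A l *v (c' l - (\<xi> $ l) *\<^sub>R S t)) - B *v C t) (at t within {0..T})"
    using W t bump_function_wave(1)[OF \<kappa>, of \<xi>] unfolding weak_evolution_def C_def[abs_def] pdc[symmetric] by blast
  have dS: "(S has_vector_derivative (\<Sum>l\<in>UNIV. A l *v (s' l + (\<xi> $ l) *\<^sub>R C t)) - B *v S t) (at t within {0..T})"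
    using W t bump_function_wave(2)[OF \<kappa>, of \<xi>] unfolding weak_evolution_def S_def[abs_def] pds[symmetric] by blast
  have "((\<lambda>t. C t - \<i> *s S t) has_vector_derivative
      ((\<Sum>l\<in>UNIV. A l *v (c' l - (\<xi> $ l) *\<^sub>R S t)) - B *v C t) -
      \<i> *s ((\<Sum>l\<in>UNIV. A l *v (s' l + (\<xi> $ l) *\<^sub>R C t)) - B *v S t)) (at t within {0..T})"
    by (intro has_vector_derivative_diff dC bounded_linear.has_vector_derivative[OF cvec.bounded_linear_right dS])
  moreover have "((\<Sum>l\<in>UNIV. A l *v (c' l - (\<xi> $ l) *\<^sub>R S t)) - B *v C t) -
      \<i> *s ((\<Sum>l\<in>UNIV. A l *v (s' l + (\<xi> $ l) *\<^sub>R C t)) - B *v S t) =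
      app (generator A B \<xi>) (C t - \<i> *s S t) + (\<Sum>l\<in>UNIV. A l *v (c' l - \<i> *s s' l))"
  proof -
    have 1: "A l *v (c' l - (\<xi> $ l) *\<^sub>R S t) - \<i> *s (A l *v (s' l + (\<xi> $ l) *\<^sub>R C t)) =
        - (\<i> *s ((\<xi> $ l) *\<^sub>R (A l *v (C t - \<i> *s S t)))) + A l *v (c' l - \<i> *s s' l)" for l
      by (simp add: matrix_vector_mult_diff_distrib matrix_vector_right_distrib vector_scalar_commute
          matrix_vector_scaleR vec_eq_iff algebra_simps)
    have "(\<Sum>l\<in>UNIV. A l *v (c' l - (\<xi> $ l) *\<^sub>R S t)) - \<i> *s (\<Sum>l\<in>UNIV. A l *v (s' l + (\<xi> $ l) *\<^sub>R C t)) =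
        (\<Sum>l\<in>UNIV. A l *v (c' l - (\<xi> $ l) *\<^sub>R S t) - \<i> *s (A l *v (s' l + (\<xi> $ l) *\<^sub>R C t)))"
      by (simp add: sum_subtractf cvec.sum_right)
    also have "\<dots> = - (\<i> *s (\<Sum>l\<in>UNIV. (\<xi> $ l) *\<^sub>R (A l *v (C t - \<i> *s S t)))) + (\<Sum>l\<in>UNIV. A l *v (c' l - \<i> *s s' l))"
      unfolding 1 by (simp add: sum.distrib sum_negf sum_subtractf cvec.sum_right)
    finally have F: "(\<Sum>l\<in>UNIV. A l *v (c' l - (\<xi> $ l) *\<^sub>R S t)) - \<i> *s (\<Sum>l\<in>UNIV. A l *v (s' l + (\<xi> $ l) *\<^sub>R C t)) =
        - (\<i> *s (\<Sum>l\<in>UNIV. (\<xi> $ l) *\<^sub>R (A l *v (C t - \<i> *s S t)))) + (\<Sum>l\<in>UNIV. A l *v (c' l - \<i> *s s' l))" .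
    have G: "app (generator A B \<xi>) (C t - \<i> *s S t) =
        - (\<i> *s (\<Sum>l\<in>UNIV. (\<xi> $ l) *\<^sub>R (A l *v (C t - \<i> *s S t)))) - (B *v C t - \<i> *s (B *v S t))"
      by (simp add: app_generator symbol_vector matrix_vector_mult_diff_distrib[of B] vector_scalar_commute[of B])
    have "(a - x) - (b - y) = (n - (x - y)) + e" if "a - b = n + e" for a b n e x y :: "complex^'n"
      using that by (simp add: algebra_simps)
    from this[OF F] show ?thesis
      unfolding G cvec.diff_right by blast
  qed
  ultimately have "((\<lambda>t. C t - \<i> *s S t) has_vector_derivative
      app (generator A B \<xi>) (mode \<kappa> (W t) \<xi>) + mode_error A \<kappa> (W t) \<xi>) (at t within {0..T})"
    using mode[OF t(1)] error by simp
  then show ?thesis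
    by (rule has_vector_derivative_transform[rotated 2]) (use t mode in auto)
qed

text \<open>The crude factor exp (b T) is harmless: the remainder r will be of order \<epsilon>
  relative to the data, with T and b fixed as \<epsilon> tends to zero.\<close>

lemma duhamel_bound:
  fixes g r :: "real \<Rightarrow> 'a::euclidean_space"
  assumes g: "\<And>t. 0 \<le> t \<Longrightarrow> t \<le> T \<Longrightarrow> (g has_vector_derivative app X (g t) + r t) (at t within {0..T})"
    and r: "continuous_on {0..T} r" and T: "0 \<le> T" and X: "norm X \<le> b"
  shows "norm (g T - app (exp (T *\<^sub>R X)) (g 0)) \<le> exp (b * T) * integral {0..T} (\<lambda>s. norm (r s))"
proof -
  let ?E = "\<lambda>s. exp ((T - s) *\<^sub>R X)"
  have dE: "(?E has_vector_derivative - (?E s * X)) (at s within {0..T})" for s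
  proof -
    have "((\<lambda>r. T - r) has_vector_derivative -1) (at s within {0..T})"
      by (auto intro!: derivative_eq_intros)
    from vector_diff_chain_within[OF this has_vector_derivative_at_within[OF exp_scaleR_has_vector_derivative_right]]
    show ?thesis
      by (simp add: o_def)
  qed
  have "((\<lambda>s. app (?E s) (g s)) has_vector_derivative app (?E s) (r s)) (at s within {0..T})" if "s \<in> {0..T}" for s
  proof -
    have "((\<lambda>s. app (?E s) (g s)) has_vector_derivative (app (?E s) (app X (g s) + r s) + app (- (?E s * X)) (g s))) (at s within {0..T})"
      using that by (intro app.has_vector_derivative dE g) auto
    then show ?thesis
      by (simp add: app.add_right app.minus_left)
  qed
  then have int: "((\<lambda>s. app (?E s) (r s)) has_integral (g T - app (exp (T *\<^sub>R X)) (g 0))) {0..T}"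
    using fundamental_theorem_of_calculus[OF T, of "\<lambda>s. app (?E s) (g s)" "\<lambda>s. app (?E s) (r s)"] by simp
  have "norm (integral {0..T} (\<lambda>s. app (?E s) (r s))) \<le> integral {0..T} (\<lambda>s. exp (b * T) * norm (r s))"
  proof (rule integral_norm_bound_integral)
    show "(\<lambda>s. app (?E s) (r s)) integrable_on {0..T}"
      using int by blast
    show "(\<lambda>s. exp (b * T) * norm (r s)) integrable_on {0..T}"
      by (intro integrable_continuous_real continuous_intros r)
    fix s assume s: "s \<in> {0..T}"
    have "norm (?E s) \<le> exp (norm ((T - s) *\<^sub>R X))"
      by (rule norm_exp)
    also have "\<dots> \<le> exp (b * T)"
    proof -
      have "(T - s) * norm X \<le> T * b"
        using s X by (intro mult_mono) auto
      then show ?thesis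
        using s by (simp add: mult.commute)
    qed
    finally have "norm (?E s) * norm (r s) \<le> exp (b * T) * norm (r s)"
      by (rule mult_right_mono) simp
    then show "norm (app (?E s) (r s)) \<le> exp (b * T) * norm (r s)"
      using norm_app order_trans by blast
  qed
  then show ?thesis
    using int by (simp add: integral_unique)
qed

section \<open>Rescaled cutoffs\<close>

definition scaled_cutoff :: "real \<Rightarrow> real^'d::finite \<Rightarrow> real" where
  "scaled_cutoff \<epsilon> x = cutoff (\<epsilon> *\<^sub>R x)"

lemma bump_function_cutoff: "bump_function (cutoff :: real^'d::finite \<Rightarrow> real)"
  unfolding bump_function_def using smooth_cutoff cutoff_support
  by (auto intro: bounded_subset[OF bounded_cbox])

lemma scaled_cutoff:
  assumes \<epsilon>: "\<epsilon> > 0"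
  shows "bump_function (scaled_cutoff \<epsilon> :: real^'d::finite \<Rightarrow> real)"
    and "pd (scaled_cutoff \<epsilon>) l (x :: real^'d) = \<epsilon> * pd cutoff l (\<epsilon> *\<^sub>R x)"
proof -
  have lin: "bounded_linear (\<lambda>x :: real^'d. \<epsilon> *\<^sub>R x)"
    by (rule bounded_linear_scaleR_right)
  have "smooth (scaled_cutoff \<epsilon> :: real^'d \<Rightarrow> real)"
    unfolding scaled_cutoff_def[abs_def] by (rule smooth_linear[OF smooth_cutoff lin])
  moreover have "bounded {x. scaled_cutoff \<epsilon> (x :: real^'d) \<noteq> 0}"
  proof -
    have "{x. scaled_cutoff \<epsilon> (x :: real^'d) \<noteq> 0} \<subseteq> (\<lambda>x. inverse \<epsilon> *\<^sub>R x) ` cbox (- 1) 1"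
    proof
      fix x :: "real^'d" assume "x \<in> {x. scaled_cutoff \<epsilon> x \<noteq> 0}"
      then have "\<epsilon> *\<^sub>R x \<in> cbox (- 1) 1"
        using cutoff_support by (simp add: scaled_cutoff_def)
      moreover have "x = inverse \<epsilon> *\<^sub>R (\<epsilon> *\<^sub>R x)"
        using \<epsilon> by simp
      ultimately show "x \<in> (\<lambda>x. inverse \<epsilon> *\<^sub>R x) ` cbox (- 1) 1"
        by blast
    qed
    then show ?thesis
      by (rule bounded_subset[OF bounded_scaling[OF bounded_cbox]])
  qed
  ultimately show "bump_function (scaled_cutoff \<epsilon> :: real^'d \<Rightarrow> real)"
    by (simp add: bump_function_def)
  let ?D = "frechet_derivative cutoff (at (\<epsilon> *\<^sub>R x))"
  have "((\<lambda>x. cutoff (\<epsilon> *\<^sub>R x)) has_derivative (\<lambda>h. ?D (\<epsilon> *\<^sub>R h))) (at x)"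
    by (rule has_derivative_compose[OF bounded_linear_imp_has_derivative[OF lin] smooth_has_derivative[OF smooth_cutoff]])
  from pd_has_derivative[OF this, of l] have "pd (scaled_cutoff \<epsilon>) l x = ?D (\<epsilon> *\<^sub>R axis l 1)"
    by (simp add: scaled_cutoff_def[abs_def])
  also have "\<dots> = \<epsilon> * ?D (axis l 1)"
  proof -
    have "linear ?D"
      by (rule has_derivative_linear[OF smooth_has_derivative[OF smooth_cutoff]])
    then show ?thesis
      by (simp add: linear_scale)
  qed
  finally show "pd (scaled_cutoff \<epsilon>) l x = \<epsilon> * pd cutoff l (\<epsilon> *\<^sub>R x)"
    by (simp add: pd_def)
qed

text \<open>Both norms contain \<epsilon>^(-d/2), but the one of the derivative has a further factor
  \<epsilon>. The quotient therefore tends to zero in every dimension.\<close>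

lemma L2_norm_scaled_cutoff:
  assumes \<epsilon>: "\<epsilon> > 0"
  shows "L2_norm (scaled_cutoff \<epsilon> :: real^'d::finite \<Rightarrow> real) = sqrt (inverse (\<epsilon> ^ CARD('d))) * L2_norm (cutoff :: real^'d \<Rightarrow> real)"
    and "L2_norm (pd (scaled_cutoff \<epsilon> :: real^'d \<Rightarrow> real) l) = \<epsilon> * (sqrt (inverse (\<epsilon> ^ CARD('d))) * L2_norm (pd (cutoff :: real^'d \<Rightarrow> real) l))"
proof -
  show "L2_norm (scaled_cutoff \<epsilon> :: real^'d \<Rightarrow> real) = sqrt (inverse (\<epsilon> ^ CARD('d))) * L2_norm (cutoff :: real^'d \<Rightarrow> real)"
    unfolding scaled_cutoff_def[abs_def] using L2_norm_scaled[OF \<epsilon>, of "cutoff :: real^'d \<Rightarrow> real"] by simp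
  have "L2_norm (\<lambda>x. \<epsilon> * f x) = \<epsilon> * L2_norm f" for f :: "real^'d \<Rightarrow> real"
    using \<epsilon> by (simp add: L2_norm_def power_mult_distrib real_sqrt_mult)
  then have "L2_norm (\<lambda>x :: real^'d. \<epsilon> * pd cutoff l (\<epsilon> *\<^sub>R x)) = \<epsilon> * L2_norm (\<lambda>x :: real^'d. pd cutoff l (\<epsilon> *\<^sub>R x))" .
  then show "L2_norm (pd (scaled_cutoff \<epsilon> :: real^'d \<Rightarrow> real) l) = \<epsilon> * (sqrt (inverse (\<epsilon> ^ CARD('d))) * L2_norm (pd (cutoff :: real^'d \<Rightarrow> real) l))"
    using L2_norm_scaled[OF \<epsilon>, of "pd (cutoff :: real^'d \<Rightarrow> real) l"]
    by (simp add: scaled_cutoff(2)[OF \<epsilon>, abs_def])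
qed

lemma L2_norm_cutoff_pos: "0 < L2_norm (cutoff :: real^'d::finite \<Rightarrow> real)"
proof -
  have "L2_norm (cutoff :: real^'d \<Rightarrow> real) \<noteq> 0"
  proof
    assume "L2_norm (cutoff :: real^'d \<Rightarrow> real) = 0"
    then have "sq_norm (cutoff :: real^'d \<Rightarrow> real) = 0"
      using sq_norm_L2_norm[OF bump_function_L2[OF bump_function_cutoff[where 'd = 'd]]] by simp
    then have "AE x in lborel. cutoff (x :: real^'d) = 0"
      using square_integrable_measurable[OF bump_function_L2[OF bump_function_cutoff[where 'd = 'd]]] by (simp add: sq_norm_eq_0)
    moreover have "open {x :: real^'d. cutoff x \<noteq> 0}"
      by (rule open_Collect_neq[OF smooth_continuous[OF smooth_cutoff] continuous_on_const])
    moreover have "cutoff (0 :: real^'d) \<noteq> 0"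
      by (simp add: cutoff_0)
    ultimately obtain e where e: "0 < e" "ball (0 :: real^'d) e \<subseteq> {x. cutoff x \<noteq> 0}"
      and null: "{x :: real^'d. cutoff x \<noteq> 0} \<in> null_sets lborel"
      using AE_iff_null[of lborel "\<lambda>x :: real^'d. cutoff x = 0"]
      by (auto simp: open_contains_ball dest: borel_open)
    have "ball (0 :: real^'d) e \<in> null_sets lborel"
      by (rule null_sets_subset[OF null _ e(2)]) simp
    then have "negligible (ball (0 :: real^'d) e)"
      by (simp add: negligible_iff_null_sets null_sets_completionI)
    then show False
      using open_not_negligible[of "ball (0 :: real^'d) e"] e(1) by simp
  qed
  then show ?thesis
    using L2_norm_nonneg order_le_less by metis
qed

section \<open>Growth of the symbol of a strongly well posed problem\<close>

lemma norm_mode_error_le: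
  assumes \<kappa>: "bump_function \<kappa>" and u: "square_integrable u"
  shows "norm (mode_error A \<kappa> u \<xi>) \<le> (\<Sum>l\<in>UNIV. norm (op (A l)) * L2_norm (pd \<kappa> l)) * L2_norm u"
proof -
  have "norm (A l *v mode (pd \<kappa> l) u \<xi>) \<le> norm (op (A l)) * (L2_norm (pd \<kappa> l) * L2_norm u)" for l
  proof -
    have "norm (A l *v mode (pd \<kappa> l) u \<xi>) \<le> norm (op (A l)) * norm (mode (pd \<kappa> l) u \<xi>)"
      using norm_app[of "op (A l)"] by (simp add: app_op)
    also have "\<dots> \<le> norm (op (A l)) * (L2_norm (pd \<kappa> l) * L2_norm u)"
      by (intro mult_left_mono norm_mode_le bump_function_pd(3) \<kappa> u norm_ge_zero)
    finally show ?thesis .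
  qed
  then have "norm (mode_error A \<kappa> u \<xi>) \<le> (\<Sum>l\<in>UNIV. norm (op (A l)) * (L2_norm (pd \<kappa> l) * L2_norm u))"
    unfolding mode_error_def by (intro order_trans[OF norm_sum] sum_mono)
  then show ?thesis
    by (simp add: sum_distrib_right mult.assoc)
qed

definition wave_packet :: "(real^'d::finite \<Rightarrow> real) \<Rightarrow> real^'d \<Rightarrow> complex^'n::finite \<Rightarrow> real^'d \<Rightarrow> complex^'n" where
  "wave_packet \<kappa> \<xi> v x = \<kappa> x *\<^sub>R (cis (\<xi> \<bullet> x) *s v)"

lemma wave_packet:
  assumes \<kappa>: "square_integrable \<kappa>"
  shows "square_integrable (wave_packet \<kappa> \<xi> v)" "L2_norm (wave_packet \<kappa> \<xi> v) = L2_norm \<kappa> * norm v"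
    "mode \<kappa> (wave_packet \<kappa> \<xi> v) \<xi> = (L2_norm \<kappa>)\<^sup>2 *\<^sub>R v"
proof -
  note [measurable] = square_integrable_measurable[OF \<kappa>]
  have n: "norm (wave_packet \<kappa> \<xi> v x) = \<bar>\<kappa> x\<bar> * norm v" for x
    by (simp add: wave_packet_def)
  show "square_integrable (wave_packet \<kappa> \<xi> v)"
    by (rule square_integrable_bound[OF \<kappa>, where C = "norm v"]) (simp_all add: n mult.commute, simp add: wave_packet_def[abs_def])
  show "L2_norm (wave_packet \<kappa> \<xi> v) = L2_norm \<kappa> * norm v"
    by (simp add: L2_norm_def n power_mult_distrib real_sqrt_mult)
  have int: "integrable lborel (\<lambda>x. (norm (\<kappa> x))\<^sup>2)"
    using \<kappa> by (simp add: square_integrable_def)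
  have "cis (- (\<xi> \<bullet> x)) *s (\<kappa> x *\<^sub>R wave_packet \<kappa> \<xi> v x) = (norm (\<kappa> x))\<^sup>2 *\<^sub>R v" for x
  proof -
    have "cis (- (\<xi> \<bullet> x)) * cis (\<xi> \<bullet> x) = 1"
      by (simp add: cis_mult)
    then have "cis (- (\<xi> \<bullet> x)) * (cis (\<xi> \<bullet> x) * z) = z" for z
      by (simp flip: mult.assoc)
    then show ?thesis
      by (simp add: vec_eq_iff wave_packet_def power2_eq_square)
  qed
  then have "mode \<kappa> (wave_packet \<kappa> \<xi> v) \<xi> = (LINT x|lborel. (norm (\<kappa> x))\<^sup>2) *\<^sub>R v"
    using int by (simp add: mode_def del: real_norm_def)
  also have "(LINT x|lborel. (norm (\<kappa> x))\<^sup>2) = (L2_norm \<kappa>)\<^sup>2"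
    by (simp add: L2_norm_def)
  finally show "mode \<kappa> (wave_packet \<kappa> \<xi> v) \<xi> = (L2_norm \<kappa>)\<^sup>2 *\<^sub>R v" .
qed

lemma sobolev_weighted_0: "sobolev_weighted 0 f = fourier f"
  by (rule ext) (simp add: sobolev_weighted_def add_nonneg_eq_0_iff)

lemma in_sobolev_0:
  assumes "square_integrable f"
  shows "in_sobolev 0 f" "sobolev_norm 0 f \<le> sqrt 2 * L2_norm f"
proof -
  note f = is_fourier_fourier[OF assms]
  show "in_sobolev 0 f"
    using assms f is_fourierD(2)[OF f] by (auto simp: in_sobolev_def sobolev_weighted_0)
  have "sq_norm (fourier f) \<le> ennreal ((sqrt 2 * L2_norm f)\<^sup>2)"
    using is_fourier_bound[OF f]
    by (simp add: sq_norm_L2_norm[OF assms] power_mult_distrib ennreal_mult)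
  then show "sobolev_norm 0 f \<le> sqrt 2 * L2_norm f"
    unfolding sobolev_norm_def sobolev_weighted_0
    by (intro L2_norm_le square_integrable_measurable is_fourierD(2)[OF f] mult_nonneg_nonneg L2_norm_nonneg) auto
qed

lemma continuous_mode:
  assumes W: "continuous_L2 W" and \<kappa>: "bump_function \<kappa>"
  shows "continuous_on {0..T} (\<lambda>t. mode_error A \<kappa> (W t) \<xi>)"
proof -
  have "continuous_on {0..} (\<lambda>t. mode (pd \<kappa> l) (W t) \<xi>)" for l
  proof -
    note pd2 = bump_function_pd(3)[OF \<kappa>, of l]
    have "continuous_on {0..} (\<lambda>t. (LINT x|lborel. (pd \<kappa> l x * cos (\<xi> \<bullet> x)) *\<^sub>R W t x) - \<i> *s (LINT x|lborel. (pd \<kappa> l x * sin (\<xi> \<bullet> x)) *\<^sub>R W t x))"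
      by (intro continuous_intros bounded_linear.continuous_on[OF cvec.bounded_linear_right]
          continuous_on_pairing[OF W] square_integrable_wave pd2)
    then show ?thesis
      by (rule continuous_on_eq) (simp add: mode_eq[OF pd2 continuous_L2D(1)[OF W]])
  qed
  then have "continuous_on {0..T} (\<lambda>t. mode (pd \<kappa> l) (W t) \<xi>)" for l
    by (rule continuous_on_subset) auto
  then show ?thesis
    unfolding mode_error_def
    by (intro continuous_on_sum bounded_linear.continuous_on[OF matrix_vector_mul_bounded_linear])
qed

lemma well_posed_growth:
  fixes A :: "'d::finite \<Rightarrow> complex^'n^'n::finite"
  assumes wp: "well_posed 0 A (\<lambda>_. B)"
  obtains K \<alpha> where "0 < K" "\<And>\<xi> t. 0 \<le> t \<Longrightarrow> norm (exp (t *\<^sub>R generator A B \<xi>)) \<le> K * exp (\<alpha> * t)"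
proof -
  obtain K0 \<alpha>0 where K0: "K0 > 0" and sol: "\<And>u0. in_sobolev 0 u0 \<Longrightarrow>
      \<exists>U. cauchy_solution A (\<lambda>_. B) u0 U \<and> (\<forall>t\<ge>0. L2_norm (U t) \<le> K0 * exp (\<alpha>0 * t) * sobolev_norm 0 (U 0))"
    using wp unfolding well_posed_def by meson
  \<comment> \<open>Made nonnegative, so that the bound at time T holds on all of [0, T].\<close>
  define \<alpha> where "\<alpha> = max \<alpha>0 0"
  \<comment> \<open>The 1 covers t = 0; sqrt 2 is the loss between the Sobolev norm of order zero
    and the norm of square integrable functions.\<close>
  define K where "K = max 1 (sqrt 2 * K0)"
  \<comment> \<open>The size of the derivatives of the unscaled cutoff relative to the cutoff,
    weighted by the norms of the coefficients.\<close>
  define D where "D = (\<Sum>l\<in>UNIV. norm (op (A l)) * L2_norm (pd (cutoff :: real^'d \<Rightarrow> real) l)) / L2_norm (cutoff :: real^'d \<Rightarrow> real)"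
  have c0: "0 < L2_norm (cutoff :: real^'d \<Rightarrow> real)"
    by (rule L2_norm_cutoff_pos)
  have K1: "1 \<le> K" "sqrt 2 * K0 \<le> K"
    by (auto simp: K_def)
  \<comment> \<open>The datum is a wave packet of width 1 / \<epsilon>. The term with D is the
    commutator error, of order \<epsilon> for fixed T and \<xi>.\<close>
  have step: "norm (app (exp (T *\<^sub>R generator A B \<xi>)) v) \<le> K * exp (\<alpha> * T) * norm v * (1 + \<epsilon> * (exp (norm (generator A B \<xi>) * T) * T * D))"
    if T: "0 < T" and \<epsilon>: "0 < \<epsilon>" for T \<xi> v \<epsilon>
  proof -
    let ?\<kappa> = "scaled_cutoff \<epsilon> :: real^'d \<Rightarrow> real" and ?X = "generator A B \<xi>"
    let ?u = "wave_packet ?\<kappa> \<xi> v"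
    define c where "c = L2_norm ?\<kappa>"
    have c: "0 < c" and cD: "(\<Sum>l\<in>UNIV. norm (op (A l)) * L2_norm (pd ?\<kappa> l)) = \<epsilon> * D * c"
    proof -
      define s where "s = sqrt (inverse (\<epsilon> ^ CARD('d)))"
      have s: "0 < s"
        using \<epsilon> by (simp add: s_def)
      have cs: "c = s * L2_norm (cutoff :: real^'d \<Rightarrow> real)"
        unfolding c_def s_def by (rule L2_norm_scaled_cutoff(1)[OF \<epsilon>])
      show "0 < c"
        using s c0 by (simp add: cs)
      show "(\<Sum>l\<in>UNIV. norm (op (A l)) * L2_norm (pd ?\<kappa> l)) = \<epsilon> * D * c"
      proof -
        have "(\<Sum>l\<in>UNIV. norm (op (A l)) * L2_norm (pd ?\<kappa> l)) =
            \<epsilon> * s * (\<Sum>l\<in>UNIV. norm (op (A l)) * L2_norm (pd (cutoff :: real^'d \<Rightarrow> real) l))"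
          unfolding L2_norm_scaled_cutoff(2)[OF \<epsilon>] s_def[symmetric] by (simp add: sum_distrib_left mult_ac)
        then show ?thesis
          using c0 by (simp add: cs D_def)
      qed
    qed
    note \<kappa> = scaled_cutoff(1)[OF \<epsilon>, where 'd = 'd]
    note \<kappa>2 = bump_function_L2[OF \<kappa>]
    note u = wave_packet[OF \<kappa>2, of \<xi> v, folded c_def]
    obtain U where U: "cauchy_solution A (\<lambda>_. B) ?u U"
      and le: "\<And>t. 0 \<le> t \<Longrightarrow> L2_norm (U t) \<le> K0 * exp (\<alpha>0 * t) * sobolev_norm 0 (U 0)"
      using sol[OF in_sobolev_0(1)[OF u(1)]] by blast
    have cU: "continuous_L2 U" and U0: "AE x in lborel. U 0 x = ?u x" and dU: "distributional_solution A (\<lambda>_. B) U"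
      using U by (auto simp: cauchy_solution_def)
    note ev = distributional_solution_weak_evolution[OF cU dU]
    note U2 = continuous_L2D(1)[OF cU]
    have meas: "U 0 \<in> borel_measurable borel" "?u \<in> borel_measurable borel"
      using U2[of 0] u(1) by (auto intro: square_integrable_measurable)
    \<comment> \<open>The estimate in the definition refers to the representative U 0, which agrees
      with the packet only almost everywhere.\<close>
    have "sobolev_norm 0 (U 0) = sobolev_norm 0 ?u"
      by (simp add: sobolev_norm_def sobolev_weighted_0 fourier_cong[OF U0 meas])
    also have "\<dots> \<le> sqrt 2 * (c * norm v)"
      using in_sobolev_0(2)[OF u(1)] by (simp add: u(2))
    finally have s0: "sobolev_norm 0 (U 0) \<le> sqrt 2 * (c * norm v)" .
    define M where "M = K * exp (\<alpha> * T) * (c * norm v)"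
    have M0: "0 \<le> M"
      using K1 c by (simp add: M_def)
    have M: "L2_norm (U t) \<le> M" if t: "0 \<le> t" "t \<le> T" for t
    proof -
      have "\<alpha>0 * t \<le> \<alpha> * T"
      proof -
        have "\<alpha>0 * t \<le> \<alpha> * t" using t by (intro mult_right_mono) (auto simp: \<alpha>_def)
        also have "\<dots> \<le> \<alpha> * T" using t by (intro mult_left_mono) (auto simp: \<alpha>_def)
        finally show ?thesis .
      qed
      have "L2_norm (U t) \<le> K0 * exp (\<alpha>0 * t) * sobolev_norm 0 (U 0)"
        by (rule le[OF t(1)])
      also have "\<dots> \<le> K0 * exp (\<alpha> * T) * (sqrt 2 * (c * norm v))"
        using \<open>\<alpha>0 * t \<le> \<alpha> * T\<close> K0 s0 by (intro mult_mono) (auto simp: sobolev_norm_def L2_norm_nonneg)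
      also have "\<dots> = (sqrt 2 * K0) * (exp (\<alpha> * T) * (c * norm v))"
        by simp
      also have "\<dots> \<le> K * (exp (\<alpha> * T) * (c * norm v))"
        using K1(2) c by (intro mult_right_mono) auto
      finally show ?thesis
        by (simp add: M_def mult.assoc)
    qed
    let ?g = "\<lambda>t. mode ?\<kappa> (U t) \<xi>" and ?r = "\<lambda>t. mode_error A ?\<kappa> (U t) \<xi>"
    have g0: "?g 0 = c\<^sup>2 *\<^sub>R v"
    proof -
      have [measurable]: "?\<kappa> \<in> borel_measurable borel" "U 0 \<in> borel_measurable borel" "?u \<in> borel_measurable borel"
        using square_integrable_measurable[OF \<kappa>2] meas by auto
      have "?g 0 = mode ?\<kappa> ?u \<xi>"
        unfolding mode_def by (rule integral_cong_AE) (measurable, use U0 in eventually_elim, simp)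
      then show ?thesis
        using u(3) by simp
    qed
    have r: "norm (?r t) \<le> \<epsilon> * D * c * M" if "0 \<le> t" "t \<le> T" for t
    proof -
      have "norm (?r t) \<le> \<epsilon> * D * c * L2_norm (U t)"
        using norm_mode_error_le[OF \<kappa> U2[OF that(1)], of A \<xi>] by (simp only: cD)
      also have "\<dots> \<le> \<epsilon> * D * c * M"
        using M[OF that] \<epsilon> c c0 by (intro mult_left_mono) (auto simp: D_def intro!: sum_nonneg divide_nonneg_pos mult_nonneg_nonneg L2_norm_nonneg)
      finally show ?thesis .
    qed
    have cr: "continuous_on {0..T} ?r"
      by (rule continuous_mode[OF cU \<kappa>])
    have "integral {0..T} (\<lambda>s. norm (?r s)) \<le> integral {0..T} (\<lambda>s. \<epsilon> * D * c * M)"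
      using r by (intro Henstock_Kurzweil_Integration.integral_le integrable_continuous_real continuous_intros cr) auto
    then have int: "integral {0..T} (\<lambda>s. norm (?r s)) \<le> T * (\<epsilon> * D * c * M)"
      using T by (simp add: mult_ac)
    have "norm (?g T - app (exp (T *\<^sub>R ?X)) (?g 0)) \<le> exp (norm ?X * T) * integral {0..T} (\<lambda>s. norm (?r s))"
      using T by (intro duhamel_bound mode_has_vector_derivative ev \<kappa> cr) auto
    also have "\<dots> \<le> exp (norm ?X * T) * (T * (\<epsilon> * D * c * M))"
      by (intro mult_left_mono int) simp
    finally have d: "norm (?g T - app (exp (T *\<^sub>R ?X)) (?g 0)) \<le> exp (norm ?X * T) * (T * (\<epsilon> * D * c * M))" .
    have "c * L2_norm (U T) \<le> c * M"
      using M[of T] T c by (intro mult_left_mono) auto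
    then have gT: "norm (?g T) \<le> c * M"
      using norm_mode_le[OF \<kappa>2 U2[of T], of \<xi>] T by (simp add: c_def)
    \<comment> \<open>The initial mode is c^2 v, and both terms on the right contain c M with M
      proportional to c; so c cancels, although it tends to infinity as \<epsilon> tends to
      zero.\<close>
    have "c\<^sup>2 * norm (app (exp (T *\<^sub>R ?X)) v) = norm (app (exp (T *\<^sub>R ?X)) (?g 0))"
      by (simp add: g0 app.scaleR_right)
    also have "\<dots> \<le> norm (?g T) + norm (?g T - app (exp (T *\<^sub>R ?X)) (?g 0))"
      using norm_triangle_ineq4[of "?g T" "?g T - app (exp (T *\<^sub>R ?X)) (?g 0)"] by simp
    also have "\<dots> \<le> c * M + exp (norm ?X * T) * (T * (\<epsilon> * D * c * M))"
      by (rule add_mono[OF gT d])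
    also have "\<dots> = c\<^sup>2 * (K * exp (\<alpha> * T) * norm v * (1 + \<epsilon> * (exp (norm ?X * T) * T * D)))"
      by (simp add: M_def power2_eq_square algebra_simps)
    finally show ?thesis
      using c by simp
  qed
  have "norm (exp (t *\<^sub>R generator A B \<xi>)) \<le> K * exp (\<alpha> * t)" if t: "0 \<le> t" for \<xi> t
  proof (cases "t = 0")
    case True
    have "norm (1 :: (complex^'n) endo) \<le> 1"
      by (rule norm_endo_bound) (simp_all add: app_one)
    then show ?thesis
      using True K1 by simp
  next
    case False
    with t have T: "0 < t" by simp
    show ?thesis
    proof (rule norm_endo_bound)
      show "0 \<le> K * exp (\<alpha> * t)"
        using K1 by simp
      fix v :: "complex^'n"
      let ?c = "K * exp (\<alpha> * t) * norm v" and ?e = "exp (norm (generator A B \<xi>) * t) * t * D"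
      \<comment> \<open>With t, \<xi> and v fixed, the error disappears in the limit.\<close>
      have "((\<lambda>\<epsilon>. ?c * (1 + \<epsilon> * ?e)) \<longlongrightarrow> ?c * (1 + 0 * ?e)) (at_right 0)"
        by (intro tendsto_intros)
      moreover have "\<forall>\<^sub>F \<epsilon> in at_right 0. norm (app (exp (t *\<^sub>R generator A B \<xi>)) v) \<le> ?c * (1 + \<epsilon> * ?e)"
        using step[OF T] by (auto simp: eventually_at_right_field intro: exI[of _ 1])
      ultimately show "norm (app (exp (t *\<^sub>R generator A B \<xi>)) v) \<le> ?c"
        using tendsto_lowerbound[of "\<lambda>\<epsilon>. ?c * (1 + \<epsilon> * ?e)" ?c "at_right 0"] by simp
    qed
  qed
  then show thesis
    using that[of K \<alpha>] K1 by auto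
qed

text \<open>Frequency \<xi> / r at time t r is the same as frequency \<xi> at time t with r B in
  place of B; the limit r = 0 removes B and the exponential factor together.\<close>

lemma rescaled_growth:
  fixes A :: "'d::finite \<Rightarrow> complex^'n^'n::finite"
  assumes K: "\<And>\<xi> t. 0 \<le> t \<Longrightarrow> norm (exp (t *\<^sub>R generator A B \<xi>)) \<le> K * exp (\<alpha> * t)"
  shows "bounded_group A K"
  unfolding bounded_group_def
proof (intro allI impI)
  fix \<xi> :: "real^'d" and t :: real assume t: "0 \<le> t"
  have "((\<lambda>r. exp (t *\<^sub>R (generator A 0 \<xi> + r *\<^sub>R op (- B)))) \<longlongrightarrow> exp (t *\<^sub>R (generator A 0 \<xi> + 0 *\<^sub>R op (- B)))) (at_right 0)"
    by (intro continuous_on_tendsto_compose[OF continuous_exp] tendsto_intros) auto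
  then have 1: "((\<lambda>r. norm (exp (t *\<^sub>R (generator A 0 \<xi> + r *\<^sub>R op (- B))))) \<longlongrightarrow> norm (exp (t *\<^sub>R generator A 0 \<xi>))) (at_right 0)"
    by (intro tendsto_norm) simp
  have "((\<lambda>r. K * exp (\<alpha> * (t * r))) \<longlongrightarrow> K * exp (\<alpha> * (t * 0))) (at_right 0)"
    by (intro tendsto_intros)
  then have 2: "((\<lambda>r. K * exp (\<alpha> * (t * r))) \<longlongrightarrow> K) (at_right 0)"
    by simp
  have "norm (exp (t *\<^sub>R (generator A 0 \<xi> + r *\<^sub>R op (- B)))) \<le> K * exp (\<alpha> * (t * r))" if r: "0 < r" for r
  proof -
    have "t *\<^sub>R (generator A 0 \<xi> + r *\<^sub>R op (- B)) = (t * r) *\<^sub>R generator A B (inverse r *\<^sub>R \<xi>)"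
      unfolding generator_add[of A B] using r by (simp add: generator_scale algebra_simps)
    then show ?thesis
      using K[of "t * r" "inverse r *\<^sub>R \<xi>"] t r by simp
  qed
  then have 3: "\<forall>\<^sub>F r in at_right 0. norm (exp (t *\<^sub>R (generator A 0 \<xi> + r *\<^sub>R op (- B)))) \<le> K * exp (\<alpha> * (t * r))"
    by (auto simp: eventually_at_right_field intro: exI[of _ 1])
  show "norm (exp (t *\<^sub>R generator A 0 \<xi>)) \<le> K"
    by (rule tendsto_le[OF _ 2 1 3]) simp
qed

section \<open>Uniqueness of weak solutions\<close>

text \<open>The integral of (h - m)^2 is nonnegative, m being the mean of h.\<close>

lemma integral_square_le:
  fixes h :: "real \<Rightarrow> real"
  assumes h: "continuous_on {0..T} h" and T: "0 < T"
  shows "(integral {0..T} h)\<^sup>2 \<le> T * integral {0..T} (\<lambda>s. (h s)\<^sup>2)"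
proof -
  let ?I = "integral {0..T} h" and ?J = "integral {0..T} (\<lambda>s. (h s)\<^sup>2)"
  define m where "m = ?I / T"
  have int: "h integrable_on {0..T}" "(\<lambda>s. (h s)\<^sup>2) integrable_on {0..T}"
    by (intro integrable_continuous_real continuous_intros h)+
  have "0 \<le> integral {0..T} (\<lambda>s. (h s - m)\<^sup>2)"
    by (rule Henstock_Kurzweil_Integration.integral_nonneg) (intro integrable_continuous_real continuous_intros h, simp)
  also have "integral {0..T} (\<lambda>s. (h s - m)\<^sup>2) = integral {0..T} (\<lambda>s. (h s)\<^sup>2 - 2 * m * h s + m\<^sup>2)"
    by (simp add: power2_diff algebra_simps)
  also have "\<dots> = ?J - 2 * m * ?I + T * m\<^sup>2"
  proof -
    have "((\<lambda>s. (h s)\<^sup>2 - 2 * m * h s + m\<^sup>2) has_integral (?J - 2 * m * ?I + T * m\<^sup>2)) {0..T}"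
      using has_integral_const_real[of "m\<^sup>2" 0 T] T
      by (intro has_integral_add has_integral_diff has_integral_mult_right integrable_integral int) auto
    then show ?thesis by (rule integral_unique)
  qed
  finally have "0 \<le> T * (?J - 2 * m * ?I + T * m\<^sup>2)"
    using T by simp
  moreover have "T * (?J - 2 * m * ?I + T * m\<^sup>2) = T * ?J - ?I\<^sup>2"
    using T by (simp add: m_def power2_eq_square field_simps)
  ultimately show ?thesis by simp
qed

lemma mode_FT: "mode \<kappa> u = (\<lambda>\<xi>. inverse (fourier_const TYPE('d)) *\<^sub>R FT (\<lambda>x. \<kappa> x *\<^sub>R u x) (\<xi> :: real^'d::finite))"
  by (rule ext) (simp add: mode_def FT_def)

lemma mode_error_FT:
  fixes A :: "'d::finite \<Rightarrow> complex^'n^'n" and u :: "real^'d::finite \<Rightarrow> complex^'n::finite"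
  assumes \<kappa>: "bump_function \<kappa>" and u: "square_integrable u"
  defines "E \<equiv> \<lambda>x. \<Sum>l\<in>UNIV. A l *v (pd \<kappa> l x *\<^sub>R u x)"
  shows "mode_error A \<kappa> u = (\<lambda>\<xi>. inverse (fourier_const TYPE('d)) *\<^sub>R FT E \<xi>)" "integrable lborel E"
proof -
  have i: "integrable lborel (\<lambda>x. pd \<kappa> l x *\<^sub>R u x)" for l
    by (rule integrable_scaleR_L2[OF bump_function_pd(3)[OF \<kappa>] u])
  show "integrable lborel E"
    unfolding E_def by (intro Bochner_Integration.integrable_sum integrable_bounded_linear[OF matrix_vector_mul_bounded_linear i])
  show "mode_error A \<kappa> u = (\<lambda>\<xi>. inverse (fourier_const TYPE('d)) *\<^sub>R FT E \<xi>)"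
  proof
    fix \<xi> :: "real^'d"
    have c: "integrable lborel (\<lambda>x. cis (- (\<xi> \<bullet> x)) *s (pd \<kappa> l x *\<^sub>R u x))" for l
      by (rule integrable_cis_scale[OF i]) measurable
    have "(LINT x|lborel. cis (- (\<xi> \<bullet> x)) *s E x) = (LINT x|lborel. (\<Sum>l\<in>UNIV. A l *v (cis (- (\<xi> \<bullet> x)) *s (pd \<kappa> l x *\<^sub>R u x))))"
      unfolding E_def by (simp add: cvec.sum_right vector_scalar_commute)
    also have "\<dots> = mode_error A \<kappa> u \<xi>"
      unfolding mode_error_def mode_def
      using integrable_bounded_linear[OF matrix_vector_mul_bounded_linear c]
      by (subst Bochner_Integration.integral_sum) (auto simp: integral_matrix_vector[OF c])
    finally show "mode_error A \<kappa> u \<xi> = inverse (fourier_const TYPE('d)) *\<^sub>R FT E \<xi>"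
      by (simp add: FT_def)
  qed
qed

text \<open>Here the derivative of the cutoff is bounded in the supremum norm, which is of order
  \<epsilon> in every dimension, and the transform is bounded by \<open>sq_norm_FT\<close>. So P
  serves all \<epsilon>.\<close>

lemma mode_error_L2:
  fixes A :: "'d::finite \<Rightarrow> complex^'n^'n::finite"
  obtains P where "0 \<le> P" "\<And>\<epsilon> u. 0 < \<epsilon> \<Longrightarrow> square_integrable u \<Longrightarrow>
    sq_norm (mode_error A (scaled_cutoff \<epsilon>) u) \<le> ennreal ((\<epsilon> * P)\<^sup>2) * sq_norm u"
proof -
  note cut = bump_function_cutoff[where 'd = 'd]
  have "\<exists>p\<ge>0. \<forall>x :: real^'d. norm (pd cutoff l x) \<le> p" for l
    by (rule compactly_supported_bounded[OF bump_function_pd(1,2)[OF cut]])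
  then obtain p where p: "\<And>l. 0 \<le> p l" "\<And>l x. norm (pd cutoff l (x :: real^'d)) \<le> p l"
    by metis
  let ?c = "inverse (fourier_const TYPE('d))"
  define Q where "Q = (\<Sum>l\<in>UNIV. norm (op (A l)) * p l)"
  have Q: "0 \<le> Q"
    unfolding Q_def by (intro sum_nonneg mult_nonneg_nonneg p norm_ge_zero)
  show thesis
  proof (rule that[of "?c * Q"])
    show "0 \<le> ?c * Q"
      using Q by simp
    fix \<epsilon> :: real and u :: "real^'d \<Rightarrow> complex^'n"
    assume \<epsilon>: "0 < \<epsilon>" and u: "square_integrable u"
    note \<kappa> = scaled_cutoff(1)[OF \<epsilon>, where 'd = 'd]
    define E where "E x = (\<Sum>l\<in>UNIV. A l *v (pd (scaled_cutoff \<epsilon>) l x *\<^sub>R u x))" for x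
    note ef = mode_error_FT[OF \<kappa> u, of A, folded E_def[abs_def]]
    have "norm (E x) \<le> (\<epsilon> * Q) * norm (u x)" for x
    proof -
      have "norm (A l *v (pd (scaled_cutoff \<epsilon>) l x *\<^sub>R u x)) \<le> norm (op (A l)) * (\<epsilon> * p l * norm (u x))" for l
      proof -
        have "norm (A l *v (pd (scaled_cutoff \<epsilon>) l x *\<^sub>R u x)) \<le> norm (op (A l)) * norm (pd (scaled_cutoff \<epsilon>) l x *\<^sub>R u x)"
          using norm_app[of "op (A l)"] unfolding app_op .
        also have "norm (pd (scaled_cutoff \<epsilon>) l x *\<^sub>R u x) \<le> \<epsilon> * p l * norm (u x)"
          using p(2)[of l "\<epsilon> *\<^sub>R x"] \<epsilon> by (simp add: scaled_cutoff(2)[OF \<epsilon>] abs_mult mult_mono)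
        finally show ?thesis
          by (simp add: mult_left_mono)
      qed
      then have "norm (E x) \<le> (\<Sum>l\<in>UNIV. norm (op (A l)) * (\<epsilon> * p l * norm (u x)))"
        unfolding E_def by (intro order_trans[OF norm_sum] sum_mono)
      then show ?thesis
        by (simp add: Q_def sum_distrib_left sum_distrib_right mult_ac)
    qed
    then have "sq_norm E \<le> ennreal ((\<epsilon> * Q)\<^sup>2) * sq_norm u"
      by (rule sq_norm_le_mult[OF square_integrable_measurable[OF u]])
    then have "sq_norm (FT E) \<le> ennreal ((\<epsilon> * Q)\<^sup>2) * sq_norm u"
      using sq_norm_FT[OF ef(2)] by (rule order_trans[rotated])
    moreover have "sq_norm (mode_error A (scaled_cutoff \<epsilon>) u) \<le> ennreal (?c\<^sup>2) * sq_norm (FT E)"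
      unfolding ef(1) by (rule sq_norm_le_mult[OF FT_measurable[OF ef(2)]]) simp
    ultimately have "sq_norm (mode_error A (scaled_cutoff \<epsilon>) u) \<le> ennreal (?c\<^sup>2) * (ennreal ((\<epsilon> * Q)\<^sup>2) * sq_norm u)"
      by (meson mult_left_mono order_trans zero_le)
    also have "\<dots> = ennreal ((\<epsilon> * (?c * Q))\<^sup>2) * sq_norm u"
    proof -
      have "ennreal (?c\<^sup>2) * ennreal ((\<epsilon> * Q)\<^sup>2) = ennreal ((\<epsilon> * (?c * Q))\<^sup>2)"
        by (subst ennreal_mult[symmetric]) (simp_all add: power_mult_distrib mult_ac)
      then show ?thesis
        by (simp only: mult.assoc[symmetric])
    qed
    finally show "sq_norm (mode_error A (scaled_cutoff \<epsilon>) u) \<le> ennreal ((\<epsilon> * (?c * Q))\<^sup>2) * sq_norm u" .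
  qed
qed

text \<open>The representatives W t are chosen separately for each t, so W itself may fail to be
  measurable in (t, x). Its modes are jointly continuous in (t, \<xi>), which provides the
  measurability for Fubini's theorem.\<close>

lemma continuous_mode_pair:
  fixes W :: "real \<Rightarrow> real^'d::finite \<Rightarrow> complex^'n::finite"
  assumes W: "continuous_L2 W" and f: "square_integrable f"
  shows "continuous_on UNIV (\<lambda>p. mode f (W (max 0 (fst p))) (snd p))"
  unfolding continuous_on_def
proof
  fix p0 :: "real \<times> (real^'d)"
  define t0 where "t0 = max 0 (fst p0)"
  have t0: "0 \<le> t0"
    by (simp add: t0_def)
  note W2 = continuous_L2D(1)[OF W]
  let ?b = "\<lambda>p. L2_norm f * L2_norm (\<lambda>x. W (max 0 (fst p)) x - W t0 x) + norm (mode f (W t0) (snd p) - mode f (W t0) (snd p0))"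
  have le: "norm (mode f (W (max 0 (fst p))) (snd p) - mode f (W t0) (snd p0)) \<le> ?b p" for p
  proof -
    let ?W = "W (max 0 (fst p))"
    have d: "square_integrable (\<lambda>x. ?W x - W t0 x)"
      by (intro square_integrable_diff W2 t0) simp
    have "mode f (\<lambda>x. ?W x - W t0 x) (snd p) = mode f ?W (snd p) - mode f (W t0) (snd p)"
    proof -
      have "integrable lborel (\<lambda>x. cis (- (snd p \<bullet> x)) *s (f x *\<^sub>R ?W x))" "integrable lborel (\<lambda>x. cis (- (snd p \<bullet> x)) *s (f x *\<^sub>R W t0 x))"
        by (intro integrable_cis_scale integrable_scaleR_L2 f W2 t0, simp, measurable)+
      then show ?thesis
        by (simp add: mode_def scaleR_diff_right cvec.diff_right)
    qed
    then have "norm (mode f ?W (snd p) - mode f (W t0) (snd p)) \<le> L2_norm f * L2_norm (\<lambda>x. ?W x - W t0 x)"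
      using norm_mode_le[OF f d, of "snd p"] by simp
    then show ?thesis
      using norm_triangle_ineq[of "mode f ?W (snd p) - mode f (W t0) (snd p)" "mode f (W t0) (snd p) - mode f (W t0) (snd p0)"]
      by simp
  qed
  have "(?b \<longlongrightarrow> L2_norm f * 0 + 0) (at p0)"
  proof (intro tendsto_add tendsto_mult tendsto_const)
    have "continuous (at t0 within {0..}) (\<lambda>t. L2_norm (\<lambda>x. W t x - W t0 x))"
      using continuous_L2D(2)[OF W t0] by (simp add: continuous_within L2_norm_def)
    moreover have "((\<lambda>p. max 0 (fst p)) \<longlongrightarrow> t0) (at p0)"
      unfolding t0_def by (intro tendsto_intros)
    ultimately have "((\<lambda>p. L2_norm (\<lambda>x. W (max 0 (fst p)) x - W t0 x)) \<longlongrightarrow> L2_norm (\<lambda>x. W t0 x - W t0 x)) (at p0)"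
      by (intro continuous_within_tendsto_compose[where f = "\<lambda>t. L2_norm (\<lambda>x. W t x - W t0 x)"]) auto
    then show "((\<lambda>p. L2_norm (\<lambda>x. W (max 0 (fst p)) x - W t0 x)) \<longlongrightarrow> 0) (at p0)"
      by (simp add: L2_norm_def)
    have "continuous_on UNIV (mode f (W t0))"
      unfolding mode_FT by (intro continuous_intros continuous_FT integrable_scaleR_L2 f W2 t0)
    then have "((\<lambda>p. mode f (W t0) (snd p)) \<longlongrightarrow> mode f (W t0) (snd p0)) (at p0)"
      by (rule continuous_on_tendsto_compose) (auto intro!: tendsto_intros)
    then show "((\<lambda>p. norm (mode f (W t0) (snd p) - mode f (W t0) (snd p0))) \<longlongrightarrow> 0) (at p0)"
      using LIM_zero tendsto_norm_zero by blast
  qed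
  then have lim: "(?b \<longlongrightarrow> 0) (at p0)"
    by simp
  have "((\<lambda>p. mode f (W (max 0 (fst p))) (snd p) - mode f (W t0) (snd p0)) \<longlongrightarrow> 0) (at p0)"
    by (rule Lim_null_comparison[OF always_eventually[OF allI[OF le]] lim])
  then show "((\<lambda>p. mode f (W (max 0 (fst p))) (snd p)) \<longlongrightarrow> mode f (W (max 0 (fst p0))) (snd p0)) (at p0 within UNIV)"
    unfolding t0_def[symmetric] by (rule LIM_zero_cancel)
qed

lemma measurable_mode_error_pair:
  assumes W: "continuous_L2 W" and \<kappa>: "bump_function \<kappa>"
  shows "(\<lambda>p. mode_error A \<kappa> (W (max 0 (fst p))) (snd p)) \<in> borel_measurable (lborel \<Otimes>\<^sub>M lborel)"
proof -
  have "continuous_on UNIV (\<lambda>p. mode_error A \<kappa> (W (max 0 (fst p))) (snd p))"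
    unfolding mode_error_def
    by (intro continuous_on_sum bounded_linear.continuous_on[OF matrix_vector_mul_bounded_linear]
        continuous_mode_pair W bump_function_pd(3)[OF \<kappa>])
  from borel_measurable_continuous_onI[OF this] show ?thesis
    by (simp add: lborel_prod)
qed


text \<open>The generator is bounded on the ball of radius R, so C depends on R and T but not on
  \<epsilon>. After exchange of the integrals over time and frequency, \<open>mode_error_L2\<close>
  bounds the error at each time by a multiple of \<epsilon>^2.\<close>

lemma sq_norm_localized_solution:
  fixes W :: "real \<Rightarrow> real^'d::finite \<Rightarrow> complex^'n::finite"
  assumes W: "weak_evolution A B W" and W0: "AE x in lborel. W 0 x = 0" and T: "0 < T"
  obtains C where "0 \<le> C" "\<And>\<epsilon>. 0 < \<epsilon> \<Longrightarrow>
    sq_norm (trunc R (mode (scaled_cutoff \<epsilon>) (W T))) \<le> ennreal (C * \<epsilon>\<^sup>2)"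
proof -
  have cW: "continuous_L2 W"
    using W by (simp add: weak_evolution_def)
  note W2 = continuous_L2D(1)[OF cW]
  obtain M where M: "0 \<le> M" "\<And>t. 0 \<le> t \<Longrightarrow> t \<le> T \<Longrightarrow> L2_norm (W t) \<le> M"
    by (rule L2_norm_bounded[OF cW, of T]) blast
  obtain P where P: "0 \<le> P" "\<And>\<epsilon> u. 0 < \<epsilon> \<Longrightarrow> square_integrable u \<Longrightarrow>
      sq_norm (mode_error A (scaled_cutoff \<epsilon>) u) \<le> ennreal ((\<epsilon> * P)\<^sup>2) * sq_norm u"
    by (rule mode_error_L2[of A]) blast
  have "compact (generator A B ` cball 0 R)"
    by (intro compact_continuous_image continuous_on_subset[OF continuous_generator]) auto
  then obtain b where b: "\<And>\<xi>. norm \<xi> \<le> R \<Longrightarrow> norm (generator A B \<xi>) \<le> b"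
    by (meson bounded_iff compact_imp_bounded imageI mem_cball_0)
  define C where "C = (exp (b * T))\<^sup>2 * T * (T * (P * M)\<^sup>2)"
  have "sq_norm (trunc R (mode (scaled_cutoff \<epsilon>) (W T))) \<le> ennreal (C * \<epsilon>\<^sup>2)" if \<epsilon>: "0 < \<epsilon>" for \<epsilon>
  proof -
    let ?\<kappa> = "scaled_cutoff \<epsilon> :: real^'d \<Rightarrow> real"
    note \<kappa> = scaled_cutoff(1)[OF \<epsilon>, where 'd = 'd]
    define r where "r t \<xi> = mode_error A ?\<kappa> (W (max 0 t)) \<xi>" for t \<xi>
    have r [measurable]: "(\<lambda>p. r (fst p) (snd p)) \<in> borel_measurable (lborel \<Otimes>\<^sub>M lborel)"
      unfolding r_def by (rule measurable_mode_error_pair[OF cW \<kappa>])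
    let ?h = "\<lambda>t \<xi>. indicator {0..T} t * ennreal ((norm (r t \<xi>))\<^sup>2)"
    have [measurable]: "(\<lambda>(t, \<xi>). ?h t \<xi>) \<in> borel_measurable (lborel \<Otimes>\<^sub>M lborel)"
      unfolding case_prod_beta by measurable
    have pointwise: "ennreal ((norm (trunc R (mode ?\<kappa> (W T)) \<xi>))\<^sup>2) \<le> ennreal ((exp (b * T))\<^sup>2 * T) * (\<integral>\<^sup>+t. ?h t \<xi> \<partial>lborel)" for \<xi>
    proof (cases "norm \<xi> \<le> R")
      case True
      have cr: "continuous_on {0..T} (\<lambda>t. mode_error A ?\<kappa> (W t) \<xi>)"
        by (rule continuous_mode[OF cW \<kappa>])
      have cr': "continuous_on {0..T} (\<lambda>t. r t \<xi>)"
        by (rule continuous_on_eq[OF cr]) (simp add: r_def)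
      let ?J = "integral {0..T} (\<lambda>t. (norm (r t \<xi>))\<^sup>2)"
      have g0: "mode ?\<kappa> (W 0) \<xi> = 0"
      proof -
        have [measurable]: "?\<kappa> \<in> borel_measurable borel" "W 0 \<in> borel_measurable borel"
          using square_integrable_measurable[OF bump_function_L2[OF \<kappa>]] square_integrable_measurable[OF W2] by auto
        have "mode ?\<kappa> (W 0) \<xi> = (LINT (x :: real^'d)|lborel. (0 :: complex^'n))"
          unfolding mode_def
          by (rule integral_cong_AE) (measurable, use W0 in eventually_elim, simp)
        then show ?thesis by simp
      qed
      have "norm (mode ?\<kappa> (W T) \<xi> - app (exp (T *\<^sub>R generator A B \<xi>)) (mode ?\<kappa> (W 0) \<xi>)) \<le>
          exp (b * T) * integral {0..T} (\<lambda>t. norm (mode_error A ?\<kappa> (W t) \<xi>))"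
        using T by (intro duhamel_bound mode_has_vector_derivative W \<kappa> cr b True) auto
      also have "integral {0..T} (\<lambda>t. norm (mode_error A ?\<kappa> (W t) \<xi>)) = integral {0..T} (\<lambda>t. norm (r t \<xi>))"
        by (intro Henstock_Kurzweil_Integration.integral_cong) (simp add: r_def)
      finally have "(norm (mode ?\<kappa> (W T) \<xi>))\<^sup>2 \<le> (exp (b * T) * integral {0..T} (\<lambda>t. norm (r t \<xi>)))\<^sup>2"
        by (intro power_mono) (simp_all add: g0 app.zero_right)
      \<comment> \<open>The square is moved inside the time integral, so that the integrals can be
        exchanged.\<close>
      also have "\<dots> \<le> (exp (b * T))\<^sup>2 * (T * ?J)"
        unfolding power_mult_distrib by (intro mult_left_mono integral_square_le continuous_intros cr' T) simp
      finally have le: "(norm (mode ?\<kappa> (W T) \<xi>))\<^sup>2 \<le> (exp (b * T))\<^sup>2 * T * ?J"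
        by (simp add: mult.assoc)
      have "((\<lambda>t. (norm (r t \<xi>))\<^sup>2) has_integral ?J) {0..T}"
        by (intro integrable_integral integrable_continuous_real continuous_intros cr')
      then have J: "(\<integral>\<^sup>+t. ?h t \<xi> \<partial>lborel) = ennreal ?J"
        using nn_integral_has_integral_lebesgue'[of "{0..T}" "\<lambda>t. (norm (r t \<xi>))\<^sup>2" ?J]
        by (simp add: mult.commute)
      show ?thesis
        unfolding J using le True by (simp add: trunc_inside ennreal_mult[symmetric] ennreal_leI T less_imp_le
          Henstock_Kurzweil_Integration.integral_nonneg integrable_continuous_real continuous_intros cr')
    next
      case False
      then show ?thesis by (simp add: trunc_def)
    qed
    have "sq_norm (trunc R (mode ?\<kappa> (W T))) \<le> (\<integral>\<^sup>+\<xi>. ennreal ((exp (b * T))\<^sup>2 * T) * (\<integral>\<^sup>+t. ?h t \<xi> \<partial>lborel) \<partial>lborel)"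
      unfolding sq_norm_def by (intro nn_integral_mono pointwise)
    also have "\<dots> = ennreal ((exp (b * T))\<^sup>2 * T) * (\<integral>\<^sup>+\<xi>. (\<integral>\<^sup>+t. ?h t \<xi> \<partial>lborel) \<partial>lborel)"
      by (rule nn_integral_cmult) measurable
    also have "(\<integral>\<^sup>+\<xi>. (\<integral>\<^sup>+t. ?h t \<xi> \<partial>lborel) \<partial>lborel) = (\<integral>\<^sup>+t. (\<integral>\<^sup>+\<xi>. ?h t \<xi> \<partial>lborel) \<partial>lborel)"
      by (rule lborel_pair.Fubini') measurable
    also have "\<dots> \<le> (\<integral>\<^sup>+t. ennreal ((\<epsilon> * P)\<^sup>2 * M\<^sup>2) * indicator {0..T} t \<partial>lborel)"
    proof (rule nn_integral_mono)
      fix t :: real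
      show "(\<integral>\<^sup>+\<xi>. ?h t \<xi> \<partial>lborel) \<le> ennreal ((\<epsilon> * P)\<^sup>2 * M\<^sup>2) * indicator {0..T} t"
      proof (cases "t \<in> {0..T}")
        case True
        then have "(\<integral>\<^sup>+\<xi>. ?h t \<xi> \<partial>lborel) = sq_norm (mode_error A ?\<kappa> (W t))"
          by (simp add: sq_norm_def r_def)
        also have "\<dots> \<le> ennreal ((\<epsilon> * P)\<^sup>2) * sq_norm (W t)"
          using True by (intro P \<epsilon> W2) auto
        also have "\<dots> \<le> ennreal ((\<epsilon> * P)\<^sup>2) * ennreal (M\<^sup>2)"
          using True M(2)[of t] W2[of t]
          by (intro mult_left_mono) (auto simp: sq_norm_L2_norm L2_norm_nonneg intro!: ennreal_leI power_mono)
        finally show ?thesis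
          using True by (simp add: ennreal_mult)
      qed simp
    qed
    also have "\<dots> = ennreal ((\<epsilon> * P)\<^sup>2 * M\<^sup>2) * ennreal T"
      using T by (simp add: nn_integral_cmult)
    finally have "sq_norm (trunc R (mode ?\<kappa> (W T))) \<le> ennreal ((exp (b * T))\<^sup>2 * T) * (ennreal ((\<epsilon> * P)\<^sup>2 * M\<^sup>2) * ennreal T)"
      by (simp add: mult_left_mono)
    also have "\<dots> = ennreal (C * \<epsilon>\<^sup>2)"
      using T by (simp add: C_def ennreal_mult[symmetric] power_mult_distrib mult_ac)
    finally show ?thesis .
  qed
  moreover have "0 \<le> C"
    using T by (simp add: C_def)
  ultimately show thesis
    using that by blast
qed

lemma tendsto_0_le_ennreal:
  fixes f g :: "'a \<Rightarrow> ennreal"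
  assumes le: "\<And>n. f n \<le> g n" and g: "(g \<longlongrightarrow> 0) F"
  shows "(f \<longlongrightarrow> 0) F"
  by (rule tendsto_sandwich[OF _ _ tendsto_const g]) (simp_all add: le)

text \<open>The localized functions tend to W T in mean square, and their transforms tend to zero on
  every ball. Hence the transform of W T is zero, and W T with it.\<close>

lemma weak_evolution_unique:
  fixes W :: "real \<Rightarrow> real^'d::finite \<Rightarrow> complex^'n::finite"
  assumes W: "weak_evolution A B W" and W0: "AE x in lborel. W 0 x = 0" and T: "0 < T"
  shows "AE x in lborel. W T x = 0"
proof -
  have W2: "square_integrable (W T)"
    using W T by (intro continuous_L2D(1)) (auto simp: weak_evolution_def)
  note [measurable] = square_integrable_measurable[OF W2]
  obtain w where w: "is_fourier (W T) w"
    by (rule fourier_exists[OF W2])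
  note [measurable] = square_integrable_measurable[OF is_fourierD(2)[OF w]]
  define \<epsilon> where "\<epsilon> n = inverse (real (Suc n))" for n
  have \<epsilon>: "0 < \<epsilon> n" "\<epsilon> \<longlonglongrightarrow> 0" for n
    unfolding \<epsilon>_def using LIMSEQ_inverse_real_of_nat by auto
  define u where "u n x = scaled_cutoff (\<epsilon> n) x *\<^sub>R W T x" for n x
  note \<kappa>2 = bump_function_L2[OF scaled_cutoff(1)[OF \<epsilon>(1)]]
  have ui: "integrable lborel (u n)" for n
    unfolding u_def by (rule integrable_scaleR_L2[OF \<kappa>2 W2])
  have [measurable]: "u n \<in> borel_measurable borel" for n
    using ui[of n] by auto
  have [measurable]: "FT (u n) \<in> borel_measurable borel" for n
    by (rule FT_measurable[OF ui])
  obtain p where p: "0 \<le> p" "\<And>x :: real^'d. norm (cutoff x) \<le> p"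
    using compactly_supported_bounded[of "cutoff :: real^'d \<Rightarrow> real"] smooth_continuous[OF smooth_cutoff]
      bump_function_cutoff[where 'd = 'd]
    unfolding bump_function_def by blast
  have ub: "norm (u n x) \<le> p * norm (W T x)" for n x
    using p(2)[of "\<epsilon> n *\<^sub>R x"] by (simp add: u_def scaled_cutoff_def mult_right_mono)
  have u2: "square_integrable (u n)" for n
    by (rule square_integrable_bound[OF W2 _ ub]) measurable
  have lim: "(\<lambda>n. sq_norm (\<lambda>x. u n x - W T x)) \<longlonglongrightarrow> 0"
  proof (rule sq_norm_tendsto_0)
    show "(\<lambda>x. u n x - W T x) \<in> borel_measurable borel" for n
      by measurable
    show "square_integrable (\<lambda>x. (p + 1) *\<^sub>R W T x)"
      by (rule square_integrable_bound[OF W2, where C = "p + 1"]) (use p in auto)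
    show "norm (u n x - W T x) \<le> norm ((p + 1) *\<^sub>R W T x)" for n x
      unfolding norm_scaleR using ub[of n x] norm_triangle_ineq4[of "u n x" "W T x"] p(1) by (simp add: distrib_right)
    fix x :: "real^'d"
    have "(\<lambda>n. \<epsilon> n *\<^sub>R x) \<longlonglongrightarrow> 0 *\<^sub>R x"
      by (rule tendsto_scaleR[OF \<epsilon>(2) tendsto_const])
    then have "(\<lambda>n. cutoff (\<epsilon> n *\<^sub>R x)) \<longlonglongrightarrow> cutoff (0 *\<^sub>R x)"
      by (rule continuous_on_tendsto_compose[OF smooth_continuous[OF smooth_cutoff, of UNIV]]) simp_all
    then have "(\<lambda>n. cutoff (\<epsilon> n *\<^sub>R x) *\<^sub>R W T x) \<longlonglongrightarrow> cutoff (0 *\<^sub>R x) *\<^sub>R W T x"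
      by (intro tendsto_intros)
    then show "(\<lambda>n. u n x - W T x) \<longlonglongrightarrow> 0"
      by (intro LIM_zero) (simp add: u_def scaled_cutoff_def cutoff_0)
  qed
  have limF: "(\<lambda>n. sq_norm (\<lambda>\<xi>. w \<xi> - FT (u n) \<xi>)) \<longlonglongrightarrow> 0"
  proof -
    have "sq_norm (\<lambda>\<xi>. w \<xi> - FT (u n) \<xi>) \<le> 2 * sq_norm (\<lambda>x. u n x - W T x)" for n
      using is_fourier_bound[OF is_fourier_diff[OF w is_fourier_FT[OF u2 ui]]] by (simp add: sq_norm_minus_commute[of "W T"])
    moreover have "(\<lambda>n. 2 * sq_norm (\<lambda>x. u n x - W T x)) \<longlonglongrightarrow> 0"
      using ennreal_tendsto_cmult[OF _ lim, of 2] by simp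
    ultimately show ?thesis
      by (rule tendsto_0_le_ennreal)
  qed
  have zero: "sq_norm (trunc R w) = 0" for R
  proof -
    let ?c = "fourier_const TYPE('d)"
    have c0: "0 < ?c"
      by simp
    obtain C where C: "0 \<le> C" "\<And>\<epsilon>. 0 < \<epsilon> \<Longrightarrow> sq_norm (trunc R (mode (scaled_cutoff \<epsilon>) (W T))) \<le> ennreal (C * \<epsilon>\<^sup>2)"
      by (rule sq_norm_localized_solution[OF W W0 T, of R]) blast
    have "sq_norm (trunc R (FT (u n))) \<le> ennreal (?c\<^sup>2) * ennreal (C * (\<epsilon> n)\<^sup>2)" for n
    proof -
      have m: "mode (scaled_cutoff (\<epsilon> n)) (W T) = (\<lambda>\<xi>. inverse ?c *\<^sub>R FT (u n) \<xi>)"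
        unfolding u_def[abs_def] by (rule mode_FT)
      have "sq_norm (trunc R (FT (u n))) \<le> ennreal (?c\<^sup>2) * sq_norm (trunc R (mode (scaled_cutoff (\<epsilon> n)) (W T)))"
      proof (rule sq_norm_le_mult)
        show "trunc R (mode (scaled_cutoff (\<epsilon> n)) (W T)) \<in> borel_measurable borel"
          unfolding m by measurable
        have "norm (trunc R f x) \<le> c * norm (trunc R (\<lambda>\<xi>. inverse c *\<^sub>R f \<xi>) x)" if "0 < c" for c x and f :: "real^'d \<Rightarrow> complex^'n"
          using that by (simp add: trunc_def field_simps)
        from this[OF c0] show "norm (trunc R (FT (u n)) x) \<le> ?c * norm (trunc R (mode (scaled_cutoff (\<epsilon> n)) (W T)) x)" for x
          unfolding m .
      qed
      also have "\<dots> \<le> ennreal (?c\<^sup>2) * ennreal (C * (\<epsilon> n)\<^sup>2)"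
        by (intro mult_left_mono C \<epsilon>) simp
      finally show ?thesis .
    qed
    moreover have "(\<lambda>n. ennreal (?c\<^sup>2) * ennreal (C * (\<epsilon> n)\<^sup>2)) \<longlonglongrightarrow> 0"
    proof -
      have "(\<lambda>n. C * (\<epsilon> n)\<^sup>2) \<longlonglongrightarrow> C * 0\<^sup>2"
        by (rule tendsto_mult[OF tendsto_const tendsto_power[OF \<epsilon>(2)]])
      from ennreal_tendsto_cmult[OF _ tendsto_ennrealI[OF this], of "ennreal (?c\<^sup>2)"] show ?thesis
        by simp
    qed
    ultimately have limT: "(\<lambda>n. sq_norm (trunc R (FT (u n)))) \<longlonglongrightarrow> 0"
      by (rule tendsto_0_le_ennreal)
    have "sq_norm (trunc R w) \<le> 2 * sq_norm (\<lambda>\<xi>. w \<xi> - FT (u n) \<xi>) + 2 * sq_norm (trunc R (FT (u n)))" for n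
    proof -
      have "sq_norm (trunc R w) = sq_norm (\<lambda>\<xi>. trunc R (\<lambda>\<xi>. w \<xi> - FT (u n) \<xi>) \<xi> + trunc R (FT (u n)) \<xi>)"
        by (rule arg_cong[where f = sq_norm]) (simp add: fun_eq_iff trunc_def scaleR_diff_right)
      also have "\<dots> \<le> 2 * sq_norm (trunc R (\<lambda>\<xi>. w \<xi> - FT (u n) \<xi>)) + 2 * sq_norm (trunc R (FT (u n)))"
        by (rule sq_norm_add) measurable
      also have "\<dots> \<le> 2 * sq_norm (\<lambda>\<xi>. w \<xi> - FT (u n) \<xi>) + 2 * sq_norm (trunc R (FT (u n)))"
        by (intro add_mono mult_left_mono order_refl sq_norm_mono norm_trunc_le) simp
      finally show ?thesis .
    qed
    then have "sq_norm (trunc R w) \<le> 0"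
      by (rule LIMSEQ_le_const[OF tendsto_0_twice_sum[OF limF limT], OF exI, OF allI, OF impI])
    then show ?thesis by simp
  qed
  have "AE \<xi> in lborel. \<forall>n :: nat. trunc (real n) w \<xi> = 0"
    unfolding AE_all_countable
  proof
    fix n :: nat
    show "AE \<xi> in lborel. trunc (real n) w \<xi> = 0"
      using zero[of "real n"] by (subst (asm) sq_norm_eq_0) measurable
  qed
  then have "AE \<xi> in lborel. w \<xi> = 0"
  proof eventually_elim
    case (elim \<xi>)
    obtain n :: nat where "norm \<xi> \<le> real n"
      using real_arch_simple by blast
    then show ?case
      using elim trunc_inside[of \<xi> "real n" w] by metis
  qed
  then have "sq_norm w = 0"
    by (simp add: sq_norm_eq_0)
  \<comment> \<open>The bound for the inverse transform yields injectivity of the Fourier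
    transform.\<close>
  moreover have "sq_norm (\<lambda>x. W T (- x)) \<le> 2 * sq_norm w"
    by (rule is_fourier_bound[OF fourier_inversion[OF w]])
  ultimately have "sq_norm (W T) = 0"
    by (simp add: sq_norm_reflect)
  then show ?thesis
    by (simp add: sq_norm_eq_0)
qed

lemma cauchy_solution_unique:
  assumes V: "cauchy_solution A (\<lambda>_. B) u0 V" and U: "cauchy_solution A (\<lambda>_. B) u0 U" and t: "0 \<le> t"
  shows "AE x in lborel. V t x = U t x"
proof -
  have ev: "weak_evolution A B (\<lambda>t x. V t x - U t x)"
    using V U unfolding cauchy_solution_def
    by (intro weak_evolution_diff distributional_solution_weak_evolution) auto
  have "AE x in lborel. V 0 x = u0 x" "AE x in lborel. U 0 x = u0 x"
    using V U by (auto simp: cauchy_solution_def)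
  then have 0: "AE x in lborel. V 0 x - U 0 x = 0"
    by eventually_elim simp
  have "AE x in lborel. V t x - U t x = 0"
    using weak_evolution_unique[OF ev 0] 0 t by (cases "t = 0") auto
  then show ?thesis by simp
qed

section \<open>Plane waves as weak solutions\<close>

text \<open>Difference quotients of f have integral zero by translation invariance, and they
  converge to the derivative under an integrable majorant.\<close>

lemma integral_derivative:
  fixes f :: "'a::euclidean_space \<Rightarrow> 'b::euclidean_space"
  assumes d: "\<And>x. (f has_derivative f' x) (at x)" and supp: "bounded {x. f x \<noteq> 0}"
    and c: "continuous_on UNIV (\<lambda>x. f' x h)"
  shows "integrable lborel (\<lambda>x. f' x h)" "(LINT x|lborel. f' x h) = 0"
proof -
  have "{x. f' x h \<noteq> 0} \<subseteq> closure {x. f x \<noteq> 0}"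
    using derivative_support[OF d] by blast
  then have b': "bounded {x. f' x h \<noteq> 0}"
    using bounded_closure[OF supp] bounded_subset by blast
  show "integrable lborel (\<lambda>x. f' x h)"
    by (rule compactly_supported_integrable[OF c b'])
  have cf: "continuous_on UNIV f"
    using d by (meson continuous_at_imp_continuous_on has_derivative_continuous)
  have fi: "integrable lborel f"
    by (rule compactly_supported_integrable[OF cf supp])
  obtain M where M: "0 \<le> M" "\<And>x. norm (f' x h) \<le> M"
    using compactly_supported_bounded[OF c b'] by blast
  obtain R where R: "\<And>x. f x \<noteq> 0 \<Longrightarrow> norm x \<le> R"
    using supp unfolding bounded_iff by blast
  \<comment> \<open>Steps of length at most one keep the supports of the translates in the ball of
    radius R + |h|.\<close>
  define e where "e n = inverse (real (Suc n))" for n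
  have e: "0 < e n" "e n \<le> 1" for n
    unfolding e_def by (auto simp: inverse_le_1_iff)
  have elim: "e \<longlonglongrightarrow> 0"
    unfolding e_def by (rule LIMSEQ_inverse_real_of_nat)
  define s where "s n x = inverse (e n) *\<^sub>R (f (x + e n *\<^sub>R h) - f x)" for n x
  have vd: "((\<lambda>t. f (x + t *\<^sub>R h)) has_vector_derivative f' (x + t *\<^sub>R h) h) (at t within S)" for x t S
  proof -
    have "((\<lambda>t. x + t *\<^sub>R h) has_derivative (\<lambda>t. t *\<^sub>R h)) (at t within S)"
      by (auto intro!: derivative_eq_intros)
    from has_derivative_compose[OF this d] have "((\<lambda>t. f (x + t *\<^sub>R h)) has_derivative (\<lambda>s. f' (x + t *\<^sub>R h) (s *\<^sub>R h))) (at t within S)" .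
    then show ?thesis
      unfolding has_vector_derivative_def using has_derivative_linear[OF d] by (simp add: linear_scale)
  qed
  have [measurable]: "f \<in> borel_measurable borel"
    using cf by (rule borel_measurable_continuous_onI)
  have si: "(LINT x|lborel. s n x) = 0" for n
  proof -
    have "integrable lborel (\<lambda>x. f (e n *\<^sub>R h + 1 *\<^sub>R x))"
      by (rule integrable_lborel_affine[OF fi]) simp
    then have i: "integrable lborel (\<lambda>x. f (x + e n *\<^sub>R h))"
      by (simp add: add.commute)
    have "(LINT x|lborel. f x) = (LINT x|lborel. f (x + e n *\<^sub>R h))"
      using integral_lborel_affine[of 1 f "e n *\<^sub>R h"] by (simp add: add.commute)
    then show ?thesis
      using i fi by (simp add: s_def)
  qed
  have "(\<lambda>n. LINT x|lborel. s n x) \<longlonglongrightarrow> (LINT x|lborel. f' x h)"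
  proof (rule integral_dominated_convergence)
    show "(\<lambda>x. f' x h) \<in> borel_measurable lborel" "\<And>n. s n \<in> borel_measurable lborel"
      using borel_measurable_continuous_onI[OF c] by (auto simp: s_def[abs_def])
    have "emeasure lborel (cball (0 :: 'a) (R + norm h)) < \<infinity>"
      by (rule emeasure_bounded_finite) simp
    then show "integrable lborel (\<lambda>x. indicator (cball (0 :: 'a) (R + norm h)) x * M)"
      by (auto intro: integrable_real_indicator)
    have "(\<lambda>n. s n x) \<longlonglongrightarrow> f' x h" for x
    proof -
      have "(\<lambda>t. norm (f (x + (0 + t) *\<^sub>R h) - f (x + 0 *\<^sub>R h) - t *\<^sub>R f' (x + 0 *\<^sub>R h) h) / norm t) \<midarrow>0\<rightarrow> 0"
        using vd[of x 0 UNIV] unfolding has_vector_derivative_def has_derivative_at by blast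
      moreover have "filterlim e (at 0) sequentially"
        using elim e(1) by (auto simp: filterlim_at less_imp_neq[symmetric] intro!: always_eventually)
      ultimately have "(\<lambda>n. norm (f (x + (0 + e n) *\<^sub>R h) - f (x + 0 *\<^sub>R h) - e n *\<^sub>R f' (x + 0 *\<^sub>R h) h) / norm (e n)) \<longlonglongrightarrow> 0"
        by (rule filterlim_compose)
      moreover have "norm (f (x + (0 + e n) *\<^sub>R h) - f (x + 0 *\<^sub>R h) - e n *\<^sub>R f' (x + 0 *\<^sub>R h) h) / norm (e n) = norm (s n x - f' x h)" for n
      proof -
        have "s n x - f' x h = inverse (e n) *\<^sub>R (f (x + e n *\<^sub>R h) - f x - e n *\<^sub>R f' x h)"
          using e(1)[of n] by (simp add: s_def scaleR_diff_right)
        then have "norm (s n x - f' x h) = inverse (e n) * norm (f (x + e n *\<^sub>R h) - f x - e n *\<^sub>R f' x h)"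
          using e(1)[of n] by simp
        then show ?thesis
          using e(1)[of n] by (simp add: divide_inverse mult.commute)
      qed
      ultimately have "(\<lambda>n. norm (s n x - f' x h)) \<longlonglongrightarrow> 0"
        by simp
      then show ?thesis
        by (rule LIM_zero_cancel[OF tendsto_norm_zero_cancel])
    qed
    then show "AE x in lborel. (\<lambda>n. s n x) \<longlonglongrightarrow> f' x h"
      by simp
    have "norm (s n x) \<le> indicator (cball 0 (R + norm h)) x * M" for n x
    proof (cases "norm x \<le> R + norm h")
      case True
      have "norm (f (x + e n *\<^sub>R h) - f (x + 0 *\<^sub>R h)) \<le> M * norm (e n - 0)"
      proof (rule differentiable_bound)
        show "convex (UNIV :: real set)" by simp
        show "((\<lambda>t. f (x + t *\<^sub>R h)) has_derivative (\<lambda>s. s *\<^sub>R f' (x + t *\<^sub>R h) h)) (at t within UNIV)" for t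
          using vd[of x t UNIV] unfolding has_vector_derivative_def .
        show "onorm (\<lambda>s :: real. s *\<^sub>R f' (x + t *\<^sub>R h) h) \<le> M" for t
        proof (rule onorm_bound[OF M(1)])
          show "norm (s *\<^sub>R f' (x + t *\<^sub>R h) h) \<le> M * norm s" for s :: real
            unfolding norm_scaleR real_norm_def mult.commute[of "\<bar>s\<bar>"] by (rule mult_right_mono[OF M(2) abs_ge_zero])
        qed
      qed auto
      then have "norm (f (x + e n *\<^sub>R h) - f x) \<le> M * e n"
        using e(1)[of n] by simp
      then have "inverse (e n) * norm (f (x + e n *\<^sub>R h) - f x) \<le> M"
        using e(1)[of n] by (simp add: field_simps)
      then show ?thesis
        using e(1)[of n] True by (simp add: s_def)
    next
      case False
      have "norm x \<le> norm (x + e n *\<^sub>R h) + norm h"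
      proof -
        have "norm x \<le> norm (x + e n *\<^sub>R h) + norm (e n *\<^sub>R h)"
          using norm_triangle_ineq4[of "x + e n *\<^sub>R h" "e n *\<^sub>R h"] by simp
        also have "norm (e n *\<^sub>R h) \<le> norm h"
          using e[of n] by (simp add: mult_left_le_one_le)
        finally show ?thesis by simp
      qed
      then have "f (x + e n *\<^sub>R h) = 0" "f x = 0"
        using False R[of x] R[of "x + e n *\<^sub>R h"] norm_ge_zero[of h] by fastforce+
      then show ?thesis
        using M(1) by (simp add: s_def)
    qed
    then show "\<And>n. AE x in lborel. norm (s n x) \<le> indicator (cball 0 (R + norm h)) x * M"
      by simp
  qed
  then have "(\<lambda>n. 0) \<longlonglongrightarrow> (LINT x|lborel. f' x h)"
    by (simp add: si)
  then show "(LINT x|lborel. f' x h) = 0"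
    using LIMSEQ_unique tendsto_const by blast
qed

definition weak_form ::
    "('d::finite \<Rightarrow> complex^'n^'n) \<Rightarrow> complex^'n^'n \<Rightarrow> (real \<times> (real^'d) \<Rightarrow> real) \<Rightarrow>
     real \<times> (real^'d) \<Rightarrow> complex^'n::finite \<Rightarrow> complex^'n" where
  "weak_form A B \<phi> z v = - (frechet_derivative \<phi> (at z) (1, 0) *\<^sub>R v)
     - (\<Sum>l\<in>UNIV. frechet_derivative \<phi> (at z) (0, axis l 1) *\<^sub>R (A l *v v)) + \<phi> z *\<^sub>R (B *v v)"

text \<open>A continuous, compactly supported majorant for the operator norm of
  \<open>weak_form A B \<phi> z\<close>.\<close>

definition weak_form_bound ::
    "('d::finite \<Rightarrow> complex^'n^'n) \<Rightarrow> complex^'n^'n::finite \<Rightarrow> (real \<times> (real^'d) \<Rightarrow> real) \<Rightarrow> real \<times> (real^'d) \<Rightarrow> real" where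
  "weak_form_bound A B \<phi> z = \<bar>frechet_derivative \<phi> (at z) (1, 0)\<bar>
     + (\<Sum>l\<in>UNIV. \<bar>frechet_derivative \<phi> (at z) (0, axis l 1)\<bar> * norm (op (A l))) + \<bar>\<phi> z\<bar> * norm (op B)"

lemma bounded_linear_weak_form: "bounded_linear (weak_form A B \<phi> z)"
  unfolding weak_form_def[abs_def]
  by (intro bounded_linear_add bounded_linear_sub bounded_linear_minus bounded_linear_sum
      bounded_linear_const_scaleR bounded_linear_ident matrix_vector_mul_bounded_linear)

lemma norm_weak_form_le:
  fixes A :: "'d::finite \<Rightarrow> complex^'n^'n::finite"
  shows "norm (weak_form A B \<phi> z v) \<le> weak_form_bound A B \<phi> z * norm v"
proof -
  let ?D = "frechet_derivative \<phi> (at z)"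
  have op: "norm (M *v v) \<le> norm (op M) * norm v" for M :: "complex^'n^'n"
    using norm_app[of "op M" v] unfolding app_op .
  have "norm (weak_form A B \<phi> z v) \<le> norm (?D (1, 0) *\<^sub>R v) + norm (\<Sum>l\<in>UNIV. ?D (0, axis l 1) *\<^sub>R (A l *v v)) + norm (\<phi> z *\<^sub>R (B *v v))"
    unfolding weak_form_def
    using norm_triangle_ineq[of "- (?D (1, 0) *\<^sub>R v) - (\<Sum>l\<in>UNIV. ?D (0, axis l 1) *\<^sub>R (A l *v v))" "\<phi> z *\<^sub>R (B *v v)"]
      norm_triangle_ineq4[of "- (?D (1, 0) *\<^sub>R v)" "\<Sum>l\<in>UNIV. ?D (0, axis l 1) *\<^sub>R (A l *v v)"] by simp
  also have "\<dots> \<le> \<bar>?D (1, 0)\<bar> * norm v + (\<Sum>l\<in>UNIV. \<bar>?D (0, axis l 1)\<bar> * (norm (op (A l)) * norm v)) + \<bar>\<phi> z\<bar> * (norm (op B) * norm v)"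
  proof (intro add_mono)
    show "norm (\<Sum>l\<in>UNIV. ?D (0, axis l 1) *\<^sub>R (A l *v v)) \<le> (\<Sum>l\<in>UNIV. \<bar>?D (0, axis l 1)\<bar> * (norm (op (A l)) * norm v))"
      by (rule order_trans[OF norm_sum], rule sum_mono) (simp add: mult_left_mono op)
  qed (simp_all add: mult_left_mono op)
  also have "\<dots> = weak_form_bound A B \<phi> z * norm v"
    by (simp add: weak_form_bound_def algebra_simps sum_distrib_left sum_distrib_right)
  finally show ?thesis .
qed

lemma test_functionD:
  assumes \<phi>: "test_function \<phi>"
  shows "smooth \<phi>" "bounded {z. \<phi> z \<noteq> 0}"
    and "frechet_derivative \<phi> (at z) h \<noteq> 0 \<Longrightarrow> z \<in> closure {z. \<phi> z \<noteq> 0}"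
proof -
  show s: "smooth \<phi>" and "bounded {z. \<phi> z \<noteq> 0}"
    using \<phi> by (auto simp: test_function_def compact_eq_bounded_closed intro: bounded_subset[OF _ closure_subset])
  show "frechet_derivative \<phi> (at z) h \<noteq> 0 \<Longrightarrow> z \<in> closure {z. \<phi> z \<noteq> 0}"
    using derivative_support[OF smooth_has_derivative[OF s]] by blast
qed

lemma weak_form_bound:
  fixes A :: "'d::finite \<Rightarrow> complex^'n^'n::finite"
  assumes \<phi>: "test_function \<phi>"
  shows "continuous_on UNIV (weak_form_bound A B \<phi>)" "0 \<le> weak_form_bound A B \<phi> z"
    and "\<exists>p q \<rho> M. 0 < p \<and> 0 \<le> M \<and> (\<forall>t x. weak_form_bound A B \<phi> (t, x) \<noteq> 0 \<longrightarrow> p \<le> t \<and> t \<le> q \<and> norm x \<le> \<rho>) \<and>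
      (\<forall>z. weak_form_bound A B \<phi> z \<le> M)"
proof -
  note s = test_functionD(1)[OF \<phi>]
  show c: "continuous_on UNIV (weak_form_bound A B \<phi>)"
    unfolding weak_form_bound_def[abs_def]
    by (intro continuous_intros smooth_continuous_deriv[OF s] smooth_continuous[OF s])
  show nn: "0 \<le> weak_form_bound A B \<phi> z" for z
    unfolding weak_form_bound_def by (intro add_nonneg_nonneg sum_nonneg mult_nonneg_nonneg) auto
  let ?S = "closure {z. \<phi> z \<noteq> 0}"
  have comp: "compact ?S" and pos: "?S \<subseteq> {0<..} \<times> UNIV"
    using \<phi> by (auto simp: test_function_def)
  have supp: "z \<in> ?S" if "weak_form_bound A B \<phi> z \<noteq> 0" for z
  proof (rule ccontr)
    assume "z \<notin> ?S"
    then have "\<phi> z = 0" "\<And>h. frechet_derivative \<phi> (at z) h = 0"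
      using test_functionD(3)[OF \<phi>, of z] closure_subset[of "{z. \<phi> z \<noteq> 0}"] by blast+
    with that show False by (simp add: weak_form_bound_def)
  qed
  have "bounded ?S"
    using comp by (rule compact_imp_bounded)
  then obtain \<rho> where \<rho>: "\<And>z. z \<in> ?S \<Longrightarrow> norm z \<le> \<rho>"
    unfolding bounded_iff by blast
  \<comment> \<open>The support is compact in the open half space t > 0, so the time coordinate has
    a positive minimum there.\<close>
  have "\<exists>p>0. \<forall>z\<in>?S. p \<le> fst z"
  proof (cases "?S = {}")
    case False
    obtain z0 where z0: "z0 \<in> ?S" "\<forall>z\<in>?S. fst z0 \<le> fst z"
      using continuous_attains_inf[OF comp False continuous_on_fst[OF continuous_on_id]] by blast
    then show ?thesis
      using pos by (intro exI[of _ "fst z0"]) auto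
  next
    case True
    show ?thesis
      unfolding True by (rule exI[of _ 1]) simp
  qed
  then obtain p where p: "0 < p" "\<And>z. z \<in> ?S \<Longrightarrow> p \<le> fst z"
    by blast
  have b: "bounded {z. weak_form_bound A B \<phi> z \<noteq> 0}"
    by (rule bounded_subset[OF \<open>bounded ?S\<close>]) (use supp in blast)
  obtain M where M: "0 \<le> M" "\<And>z. norm (weak_form_bound A B \<phi> z) \<le> M"
    using compactly_supported_bounded[OF c b] by blast
  have "p \<le> t \<and> t \<le> \<rho> \<and> norm x \<le> \<rho>" if "weak_form_bound A B \<phi> (t, x) \<noteq> 0" for t x
  proof -
    have "norm (t, x) \<le> \<rho>" "p \<le> t"
      using \<rho>[OF supp[OF that]] p(2)[OF supp[OF that]] by auto
    moreover have "\<bar>t\<bar> \<le> norm (t, x)" "norm x \<le> norm (t, x)"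
      using norm_fst_le[of t x] norm_snd_le[of x t] by auto
    ultimately show ?thesis by linarith
  qed
  moreover have "weak_form_bound A B \<phi> z \<le> M" for z
    using M(2)[of z] by simp
  ultimately show "\<exists>p q \<rho> M. 0 < p \<and> 0 \<le> M \<and> (\<forall>t x. weak_form_bound A B \<phi> (t, x) \<noteq> 0 \<longrightarrow> p \<le> t \<and> t \<le> q \<and> norm x \<le> \<rho>) \<and>
      (\<forall>z. weak_form_bound A B \<phi> z \<le> M)"
    using p(1) M(1) by blast
qed

text \<open>The plane wave e solves the system pointwise. The integrand is therefore minus the time
  derivative of \<phi> e minus the sum of the A_l applied to its space derivatives, and each of
  these integrates to zero.\<close>

lemma weak_form_plane_wave:
  fixes A :: "'d::finite \<Rightarrow> complex^'n^'n::finite"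
  assumes \<phi>: "test_function \<phi>"
  shows "(LINT z|lborel. weak_form A B \<phi> z (cis (\<xi> \<bullet> snd z) *s app (exp (fst z *\<^sub>R generator A B \<xi>)) v)) = 0"
proof -
  let ?G = "generator A B \<xi>" and ?D = "\<lambda>z. frechet_derivative \<phi> (at z)"
  define e where "e z = cis (\<xi> \<bullet> snd z) *s app (exp (fst z *\<^sub>R ?G)) v" for z
  define e' where "e' z h = fst h *\<^sub>R app ?G (e z) + (\<xi> \<bullet> snd h) *\<^sub>R (\<i> *s e z)" for z h
  note s = test_functionD(1)[OF \<phi>]
  have e: "(e has_derivative e' z) (at z)" for z
  proof -
    have 1: "((\<lambda>z. app (exp (fst z *\<^sub>R ?G)) v) has_derivative (\<lambda>h. fst h *\<^sub>R app ?G (app (exp (fst z *\<^sub>R ?G)) v))) (at z)"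
      using app_exp_has_vector_derivative[of ?G v "fst z" UNIV] unfolding has_vector_derivative_def
      by (rule has_derivative_compose[of fst fst z UNIV, rotated, simplified]) (auto intro!: derivative_eq_intros)
    have "(cis has_derivative (\<lambda>r. r *\<^sub>R (\<i> * cis a))) (at a)" for a
    proof -
      have "exp (t *\<^sub>R \<i>) = cis t" for t
        by (simp add: cis_conv_exp scaleR_conv_of_real mult.commute)
      then show ?thesis
        using exp_scaleR_has_vector_derivative_right[of \<i> a UNIV] by (simp add: has_vector_derivative_def mult.commute)
    qed
    then have 2: "((\<lambda>z. cis (\<xi> \<bullet> snd z)) has_derivative (\<lambda>h. (\<xi> \<bullet> snd h) *\<^sub>R (\<i> * cis (\<xi> \<bullet> snd z)))) (at z)"
      by (rule has_derivative_compose[of "\<lambda>z. \<xi> \<bullet> snd z" "\<lambda>h. \<xi> \<bullet> snd h" z UNIV, rotated, simplified]) (auto intro!: derivative_eq_intros)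
    have "app ?G (c *s w) = c *s app ?G w" for c w
      by (simp add: app_generator vector_scalar_commute cvec.add_right cvec.minus_right mult.commute)
    then show ?thesis
      unfolding e_def[abs_def] e'_def[abs_def]
      by (intro has_derivative_eq_rhs[OF cvec.FDERIV[OF 2 1]])
        (simp add: fun_eq_iff cvec.scaleR_left cvec.scaleR_right)
  qed
  have ce: "continuous_on UNIV e"
    using e by (meson continuous_at_imp_continuous_on has_derivative_continuous)
  let ?w' = "\<lambda>z h. \<phi> z *\<^sub>R e' z h + ?D z h *\<^sub>R e z"
  have w: "((\<lambda>z. \<phi> z *\<^sub>R e z) has_derivative ?w' z) (at z)" for z
    by (rule has_derivative_scaleR[OF smooth_has_derivative[OF s] e])
  have supp: "bounded {z. \<phi> z *\<^sub>R e z \<noteq> 0}"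
    by (rule bounded_subset[OF test_functionD(2)[OF \<phi>]]) auto
  have "continuous_on UNIV (\<lambda>z. e' z h)" for h
    unfolding e'_def by (intro continuous_intros ce bounded_linear.continuous_on[OF cvec.bounded_linear_right]
        bounded_linear.continuous_on[OF app.bounded_linear_right])
  then have cw: "continuous_on UNIV (\<lambda>z. ?w' z h)" for h
    by (intro continuous_intros ce smooth_continuous[OF s] smooth_continuous_deriv[OF s])
  note z = integral_derivative[OF w supp cw]
  have "weak_form A B \<phi> z (e z) = - ?w' z (1, 0) - (\<Sum>l\<in>UNIV. A l *v ?w' z (0, axis l 1))" for z
  proof -
    let ?S = "\<Sum>l\<in>UNIV. (\<xi> $ l) *\<^sub>R (A l *v e z)"
    have w0: "?w' z (1, 0) = ?D z (1, 0) *\<^sub>R e z - \<phi> z *\<^sub>R (\<i> *s ?S + B *v e z)"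
      by (simp add: e'_def app_generator symbol_vector scaleR_diff_right scaleR_add_right)
    have "A l *v ?w' z (0, axis l 1) = ?D z (0, axis l 1) *\<^sub>R (A l *v e z) + \<phi> z *\<^sub>R (\<i> *s ((\<xi> $ l) *\<^sub>R (A l *v e z)))" for l
      by (simp add: e'_def inner_axis matrix_vector_right_distrib matrix_vector_scaleR vector_scalar_commute cvec.scaleR_right)
    then have wl: "(\<Sum>l\<in>UNIV. A l *v ?w' z (0, axis l 1)) = (\<Sum>l\<in>UNIV. ?D z (0, axis l 1) *\<^sub>R (A l *v e z)) + \<phi> z *\<^sub>R (\<i> *s ?S)"
      by (simp add: sum.distrib cvec.sum_right scaleR_sum_right)
    show ?thesis
      unfolding w0 wl weak_form_def scaleR_add_right by simp
  qed
  \<comment> \<open>Written in the shape of \<open>integral_combination\<close>, with scalars 1 and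
    the zero matrix in the last term.\<close>
  then have eq: "weak_form A B \<phi> z (e z) = - (1 *\<^sub>R ?w' z (1, 0)) - (\<Sum>l\<in>UNIV. 1 *\<^sub>R (A l *v ?w' z (0, axis l 1))) + 1 *\<^sub>R (0 *v ?w' z (1, 0))" for z
    by simp
  have "(LINT z|lborel. weak_form A B \<phi> z (e z)) = (LINT z|lborel. - (1 *\<^sub>R ?w' z (1, 0)) - (\<Sum>l\<in>UNIV. 1 *\<^sub>R (A l *v ?w' z (0, axis l 1))) + 1 *\<^sub>R (0 *v ?w' z (1, 0)))"
    by (rule Bochner_Integration.integral_cong[OF refl eq])
  also have "\<dots> = 0"
    unfolding integral_combination[OF z(1) z(1)] z(2) by simp
  finally show ?thesis
    unfolding e_def .
qed

section \<open>Existence of weak solutions\<close>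

definition evolved ::
    "('d::finite \<Rightarrow> complex^'n^'n) \<Rightarrow> complex^'n^'n \<Rightarrow> (real^'d \<Rightarrow> complex^'n::finite) \<Rightarrow> real \<Rightarrow> real^'d \<Rightarrow> complex^'n" where
  "evolved A B g t \<xi> = app (exp (t *\<^sub>R generator A B \<xi>)) (g \<xi>)"

lemma evolved_0: "evolved A B g 0 = g"
  by (rule ext) (simp add: evolved_def app_one)

lemma measurable_fst_snd_borel [measurable]:
  "(fst :: 'a::second_countable_topology \<times> 'b::second_countable_topology \<Rightarrow> 'a) \<in> borel_measurable borel"
  "(snd :: 'a \<times> 'b \<Rightarrow> 'b) \<in> borel_measurable borel"
  by (intro borel_measurable_continuous_onI continuous_intros)+

text \<open>Expansion of g in a basis leaves a finite sum of measurable scalars times continuous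
  functions of (t, \<xi>).\<close>

lemma measurable_evolved_pair:
  fixes A :: "'d::finite \<Rightarrow> complex^'n^'n::finite"
  assumes [measurable]: "g \<in> borel_measurable borel"
  shows "(\<lambda>p. evolved A B g (fst p) (snd p)) \<in> borel_measurable borel"
proof -
  let ?E = "\<lambda>p. exp (fst p *\<^sub>R generator A B (snd p))"
  have "continuous_on UNIV (\<lambda>p. fst p *\<^sub>R generator A B (snd p))"
    by (intro continuous_intros continuous_on_compose2[OF continuous_generator]) auto
  then have "continuous_on UNIV (\<lambda>p. app (?E p) b)" for b
    by (intro bounded_linear.continuous_on[OF app.bounded_linear_left] continuous_on_compose2[OF continuous_exp]) auto
  then have [measurable]: "(\<lambda>p. app (?E p) b) \<in> borel_measurable borel" for b
    by (rule borel_measurable_continuous_onI)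
  have "(\<lambda>p. \<Sum>b\<in>Basis. (g (snd p) \<bullet> b) *\<^sub>R app (?E p) b) \<in> borel_measurable borel"
    by measurable
  moreover have "evolved A B g (fst p) (snd p) = (\<Sum>b\<in>Basis. (g (snd p) \<bullet> b) *\<^sub>R app (?E p) b)" for p
  proof -
    have "app (?E p) (\<Sum>b\<in>Basis. (g (snd p) \<bullet> b) *\<^sub>R b) = (\<Sum>b\<in>Basis. (g (snd p) \<bullet> b) *\<^sub>R app (?E p) b)"
      by (simp add: app.sum_right app.scaleR_right)
    then show ?thesis
      by (simp add: evolved_def euclidean_representation)
  qed
  ultimately show ?thesis
    by simp
qed

lemma measurable_evolved:
  assumes "g \<in> borel_measurable borel"
  shows "evolved A B g t \<in> borel_measurable borel"
proof -
  have "(\<lambda>\<xi>. (t, \<xi>)) \<in> borel_measurable borel"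
    by (intro borel_measurable_continuous_onI continuous_intros)
  from measurable_compose[OF this measurable_evolved_pair[OF assms, of A B]] show ?thesis
    by simp
qed

lemma norm_evolved_trunc_le:
  fixes A :: "'d::finite \<Rightarrow> complex^'n^'n::finite"
  obtains b where "0 \<le> b" "\<And>g t \<xi>. norm (trunc R (evolved A B g t) \<xi>) \<le> exp (\<bar>t\<bar> * b) * norm (trunc R g \<xi>)"
proof -
  have "compact (generator A B ` cball 0 R)"
    by (intro compact_continuous_image continuous_on_subset[OF continuous_generator]) auto
  then obtain b where b: "\<And>\<xi>. norm \<xi> \<le> R \<Longrightarrow> norm (generator A B \<xi>) \<le> b"
    by (meson bounded_iff compact_imp_bounded imageI mem_cball_0)
  have "norm (trunc R (evolved A B g t) \<xi>) \<le> exp (\<bar>t\<bar> * max b 0) * norm (trunc R g \<xi>)" for g t \<xi>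
  proof (cases "norm \<xi> \<le> R")
    case True
    have "norm (evolved A B g t \<xi>) \<le> norm (exp (t *\<^sub>R generator A B \<xi>)) * norm (g \<xi>)"
      unfolding evolved_def by (rule norm_app)
    also have "norm (exp (t *\<^sub>R generator A B \<xi>)) \<le> exp (norm (t *\<^sub>R generator A B \<xi>))"
      by (rule norm_exp)
    also have "\<dots> \<le> exp (\<bar>t\<bar> * max b 0)"
      using b[OF True] by (simp add: mult_left_mono)
    finally show ?thesis
      using True by (simp add: trunc_inside mult_right_mono)
  qed (simp add: trunc_def)
  then show thesis
    using that[of "max b 0"] by simp
qed

lemma weak_form_measurable:
  fixes A :: "'d::finite \<Rightarrow> complex^'n^'n::finite"
  assumes \<phi>: "test_function \<phi>" and [measurable]: "z \<in> borel_measurable M" "v \<in> borel_measurable M"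
  shows "(\<lambda>x. weak_form A B \<phi> (z x) (v x)) \<in> borel_measurable M"
proof -
  note s = test_functionD(1)[OF \<phi>]
  have [measurable]: "(\<lambda>z. frechet_derivative \<phi> (at z) h) \<in> borel_measurable borel" for h
    by (rule borel_measurable_continuous_onI[OF smooth_continuous_deriv[OF s]])
  have [measurable]: "\<phi> \<in> borel_measurable borel"
    by (rule borel_measurable_continuous_onI[OF smooth_continuous[OF s]])
  have [measurable]: "(\<lambda>v. M *v v) \<in> borel_measurable borel" for M :: "complex^'n^'n"
    by (intro borel_measurable_continuous_onI linear_continuous_on matrix_vector_mul_bounded_linear)
  show ?thesis
    unfolding weak_form_def by measurable
qed

text \<open>With frequencies restricted to a ball, u is an absolutely convergent superposition of
  plane waves, each of them a weak solution; Fubini's theorem exchanges the superposition with the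
  pairing.\<close>

lemma truncated_weak_solution:
  fixes A :: "'d::finite \<Rightarrow> complex^'n^'n::finite" and B :: "complex^'n^'n" and R :: real
  assumes g: "square_integrable g" and \<phi>: "test_function \<phi>"
  defines "u \<equiv> \<lambda>t x. FT (trunc R (evolved A B g t)) (- x)"
  shows "integrable lborel (\<lambda>t. LINT x|lborel. weak_form A B \<phi> (t, x) (u t x))"
    and "(LINT t|lborel. LINT x|lborel. weak_form A B \<phi> (t, x) (u t x)) = 0"
proof -
  let ?c = "fourier_const TYPE('d)" and ?m = "weak_form_bound A B \<phi>"
  note [measurable] = square_integrable_measurable[OF g]
  obtain b where b: "0 \<le> b" "\<And>g t \<xi>. norm (trunc R (evolved A B g t) \<xi>) \<le> exp (\<bar>t\<bar> * b) * norm (trunc R g \<xi>)"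
    by (rule norm_evolved_trunc_le[of R A B]) blast
  obtain p q \<rho> where p: "0 < p" "\<And>t x. ?m (t, x) \<noteq> 0 \<Longrightarrow> p \<le> t \<and> t \<le> q \<and> norm x \<le> \<rho>"
    using weak_form_bound(3)[OF \<phi>, of A B] by blast
  have gi: "integrable lborel (trunc R g)"
    by (rule integrable_trunc[OF g])
  define f where "f z \<xi> = cis (\<xi> \<bullet> snd z) *s trunc R (evolved A B g (fst z)) \<xi>" for z and \<xi> :: "real^'d"
  have f_eq: "f z \<xi> = indicator (cball 0 R) \<xi> *\<^sub>R (cis (\<xi> \<bullet> snd z) *s evolved A B g (fst z) \<xi>)" for z \<xi>
    by (simp add: f_def trunc_def cvec.scaleR_right)
  have [measurable]: "evolved A B g t \<in> borel_measurable borel" for t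
    by (rule measurable_evolved) measurable
  have ei: "integrable lborel (trunc R (evolved A B g t))" for t
    by (rule Bochner_Integration.integrable_bound[OF integrable_scaleR_right[OF gi, of "exp (\<bar>t\<bar> * b)"]])
      (use b(2) in auto)
  have fi: "integrable lborel (f z)" for z
    unfolding f_def by (rule integrable_cis_scale[OF ei]) measurable
  have fF: "(LINT \<xi>|lborel. f (t, x) \<xi>) = inverse ?c *\<^sub>R u t x" for t x
    by (simp add: f_def u_def FT_def inner_commute)
  have fm: "(\<lambda>p. f (fst p) (snd p)) \<in> borel_measurable borel"
  proof -
    have "(\<lambda>p :: (real \<times> (real^'d)) \<times> (real^'d). (fst (fst p), snd p)) \<in> borel_measurable borel"
      by (intro borel_measurable_continuous_onI continuous_intros)
    from measurable_compose[OF this measurable_evolved_pair[OF square_integrable_measurable[OF g], of A B]]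
    have [measurable]: "(\<lambda>p :: (real \<times> (real^'d)) \<times> (real^'d). evolved A B g (fst (fst p)) (snd p)) \<in> borel_measurable borel"
      by simp
    have "(\<lambda>p :: (real \<times> (real^'d)) \<times> (real^'d). snd p \<bullet> snd (fst p)) \<in> borel_measurable borel"
      by (intro borel_measurable_continuous_onI continuous_intros)
    then have [measurable]: "(\<lambda>p :: (real \<times> (real^'d)) \<times> (real^'d). cis (snd p \<bullet> snd (fst p))) \<in> borel_measurable borel"
      by (rule borel_measurable_cis)
    have [measurable]: "(\<lambda>p :: (real \<times> (real^'d)) \<times> (real^'d). indicator (cball 0 R) (snd p) :: real) \<in> borel_measurable borel"
      by (rule measurable_compose[OF measurable_fst_snd_borel(2) borel_measurable_indicator]) simp
    show ?thesis
      unfolding f_eq by (intro borel_measurable_scaleR borel_measurable_cvec_scale) measurable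
  qed
  \<comment> \<open>Integrated in z this is the weak form of one plane wave, hence zero; integrated
    in \<xi> it is a multiple of the weak form of u.\<close>
  define Q where "Q z \<xi> = weak_form A B \<phi> z (f z \<xi>)" for z \<xi>
  have Qm: "(\<lambda>p. Q (fst p) (snd p)) \<in> borel_measurable borel"
    unfolding Q_def by (rule weak_form_measurable[OF \<phi> _ fm]) measurable
  have Qle: "norm (Q z \<xi>) \<le> ?m z * (exp (q * b) * norm (trunc R g \<xi>))" for z \<xi>
  proof (cases "?m z = 0")
    case False
    then have t: "0 \<le> fst z" "fst z \<le> q"
      using p(2)[of "fst z" "snd z"] p(1) by auto
    have "norm (f z \<xi>) \<le> exp (\<bar>fst z\<bar> * b) * norm (trunc R g \<xi>)"
      unfolding f_def using b(2) by simp
    also have "\<dots> \<le> exp (q * b) * norm (trunc R g \<xi>)"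
      using t b(1) by (intro mult_right_mono) (auto intro: mult_right_mono)
    finally have "?m z * norm (f z \<xi>) \<le> ?m z * (exp (q * b) * norm (trunc R g \<xi>))"
      by (intro mult_left_mono weak_form_bound(2)[OF \<phi>])
    then show ?thesis
      unfolding Q_def using norm_weak_form_le order_trans by blast
  next
    case True
    then show ?thesis
      using norm_weak_form_le[of A B \<phi> z "f z \<xi>"] by (simp add: Q_def)
  qed
  have mi: "integrable lborel ?m"
  proof (rule compactly_supported_integrable[OF weak_form_bound(1)[OF \<phi>]])
    show "bounded {z. ?m z \<noteq> 0}"
      by (rule bounded_subset[of "{p..q} \<times> cball 0 \<rho>"]) (use p(2) in \<open>auto intro: bounded_Times\<close>)
  qed
  have "integrable (lborel \<Otimes>\<^sub>M lborel) (\<lambda>p. Q (fst p) (snd p))"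
    by (rule integrable_pair_bound[OF _ mi integrable_mult_right[OF integrable_norm[OF gi], of "exp (q * b)"]])
      (use Qm Qle in \<open>simp_all add: lborel_prod\<close>)
  then have Qi: "integrable (lborel \<Otimes>\<^sub>M lborel) (\<lambda>(z, \<xi>). Q z \<xi>)"
    by (simp add: case_prod_beta')
  have Qz: "(LINT z|lborel. Q z \<xi>) = 0" for \<xi>
  proof (cases "norm \<xi> \<le> R")
    case True
    then show ?thesis
      unfolding Q_def f_eq evolved_def using weak_form_plane_wave[OF \<phi>, of A B \<xi> "g \<xi>"] by simp
  next
    case False
    have "weak_form A B \<phi> z 0 = 0" for z
      by (rule linear_0[OF bounded_linear.linear[OF bounded_linear_weak_form]])
    with False show ?thesis
      unfolding Q_def f_eq by simp
  qed
  have Qx: "(LINT \<xi>|lborel. Q z \<xi>) = inverse ?c *\<^sub>R weak_form A B \<phi> z (u (fst z) (snd z))" for z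
  proof -
    have "(LINT \<xi>|lborel. Q z \<xi>) = weak_form A B \<phi> z (LINT \<xi>|lborel. f z \<xi>)"
      unfolding Q_def by (rule integral_bounded_linear[OF bounded_linear_weak_form fi])
    also have "(LINT \<xi>|lborel. f z \<xi>) = inverse ?c *\<^sub>R u (fst z) (snd z)"
      using fF[of "fst z" "snd z"] by simp
    also have "weak_form A B \<phi> z (inverse ?c *\<^sub>R u (fst z) (snd z)) = inverse ?c *\<^sub>R weak_form A B \<phi> z (u (fst z) (snd z))"
      by (rule linear_scale[OF bounded_linear.linear[OF bounded_linear_weak_form]])
    finally show ?thesis .
  qed
  have c0: "inverse ?c \<noteq> 0"
    by simp
  let ?h = "\<lambda>z. weak_form A B \<phi> z (u (fst z) (snd z))"
  have "integrable lborel (\<lambda>z. inverse ?c *\<^sub>R ?h z)"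
    using lborel_pair.integrable_fst[OF Qi] unfolding Qx .
  from integrable_scaleR_right[OF this, of "inverse (inverse ?c)", unfolded scaleR_scaleR left_inverse[OF c0] scaleR_one]
  have hi: "integrable lborel ?h" .
  have "(LINT z|lborel. inverse ?c *\<^sub>R ?h z) = (LINT \<xi>|lborel. LINT z|lborel. Q z \<xi>)"
    using lborel_pair.Fubini_integral[OF Qi] unfolding Qx ..
  then have h0: "(LINT z|lborel. ?h z) = 0"
    unfolding Qz using c0 by simp
  have hi': "integrable (lborel \<Otimes>\<^sub>M lborel) (\<lambda>(t, x). weak_form A B \<phi> (t, x) (u t x))"
    using hi by (simp add: lborel_prod case_prod_beta')
  show "integrable lborel (\<lambda>t. LINT x|lborel. weak_form A B \<phi> (t, x) (u t x))"
    by (rule lborel_pair.integrable_fst[OF hi'])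
  show "(LINT t|lborel. LINT x|lborel. weak_form A B \<phi> (t, x) (u t x)) = 0"
    unfolding lborel_pair.integral_fst[OF hi'] using h0 by (simp add: lborel_prod case_prod_beta')
qed

text \<open>The constant C is uniform in t, and the form vanishes outside [p, q]; together they give
  dominated convergence of the time integral.\<close>

lemma weak_form_pairing:
  fixes A :: "'d::finite \<Rightarrow> complex^'n^'n::finite"
  assumes \<phi>: "test_function \<phi>"
  obtains p q C where "0 < p" "0 \<le> C"
    "\<And>t u. square_integrable u \<Longrightarrow> integrable lborel (\<lambda>x. weak_form A B \<phi> (t, x) (u x))"
    "\<And>t u. square_integrable u \<Longrightarrow> norm (LINT x|lborel. weak_form A B \<phi> (t, x) (u x)) \<le> C * L2_norm u"
    "\<And>t v x. t < p \<or> q < t \<Longrightarrow> weak_form A B \<phi> (t, x) v = 0"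
proof -
  let ?m = "weak_form_bound A B \<phi>"
  obtain p q \<rho> M where p: "0 < p" "0 \<le> M" "\<And>t x. ?m (t, x) \<noteq> 0 \<Longrightarrow> p \<le> t \<and> t \<le> q \<and> norm x \<le> \<rho>" "\<And>z. ?m z \<le> M"
    using weak_form_bound(3)[OF \<phi>, of A B] by blast
  let ?k = "\<lambda>x :: real^'d. indicator (cball 0 \<rho>) x * M"
  have k: "square_integrable ?k"
  proof -
    have "emeasure lborel (cball (0 :: real^'d) \<rho>) < \<infinity>"
      by (rule emeasure_bounded_finite) simp
    then have "integrable lborel (\<lambda>x :: real^'d. indicator (cball 0 \<rho>) x * M\<^sup>2)"
      by (auto intro: integrable_real_indicator)
    moreover have "(norm (?k x))\<^sup>2 = indicator (cball 0 \<rho>) x * M\<^sup>2" for x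
      by (simp add: indicator_def)
    ultimately show ?thesis
      unfolding square_integrable_def by (simp only:) (intro conjI TrueI borel_measurable_times borel_measurable_indicator, auto)
  qed
  have m: "?m (t, x) \<le> ?k x" for t x
    using p(3)[of t x] p(2) p(4)[of "(t, x)"] by (cases "?m (t, x) = 0") auto
  have le: "norm (weak_form A B \<phi> (t, x) v) \<le> norm (?k x) * norm v" for t x v
  proof -
    have "norm (weak_form A B \<phi> (t, x) v) \<le> ?m (t, x) * norm v"
      by (rule norm_weak_form_le)
    also have "\<dots> \<le> norm (?k x) * norm v"
      using m[of t x] by (intro mult_right_mono) auto
    finally show ?thesis .
  qed
  have int: "integrable lborel (\<lambda>x. weak_form A B \<phi> (t, x) (u x))" if u: "square_integrable u" for t u
  proof (rule Bochner_Integration.integrable_bound[OF integrable_norm_mult[OF k u]])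
    show "(\<lambda>x. weak_form A B \<phi> (t, x) (u x)) \<in> borel_measurable lborel"
    proof -
      have "(\<lambda>x :: real^'d. (t, x)) \<in> borel_measurable borel"
        by (intro borel_measurable_continuous_onI continuous_intros)
      from weak_form_measurable[OF \<phi> this square_integrable_measurable[OF u]] show ?thesis
        by simp
    qed
    have "norm (weak_form A B \<phi> (t, x) (u x)) \<le> norm (norm (?k x) * norm (u x))" for x
      using le[of t x "u x"] by simp
    then show "AE x in lborel. norm (weak_form A B \<phi> (t, x) (u x)) \<le> norm (norm (?k x) * norm (u x))"
      by simp
  qed
  have "norm (LINT x|lborel. weak_form A B \<phi> (t, x) (u x)) \<le> L2_norm ?k * L2_norm u" if u: "square_integrable u" for t u
  proof -
    have "norm (LINT x|lborel. weak_form A B \<phi> (t, x) (u x)) \<le> (LINT x|lborel. norm (weak_form A B \<phi> (t, x) (u x)))"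
      by (rule integral_norm_bound)
    also have "\<dots> \<le> (LINT x|lborel. norm (?k x) * norm (u x))"
      using le by (intro Bochner_Integration.integral_mono integrable_norm int u integrable_norm_mult k) auto
    also have "\<dots> \<le> L2_norm ?k * L2_norm u"
      by (rule cauchy_schwarz_L2[OF k u])
    finally show ?thesis .
  qed
  moreover have "weak_form A B \<phi> (t, x) v = 0" if "t < p \<or> q < t" for t x v
  proof -
    have "?m (t, x) = 0"
      using p(3)[of t x] that by linarith
    then show ?thesis
      using norm_weak_form_le[of A B \<phi> "(t, x)" v] by simp
  qed
  ultimately show thesis
    using that[of p "L2_norm ?k" q] p(1) int L2_norm_nonneg by blast
qed


text \<open>S dominates the evolved transform, up to factors that are bounded for bounded times. In
  the application it is the Sobolev-weighted transform of u0, so that dominated convergence works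
  although derivatives may be lost.\<close>

lemma fourier_evolution_solution:
  fixes A :: "'d::finite \<Rightarrow> complex^'n^'n::finite"
  assumes g: "is_fourier u0 g" and S: "square_integrable S" and C: "0 \<le> C"
    and bound: "\<And>t \<xi>. 0 \<le> t \<Longrightarrow> norm (evolved A B g t \<xi>) \<le> C * exp (\<alpha> * t) * norm (S \<xi> :: complex^'n)"
  obtains U where "cauchy_solution A (\<lambda>_. B) u0 U" "U 0 = u0"
    "\<And>t. 0 \<le> t \<Longrightarrow> L2_norm (U t) \<le> sqrt 2 * C * exp (\<alpha> * t) * L2_norm S"
proof -
  note g2 = is_fourierD(2)[OF g]
  note [measurable] = square_integrable_measurable[OF g2] square_integrable_measurable[OF S]
  let ?e = "evolved A B g"
  have [measurable]: "?e t \<in> borel_measurable borel" for t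
    by (rule measurable_evolved) measurable
  have e2: "square_integrable (?e t)" if "0 \<le> t" for t
    by (rule square_integrable_bound[OF S _ bound[OF that]]) measurable
  have e_norm: "sq_norm (?e t) \<le> ennreal ((C * exp (\<alpha> * t) * L2_norm S)\<^sup>2)" if "0 \<le> t" for t
  proof -
    have "sq_norm (?e t) \<le> ennreal ((C * exp (\<alpha> * t))\<^sup>2) * sq_norm S"
      by (rule sq_norm_le_mult[OF _ bound[OF that]]) measurable
    then show ?thesis
      by (simp add: sq_norm_L2_norm[OF S] ennreal_mult[symmetric] power_mult_distrib)
  qed
  \<comment> \<open>At t = 0 the given representative is used, so that U 0 is exactly u0 and the
    Sobolev norm of U 0 is that of u0.\<close>
  define H where "H t = (if t = 0 then (\<lambda>x. u0 (- x)) else fourier (?e t))" for t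
  \<comment> \<open>A Fourier transform followed by a reflection is the inverse transform.\<close>
  define U where "U t x = H t (- x)" for t x
  have HF: "is_fourier (?e t) (H t)" if "0 \<le> t" for t
    using fourier_inversion[OF g] is_fourier_fourier[OF e2[OF that]] by (simp add: H_def evolved_0)
  note H2 = is_fourierD(2)[OF HF]
  note [measurable] = square_integrable_measurable[OF H2]
  have U2: "square_integrable (U t)" if "0 \<le> t" for t
    unfolding U_def by (rule square_integrable_reflect[OF H2[OF that]])
  have U_norm: "L2_norm (U t) \<le> sqrt 2 * C * exp (\<alpha> * t) * L2_norm S" if t: "0 \<le> t" for t
  proof (rule L2_norm_le)
    show "U t \<in> borel_measurable borel"
      by (rule square_integrable_measurable[OF U2[OF t]])
    have "sq_norm (U t) = sq_norm (H t)"
      unfolding U_def by (rule sq_norm_reflect[OF square_integrable_measurable[OF H2[OF t]]])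
    also have "\<dots> \<le> 2 * sq_norm (?e t)"
      by (rule is_fourier_bound[OF HF[OF t]])
    also have "\<dots> \<le> 2 * ennreal ((C * exp (\<alpha> * t) * L2_norm S)\<^sup>2)"
      by (intro mult_left_mono e_norm t) simp
    also have "\<dots> = ennreal (2 * (C * exp (\<alpha> * t) * L2_norm S)\<^sup>2)"
      by (simp add: ennreal_mult)
    also have "2 * (C * exp (\<alpha> * t) * L2_norm S)\<^sup>2 = (sqrt 2 * C * exp (\<alpha> * t) * L2_norm S)\<^sup>2"
      by (simp add: power_mult_distrib)
    finally show "sq_norm (U t) \<le> ennreal ((sqrt 2 * C * exp (\<alpha> * t) * L2_norm S)\<^sup>2)" .
    show "0 \<le> sqrt 2 * C * exp (\<alpha> * t) * L2_norm S"
      using C by (simp add: L2_norm_nonneg)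
  qed
  have cont: "continuous_L2 U"
    unfolding continuous_L2_def
  proof (intro conjI allI impI U2)
    fix t :: real assume t: "0 \<le> t"
    show "((\<lambda>s. L2_norm (\<lambda>x. U s x - U t x)) \<longlongrightarrow> 0) (at t within {0..})"
      unfolding tendsto_at_iff_sequentially
    proof (intro allI impI)
      fix X :: "nat \<Rightarrow> real" assume "\<forall>i. X i \<in> {0..} - {t}" and X: "X \<longlonglongrightarrow> t"
      then have X0: "0 \<le> X i" for i
        by auto
      obtain M where M: "0 < M" "\<And>i. norm (X i) \<le> M"
        using convergent_imp_Bseq[OF convergentI[OF X]] unfolding Bseq_def by auto
      let ?c = "C * exp (\<bar>\<alpha>\<bar> * (M + t)) + C * exp (\<bar>\<alpha>\<bar> * (M + t))"
      \<comment> \<open>A bound uniform over the convergent sequence of times and its limit, for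
        either sign of \<alpha>.\<close>
      have le: "norm (?e s \<xi>) \<le> C * exp (\<bar>\<alpha>\<bar> * (M + t)) * norm (S \<xi>)" if s: "0 \<le> s" "s \<le> M + t" for s \<xi>
      proof -
        have "\<alpha> * s \<le> \<bar>\<alpha>\<bar> * (M + t)"
          using s by (intro mult_mono) auto
        then have "C * exp (\<alpha> * s) * norm (S \<xi>) \<le> C * exp (\<bar>\<alpha>\<bar> * (M + t)) * norm (S \<xi>)"
          using C by (intro mult_right_mono mult_left_mono) auto
        then show ?thesis
          using bound[OF s(1), of \<xi>] by linarith
      qed
      have lim: "(\<lambda>i. sq_norm (\<lambda>\<xi>. ?e (X i) \<xi> - ?e t \<xi>)) \<longlonglongrightarrow> 0"
      proof (rule sq_norm_tendsto_0)
        show "(\<lambda>\<xi>. ?e (X i) \<xi> - ?e t \<xi>) \<in> borel_measurable borel" for i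
          by measurable
        show "square_integrable (\<lambda>\<xi>. ?c *\<^sub>R S \<xi>)"
          by (rule square_integrable_bound[OF S, where C = ?c]) (use C in auto)
        have "X i \<le> M + t" for i
          using M(2)[of i] t by simp
        then have "norm (?e (X i) \<xi> - ?e t \<xi>) \<le> ?c * norm (S \<xi>)" for i \<xi>
          using norm_triangle_ineq4[of "?e (X i) \<xi>" "?e t \<xi>"] le[OF X0, of i \<xi>] le[OF t, of \<xi>] M(1)
          by (simp add: distrib_right)
        then show "norm (?e (X i) \<xi> - ?e t \<xi>) \<le> norm (?c *\<^sub>R S \<xi>)" for i \<xi>
          unfolding norm_scaleR by (rule order_trans) (intro mult_right_mono, auto)
        fix \<xi> :: "real^'d"
        have "isCont (\<lambda>s. ?e s \<xi>) t"
          unfolding evolved_def by (rule has_vector_derivative_continuous[OF app_exp_has_vector_derivative])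
        then have "(\<lambda>i. ?e (X i) \<xi>) \<longlonglongrightarrow> ?e t \<xi>"
          by (rule isCont_tendsto_compose[OF _ X])
        then show "(\<lambda>i. ?e (X i) \<xi> - ?e t \<xi>) \<longlonglongrightarrow> 0"
          by (rule LIM_zero)
      qed
      have "sq_norm (\<lambda>x. U (X i) x - U t x) \<le> 2 * sq_norm (\<lambda>\<xi>. ?e (X i) \<xi> - ?e t \<xi>)" for i
      proof -
        note d = is_fourier_diff[OF HF[OF X0[of i]] HF[OF t]]
        have "sq_norm (\<lambda>x. U (X i) x - U t x) = sq_norm (\<lambda>x. H (X i) x - H t x)"
          unfolding U_def by (rule sq_norm_reflect[OF square_integrable_measurable[OF is_fourierD(2)[OF d]]])
        then show ?thesis
          using is_fourier_bound[OF d] by simp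
      qed
      moreover have "(\<lambda>i. 2 * sq_norm (\<lambda>\<xi>. ?e (X i) \<xi> - ?e t \<xi>)) \<longlonglongrightarrow> 0"
        using ennreal_tendsto_cmult[OF _ lim, of 2] by simp
      ultimately have "(\<lambda>i. sq_norm (\<lambda>x. U (X i) x - U t x)) \<longlonglongrightarrow> 0"
        by (rule tendsto_0_le_ennreal)
      then have "(\<lambda>i. L2_norm (\<lambda>x. U (X i) x - U t x)) \<longlonglongrightarrow> 0"
        by (rule L2_norm_tendsto_0[OF square_integrable_diff[OF U2[OF X0] U2[OF t]]])
      then show "((\<lambda>s. L2_norm (\<lambda>x. U s x - U t x)) \<circ> X) \<longlonglongrightarrow> 0"
        by (simp add: o_def)
    qed
  qed
  have "distributional_solution A (\<lambda>_. B) U"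
    unfolding distributional_solution_def weak_form_def[symmetric]
  proof (intro allI impI)
    fix \<phi> :: "real \<times> (real^'d) \<Rightarrow> real" assume \<phi>: "test_function \<phi>"
    obtain p q C' where p: "0 < p" "0 \<le> C'"
      and wi: "\<And>t u. square_integrable u \<Longrightarrow> integrable lborel (\<lambda>x. weak_form A B \<phi> (t, x) (u x))"
      and wle: "\<And>t u. square_integrable u \<Longrightarrow> norm (LINT x|lborel. weak_form A B \<phi> (t, x) (u x)) \<le> C' * L2_norm u"
      and w0: "\<And>t v x. t < p \<or> q < t \<Longrightarrow> weak_form A B \<phi> (t, x) v = 0"
      by (rule weak_form_pairing[OF \<phi>, of A B]) blast
    \<comment> \<open>Approximations with frequencies truncated at n, which satisfy the weak
      equation by \<open>truncated_weak_solution\<close>.\<close>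
    define V where "V n t x = FT (trunc (real n) (?e t)) (- x)" for n t x
    define F where "F n t = (LINT x|lborel. weak_form A B \<phi> (t, x) (V n t x))" for n t
    define F' where "F' t = (LINT x|lborel. weak_form A B \<phi> (t, x) (U t x))" for t
    have Vm: "FT (trunc (real n) (?e t)) \<in> borel_measurable borel" if "0 \<le> t" for n t
      by (rule FT_trunc_measurable[OF e2[OF that]])
    have V_sq: "sq_norm (V n t) \<le> ennreal ((C * exp (\<alpha> * t) * L2_norm S)\<^sup>2)" if t: "0 \<le> t" for n t
    proof -
      have "sq_norm (V n t) = sq_norm (FT (trunc (real n) (?e t)))"
        unfolding V_def by (rule sq_norm_reflect[OF Vm[OF t]])
      also have "\<dots> \<le> sq_norm (trunc (real n) (?e t))"
        by (rule sq_norm_FT[OF integrable_trunc[OF e2[OF t]]])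
      also have "\<dots> \<le> sq_norm (?e t)"
        by (rule sq_norm_mono[OF norm_trunc_le])
      finally show ?thesis
        using e_norm[OF t] by (rule order_trans)
    qed
    have V_meas: "V n t \<in> borel_measurable borel" if t: "0 \<le> t" for n t
    proof -
      note [measurable] = Vm[OF t]
      show ?thesis unfolding V_def by measurable
    qed
    have V2: "square_integrable (V n t)" if t: "0 \<le> t" for n t
      unfolding square_integrable_iff
      using V_meas[OF t] le_less_trans[OF V_sq[OF t] ennreal_less_top] by simp
    have V_norm: "L2_norm (V n t) \<le> C * exp (\<alpha> * t) * L2_norm S" if t: "0 \<le> t" for n t
      using C by (intro L2_norm_le V_meas V_sq t mult_nonneg_nonneg L2_norm_nonneg) auto
    have lim: "(\<lambda>n. F n t) \<longlonglongrightarrow> F' t" for t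
    proof (cases "t < p \<or> q < t")
      case True
      then show ?thesis by (simp add: F_def F'_def w0)
    next
      case False
      then have t: "0 \<le> t"
        using p(1) by linarith
      have "(\<lambda>n. sq_norm (\<lambda>\<xi>. FT (trunc (real n) (?e t)) \<xi> - H t \<xi>)) \<longlonglongrightarrow> 0"
        by (rule filterlim_compose[OF is_fourierD(3)[OF HF[OF t]] filterlim_real_sequentially])
      moreover have "sq_norm (\<lambda>x. V n t x - U t x) = sq_norm (\<lambda>\<xi>. FT (trunc (real n) (?e t)) \<xi> - H t \<xi>)" for n
        unfolding V_def U_def
        by (rule sq_norm_reflect[OF borel_measurable_diff[OF Vm[OF t] square_integrable_measurable[OF H2[OF t]]]])
      ultimately have "(\<lambda>n. sq_norm (\<lambda>x. V n t x - U t x)) \<longlonglongrightarrow> 0"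
        by simp
      then have "(\<lambda>n. L2_norm (\<lambda>x. V n t x - U t x)) \<longlonglongrightarrow> 0"
        by (rule L2_norm_tendsto_0[OF square_integrable_diff[OF V2[OF t] U2[OF t]]])
      then have l: "(\<lambda>n. C' * L2_norm (\<lambda>x. V n t x - U t x)) \<longlonglongrightarrow> 0"
        using tendsto_mult_right_zero by blast
      have "norm (F n t - F' t) \<le> C' * L2_norm (\<lambda>x. V n t x - U t x)" for n
      proof -
        have "weak_form A B \<phi> z (v - w) = weak_form A B \<phi> z v - weak_form A B \<phi> z w" for z v w
          by (rule linear_diff[OF bounded_linear.linear[OF bounded_linear_weak_form]])
        then have "F n t - F' t = (LINT x|lborel. weak_form A B \<phi> (t, x) (V n t x - U t x))"
          unfolding F_def F'_def using wi[OF V2[OF t]] wi[OF U2[OF t]] by simp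
        then show ?thesis
          using wle[OF square_integrable_diff[OF V2[OF t] U2[OF t]]] by simp
      qed
      from Lim_null_comparison[OF always_eventually[OF allI[OF this]] l] show ?thesis
        by (rule LIM_zero_cancel)
    qed
    note trunc_sol = truncated_weak_solution[OF g2 \<phi>, where A = A and B = B]
    have Fi: "integrable lborel (F n)" and F0: "(LINT t|lborel. F n t) = 0" for n
      unfolding F_def V_def by (rule trunc_sol)+
    let ?M = "C' * (C * exp (\<bar>\<alpha>\<bar> * q) * L2_norm S)"
    \<comment> \<open>The time interval [p, q] of the test function supplies a majorant that is
      independent of n.\<close>
    have "norm (F n t) \<le> indicator {p..q} t * ?M" for n t
    proof (cases "t \<in> {p..q}")
      case True
      then have t: "0 \<le> t" "t \<le> q"
        using p(1) by auto
      have "norm (F n t) \<le> C' * L2_norm (V n t)"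
        unfolding F_def by (rule wle[OF V2[OF t(1)]])
      also have "\<dots> \<le> C' * (C * exp (\<alpha> * t) * L2_norm S)"
        by (rule mult_left_mono[OF V_norm[OF t(1)] p(2)])
      also have "\<dots> \<le> ?M"
      proof -
        have "\<alpha> * t \<le> \<bar>\<alpha>\<bar> * q"
          using t by (intro mult_mono) auto
        then show ?thesis
          using C p(2) by (intro mult_left_mono mult_right_mono L2_norm_nonneg) auto
      qed
      finally show ?thesis
        using True by simp
    next
      case False
      then have "F n t = 0"
        unfolding F_def by (subst w0) auto
      then show ?thesis
        using False by simp
    qed
    moreover have "integrable lborel (\<lambda>t. indicator {p..q} t * ?M)"
      by (intro integrable_mult_left integrable_real_indicator emeasure_bounded_finite) auto
    moreover have [measurable]: "F n \<in> borel_measurable lborel" for n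
      using Fi by auto
    moreover have "F' \<in> borel_measurable lborel"
      by (rule borel_measurable_LIMSEQ_metric[where f = F]) (use lim in auto)
    ultimately have "(\<lambda>n. LINT t|lborel. F n t) \<longlonglongrightarrow> (LINT t|lborel. F' t)"
      using lim by (intro integral_dominated_convergence[where w = "\<lambda>t. indicator {p..q} t * ?M"]) auto
    then have "(LINT t|lborel. F' t) = 0"
      unfolding F0 using LIMSEQ_unique tendsto_const by blast
    then show "(LINT t|lborel. LINT x|lborel. weak_form A B \<phi> (t, x) (U t x)) = 0"
      by (simp add: F'_def)
  qed
  moreover have "U 0 = u0"
    by (rule ext) (simp add: U_def H_def)
  ultimately show thesis
    using that[of U] cont U_norm by (simp add: cauchy_solution_def)
qed

text \<open>The weight in the growth bound is the Sobolev weight, so the weighted transform of u0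
  dominates the evolution of its transform.\<close>

lemma well_posed_of_growth:
  fixes A :: "'d::finite \<Rightarrow> complex^'n^'n::finite"
  assumes K: "0 < K" and growth: "\<And>\<xi> t. 0 \<le> t \<Longrightarrow>
      norm (exp (t *\<^sub>R generator A B \<xi>)) \<le> K * exp (\<alpha> * t) * (1 + (norm \<xi>)\<^sup>2) powr (q / 2)"
  shows "well_posed q A (\<lambda>_. B)"
  unfolding well_posed_def
proof (rule exI[of _ "sqrt 2 * K"], rule conjI[rotated], rule exI[of _ \<alpha>], intro allI impI)
  show "0 < sqrt 2 * K"
    using K by simp
  fix u0 :: "real^'d \<Rightarrow> complex^'n" assume "in_sobolev q u0"
  then have u0: "square_integrable u0" and S: "square_integrable (sobolev_weighted q u0)"
    by (auto simp: in_sobolev_def)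
  have bound: "norm (evolved A B (fourier u0) t \<xi>) \<le> K * exp (\<alpha> * t) * norm (sobolev_weighted q u0 \<xi>)" if t: "0 \<le> t" for t \<xi>
  proof -
    have "norm (evolved A B (fourier u0) t \<xi>) \<le> norm (exp (t *\<^sub>R generator A B \<xi>)) * norm (fourier u0 \<xi>)"
      unfolding evolved_def by (rule norm_app)
    also have "\<dots> \<le> K * exp (\<alpha> * t) * (1 + (norm \<xi>)\<^sup>2) powr (q / 2) * norm (fourier u0 \<xi>)"
      by (intro mult_right_mono growth t) simp
    also have "\<dots> = K * exp (\<alpha> * t) * norm (sobolev_weighted q u0 \<xi>)"
      by (simp add: sobolev_weighted_def)
    finally show ?thesis .
  qed
  obtain U where U: "cauchy_solution A (\<lambda>_. B) u0 U" "U 0 = u0"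
    "\<And>t. 0 \<le> t \<Longrightarrow> L2_norm (U t) \<le> sqrt 2 * K * exp (\<alpha> * t) * L2_norm (sobolev_weighted q u0)"
    by (rule fourier_evolution_solution[OF is_fourier_fourier[OF u0] S _ bound]) (use K in auto)
  have "\<forall>V. cauchy_solution A (\<lambda>_. B) u0 V \<longrightarrow> (\<forall>t\<ge>0. AE x in lborel. V t x = U t x)"
    using cauchy_solution_unique[OF _ U(1)] by blast
  then show "\<exists>U. cauchy_solution A (\<lambda>_. B) u0 U \<and>
      (\<forall>V. cauchy_solution A (\<lambda>_. B) u0 V \<longrightarrow> (\<forall>t\<ge>0. AE x in lborel. V t x = U t x)) \<and>
      (\<forall>t\<ge>0. L2_norm (U t) \<le> sqrt 2 * K * exp (\<alpha> * t) * sobolev_norm q (U 0))"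
    using U by (intro exI[of _ U]) (simp add: sobolev_norm_def)
qed

section \<open>Well posedness of the split operator\<close>

lemma strongly_well_posed_bounded_group:
  assumes "strongly_well_posed A (\<lambda>_. B)"
  obtains K where "bounded_group A K"
proof -
  obtain K \<alpha> where "\<And>\<xi> t. 0 \<le> t \<Longrightarrow> norm (exp (t *\<^sub>R generator A B \<xi>)) \<le> K * exp (\<alpha> * t)"
    using assms unfolding strongly_well_posed_def by (rule well_posed_growth) blast
  then show thesis
    by (rule that[OF rescaled_growth])
qed

lemma bounded_group_strongly_well_posed:
  assumes K: "bounded_group A K"
  shows "strongly_well_posed A (\<lambda>_. B)"
proof -
  \<comment> \<open>At least one, hence positive as the constant of a well-posed problem has to
    be.\<close>
  define K' where "K' = max K 1"
  have "norm (exp (t *\<^sub>R generator A 0 \<xi>)) \<le> K' * exp (0 * t)" if "0 \<le> t" for t \<xi>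
    using K that unfolding bounded_group_def K'_def by (simp add: le_max_iff_disj)
  from exp_perturbation[OF this, where P = "op (- B)"]
  have "norm (exp (t *\<^sub>R generator A B \<xi>)) \<le> K' * exp ((0 + K' * norm (op (- B))) * t)" if "0 \<le> t" for t \<xi>
    using that unfolding generator_add[of A B] by blast
  then show ?thesis
    unfolding strongly_well_posed_def
    by (intro well_posed_of_growth[of K' _ _ "0 + K' * norm (op (- B))"])
      (auto simp: K'_def add_nonneg_eq_0_iff)
qed

theorem theorem2p4:
  fixes A :: "'d::finite \<Rightarrow> complex^'n::finite^'n" and \<sigma> :: "'d \<Rightarrow> complex" and m :: nat
  assumes multiplicity: "\<forall>\<xi>::real^'d. \<xi> \<noteq> 0 \<longrightarrow> order 0 (symbol_det A \<xi>) = m"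
  shows "(strongly_well_posed A (\<lambda>_. 0) \<longrightarrow>
            weakly_well_posed (split_coeff A) (\<lambda>_. absorption \<sigma>)) \<and>
         (strongly_well_posed A (\<lambda>_. 0) \<longrightarrow>
            (\<forall>\<xi>::real^'d. \<xi> \<noteq> 0 \<and>
                mat_kernel (symbol A 0 \<xi>) \<noteq> (\<Inter>j\<in>{j. \<xi> $ j \<noteq> 0}. mat_kernel (A j)) \<longrightarrow>
                \<not> diagonalizable (symbol (split_coeff A) 0 \<xi>) \<and>
                \<not> strongly_well_posed (split_coeff A) (\<lambda>_. absorption \<sigma>))) \<and>
         (strongly_well_posed A (\<lambda>_. 0) \<and>
            (\<forall>\<xi>::real^'d. \<xi> \<noteq> 0 \<longrightarrow>
                mat_kernel (symbol A 0 \<xi>) = (\<Inter>j\<in>{j. \<xi> $ j \<noteq> 0}. mat_kernel (A j))) \<longrightarrow>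
            strongly_well_posed (split_coeff A) (\<lambda>_. absorption \<sigma>)) \<and>
         ((\<forall>\<xi>::real^'d. \<xi> \<noteq> 0 \<longrightarrow> det (symbol A 0 \<xi>) \<noteq> 0) \<longrightarrow>
            (\<forall>\<xi>::real^'d. \<xi> \<noteq> 0 \<longrightarrow>
                mat_kernel (symbol A 0 \<xi>) = (\<Inter>j\<in>{j. \<xi> $ j \<noteq> 0}. mat_kernel (A j))))"
proof -
  have mult: "order 0 (symbol_det A \<xi>) = m" if "\<xi> \<noteq> 0" for \<xi> :: "real^'d"
    using multiplicity that by blast
  show ?thesis
  proof (intro conjI impI allI)
    assume "strongly_well_posed A (\<lambda>_. 0)"
    then obtain K where K: "bounded_group A K"
      by (rule strongly_well_posed_bounded_group)
    obtain q C \<alpha> where "q > 0" "C > 0" and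
      "\<And>t \<xi>. 0 \<le> t \<Longrightarrow> norm (exp (t *\<^sub>R generator (split_coeff A) (absorption \<sigma>) \<xi>)) \<le>
         C * exp (\<alpha> * t) * (1 + (norm \<xi>)\<^sup>2) powr (q / 2)"
      by (rule split_weak_bound[OF K mult, of \<sigma>]) blast+
    then show "weakly_well_posed (split_coeff A) (\<lambda>_. absorption \<sigma>)"
      unfolding weakly_well_posed_def using well_posed_of_growth by blast
  next
    fix \<xi> :: "real^'d"
    assume "\<xi> \<noteq> 0 \<and> mat_kernel (symbol A 0 \<xi>) \<noteq> (\<Inter>j\<in>{j. \<xi> $ j \<noteq> 0}. mat_kernel (A j))"
    then obtain U where U: "symbol (split_coeff A) 0 \<xi> *v (symbol (split_coeff A) 0 \<xi> *v U) = 0"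
      "symbol (split_coeff A) 0 \<xi> *v U \<noteq> 0"
      using split_nilpotent[of A \<xi>] by blast
    then show "\<not> diagonalizable (symbol (split_coeff A) 0 \<xi>)"
      using diagonalizable_semisimple by blast
    show "\<not> strongly_well_posed (split_coeff A) (\<lambda>_. absorption \<sigma>)"
    proof
      assume "strongly_well_posed (split_coeff A) (\<lambda>_. absorption \<sigma>)"
      \<comment> \<open>Strong well-posedness with absorption bounds the group without absorption,
        which forces the split symbol to be semisimple at zero.\<close>
      then obtain K where "bounded_group (split_coeff A) K"
        by (rule strongly_well_posed_bounded_group)
      from bounded_group_semisimple[OF this U(1)] U(2) show False
        by blast
    qed
  next
    assume *: "strongly_well_posed A (\<lambda>_. 0) \<and> (\<forall>\<xi>::real^'d. \<xi> \<noteq> 0 \<longrightarrow>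
      mat_kernel (symbol A 0 \<xi>) = (\<Inter>j\<in>{j. \<xi> $ j \<noteq> 0}. mat_kernel (A j)))"
    then obtain K where K: "bounded_group A K"
      using strongly_well_posed_bounded_group by blast
    obtain K' where "bounded_group (split_coeff A) K'"
      by (rule split_bounded_group[OF K mult]) (use * in blast)+
    \<comment> \<open>The absorption enters as a bounded perturbation of the bounded split
      group.\<close>
    then show "strongly_well_posed (split_coeff A) (\<lambda>_. absorption \<sigma>)"
      by (rule bounded_group_strongly_well_posed)
  next
    fix \<xi> :: "real^'d"
    assume "\<forall>\<xi>::real^'d. \<xi> \<noteq> 0 \<longrightarrow> det (symbol A 0 \<xi>) \<noteq> 0" and "\<xi> \<noteq> 0"
    then have k: "mat_kernel (symbol A 0 \<xi>) = {0}"
      using det_eq_0_kernel[of "symbol A 0 \<xi>"] by (auto simp: mat_kernel_def)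
    \<comment> \<open>The intersection contains zero and lies in the kernel of the symbol, which is
      zero here.\<close>
    have sub: "(\<Inter>j\<in>{j. \<xi> $ j \<noteq> 0}. mat_kernel (A j)) \<subseteq> mat_kernel (symbol A 0 \<xi>)"
      unfolding mat_kernel_def symbol_vector by (auto intro!: sum.neutral)
    have "0 \<in> (\<Inter>j\<in>{j. \<xi> $ j \<noteq> 0}. mat_kernel (A j))"
      by (simp add: mat_kernel_def)
    then have "mat_kernel (symbol A 0 \<xi>) \<subseteq> (\<Inter>j\<in>{j. \<xi> $ j \<noteq> 0}. mat_kernel (A j))"
      by (simp only: k insert_subset empty_subsetI simp_thms)
    then show "mat_kernel (symbol A 0 \<xi>) = (\<Inter>j\<in>{j. \<xi> $ j \<noteq> 0}. mat_kernel (A j))"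
      using sub by (rule subset_antisym)
  qed
qed

end
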